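(* Let $0<a<b$, let $A=\{x\in\mathbb{R}^2:a<|x|<b\}$, let $h_0$ satisfy (H1)--(H4) listed in the context, let $N\ge1$ be an integer, and let $u_*^N$ minimize $$I_0(u)=\int_A\tfrac12|\nabla u|^2+h_0(\det\nabla u)\,dx$$ in $\tilde{\mathcal{A}}_{N,\mathrm{sym}}$. Define $f:(0,\infty)\to\mathbb{R}$ by $f(s)=sh_0'(s)-h_0(s)$, and define the functions $d:=\det\nabla u_*^N$ and $z:=\frac12|\nabla u_*^N|^2+f(d)$ on $A$. Then $d$ and $z$ depend only on the radial variable $r=|x|$, $d$ is strictly monotonically increasing on $(a,b)$, and $z$ is strictly monotonically decreasing on $(a,b)$.
   Context: Hypotheses on $h_0:\mathbb{R}\to[0,+\infty]$: (H1) $h_0$ is convex and $h_0\ge0$; (H2) $h_0\in C^3((0,+\infty))$ and for some positive constants $s,c_1,c_2,d_0$: $c_1t^{-s-j}\le(-1)^jh_0^{(j)}(t)\le c_2t^{-s-j}$ for $0<t<d_0$ and $j=0,1,2$; (H3) $h_0(t)=+\infty$ for $t\le0$; (H4) for some real number $\tau$ and positive constants $c_3,c_4,d_1$: $c_3t^\tau\le h_0''(t)\le c_4t^\tau$ for $t\ge d_1$. $\tilde{\mathcal{A}}_N$ is the set of $u\in W^{1,2}(A;\mathbb{R}^2)$ with $u=\mathrm{id}$ on $\partial A$ (in the sense of trace), $\det\nabla u\ge0$ a.e. in $A$, and $\mathrm{wind}\#\gamma_\theta=N$ for a.e. $\theta\in[0,2\pi]$, where in polar coordinates $\gamma_\theta(r)=u(r,\theta)/|u(r,\theta)|$,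 $a\le r\le b$. The winding number of a closed $C^1$ curve $\gamma=(x,y):[a,b]\to\mathbb{R}^2\setminus\{0\}$ is $\frac1{2\pi}\int_a^b\frac{xy'-x'y}{x^2+y^2}\,dr$, extended to closed continuous curves by approximation. $\tilde{\mathcal{A}}_{N,\mathrm{sym}}=\{u\in\tilde{\mathcal{A}}_N:u(x)=Q^Tu(Qx)\text{ for all }Q\in SO(2)\}$. Such a minimizer is written $u_*^N(r,\theta)=\rho(r)(\cos(\theta+\psi(r)),\sin(\theta+\psi(r)))$. It is known (Post and Sivaloganathan, 1997) that $\rho,\psi$ are of class $C^2(a,b)$ (and, under the present hypotheses, $\rho\in C([a,b])\cap C^3(a,b)$) and that $u_*^N$ solves the Euler-Lagrange equations, which for such maps read, with $d=\rho\dot\rho/r$ and a constant $\omega$: $[r\dot\rho+\rho h_0'(d)]'=\frac\rho r+r\rho\dot\psi^2+\dot\rho h_0'(d)$ and $r\rho^2\dot\psi=\omega$. *)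

theory Defs
  imports "HOL-Analysis.Analysis" "HOL-Complex_Analysis.Winding_Numbers"
begin

section \<open>Sobolev functions\<close>

text \<open>To be used for open \<open>S\<close>, where \<open>at x\<close> and \<open>at x within S\<close> agree.\<close>

definition C1_on :: "(real ^ 'n) set \<Rightarrow> (real ^ 'n \<Rightarrow> 'b::real_normed_vector) \<Rightarrow> bool" where
  "C1_on S f \<longleftrightarrow> (\<forall>x\<in>S. f differentiable (at x)) \<and>
     (\<forall>v. continuous_on S (\<lambda>x. frechet_derivative f (at x) v))"

definition C1_compact_support :: "(real ^ 'n) set \<Rightarrow> (real ^ 'n \<Rightarrow> real) \<Rightarrow> bool" where
  "C1_compact_support \<Omega> \<phi> \<longleftrightarrow> C1_on UNIV \<phi> \<and>
     (\<exists>K. compact K \<and> K \<subseteq> \<Omega> \<and> (\<forall>x. x \<notin> K \<longrightarrow> \<phi> x = 0))"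

definition L2_on :: "(real ^ 'n) set \<Rightarrow> (real ^ 'n \<Rightarrow> 'b::real_normed_vector) \<Rightarrow> bool" where
  "L2_on \<Omega> f \<longleftrightarrow> f \<in> borel_measurable (lebesgue_on \<Omega>) \<and>
     integrable (lebesgue_on \<Omega>) (\<lambda>x. (norm (f x))\<^sup>2)"

text \<open>
  \<open>u \<in> W\<^sup>1\<^sup>,\<^sup>2(\<Omega>)\<close> with weak gradient \<open>G\<close>, where \<open>G x $ i $ j\<close> is the weak partial derivative
  of the component \<open>u\<^sub>i\<close> with respect to \<open>x\<^sub>j\<close>. Testing against \<open>C\<^sup>1\<close> instead of smooth
  functions with compact support gives the same weak gradients, by mollification.
\<close>

definition weak_gradient ::
  "(real ^ 'n) set \<Rightarrow> (real ^ 'n \<Rightarrow> real ^ 'm) \<Rightarrow> (real ^ 'n \<Rightarrow> real ^ 'n ^ 'm) \<Rightarrow> bool" where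
  "weak_gradient \<Omega> u G \<longleftrightarrow> L2_on \<Omega> u \<and> L2_on \<Omega> G \<and>
     (\<forall>\<phi> i j. C1_compact_support \<Omega> \<phi> \<longrightarrow>
        (LINT x|lebesgue_on \<Omega>. u x $ i * frechet_derivative \<phi> (at x) (axis j 1)) =
        - (LINT x|lebesgue_on \<Omega>. G x $ i $ j * \<phi> x))"

definition W12 :: "(real ^ 'n) set \<Rightarrow> (real ^ 'n \<Rightarrow> real ^ 'm) set" where
  "W12 \<Omega> = {u. \<exists>G. weak_gradient \<Omega> u G}"

text \<open>Unique up to null sets, and only used where null sets do not matter.\<close>

definition wgrad :: "(real ^ 'n) set \<Rightarrow> (real ^ 'n \<Rightarrow> real ^ 'm) \<Rightarrow> real ^ 'n \<Rightarrow> real ^ 'n ^ 'm" where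
  "wgrad \<Omega> u = (SOME G. weak_gradient \<Omega> u G)"

section \<open>The annulus, boundary values and winding number\<close>

definition annulus :: "real \<Rightarrow> real \<Rightarrow> (real ^ 2) set" where
  "annulus a b = {x. a < norm x \<and> norm x < b}"

definition polar :: "real \<Rightarrow> real \<Rightarrow> real ^ 2" where
  "polar r \<theta> = vector [r * cos \<theta>, r * sin \<theta>]"

text \<open>
  \<open>u = g\<close> on the boundary of the annulus in the sense of trace. The trace operator is the continuous
  extension, from \<open>W\<^sup>1\<^sup>,\<^sup>2\<close> to \<open>L\<^sup>2\<close> of the boundary, of the restriction of functions that are \<open>C\<^sup>1\<close>
  up to the boundary: the trace of \<open>u\<close> is the limit of the restrictions of approximations \<open>V n\<close>
  to the two boundary circles.
\<close>

definition has_trace ::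
  "real \<Rightarrow> real \<Rightarrow> (real ^ 2 \<Rightarrow> real ^ 2) \<Rightarrow> (real ^ 2 \<Rightarrow> real ^ 2) \<Rightarrow> bool" where
  "has_trace a b u g \<longleftrightarrow> (\<exists>V :: nat \<Rightarrow> real ^ 2 \<Rightarrow> real ^ 2.
     (\<forall>n. \<exists>W. open W \<and> closure (annulus a b) \<subseteq> W \<and> C1_on W (V n)) \<and>
     (\<lambda>n. \<integral>\<^sup>+x. ennreal ((norm (V n x - u x))\<^sup>2) \<partial>lebesgue_on (annulus a b)) \<longlonglongrightarrow> 0 \<and>
     (\<lambda>n. \<integral>\<^sup>+x. ennreal ((norm (jacobian (V n) (at x) - wgrad (annulus a b) u x))\<^sup>2)
             \<partial>lebesgue_on (annulus a b)) \<longlonglongrightarrow> 0 \<and>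
     (\<forall>R\<in>{a, b}. (\<lambda>n. \<integral>\<^sup>+\<theta>. ennreal ((norm (V n (polar R \<theta>) - g (polar R \<theta>)))\<^sup>2)
             \<partial>lebesgue_on {0..2 * pi}) \<longlonglongrightarrow> 0))"

definition to_complex :: "real ^ 2 \<Rightarrow> complex" where
  "to_complex v = Complex (v $ 1) (v $ 2)"

text \<open>\<open>r \<mapsto> v(r,\<theta>) / |v(r,\<theta>)|\<close> for \<open>a \<le> r \<le> b\<close>, reparametrised over \<open>[0,1]\<close>.\<close>

definition ray_curve :: "real \<Rightarrow> real \<Rightarrow> (real ^ 2 \<Rightarrow> real ^ 2) \<Rightarrow> real \<Rightarrow> real \<Rightarrow> complex" where
  "ray_curve a b v \<theta> = (\<lambda>t. to_complex (sgn (v (polar (linepath a b t) \<theta>))))"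

text \<open>
  A Sobolev map is continuous on almost every ray after a change on a null set, and any two
  such representatives agree on almost every ray, so the choice of \<open>v\<close> is immaterial.
\<close>

definition ray_winding :: "real \<Rightarrow> real \<Rightarrow> (real ^ 2 \<Rightarrow> real ^ 2) \<Rightarrow> int \<Rightarrow> bool" where
  "ray_winding a b u N \<longleftrightarrow> (\<exists>v :: real ^ 2 \<Rightarrow> real ^ 2.
     (AE x in lebesgue_on (annulus a b). v x = u x) \<and>
     (AE \<theta> in lebesgue_on {0..2 * pi}.
        continuous_on {a..b} (\<lambda>r. v (polar r \<theta>)) \<and>
        (\<forall>r\<in>{a..b}. v (polar r \<theta>) \<noteq> 0) \<and>
        pathfinish (ray_curve a b v \<theta>) = pathstart (ray_curve a b v \<theta>) \<and>
        winding_number (ray_curve a b v \<theta>) 0 = of_int N))"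

definition admissible :: "real \<Rightarrow> real \<Rightarrow> int \<Rightarrow> (real ^ 2 \<Rightarrow> real ^ 2) set" where
  "admissible a b N = {u \<in> W12 (annulus a b).
     has_trace a b u (\<lambda>x. x) \<and>
     (AE x in lebesgue_on (annulus a b). 0 \<le> det (wgrad (annulus a b) u x)) \<and>
     ray_winding a b u N}"

definition admissible_sym :: "real \<Rightarrow> real \<Rightarrow> int \<Rightarrow> (real ^ 2 \<Rightarrow> real ^ 2) set" where
  "admissible_sym a b N = {u \<in> admissible a b N.
     \<forall>Q :: real ^ 2 ^ 2. rotation_matrix Q \<longrightarrow>
       (AE x in lebesgue_on (annulus a b). u x = transpose Q *v u (Q *v x))}"

section \<open>The stored energy\<close>

abbreviation finite_part :: "(real \<Rightarrow> ennreal) \<Rightarrow> real \<Rightarrow> real" where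
  "finite_part h \<equiv> \<lambda>t. enn2real (h t)"

definition H1 :: "(real \<Rightarrow> ennreal) \<Rightarrow> bool" where
  "H1 h \<longleftrightarrow> (\<forall>x y t. 0 \<le> t \<and> t \<le> 1 \<longrightarrow>
     h ((1 - t) * x + t * y) \<le> ennreal (1 - t) * h x + ennreal t * h y)"

definition H2 :: "(real \<Rightarrow> ennreal) \<Rightarrow> bool" where
  "H2 h \<longleftrightarrow>
     (\<forall>t>0. h t < \<infinity>) \<and>
     (\<forall>j<3. \<forall>t>0. (deriv ^^ j) (finite_part h) field_differentiable (at t)) \<and>
     continuous_on {0<..} ((deriv ^^ 3) (finite_part h)) \<and>
     (\<exists>s>0. \<exists>c1>0. \<exists>c2>0. \<exists>d0>0. \<forall>t j. 0 < t \<and> t < d0 \<and> j \<le> 2 \<longrightarrow>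
        c1 * t powr (- s - real j) \<le> (- 1) ^ j * (deriv ^^ j) (finite_part h) t \<and>
        (- 1) ^ j * (deriv ^^ j) (finite_part h) t \<le> c2 * t powr (- s - real j))"

definition H3 :: "(real \<Rightarrow> ennreal) \<Rightarrow> bool" where
  "H3 h \<longleftrightarrow> (\<forall>t\<le>0. h t = \<infinity>)"

definition H4 :: "(real \<Rightarrow> ennreal) \<Rightarrow> bool" where
  "H4 h \<longleftrightarrow> (\<exists>\<tau>. \<exists>c3>0. \<exists>c4>0. \<exists>d1>0. \<forall>t\<ge>d1.
     c3 * t powr \<tau> \<le> (deriv ^^ 2) (finite_part h) t \<and>
     (deriv ^^ 2) (finite_part h) t \<le> c4 * t powr \<tau>)"

text \<open>The norm on \<open>real ^ 2 ^ 2\<close> is the Frobenius norm.\<close>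

definition energy :: "real \<Rightarrow> real \<Rightarrow> (real \<Rightarrow> ennreal) \<Rightarrow> (real ^ 2 \<Rightarrow> real ^ 2) \<Rightarrow> ennreal" where
  "energy a b h u = (\<integral>\<^sup>+x. (ennreal (1 / 2 * (norm (wgrad (annulus a b) u x))\<^sup>2) +
     h (det (wgrad (annulus a b) u x))) \<partial>lebesgue_on (annulus a b))"

text \<open>Only meaningful for \<open>s > 0\<close>.\<close>

definition f_of :: "(real \<Rightarrow> ennreal) \<Rightarrow> real \<Rightarrow> real" where
  "f_of h s = s * deriv (finite_part h) s - finite_part h s"

end

theory Submission
  imports Defs
begin

text \<open>
  An admissible symmetric map is \<open>u(r e\<^sup>i\<^sup>\<theta>) = w(r) e\<^sup>i\<^sup>\<theta>\<close> for a complex curve \<open>w\<close> with derivative \<open>g \<in> L\<^sup>2\<close>; then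
  \<open>|\<nabla>u|\<^sup>2 = |g|\<^sup>2 + |w|\<^sup>2/r\<^sup>2\<close>, \<open>r det \<nabla>u = Re (w\<^sup>* g)\<close>, and \<open>w\<close> minimizes a one-dimensional energy.
  Rotating \<open>w\<close> by \<open>e\<^sup>i\<^sup>\<epsilon>\<^sup>\<eta>\<^sup>(\<^sup>r\<^sup>)\<close> gives \<open>r Im (w\<^sup>* g) = \<omega>\<close>. Reparametrizing \<open>r\<close>, which unlike an outer
  variation keeps the determinant positive, gives \<open>(r e)' = |g|\<^sup>2/2 - |w|\<^sup>2/(2 r\<^sup>2) - f(d)\<close> for
  \<open>e = |g|\<^sup>2/2 - |w|\<^sup>2/(2 r\<^sup>2) + f(d)\<close>. Together these read \<open>A d\<^sup>2 + f(d) = K\<close> with \<open>A = r\<^sup>2/(2 |w|\<^sup>2)\<close> and continuous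
  \<open>A\<close>, \<open>K\<close>; the left side is strictly increasing in \<open>d\<close>, so \<open>d\<close> and \<open>g\<close> are continuous, and then
  differentiable where needed. The two equations now give
  \<open>z' = - |g - w/r|\<^sup>2/r\<close> and \<open>(r\<^sup>2 + |w|\<^sup>2 h\<^sub>0''(d)) d' = r |g - w/r|\<^sup>2\<close>. If \<open>g = w/r\<close> at some point then \<open>\<omega> = 0\<close>,
  so \<open>w/|w|\<close> is constant and the winding number vanishes, contrary to \<open>N \<ge> 1\<close>.
\<close>

section \<open>Polar coordinates\<close>

text \<open>What is known of a minimizer at the outset is weak: \<open>w\<close> is continuous with
  square integrable derivative, the determinant is positive only almost everywhere, and
  \<open>h0\<close> blows up at 0. Adding a small multiple of a test curve may therefore leave the
  admissible set however small the multiple is. The two families used avoid this. A rotation does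
  not change \<open>Re (cnj w * g)\<close>, so the energy is a quadratic polynomial in \<epsilon>. A
  change of radius multiplies the determinant by a factor close to 1, and (H2) and (H4) bound
  \<open>h0\<close> and its derivative at such multiples by the energy density. Both keep the
  boundary values, and for small \<epsilon> the winding number, because the unit vectors w/|w| move
  by less than 1. Convexity only makes f nondecreasing; the strictness that determines d comes from
  the quadratic term. The passage from the plane to the interval is by averaging: the maps that
  approximate \<open>u\<close> in the definition of the trace need not be symmetric, but their
  averages over all rotations are, and they have the same limit.\<close>

lemma distr_lborel_orthogonal:
  fixes f :: "real^'n::{finite,wellorder} \<Rightarrow> real^'n::_"
  assumes f: "orthogonal_transformation f"
  shows "distr lborel borel f = lborel"
proof (rule sym, rule lborel_eqI)
  have lin: "linear f" and bij: "bij f"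
    using f orthogonal_transformation_linear orthogonal_transformation_bij by blast+
  have [measurable]: "f \<in> borel_measurable borel"
    by (simp add: borel_measurable_continuous_onI lin linear_continuous_on linear_linear)
  fix l u :: "real^'n::_" assume lu: "\<And>b. b \<in> Basis \<Longrightarrow> l \<bullet> b \<le> u \<bullet> b"
  have inv: "orthogonal_transformation (inv f)"
    using f by (rule orthogonal_transformation_inv)
  \<comment> \<open>The preimage of a box is the image of the box under the inverse, again
    orthogonal, so invariance of the volume of images suffices.\<close>
  have eq: "f -` box l u = inv f ` box l u"
    using bij by (simp add: bij_vimage_eq_inv_image)
  have im: "inv f ` box l u \<in> lmeasurable"
    using inv by (rule measurable_orthogonal_image) simp
  have "emeasure (distr lborel borel f) (box l u) = emeasure lborel (f -` box l u)"
    by (simp add: emeasure_distr)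
  also have "\<dots> = emeasure lebesgue (inv f ` box l u)"
    unfolding eq[symmetric] by (simp add: measurable_sets_borel[of f borel] emeasure_completion)
  also have "\<dots> = ennreal (measure lebesgue (inv f ` box l u))"
    using im by (simp add: emeasure_eq_measure2)
  also have "\<dots> = ennreal (measure lebesgue (box l u))"
    using measure_orthogonal_image[OF inv] by simp
  also have "\<dots> = ennreal (\<Prod>b\<in>Basis. (u - l) \<bullet> b)"
    using lu by (simp add: measure_lborel_box)
  finally show "emeasure (distr lborel borel f) (box l u) = ennreal (\<Prod>b\<in>Basis. (u - l) \<bullet> b)" .
qed simp

text \<open>The image of planar Lebesgue measure under \<open>norm\<close> and the measure 2 pi r dr
  on r \<ge> 0 give every half-line up to t the same mass, the area of a disc. Half-lines form a
  generator closed under intersection, so the measures coincide.\<close>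

lemma nn_integral_radial:
  fixes F :: "real \<Rightarrow> ennreal"
  assumes [measurable]: "F \<in> borel_measurable borel"
  shows "(\<integral>\<^sup>+x. F (norm x) \<partial>(lborel :: (real^2) measure)) =
    (\<integral>\<^sup>+r. ennreal (2 * pi * r) * F r * indicator {0..} r \<partial>lborel)"
proof -
  define M where "M = distr (lborel :: (real^2) measure) borel norm"
  define N where "N = density lborel (\<lambda>r::real. ennreal (2 * pi * r) * indicator {0..} r)"
  have M: "emeasure M {..t} = (if t < 0 then 0 else ennreal (t\<^sup>2 * pi))" for t
  proof -
    have "emeasure M {..t} = emeasure (lborel :: (real^2) measure) (norm -` {..t})"
      unfolding M_def by (subst emeasure_distr) auto
    also have "norm -` {..t} = cball (0::real^2) t"
      by auto
    finally show ?thesis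
      by (auto simp: emeasure_cball unit_ball_vol_2 mult.commute)
  qed
  have N: "emeasure N {..t} = (if t < 0 then 0 else ennreal (t\<^sup>2 * pi))" for t
  proof -
    have "emeasure N {..t} = (\<integral>\<^sup>+r. ennreal (2 * pi * r) * indicator {0..t} r \<partial>lborel)"
      unfolding N_def by (subst emeasure_density) (auto intro!: nn_integral_cong split: split_indicator)
    also have "\<dots> = (if t < 0 then 0 else ennreal (t\<^sup>2 * pi))"
    proof (cases "t < 0")
      case False
      have "(\<integral>\<^sup>+r. ennreal (2 * pi * r) * indicator {0..t} r \<partial>lborel) = ennreal (pi * t\<^sup>2 - pi * 0\<^sup>2)"
        using False
        by (intro nn_integral_FTC_Icc) (auto intro!: derivative_eq_intros)
      then show ?thesis using False by (simp add: mult.commute)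
    qed auto
    finally show ?thesis .
  qed
  have "M = N"
  proof (rule measure_eqI_generator_eq[where E = "range (\<lambda>t::real. {..t})" and \<Omega> = UNIV and A = "\<lambda>i. {..real i}"])
    show "Int_stable (range (\<lambda>t::real. {..t}))"
      by (auto simp: Int_stable_def)
    show "(\<Union>i. {..real i}) = UNIV"
      using real_arch_simple by auto
    show "emeasure M X = emeasure N X" if "X \<in> range (\<lambda>t::real. {..t})" for X
      using that by (auto simp: M N)
    show "emeasure M {..real i} \<noteq> \<infinity>" for i
      by (simp add: M)
    show "sets M = sigma_sets UNIV (range (\<lambda>t::real. {..t}))"
         "sets N = sigma_sets UNIV (range (\<lambda>t::real. {..t}))"
      unfolding M_def N_def by (simp_all, simp_all add: borel_eq_atMost)
  qed auto
  have "(\<integral>\<^sup>+x. F (norm x) \<partial>(lborel :: (real^2) measure)) = (\<integral>\<^sup>+r. F r \<partial>M)"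
    unfolding M_def by (subst nn_integral_distr) auto
  also have "\<dots> = (\<integral>\<^sup>+r. ennreal (2 * pi * r) * F r * indicator {0..} r \<partial>lborel)"
    unfolding \<open>M = N\<close> N_def by (subst nn_integral_density) (auto intro!: nn_integral_cong simp: mult_ac)
  finally show ?thesis .
qed

section \<open>The plane as the complex numbers, and rotations\<close>

definition vec_of_complex :: "complex \<Rightarrow> real^2" where
  "vec_of_complex z = vector [Re z, Im z]"

lemma to_complex_vec_of_complex [simp]: "to_complex (vec_of_complex z) = z"
  by (simp add: to_complex_def vec_of_complex_def)

lemma vec_of_complex_to_complex [simp]: "vec_of_complex (to_complex x) = x"
  by (simp add: to_complex_def vec_of_complex_def vec_eq_iff forall_2)

lemma norm_to_complex [simp]: "norm (to_complex x) = norm x"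
  by (simp add: to_complex_def norm_vec_def L2_set_def sum_2 cmod_def)

lemma norm_vec_of_complex [simp]: "norm (vec_of_complex z) = norm z"
  by (metis norm_to_complex to_complex_vec_of_complex)

lemma bounded_linear_to_complex: "bounded_linear to_complex"
  by (rule bounded_linear_intro[where K = 1]) (auto simp: to_complex_def complex_eq_iff norm_vec_def L2_set_def sum_2 cmod_def)

lemma bounded_linear_vec_of_complex: "bounded_linear vec_of_complex"
  by (rule bounded_linear_intro[where K = 1]) (auto simp: vec_of_complex_def vec_eq_iff forall_2 norm_vec_def L2_set_def sum_2 cmod_def)

lemma to_complex_polar: "to_complex (polar r \<theta>) = of_real r * cis \<theta>"
  by (simp add: to_complex_def polar_def complex_eq_iff)

lemma norm_polar [simp]: "norm (polar r \<theta>) = \<bar>r\<bar>"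
  by (metis abs_of_nonneg mult.right_neutral norm_cis norm_mult norm_of_real norm_to_complex real_norm_def to_complex_polar)

definition rot :: "real \<Rightarrow> real^2 \<Rightarrow> real^2" where
  "rot \<alpha> x = vec_of_complex (cis \<alpha> * to_complex x)"

lemma polar_eq: "polar r \<theta> = vec_of_complex (of_real r * cis \<theta>)"
  by (metis to_complex_polar vec_of_complex_to_complex)

lemma rot_polar: "rot \<alpha> (polar r \<theta>) = polar r (\<alpha> + \<theta>)"
  by (simp add: rot_def to_complex_polar polar_eq cis_mult[symmetric] mult_ac)

lemma ex_polar: "\<exists>\<theta>\<in>{0..2*pi}. x = polar (norm x) \<theta>"
proof -
  obtain t where t: "0 \<le> t" "t < 2*pi" "to_complex x = rcis (norm x) t"
  proof -
    have "to_complex x = rcis (norm x) (Arg2pi (to_complex x))"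
      using Arg2pi_eq[of "to_complex x"] by (simp add: rcis_def cis_conv_exp mult.commute)
    then show thesis using that[of "Arg2pi (to_complex x)"] by (simp add: Arg2pi_ge_0 Arg2pi_lt_2pi)
  qed
  then have "x = polar (norm x) t"
    by (metis polar_eq rcis_def vec_of_complex_to_complex)
  then show ?thesis using t by force
qed

lemma orthogonal_transformation_rot: "orthogonal_transformation (rot \<alpha>)"
proof -
  have "linear (rot \<alpha>)"
    using bounded_linear_compose[OF bounded_linear_vec_of_complex
       bounded_linear_compose[OF bounded_linear_mult_right bounded_linear_to_complex]]
    by (simp add: rot_def[abs_def] bounded_linear.linear)
  then show ?thesis
    by (simp add: orthogonal_transformation rot_def norm_mult)
qed

lemma measurable_to_complex [measurable]: "to_complex \<in> borel_measurable borel"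
  by (intro borel_measurable_continuous_onI bounded_linear.continuous_on[OF bounded_linear_to_complex] continuous_on_id)

lemma measurable_vec_of_complex [measurable]: "vec_of_complex \<in> borel_measurable borel"
  by (intro borel_measurable_continuous_onI bounded_linear.continuous_on[OF bounded_linear_vec_of_complex] continuous_on_id)

lemma measurable_cis [measurable]: "cis \<in> borel_measurable borel"
  by (intro borel_measurable_continuous_onI continuous_intros)

lemma measurable_polar [measurable (raw)]:
  assumes [measurable]: "f \<in> borel_measurable M" "g \<in> borel_measurable M"
  shows "(\<lambda>x. polar (f x) (g x)) \<in> borel_measurable M"
  unfolding polar_eq by measurable

lemma measurable_rot [measurable (raw)]:
  assumes [measurable]: "f \<in> borel_measurable M" "g \<in> borel_measurable M"
  shows "(\<lambda>x. rot (f x) (g x)) \<in> borel_measurable M"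
  unfolding rot_def by measurable

section \<open>Rotation invariance and integration in polar coordinates\<close>

lemma nn_integral_rot:
  assumes [measurable]: "F \<in> borel_measurable borel"
  shows "(\<integral>\<^sup>+x. F (rot \<alpha> x) \<partial>lborel) = (\<integral>\<^sup>+x. F x \<partial>lborel)"
proof -
  have "(\<integral>\<^sup>+x. F x \<partial>lborel) = (\<integral>\<^sup>+x. F x \<partial>distr lborel borel (rot \<alpha>))"
    by (subst distr_lborel_orthogonal[OF orthogonal_transformation_rot]) simp
  also have "\<dots> = (\<integral>\<^sup>+x. F (rot \<alpha> x) \<partial>lborel)"
    by (subst nn_integral_distr) auto
  finally show ?thesis by simp
qed

text \<open>The interval is cut at \<theta>: one piece is translated by \<theta>, the other by
  \<theta> - T, where periodicity leaves the integrand unchanged.\<close>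

lemma nn_integral_periodic_shift:
  fixes P :: "real \<Rightarrow> ennreal"
  assumes [measurable]: "P \<in> borel_measurable borel" and per: "\<And>t. P (t + T) = P t"
    and \<theta>: "0 \<le> \<theta>" "\<theta> \<le> T"
  shows "(\<integral>\<^sup>+t\<in>{0..T}. P (t + \<theta>) \<partial>lborel) = (\<integral>\<^sup>+t\<in>{0..T}. P t \<partial>lborel)"
proof -
  have "(\<integral>\<^sup>+t\<in>{0..T}. P t \<partial>lborel) = (\<integral>\<^sup>+t. P t * indicator {\<theta><..T} t + P t * indicator {0<..\<theta>} t \<partial>lborel)"
    using \<theta> AE_lborel_singleton[of 0]
    by (intro nn_integral_cong_AE) (auto elim!: eventually_mono split: split_indicator)
  also have "\<dots> = (\<integral>\<^sup>+t. P t * indicator {\<theta><..T} t \<partial>lborel) + (\<integral>\<^sup>+t. P t * indicator {0<..\<theta>} t \<partial>lborel)"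
    by (rule nn_integral_add) auto
  also have "(\<integral>\<^sup>+t. P t * indicator {\<theta><..T} t \<partial>lborel) = (\<integral>\<^sup>+t. P (t + \<theta>) * indicator {0<..T - \<theta>} t \<partial>lborel)"
    by (subst nn_integral_real_affine[where c = 1 and t = \<theta>])
       (auto intro!: nn_integral_cong simp: add.commute split: split_indicator)
  also have "(\<integral>\<^sup>+t. P t * indicator {0<..\<theta>} t \<partial>lborel) = (\<integral>\<^sup>+t. P (t + \<theta>) * indicator {T - \<theta><..T} t \<partial>lborel)"
    using per[of "_ + (\<theta> - T)"]
    by (subst nn_integral_real_affine[where c = 1 and t = "\<theta> - T"])
       (auto intro!: nn_integral_cong simp: algebra_simps split: split_indicator)
  also have "(\<integral>\<^sup>+t. P (t + \<theta>) * indicator {0<..T - \<theta>} t \<partial>lborel) + \<dots> =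
      (\<integral>\<^sup>+t. P (t + \<theta>) * indicator {0<..T - \<theta>} t + P (t + \<theta>) * indicator {T - \<theta><..T} t \<partial>lborel)"
    by (rule nn_integral_add[symmetric]) auto
  also have "\<dots> = (\<integral>\<^sup>+t\<in>{0..T}. P (t + \<theta>) \<partial>lborel)"
    using \<theta> AE_lborel_singleton[of 0]
    by (intro nn_integral_cong_AE) (auto elim!: eventually_mono split: split_indicator)
  finally show ?thesis ..
qed

lemma polar_periodic: "polar r (\<theta> + 2 * pi) = polar r \<theta>"
  by (simp add: polar_def)

text \<open>Averaging replaces a Jacobian computation: integrating \<open>F (rot \<alpha> x)\<close>
  over \<alpha> gives a function of \<open>norm x\<close> alone, to which the radial formula
  applies, while rotation invariance shows that each \<alpha> contributes the same integral over the
  plane.\<close>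

lemma nn_integral_polar:
  fixes F :: "real^2 \<Rightarrow> ennreal"
  assumes [measurable]: "F \<in> borel_measurable borel"
  shows "(\<integral>\<^sup>+x. F x \<partial>lborel) =
    (\<integral>\<^sup>+r\<in>{0..}. (\<integral>\<^sup>+\<theta>\<in>{0..2*pi}. ennreal r * F (polar r \<theta>) \<partial>lborel) \<partial>lborel)"
proof -
  define m where "m r = (\<integral>\<^sup>+\<theta>\<in>{0..2*pi}. F (polar r \<theta>) \<partial>lborel)" for r
  have [measurable]: "m \<in> borel_measurable borel"
    unfolding m_def by measurable
  have avg: "(\<integral>\<^sup>+\<alpha>\<in>{0..2*pi}. F (rot \<alpha> x) \<partial>lborel) = m (norm x)" for x
  proof -
    obtain \<theta> where \<theta>: "\<theta> \<in> {0..2*pi}" "x = polar (norm x) \<theta>"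
      using ex_polar by blast
    have "(\<integral>\<^sup>+\<alpha>\<in>{0..2*pi}. F (rot \<alpha> x) \<partial>lborel) = (\<integral>\<^sup>+\<alpha>\<in>{0..2*pi}. F (polar (norm x) (\<alpha> + \<theta>)) \<partial>lborel)"
      by (subst \<theta>(2)) (simp add: rot_polar)
    also have "\<dots> = m (norm x)"
      unfolding m_def using \<theta> by (intro nn_integral_periodic_shift) (auto simp: polar_periodic)
    finally show ?thesis .
  qed
  have "ennreal (2 * pi) * (\<integral>\<^sup>+x. F x \<partial>lborel) = (\<integral>\<^sup>+\<alpha>\<in>{0..2*pi}. (\<integral>\<^sup>+x. F (rot \<alpha> x) \<partial>lborel) \<partial>lborel)"
    by (simp add: nn_integral_rot nn_integral_cmult mult.commute)
  also have "\<dots> = (\<integral>\<^sup>+\<alpha>. (\<integral>\<^sup>+x. F (rot \<alpha> x) * indicator {0..2*pi} \<alpha> \<partial>lborel) \<partial>lborel)"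
    by (simp add: nn_integral_multc)
  also have "\<dots> = (\<integral>\<^sup>+x. (\<integral>\<^sup>+\<alpha>\<in>{0..2*pi}. F (rot \<alpha> x) \<partial>lborel) \<partial>lborel)"
    by (rule lborel_pair.Fubini') measurable
  also have "\<dots> = (\<integral>\<^sup>+r. ennreal (2 * pi * r) * m r * indicator {0..} r \<partial>lborel)"
    unfolding avg by (rule nn_integral_radial) measurable
  also have "\<dots> = (\<integral>\<^sup>+r. ennreal (2 * pi) * (ennreal r * m r * indicator {0..} r) \<partial>lborel)"
    by (intro nn_integral_cong) (auto split: split_indicator simp: ennreal_mult' mult_ac)
  also have "\<dots> = ennreal (2 * pi) * (\<integral>\<^sup>+r\<in>{0..}. ennreal r * m r \<partial>lborel)"
    by (rule nn_integral_cmult) measurable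
  finally have "(\<integral>\<^sup>+x. F x \<partial>lborel) = (\<integral>\<^sup>+r\<in>{0..}. ennreal r * m r \<partial>lborel)"
    by (subst (asm) ennreal_mult_cancel_left) auto
  then show ?thesis
    unfolding m_def by (simp add: nn_integral_cmult[symmetric] mult_ac)
qed

lemma annulus_sets [measurable]: "annulus a b \<in> sets borel"
  unfolding annulus_def by measurable

lemma nn_integral_annulus_polar:
  fixes F :: "real^2 \<Rightarrow> ennreal"
  assumes [measurable]: "F \<in> borel_measurable borel" and "0 \<le> a"
  shows "(\<integral>\<^sup>+x\<in>annulus a b. F x \<partial>lborel) =
    (\<integral>\<^sup>+r\<in>{a<..<b}. (\<integral>\<^sup>+\<theta>\<in>{0..2*pi}. ennreal r * F (polar r \<theta>) \<partial>lborel) \<partial>lborel)"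
  using assms(2)
  by (subst nn_integral_polar)
     (auto intro!: nn_integral_cong simp: annulus_def nn_integral_multc[symmetric] split: split_indicator)

section \<open>Test functions and weak gradients\<close>

lemma AE_lebesgue_on_iff:
  assumes "S \<in> sets borel"
  shows "(AE x in lebesgue_on S. P x) \<longleftrightarrow> (AE x in lborel. x \<in> S \<longrightarrow> P x)"
  using assms by (subst AE_restrict_space_iff) (auto simp: AE_completion_iff)

lemma nn_integral_lebesgue_on:
  assumes "S \<in> sets borel" and [measurable]: "f \<in> borel_measurable borel"
  shows "(\<integral>\<^sup>+x. f x \<partial>lebesgue_on S) = (\<integral>\<^sup>+x\<in>S. f x \<partial>lborel)"
  using assms by (subst nn_integral_restrict_space) (auto simp: nn_integral_completion)

text \<open>Replaces data measurable for the completed measure by Borel functions, so that Fubini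
  and image measures can be used over \<open>lborel\<close>. Each coordinate is treated
  separately.\<close>

lemma ex_borel_eq_lebesgue_on:
  fixes f :: "'a::euclidean_space \<Rightarrow> 'b::euclidean_space"
  assumes S: "S \<in> sets borel" and f: "f \<in> borel_measurable (lebesgue_on S)"
  obtains g where "g \<in> borel_measurable borel" "AE x in lebesgue_on S. f x = g x"
proof -
  have "\<exists>g. g \<in> borel_measurable borel \<and> (AE x in lborel. (if x \<in> S then f x \<bullet> b else 0) = (g x :: real))" for b
  proof -
    have "(\<lambda>x. f x \<bullet> b) \<in> borel_measurable (lebesgue_on S)"
      using f by measurable
    then have "(\<lambda>x. if x \<in> S then f x \<bullet> b else 0) \<in> borel_measurable lebesgue"
      using S by (intro borel_measurable_if_I) auto
    from completion_ex_borel_measurable_real[OF this] show ?thesis by auto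
  qed
  then obtain g :: "'b \<Rightarrow> 'a \<Rightarrow> real" where "\<forall>b. g b \<in> borel_measurable borel \<and>
     (AE x in lborel. (if x \<in> S then f x \<bullet> b else 0) = g b x)"
    using choice[of "\<lambda>b g. g \<in> borel_measurable borel \<and> (AE x in lborel. (if x \<in> S then f x \<bullet> b else 0) = g x)"] by blast
  then have g: "\<And>b. g b \<in> borel_measurable borel"
     "\<And>b. AE x in lborel. (if x \<in> S then f x \<bullet> b else 0) = g b x"
    by blast+
  have [measurable]: "(\<lambda>x. \<Sum>b\<in>Basis. g b x *\<^sub>R b) \<in> borel_measurable borel"
    using g(1) by measurable
  have "AE x in lborel. \<forall>b\<in>Basis. (if x \<in> S then f x \<bullet> b else 0) = g b x"
    using g(2) by (simp add: AE_finite_all)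
  then have "AE x in lborel. x \<in> S \<longrightarrow> f x = (\<Sum>b\<in>Basis. g b x *\<^sub>R b)"
  proof eventually_elim
    case (elim x)
    show ?case
    proof
      assume "x \<in> S"
      then have "(\<Sum>b\<in>Basis. g b x *\<^sub>R b) = (\<Sum>b\<in>Basis. (f x \<bullet> b) *\<^sub>R b)"
        using elim by (intro sum.cong) auto
      then show "f x = (\<Sum>b\<in>Basis. g b x *\<^sub>R b)"
        by (simp add: euclidean_representation)
    qed
  qed
  then show thesis
    using S by (intro that[of "\<lambda>x. \<Sum>b\<in>Basis. g b x *\<^sub>R b"]) (simp_all add: AE_lebesgue_on_iff)
qed

text \<open>The densities \<open>ennreal (F x)\<close> and \<open>ennreal (- F x)\<close> are the
  positive and negative parts of \<open>F\<close>. Their measures agree on boxes, hence everywhere,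
  so the two parts are equal almost everywhere; as one of them is always 0, both vanish.\<close>

lemma AE_zero_of_box_integrals:
  fixes F :: "'a::euclidean_space \<Rightarrow> real"
  assumes F: "integrable lborel F" and zero: "\<And>a b. (LINT x:box a b|lborel. F x) = 0"
  shows "AE x in lborel. F x = 0"
proof -
  have [measurable]: "F \<in> borel_measurable borel"
    using borel_measurable_integrable[OF F] by simp
  define M where "M = density lborel (\<lambda>x. ennreal (F x))"
  define N where "N = density lborel (\<lambda>x. ennreal (- F x))"
  have fin: "(\<integral>\<^sup>+x. ennreal (s * F x) * indicator A x \<partial>lborel) < \<infinity>"
    if "\<bar>s\<bar> = 1" and [measurable]: "A \<in> sets borel" for s A
  proof -
    have "(\<integral>\<^sup>+x. ennreal (s * F x) * indicator A x \<partial>lborel) \<le> (\<integral>\<^sup>+x. ennreal (norm (F x)) \<partial>lborel)"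
      using that by (intro nn_integral_mono) (auto simp: abs_mult abs_if split: split_indicator if_splits intro!: ennreal_leI)
    also have "\<dots> < \<infinity>" using F by (simp add: integrable_iff_bounded)
    finally show ?thesis .
  qed
  have eq: "emeasure M (box a b) = emeasure N (box a b)" for a b
  proof -
    have "0 = (LINT x|lborel. indicator (box a b) x * F x)"
      using zero[of a b] by (simp add: set_lebesgue_integral_def)
    also have "\<dots> = enn2real (\<integral>\<^sup>+x. ennreal (indicator (box a b) x * F x) \<partial>lborel) -
        enn2real (\<integral>\<^sup>+x. ennreal (- (indicator (box a b) x * F x)) \<partial>lborel)"
      using F by (intro real_lebesgue_integral_def)
        (simp add: integrable_real_mult_indicator mult.commute)
    also have "(\<integral>\<^sup>+x. ennreal (indicator (box a b) x * F x) \<partial>lborel) = emeasure M (box a b)"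
      unfolding M_def by (subst emeasure_density) (auto intro!: nn_integral_cong split: split_indicator)
    also have "(\<integral>\<^sup>+x. ennreal (- (indicator (box a b) x * F x)) \<partial>lborel) = emeasure N (box a b)"
      unfolding N_def by (subst emeasure_density) (auto intro!: nn_integral_cong split: split_indicator)
    finally have "enn2real (emeasure M (box a b)) = enn2real (emeasure N (box a b))"
      by simp
    moreover have "emeasure M (box a b) < \<infinity>" "emeasure N (box a b) < \<infinity>"
      using fin[of 1 "box a b"] fin[of "-1" "box a b"] unfolding M_def N_def by (simp_all add: emeasure_density)
    ultimately show ?thesis
      by (metis ennreal_enn2real infinity_ennreal_def)
  qed
  have "M = N"
  proof (rule measure_eqI_generator_eq[where E = "range (\<lambda>(a, b). box a b :: 'a set)" and \<Omega> = UNIV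
        and A = "\<lambda>i. box (- (real i *\<^sub>R One)) (real i *\<^sub>R One)"])
    show "Int_stable (range (\<lambda>(a, b). box a b :: 'a set))"
      by (auto simp: Int_stable_def Int_interval image_iff box_Int_box)
    show "(\<Union>i. box (- (real i *\<^sub>R One)) (real i *\<^sub>R One)) = (UNIV :: 'a set)"
      by (rule UN_box_eq_UNIV)
    show "emeasure M X = emeasure N X" if "X \<in> range (\<lambda>(a, b). box a b)" for X
      using that eq by auto
    show "emeasure M (box (- (real i *\<^sub>R One)) (real i *\<^sub>R One)) \<noteq> \<infinity>" for i
      using fin[of 1 "box (- (real i *\<^sub>R One)) (real i *\<^sub>R One)"] unfolding M_def by (simp add: emeasure_density)
    show "sets M = sigma_sets UNIV (range (\<lambda>(a, b). box a b))"
         "sets N = sigma_sets UNIV (range (\<lambda>(a, b). box a b))"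
      unfolding M_def N_def by (simp_all, simp_all add: borel_eq_box)
  qed auto
  then have "AE x in lborel. ennreal (F x) = ennreal (- F x)"
    unfolding M_def N_def by (subst (asm) sigma_finite_measure.density_unique_iff[OF sigma_finite_lborel]) auto
  then show ?thesis
  proof eventually_elim
    case (elim x)
    then show ?case by (cases "F x > 0"; cases "F x < 0") (auto simp: ennreal_neg ennreal_eq_0_iff)
  qed
qed

section \<open>Calculus of C1 functions and cut-off functions\<close>

lemma C1_onI:
  assumes "\<And>x. x \<in> S \<Longrightarrow> (f has_derivative f' x) (at x)"
    and "\<And>v. continuous_on S (\<lambda>x. f' x v)"
  shows "C1_on S f"
proof -
  have "frechet_derivative f (at x) = f' x" if "x \<in> S" for x
    using frechet_derivative_at[OF assms(1)[OF that]] by simp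
  then show ?thesis
    using assms unfolding C1_on_def differentiable_def by (auto cong: continuous_on_cong)
qed

lemma C1_onD:
  assumes "C1_on S f" "x \<in> S"
  shows "(f has_derivative frechet_derivative f (at x)) (at x)"
  using assms by (simp add: C1_on_def frechet_derivative_works)

lemma C1_on_continuous_on: "C1_on S f \<Longrightarrow> continuous_on S f"
  by (simp add: C1_on_def continuous_at_imp_continuous_on differentiable_imp_continuous_within)

lemma C1_on_subset: "C1_on T f \<Longrightarrow> S \<subseteq> T \<Longrightarrow> C1_on S f"
  unfolding C1_on_def by (meson continuous_on_subset subset_iff)

lemma C1_on_const: "C1_on S (\<lambda>x. c)"
  by (rule C1_onI[where f' = "\<lambda>x v. 0"]) (auto intro!: derivative_eq_intros continuous_intros)

lemma C1_on_diff:
  assumes "C1_on S f" "C1_on S g"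
  shows "C1_on S (\<lambda>x. f x - g x)"
proof (rule C1_onI)
  show "((\<lambda>x. f x - g x) has_derivative (\<lambda>v. frechet_derivative f (at x) v - frechet_derivative g (at x) v)) (at x)"
    if "x \<in> S" for x
    by (rule has_derivative_diff[OF C1_onD[OF assms(1) that] C1_onD[OF assms(2) that]])
  show "continuous_on S (\<lambda>x. frechet_derivative f (at x) v - frechet_derivative g (at x) v)" for v
    using assms by (auto simp: C1_on_def intro!: continuous_intros)
qed

lemma C1_on_mult:
  fixes f g :: "real^'n \<Rightarrow> real"
  assumes "C1_on S f" "C1_on S g"
  shows "C1_on S (\<lambda>x. f x * g x)"
proof (rule C1_onI)
  show "((\<lambda>x. f x * g x) has_derivative (\<lambda>v. f x * frechet_derivative g (at x) v + frechet_derivative f (at x) v * g x)) (at x)"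
    if "x \<in> S" for x
    by (rule has_derivative_mult[OF C1_onD[OF assms(1) that] C1_onD[OF assms(2) that]])
  show "continuous_on S (\<lambda>x. f x * frechet_derivative g (at x) v + frechet_derivative f (at x) v * g x)" for v
    using assms C1_on_continuous_on[OF assms(1)] C1_on_continuous_on[OF assms(2)]
    by (auto simp: C1_on_def intro!: continuous_intros)
qed

lemma C1_on_power:
  fixes f :: "real^'n \<Rightarrow> real"
  shows "C1_on S f \<Longrightarrow> C1_on S (\<lambda>x. f x ^ k)"
  by (induction k) (auto intro: C1_on_const C1_on_mult)

lemma C1_on_prod:
  fixes f :: "'i \<Rightarrow> real^'n \<Rightarrow> real"
  shows "(\<And>i. i \<in> I \<Longrightarrow> C1_on S (f i)) \<Longrightarrow> C1_on S (\<lambda>x. \<Prod>i\<in>I. f i x)"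
  by (induction I rule: infinite_finite_induct) (auto intro: C1_on_const C1_on_mult)

lemma C1_on_comp_nth:
  assumes "\<And>t. (p has_real_derivative p' t) (at t)" "continuous_on UNIV p'"
  shows "C1_on S (\<lambda>x :: real^'n. p (x $ i))"
proof (rule C1_onI)
  show "((\<lambda>x. p (x $ i)) has_derivative (\<lambda>v. p' (x $ i) * v $ i)) (at x)" for x :: "real^'n"
    using has_derivative_compose[OF bounded_linear_imp_has_derivative[OF bounded_linear_vec_nth[of i]],
        OF has_field_derivative_imp_has_derivative[OF assms(1)]] by simp
  show "continuous_on S (\<lambda>x. p' (x $ i) * v $ i)" for v
    by (intro continuous_intros continuous_on_compose2[OF assms(2)]) auto
qed

text \<open>The square removes the corner of the positive part at 0, which makes it usable in C1
  cut-off functions.\<close>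

lemma square_pos_part_has_derivative:
  "((\<lambda>y::real. (max 0 y)\<^sup>2) has_real_derivative 2 * max 0 y) (at y)"
proof (cases y "0::real" rule: linorder_cases)
  case less
  have "((\<lambda>y::real. 0) has_real_derivative 2 * max 0 y) (at y)"
    using less by (auto intro!: derivative_eq_intros)
  moreover have "\<forall>\<^sub>F y in nhds y. (max 0 y)\<^sup>2 = (0::real)"
    using eventually_nhds_in_open[of "{..<0}" y] less by (auto elim!: eventually_mono)
  ultimately show ?thesis
    by (subst DERIV_cong_ev[OF refl _ refl]) auto
next
  case greater
  have "((\<lambda>y::real. y\<^sup>2) has_real_derivative 2 * max 0 y) (at y)"
    using greater by (auto intro!: derivative_eq_intros)
  moreover have "\<forall>\<^sub>F y in nhds y. (max 0 y)\<^sup>2 = y\<^sup>2"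
    using eventually_nhds_in_open[of "{0<..}" y] greater by (auto elim!: eventually_mono)
  ultimately show ?thesis
    by (subst DERIV_cong_ev[OF refl _ refl]) auto
next
  case equal
  have "((\<lambda>h. ((max 0 h)\<^sup>2) / h) \<longlongrightarrow> (0::real)) (at 0)"
  proof (rule Lim_null_comparison)
    show "\<forall>\<^sub>F h in at 0. norm ((max 0 h)\<^sup>2 / h) \<le> \<bar>h\<bar>" for h :: real
      by (rule always_eventually) (auto simp: max_def power2_eq_square)
    show "((\<lambda>h::real. \<bar>h\<bar>) \<longlongrightarrow> 0) (at 0)"
      by (auto intro!: tendsto_eq_intros)
  qed
  then show ?thesis
    using equal by (simp add: DERIV_def)
qed

text \<open>For \<open>0 \<le> q \<le> 1\<close>, the powers \<open>1 - (1 - q)\<^sup>k\<close> converge to the indicator of \<open>q > 0\<close>.\<close>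

lemma box_indicator_approx:
  fixes a b :: "real^'n"
  obtains \<phi> :: "nat \<Rightarrow> real^'n \<Rightarrow> real" where
    "\<And>k. C1_on UNIV (\<phi> k)" "\<And>k x. 0 \<le> \<phi> k x \<and> \<phi> k x \<le> 1"
    "\<And>k x. x \<notin> cbox a b \<Longrightarrow> \<phi> k x = 0" "\<And>x. (\<lambda>k. \<phi> k x) \<longlonglongrightarrow> indicator (box a b) x"
proof -
  \<comment> \<open>The product (t - a)(b - t) is at most (b - a)^2, so the denominator keeps
    \<open>p\<close> in [0,1]; the added 1 keeps it positive when the two endpoints
    coincide.\<close>
  define p where "p i t = (max 0 ((t - a $ i) * (b $ i - t) / (1 + (b $ i - a $ i)\<^sup>2)))\<^sup>2" for i t
  define p' where "p' i t = 2 * max 0 ((t - a $ i) * (b $ i - t) / (1 + (b $ i - a $ i)\<^sup>2)) *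
     ((b $ i - t - (t - a $ i)) / (1 + (b $ i - a $ i)\<^sup>2))" for i t
  define q where "q x = (\<Prod>i\<in>UNIV. p i (x $ i))" for x :: "real^'n"
  have nz: "1 + (b $ i - a $ i)\<^sup>2 > 0" for i
    by (simp add: add_pos_nonneg)
  have p: "0 \<le> p i t" "p i t \<le> 1" for i t
  proof -
    show "0 \<le> p i t" by (simp add: p_def)
    have "p * q \<le> (p + q)\<^sup>2" for p q :: real
    proof -
      have "0 \<le> (p + q)\<^sup>2 + p\<^sup>2 + q\<^sup>2" by simp
      then show ?thesis unfolding power2_sum by linarith
    qed
    from this[of "t - a $ i" "b $ i - t"]
    have "(t - a $ i) * (b $ i - t) \<le> (b $ i - a $ i)\<^sup>2" by simp
    then have "(t - a $ i) * (b $ i - t) / (1 + (b $ i - a $ i)\<^sup>2) \<le> 1"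
      using nz[of i] by (subst divide_le_eq_1_pos) auto
    then show "p i t \<le> 1" by (simp add: p_def power_le_one)
  qed
  have ppos: "p i t > 0 \<longleftrightarrow> a $ i < t \<and> t < b $ i" if "a $ i \<le> b $ i" for i t
  proof -
    have "p i t > 0 \<longleftrightarrow> (t - a $ i) * (b $ i - t) / (1 + (b $ i - a $ i)\<^sup>2) > 0"
    proof -
      have "(max 0 y)\<^sup>2 > 0 \<longleftrightarrow> y > 0" for y :: real
        by (auto simp: max_def)
      then show ?thesis unfolding p_def .
    qed
    also have "\<dots> \<longleftrightarrow> (t - a $ i) * (b $ i - t) > 0"
      using nz[of i] by (simp add: zero_less_divide_iff)
    also have "\<dots> \<longleftrightarrow> a $ i < t \<and> t < b $ i"
      using that by (auto simp: zero_less_mult_iff)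
    finally show ?thesis .
  qed
  have q: "0 \<le> q x" "q x \<le> 1" for x
    unfolding q_def using p by (auto intro!: prod_nonneg prod_le_1)
  have C1: "C1_on UNIV q"
    unfolding q_def
  proof (intro C1_on_prod C1_on_comp_nth)
    show "(p i has_real_derivative p' i t) (at t)" for i t
      unfolding p_def p'_def
      by (rule DERIV_chain2[OF square_pos_part_has_derivative], rule DERIV_cdivide)
        (auto intro!: derivative_eq_intros)
    show "continuous_on UNIV (p' i)" for i
      unfolding p'_def using nz[of i] by (intro continuous_intros) auto
  qed
  show thesis
  proof (cases "box a b = {}")
    case True
    then show thesis
      by (intro that[of "\<lambda>k x. 0"]) (auto intro: C1_on_const)
  next
    case False
    then have ab: "a $ i < b $ i" for i by (auto simp: interval_ne_empty_cart)
    have qpos: "q x > 0 \<longleftrightarrow> x \<in> box a b" for x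
    proof
      assume "q x > 0"
      then have "q x \<noteq> 0" by simp
      then have "p i (x $ i) \<noteq> 0" for i by (simp add: q_def)
      then have "p i (x $ i) > 0" for i using p(1)[of i "x $ i"] by (simp add: less_le)
      then have "a $ i < x $ i \<and> x $ i < b $ i" for i
        using ppos[OF less_imp_le[OF ab]] by blast
      then show "x \<in> box a b" by (simp add: mem_box_cart)
    next
      assume "x \<in> box a b"
      then have "p i (x $ i) > 0" for i
        using ppos[OF less_imp_le[OF ab]] by (simp add: mem_box_cart)
      then show "q x > 0" by (simp add: q_def prod_pos)
    qed
    show thesis
    proof (rule that[of "\<lambda>k x. 1 - (1 - q x) ^ k"])
      show "C1_on UNIV (\<lambda>x. 1 - (1 - q x) ^ k)" for k
        by (intro C1_on_diff C1_on_const C1_on_power C1)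
      show "0 \<le> 1 - (1 - q x) ^ k \<and> 1 - (1 - q x) ^ k \<le> 1" for k x
        using q[of x] by (simp add: power_le_one)
      show "1 - (1 - q x) ^ k = 0" if "x \<notin> cbox a b" for k x
      proof -
        have "x \<notin> box a b" using that box_subset_cbox by blast
        then have "q x = 0" using qpos[of x] q(1)[of x] by linarith
        then show ?thesis by simp
      qed
      show "(\<lambda>k. 1 - (1 - q x) ^ k) \<longlonglongrightarrow> indicator (box a b) x" for x
      proof (cases "x \<in> box a b")
        case True
        then have "0 < q x" "q x \<le> 1" using qpos q by auto
        then have "(\<lambda>k. 1 - (1 - q x) ^ k) \<longlonglongrightarrow> 1 - 0"
          by (intro tendsto_intros LIMSEQ_power_zero) auto
        then show ?thesis using True by simp
      next
        case False
        then have "q x = 0" using qpos[of x] q(1)[of x] by linarith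
        then show ?thesis using False by simp
      qed
    qed
  qed
qed

section \<open>Uniqueness of weak gradients\<close>

lemma borel_measurable_lebesgue_onI:
  "f \<in> borel_measurable borel \<Longrightarrow> f \<in> borel_measurable (lebesgue_on S)"
  by (intro measurable_restrict_space1 measurable_completion) simp

lemma measurable_vec_nth [measurable (raw)]:
  fixes f :: "'a \<Rightarrow> 'b::real_normed_vector ^ 'n"
  assumes "f \<in> borel_measurable M"
  shows "(\<lambda>x. f x $ i) \<in> borel_measurable M"
proof -
  have "(\<lambda>v :: 'b^'n. v $ i) \<in> borel_measurable borel"
    by (intro borel_measurable_continuous_onI continuous_intros)
  then show ?thesis using assms by (rule measurable_compose_rev)
qed

lemma abs_entry_le_norm: "\<bar>(K :: real^'n^'m) $ i $ j\<bar> \<le> norm K"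
  using component_le_norm_cart[of "K $ i" j] Finite_Cartesian_Product.norm_nth_le[of K i] by linarith

lemma abs_entry_le_square: "\<bar>(K :: real^'n^'m) $ i $ j\<bar> \<le> 1 + (norm K)\<^sup>2"
proof -
  have "norm K \<le> 1 + (norm K)\<^sup>2"
    using sum_squares_bound[of "norm K" 1] norm_ge_zero[of K] unfolding power2_eq_square by linarith
  then show ?thesis using abs_entry_le_norm[of K i j] by linarith
qed

text \<open>The difference \<open>H\<close> of two weak gradients integrates to 0 against every test
  function. Cut-off functions tending to the indicator of a box transfer this, by dominated
  convergence, to integrals over boxes with closure in \<open>S\<close>, and countably many closed
  boxes cover \<open>S\<close>.\<close>

lemma weak_gradient_unique:
  fixes u :: "real^'n \<Rightarrow> real^'m"
  assumes op: "open S" and G: "weak_gradient S u G" and G': "weak_gradient S u G'"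
  shows "AE x in lebesgue_on S. G x = G' x"
proof -
  have S[measurable]: "S \<in> sets borel" using op by simp
  have Gm[measurable]: "G \<in> borel_measurable (lebesgue_on S)" and G'm[measurable]: "G' \<in> borel_measurable (lebesgue_on S)"
    using G G' by (auto simp: weak_gradient_def L2_on_def)
  obtain H where H[measurable]: "H \<in> borel_measurable borel" and HG: "AE x in lebesgue_on S. G x - G' x = H x"
    using ex_borel_eq_lebesgue_on[OF S borel_measurable_diff[OF Gm G'm]] by blast
  have L2: "integrable lborel (\<lambda>x. indicator S x * (norm (H x))\<^sup>2)"
  proof -
    have "integrable (lebesgue_on S) (\<lambda>x. 2 * (norm (G x))\<^sup>2 + 2 * (norm (G' x))\<^sup>2)"
      using G G' by (auto simp: weak_gradient_def L2_on_def)
    then have "integrable (lebesgue_on S) (\<lambda>x. (norm (G x - G' x))\<^sup>2)"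
    proof (rule Bochner_Integration.integrable_bound)
      show "AE x in lebesgue_on S. norm ((norm (G x - G' x))\<^sup>2) \<le> norm (2 * (norm (G x))\<^sup>2 + 2 * (norm (G' x))\<^sup>2)"
      proof (rule AE_I2)
        fix x
        have "(norm (G x - G' x))\<^sup>2 \<le> (norm (G x) + norm (G' x))\<^sup>2"
          by (intro power_mono norm_triangle_ineq4) auto
        also have "\<dots> \<le> 2 * (norm (G x))\<^sup>2 + 2 * (norm (G' x))\<^sup>2"
          using sum_squares_bound[of "norm (G x)" "norm (G' x)"] by (simp add: power2_sum)
        finally show "norm ((norm (G x - G' x))\<^sup>2) \<le> norm (2 * (norm (G x))\<^sup>2 + 2 * (norm (G' x))\<^sup>2)"
          by simp
      qed
    qed measurable
    also have "?this \<longleftrightarrow> integrable (lebesgue_on S) (\<lambda>x. (norm (H x))\<^sup>2)"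
      using HG by (intro integrable_cong_AE) (auto elim!: eventually_mono simp: borel_measurable_lebesgue_onI)
    finally show ?thesis
      by (simp add: integrable_restrict_space integrable_completion)
  qed
  \<comment> \<open>\<open>S\<close> may have infinite measure, so square integrability alone does
    not make the entries integrable. A set \<open>T\<close> of finite measure carrying \<phi>
    repairs this: an entry times \<phi> is at most the indicator of \<open>T\<close> plus the
    squared norm.\<close>
  have test: "(LINT x|lborel. indicator S x * (H x $ i $ j * \<phi> x)) = 0"
    if "C1_compact_support S \<phi>" and [measurable]: "\<phi> \<in> borel_measurable borel" and bd: "\<And>x. \<bar>\<phi> x\<bar> \<le> 1"
      and supp: "\<And>x. x \<notin> T \<Longrightarrow> \<phi> x = 0" and T[measurable]: "T \<in> sets borel" and fin: "emeasure lborel T < \<infinity>" for \<phi> i j T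
  proof -
    have int: "integrable (lebesgue_on S) (\<lambda>x. K x $ i $ j * \<phi> x)"
      if [measurable]: "K \<in> borel_measurable (lebesgue_on S)" and "integrable (lebesgue_on S) (\<lambda>x. (norm (K x))\<^sup>2)" for K
    proof (rule Bochner_Integration.integrable_bound)
      have "integrable lebesgue (indicator T :: _ \<Rightarrow> real)"
        using fin by (simp add: integrable_completion)
      then have "integrable (lebesgue_on S) (indicator T :: _ \<Rightarrow> real)"
        by (subst integrable_restrict_space) (auto intro!: integrable_mult_indicator simp flip: real_scaleR_def)
      then show "integrable (lebesgue_on S) (\<lambda>x. indicator T x + (norm (K x))\<^sup>2)"
        using that by simp
      show "AE x in lebesgue_on S. norm (K x $ i $ j * \<phi> x) \<le> norm (indicator T x + (norm (K x))\<^sup>2)"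
      proof (rule AE_I2)
        fix x
        have "\<bar>K x $ i $ j\<bar> \<le> 1 + (norm (K x))\<^sup>2"
          by (rule abs_entry_le_square)
        moreover have "\<bar>K x $ i $ j * \<phi> x\<bar> \<le> \<bar>K x $ i $ j\<bar> * indicator T x"
          using bd[of x] supp[of x] by (auto simp: abs_mult mult_left_le split: split_indicator)
        ultimately have "\<bar>K x $ i $ j * \<phi> x\<bar> \<le> indicator T x + (norm (K x))\<^sup>2"
          by (auto split: split_indicator)
        then show "norm (K x $ i $ j * \<phi> x) \<le> norm (indicator T x + (norm (K x))\<^sup>2)"
          by (auto split: split_indicator)
      qed
      have [measurable]: "\<phi> \<in> borel_measurable (lebesgue_on S)"
        using that by (simp add: borel_measurable_lebesgue_onI)
      show "(\<lambda>x. K x $ i $ j * \<phi> x) \<in> borel_measurable (lebesgue_on S)"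
        by measurable
    qed
    have [measurable]: "\<phi> \<in> borel_measurable (lebesgue_on S)" "H \<in> borel_measurable (lebesgue_on S)"
      by (simp_all add: borel_measurable_lebesgue_onI)
    have "(LINT x|lborel. indicator S x * (H x $ i $ j * \<phi> x)) = (LINT x|lebesgue_on S. H x $ i $ j * \<phi> x)"
      by (subst integral_restrict_space) (auto simp: integral_completion)
    also have "\<dots> = (LINT x|lebesgue_on S. G x $ i $ j * \<phi> x - G' x $ i $ j * \<phi> x)"
      using HG by (intro integral_cong_AE) (auto elim!: eventually_mono simp: algebra_simps simp flip: vector_minus_component)
    also have "\<dots> = (LINT x|lebesgue_on S. G x $ i $ j * \<phi> x) - (LINT x|lebesgue_on S. G' x $ i $ j * \<phi> x)"
      using G G' by (intro Bochner_Integration.integral_diff int) (auto simp: weak_gradient_def L2_on_def)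
    also have "\<dots> = 0"
    proof -
      have "(LINT x|lebesgue_on S. u x $ i * frechet_derivative \<phi> (at x) (axis j 1)) = - (LINT x|lebesgue_on S. K x $ i $ j * \<phi> x)"
        if "weak_gradient S u K" for K
        using that \<open>C1_compact_support S \<phi>\<close> unfolding weak_gradient_def by blast
      from this[OF G] this[OF G'] show ?thesis by simp
    qed
    finally show ?thesis .
  qed
  have int_loc: "integrable lborel (\<lambda>x. indicator (box a b) x * H x $ i $ j)" if "box a b \<subseteq> S" for a b i j
  proof (rule Bochner_Integration.integrable_bound)
    show "integrable lborel (\<lambda>x. indicator (box a b) x + indicator S x * (norm (H x))\<^sup>2)"
      using L2 by (intro Bochner_Integration.integrable_add) (auto simp: emeasure_lborel_box_eq)
    show "AE x in lborel. norm (indicator (box a b) x * H x $ i $ j) \<le> norm (indicator (box a b) x + indicator S x * (norm (H x))\<^sup>2)"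
    proof (rule AE_I2)
      fix x
      have "\<bar>H x $ i $ j\<bar> \<le> 1 + (norm (H x))\<^sup>2" by (rule abs_entry_le_square)
      then show "norm (indicator (box a b) x * H x $ i $ j) \<le> norm (indicator (box a b) x + indicator S x * (norm (H x))\<^sup>2)"
        using that by (auto split: split_indicator)
    qed
  qed measurable
  have box0: "(LINT x:box a b|lborel. H x $ i $ j) = 0" if "cbox a b \<subseteq> S" for a b i j
  proof -
    obtain \<phi> :: "nat \<Rightarrow> real^'n \<Rightarrow> real" where \<phi>:
      "\<And>k. C1_on UNIV (\<phi> k)" "\<And>k x. 0 \<le> \<phi> k x \<and> \<phi> k x \<le> 1"
      "\<And>k x. x \<notin> cbox a b \<Longrightarrow> \<phi> k x = 0" "\<And>x. (\<lambda>k. \<phi> k x) \<longlonglongrightarrow> indicator (box a b) x"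
      using box_indicator_approx by blast
    have [measurable]: "\<phi> k \<in> borel_measurable borel" for k
      using C1_on_continuous_on[OF \<phi>(1)] by (rule borel_measurable_continuous_onI)
    have cs: "C1_compact_support S (\<phi> k)" for k
      unfolding C1_compact_support_def using \<phi>(1) \<phi>(3) that by (intro conjI exI[of _ "cbox a b"]) auto
    have bS: "box a b \<subseteq> S" using that box_subset_cbox by blast
    have "(\<lambda>k. LINT x|lborel. indicator S x * (H x $ i $ j * \<phi> k x)) \<longlonglongrightarrow>
        (LINT x|lborel. indicator (box a b) x * H x $ i $ j)"
    proof (rule integral_dominated_convergence)
      show "integrable lborel (\<lambda>x. indicator (cbox a b) x + indicator S x * (norm (H x))\<^sup>2)"
        using L2 by (intro Bochner_Integration.integrable_add) (auto simp: emeasure_lborel_cbox_eq)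
      show "AE x in lborel. (\<lambda>k. indicator S x * (H x $ i $ j * \<phi> k x)) \<longlonglongrightarrow> indicator (box a b) x * H x $ i $ j"
      proof (rule AE_I2)
        fix x
        have "(\<lambda>k. indicator S x * (H x $ i $ j * \<phi> k x)) \<longlonglongrightarrow> indicator S x * (H x $ i $ j * indicator (box a b) x)"
          by (intro tendsto_intros \<phi>)
        also have "indicator S x * (H x $ i $ j * indicator (box a b) x) = indicator (box a b) x * H x $ i $ j"
          using bS by (auto split: split_indicator)
        finally show "(\<lambda>k. indicator S x * (H x $ i $ j * \<phi> k x)) \<longlonglongrightarrow> indicator (box a b) x * H x $ i $ j" .
      qed
      show "AE x in lborel. norm (indicator S x * (H x $ i $ j * \<phi> k x)) \<le> indicator (cbox a b) x + indicator S x * (norm (H x))\<^sup>2" for k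
      proof (rule AE_I2)
        fix x
        have "\<bar>H x $ i $ j\<bar> \<le> 1 + (norm (H x))\<^sup>2" by (rule abs_entry_le_square)
        moreover have "\<bar>H x $ i $ j * \<phi> k x\<bar> \<le> \<bar>H x $ i $ j\<bar> * indicator (cbox a b) x"
          using \<phi>(2)[of k x] \<phi>(3)[of x k] by (auto simp: abs_mult mult_left_le split: split_indicator)
        ultimately show "norm (indicator S x * (H x $ i $ j * \<phi> k x)) \<le> indicator (cbox a b) x + indicator S x * (norm (H x))\<^sup>2"
          by (auto split: split_indicator)
      qed
    qed measurable
    moreover have "(LINT x|lborel. indicator S x * (H x $ i $ j * \<phi> k x)) = 0" for k
      using \<phi>(2) by (intro test[where T = "cbox a b"] cs \<phi>(3)) (auto simp: abs_le_iff emeasure_lborel_cbox_eq intro: order_trans[of _ 0])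
    ultimately show ?thesis
      by (simp add: set_lebesgue_integral_def LIMSEQ_const_iff)
  qed
  have zero_box: "AE x in lborel. x \<in> cbox a b \<longrightarrow> H x $ i $ j = 0" if ab: "cbox a b \<subseteq> S" for a b i j
  proof -
    have bS: "box a b \<subseteq> S" using that box_subset_cbox by blast
    have "AE x in lborel. indicator (box a b) x * H x $ i $ j = 0"
    proof (rule AE_zero_of_box_integrals[OF int_loc[OF bS]])
      \<comment> \<open>Boxes are closed under intersection, and a nonempty intersection with
        \<open>box a b\<close> has its closure inside \<open>cbox a b\<close>, so the vanishing
        already proved applies to it.\<close>
      fix c d
      obtain e f where ef: "box a b \<inter> box c d = box e f"
        using box_Int_box[of a b c d] by (rule that)
      have "(LINT x:box e f|lborel. H x $ i $ j) = 0"
      proof (cases "box e f = {}")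
        case False
        then have "cbox e f \<subseteq> cbox a b"
          using ef by (metis Int_lower1 closed_cbox closure_box closure_minimal box_subset_cbox order_trans)
        then show ?thesis using box0 ab by blast
      qed (simp add: set_lebesgue_integral_def)
      then show "(LINT x:box c d|lborel. indicator (box a b) x * H x $ i $ j) = 0"
        unfolding set_lebesgue_integral_def ef[symmetric]
        by (simp add: indicator_inter_arith mult_ac)
    qed
    moreover have "AE x in lborel. x \<notin> cbox a b - box a b"
      by (rule AE_not_in) (simp add: null_sets_def emeasure_Diff box_subset_cbox emeasure_lborel_cbox_eq emeasure_lborel_box_eq)
    ultimately show ?thesis
      by eventually_elim (auto split: split_indicator_asm)
  qed
  obtain \<D> where \<D>: "countable \<D>" "\<And>X. X \<in> \<D> \<Longrightarrow> X \<subseteq> S \<and> (\<exists>a b. X = cbox a b)" "\<Union>\<D> = S"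
    using open_countable_Union_open_cbox[OF op] by (metis PowD subset_iff)
  have "AE x in lborel. \<forall>X\<in>\<D>. x \<in> X \<longrightarrow> (\<forall>i j. H x $ i $ j = 0)"
  proof (subst AE_ball_countable[OF \<D>(1)], rule ballI)
    fix X assume "X \<in> \<D>"
    then obtain a b where "X = cbox a b" "cbox a b \<subseteq> S" using \<D> by metis
    then show "AE x in lborel. x \<in> X \<longrightarrow> (\<forall>i j. H x $ i $ j = 0)"
      using zero_box[of a b] by (simp add: AE_all_countable AE_conj_iff flip: all_simps)
  qed
  then have "AE x in lborel. x \<in> S \<longrightarrow> H x = 0"
    using \<D>(3) by (auto elim!: eventually_mono simp: vec_eq_iff)
  then have "AE x in lebesgue_on S. H x = 0"
    using S by (simp add: AE_lebesgue_on_iff)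
  with HG show ?thesis
    by eventually_elim simp
qed

section \<open>Integration by parts for C1 functions\<close>

lemma has_derivative_zero_outside:
  assumes "closed K" "x \<notin> K" "\<And>y. y \<notin> K \<Longrightarrow> f y = 0"
  shows "(f has_derivative (\<lambda>v. 0)) (at x)"
proof (rule has_derivative_transform_within_open[where s = "- K" and f = "\<lambda>_. 0"])
  show "((\<lambda>_. 0) has_derivative (\<lambda>v. 0)) (at x)" by simp
qed (use assms in auto)

lemma frechet_derivative_zero_outside:
  assumes "closed K" "x \<notin> K" "\<And>y. y \<notin> K \<Longrightarrow> f y = 0"
  shows "frechet_derivative f (at x) v = 0"
  using frechet_derivative_at[OF has_derivative_zero_outside[OF assms], symmetric] by simp

lemma C1_compact_support_partial_bounded:
  fixes \<psi> :: "real^'n \<Rightarrow> real"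
  assumes "C1_compact_support UNIV \<psi>"
  obtains K B where "compact K" "\<And>x. x \<notin> K \<Longrightarrow> \<psi> x = 0" "\<And>x. x \<notin> K \<Longrightarrow> frechet_derivative \<psi> (at x) v = 0"
    "\<And>x. \<bar>frechet_derivative \<psi> (at x) v\<bar> \<le> B" "0 \<le> B"
proof -
  obtain K where K: "compact K" "\<And>x. x \<notin> K \<Longrightarrow> \<psi> x = 0" and C1: "C1_on UNIV \<psi>"
    using assms unfolding C1_compact_support_def by blast
  have D0: "frechet_derivative \<psi> (at x) v = 0" if "x \<notin> K" for x
    using frechet_derivative_zero_outside[OF compact_imp_closed[OF K(1)] that K(2)] .
  have "continuous_on K (\<lambda>x. frechet_derivative \<psi> (at x) v)"
    using C1 unfolding C1_on_def by (meson continuous_on_subset subset_UNIV)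
  then have "bounded ((\<lambda>x. frechet_derivative \<psi> (at x) v) ` K)"
    using K by (intro compact_imp_bounded compact_continuous_image)
  then obtain B where B: "B > 0" "\<And>x. x \<in> K \<Longrightarrow> \<bar>frechet_derivative \<psi> (at x) v\<bar> \<le> B"
    by (auto simp: bounded_pos)
  have "\<bar>frechet_derivative \<psi> (at x) v\<bar> \<le> B" for x
    using B D0[of x] by (cases "x \<in> K") auto
  then show thesis using that[of K B, OF K D0] B(1) by auto
qed

text \<open>The integral of \<open>\<psi> (x + t v)\<close> does not depend on \<open>t\<close>; differentiate at \<open>t = 0\<close>.\<close>

lemma integral_partial_eq_0:
  fixes \<psi> :: "real^'n \<Rightarrow> real"
  assumes cs: "C1_compact_support UNIV \<psi>"
  shows "(LINT x|lborel. frechet_derivative \<psi> (at x) v) = 0"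
proof -
  obtain K B where K: "compact K" "\<And>x. x \<notin> K \<Longrightarrow> \<psi> x = 0" "\<And>x. x \<notin> K \<Longrightarrow> frechet_derivative \<psi> (at x) v = 0"
    and B: "\<And>x. \<bar>frechet_derivative \<psi> (at x) v\<bar> \<le> B" "0 \<le> B"
    using C1_compact_support_partial_bounded[OF cs, of v] by metis
  have C1: "C1_on UNIV \<psi>" using cs by (simp add: C1_compact_support_def)
  have der: "(\<psi> has_derivative frechet_derivative \<psi> (at x)) (at x)" for x
    using C1_onD[OF C1] by simp
  have [measurable]: "\<psi> \<in> borel_measurable borel"
    using C1_on_continuous_on[OF C1] by (rule borel_measurable_continuous_onI)
  have [measurable]: "(\<lambda>x. frechet_derivative \<psi> (at x) v) \<in> borel_measurable borel"
    using C1 unfolding C1_on_def by (intro borel_measurable_continuous_onI) auto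
  obtain R where R: "\<And>x. x \<in> K \<Longrightarrow> norm x \<le> R"
    using compact_imp_bounded[OF K(1)] by (auto simp: bounded_iff)
  define t where "t n = 1 / real (Suc n)" for n
  have t: "t n > 0" "t n \<le> 1" for n by (auto simp: t_def)
  have lim_t: "t \<longlonglongrightarrow> 0" unfolding t_def by (rule LIMSEQ_inverse_real_of_nat[unfolded inverse_eq_divide])
  have ray: "((\<lambda>s. \<psi> (x + s *\<^sub>R v)) has_real_derivative frechet_derivative \<psi> (at (x + s *\<^sub>R v)) v) (at s)" for x s
  proof -
    have "((\<lambda>s. x + s *\<^sub>R v) has_derivative (\<lambda>h. h *\<^sub>R v)) (at s)"
      by (auto intro!: derivative_eq_intros)
    from has_derivative_compose[OF this der]
    have "((\<lambda>s. \<psi> (x + s *\<^sub>R v)) has_derivative (\<lambda>h. frechet_derivative \<psi> (at (x + s *\<^sub>R v)) (h *\<^sub>R v))) (at s)" .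
    moreover have "frechet_derivative \<psi> (at (x + s *\<^sub>R v)) (h *\<^sub>R v) = frechet_derivative \<psi> (at (x + s *\<^sub>R v)) v * h" for h
      using linear_scale[OF linear_frechet_derivative, of \<psi> "at (x + s *\<^sub>R v)" h v] der[THEN differentiableI] by simp
    ultimately show ?thesis by (simp add: has_field_derivative_def)
  qed
  define D where "D n x = (\<psi> (x + t n *\<^sub>R v) - \<psi> x) / t n" for n x
  have [measurable]: "D n \<in> borel_measurable borel" for n
    unfolding D_def by measurable
  have int\<psi>: "integrable lborel \<psi>"
  proof -
    have "integrable lborel (\<lambda>x. indicator K x *\<^sub>R \<psi> x)"
      using K C1_on_continuous_on[OF C1] by (intro borel_integrable_compact) (auto intro: continuous_on_subset)
    moreover have "(\<lambda>x. indicator K x *\<^sub>R \<psi> x) = \<psi>"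
      using K by (auto simp: fun_eq_iff split: split_indicator)
    ultimately show ?thesis by simp
  qed
  have trans: "integrable lborel (\<lambda>x. \<psi> (x + y))" "(LINT x|lborel. \<psi> (x + y)) = (LINT x|lborel. \<psi> x)" for y
  proof -
    have eq: "lborel = distr lborel borel (\<lambda>x. x + y)"
    proof -
      have "(\<lambda>x. x + y) = (+) y" by (auto simp: add.commute)
      then show ?thesis by (simp add: lborel_distr_plus)
    qed
    show "integrable lborel (\<lambda>x. \<psi> (x + y))"
      using int\<psi> by (subst (asm) eq, subst (asm) integrable_distr_eq) auto
    show "(LINT x|lborel. \<psi> (x + y)) = (LINT x|lborel. \<psi> x)"
      by (subst (2) eq, subst integral_distr) auto
  qed
  have "(\<lambda>n. LINT x|lborel. D n x) \<longlonglongrightarrow> (LINT x|lborel. frechet_derivative \<psi> (at x) v)"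
  proof (rule integral_dominated_convergence)
    show "integrable lborel (\<lambda>x :: real^'n. B * indicator (cball 0 (R + norm v)) x :: real)"
      using emeasure_lborel_cball_finite[of "0::real^'n" "R + norm v"]
      by (intro Bochner_Integration.integrable_mult_right integrable_real_indicator) auto
    show "AE x in lborel. (\<lambda>n. D n x) \<longlonglongrightarrow> frechet_derivative \<psi> (at x) v"
    proof (rule AE_I2)
      fix x
      have "((\<lambda>s. (\<psi> (x + s *\<^sub>R v) - \<psi> x) / s) \<longlongrightarrow> frechet_derivative \<psi> (at x) v) (at 0)"
        using ray[of x 0] by (simp add: DERIV_def)
      moreover have "filterlim t (at 0) sequentially"
        using lim_t t by (auto simp: filterlim_at intro!: always_eventually less_imp_neq[symmetric])
      ultimately show "(\<lambda>n. D n x) \<longlonglongrightarrow> frechet_derivative \<psi> (at x) v"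
        unfolding D_def by (rule filterlim_compose)
    qed
    \<comment> \<open>Since \<open>t n\<close> \<le> 1, the shift moves points by at most
      \<open>norm v\<close>. Outside the ball enlarged by that amount both terms of the difference
      quotient vanish; inside, the mean value theorem bounds it by \<open>B\<close>.\<close>
    show "AE x in lborel. norm (D n x) \<le> B * indicator (cball 0 (R + norm v)) x" for n
    proof (rule AE_I2)
      fix x
      show "norm (D n x) \<le> B * indicator (cball 0 (R + norm v)) x"
      proof (cases "x \<in> cball 0 (R + norm v)")
        case True
        obtain z where "\<psi> (x + t n *\<^sub>R v) - \<psi> (x + 0 *\<^sub>R v) = (t n - 0) * frechet_derivative \<psi> (at (x + z *\<^sub>R v)) v"
          using MVT2[OF t(1)[of n], of "\<lambda>s. \<psi> (x + s *\<^sub>R v)" "\<lambda>s. frechet_derivative \<psi> (at (x + s *\<^sub>R v)) v"] ray by blast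
        then have "D n x = frechet_derivative \<psi> (at (x + z *\<^sub>R v)) v"
          using t(1)[of n] by (simp add: D_def)
        then show ?thesis using True B by simp
      next
        case False
        then have x: "norm x > R + norm v" by simp
        have "norm (x + t n *\<^sub>R v) \<ge> norm x - norm (t n *\<^sub>R v)"
          by (metis add.commute add_diff_cancel norm_triangle_ineq2 norm_diff_ineq norm_minus_cancel diff_minus_eq_add)
        moreover have "norm (t n *\<^sub>R v) \<le> norm v"
          using t[of n] by (simp add: mult_left_le_one_le)
        ultimately have "x + t n *\<^sub>R v \<notin> K" "x \<notin> K"
          using R[of x] R[of "x + t n *\<^sub>R v"] x norm_ge_zero[of v] by (auto simp del: norm_scaleR)
        then show ?thesis using K(2) B by (simp add: D_def)
      qed
    qed
  qed measurable
  moreover have "(LINT x|lborel. D n x) = 0" for n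
  proof -
    have "(LINT x|lborel. D n x) = ((LINT x|lborel. \<psi> (x + t n *\<^sub>R v)) - (LINT x|lborel. \<psi> x)) / t n"
      unfolding D_def using trans(1) int\<psi> by (subst Bochner_Integration.integral_divide_zero, subst Bochner_Integration.integral_diff) auto
    then show ?thesis using trans(2) by simp
  qed
  ultimately show ?thesis by (simp add: LIMSEQ_const_iff)
qed

text \<open>\<open>f\<close> is controlled only on \<open>S\<close>, yet the product is C1 on the
  whole space: the support \<open>K\<close> of \<phi> is compact in \<open>S\<close>, so the open
  sets \<open>S\<close> and \<open>- K\<close> cover everything, and on \<open>- K\<close> the
  product is identically 0.\<close>

lemma C1_compact_support_mult:
  fixes f \<phi> :: "real^'n \<Rightarrow> real"
  assumes f: "C1_on S f" and S: "open S" and \<phi>: "C1_compact_support S \<phi>"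
  shows "C1_compact_support UNIV (\<lambda>x. f x * \<phi> x)"
    and "x \<in> S \<Longrightarrow> frechet_derivative (\<lambda>x. f x * \<phi> x) (at x) v =
      f x * frechet_derivative \<phi> (at x) v + frechet_derivative f (at x) v * \<phi> x"
    and "x \<notin> S \<Longrightarrow> frechet_derivative (\<lambda>x. f x * \<phi> x) (at x) v = 0"
proof -
  obtain K where K: "compact K" "K \<subseteq> S" "\<And>x. x \<notin> K \<Longrightarrow> \<phi> x = 0" and C1: "C1_on UNIV \<phi>"
    using \<phi> unfolding C1_compact_support_def by blast
  define D where "D x v = (if x \<in> S then f x * frechet_derivative \<phi> (at x) v + frechet_derivative f (at x) v * \<phi> x else 0)" for x v
  have opK: "open (- K)" using K by (simp add: compact_imp_closed open_Compl)
  have D\<phi>0: "frechet_derivative \<phi> (at x) v = 0" if "x \<notin> K" for x v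
    using frechet_derivative_zero_outside[OF compact_imp_closed[OF K(1)] that K(3)] .
  have der: "((\<lambda>x. f x * \<phi> x) has_derivative D x) (at x)" for x
  proof (cases "x \<in> S")
    case True
    then show ?thesis
      unfolding D_def using has_derivative_mult[OF C1_onD[OF f True] C1_onD[OF C1 UNIV_I]] by simp
  next
    case False
    then have "x \<notin> K" using K by blast
    have "((\<lambda>x. f x * \<phi> x) has_derivative (\<lambda>v. 0)) (at x)"
      using K by (intro has_derivative_zero_outside[OF compact_imp_closed[OF K(1)] \<open>x \<notin> K\<close>]) auto
    then show ?thesis using False by (simp add: D_def[abs_def])
  qed
  have "continuous_on (S \<union> - K) (\<lambda>x. D x v)" for v
  proof (rule continuous_on_open_Un[OF S opK])
    have "continuous_on S (\<lambda>x. f x * frechet_derivative \<phi> (at x) v + frechet_derivative f (at x) v * \<phi> x)"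
      using f C1 C1_on_continuous_on[OF f] C1_on_continuous_on[OF C1]
      by (auto simp: C1_on_def intro!: continuous_intros intro: continuous_on_subset)
    then show "continuous_on S (\<lambda>x. D x v)"
      by (auto simp: D_def cong: continuous_on_cong)
    have "D x v = 0" if "x \<in> - K" for x
      using that K D\<phi>0 by (auto simp: D_def)
    then show "continuous_on (- K) (\<lambda>x. D x v)"
      by (subst continuous_on_cong[OF refl, where g = "\<lambda>_. 0"]) auto
  qed
  moreover have "S \<union> - K = UNIV" using K by blast
  ultimately have "C1_on UNIV (\<lambda>x. f x * \<phi> x)"
    using der by (intro C1_onI[where f' = D]) auto
  then show "C1_compact_support UNIV (\<lambda>x. f x * \<phi> x)"
    unfolding C1_compact_support_def using K by (intro conjI exI[of _ K]) auto
  have "frechet_derivative (\<lambda>x. f x * \<phi> x) (at x) = D x" for x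
    using frechet_derivative_at[OF der] by simp
  then show "x \<in> S \<Longrightarrow> frechet_derivative (\<lambda>x. f x * \<phi> x) (at x) v =
      f x * frechet_derivative \<phi> (at x) v + frechet_derivative f (at x) v * \<phi> x"
    "x \<notin> S \<Longrightarrow> frechet_derivative (\<lambda>x. f x * \<phi> x) (at x) v = 0"
    by (simp_all add: D_def)
qed

lemma jacobian_nth: "V differentiable (at x) \<Longrightarrow> jacobian V (at x) $ i $ j = frechet_derivative V (at x) (axis j 1) $ i"
  by (simp add: jacobian_def matrix_def)

lemma C1_on_nth:
  fixes V :: "real^'n \<Rightarrow> real^'m"
  assumes V: "C1_on S V"
  shows "C1_on S (\<lambda>x. V x $ i)"
    and "x \<in> S \<Longrightarrow> frechet_derivative (\<lambda>x. V x $ i) (at x) v = frechet_derivative V (at x) v $ i"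
proof -
  have der: "((\<lambda>x. V x $ i) has_derivative (\<lambda>v. frechet_derivative V (at x) v $ i)) (at x)" if "x \<in> S" for x
    using bounded_linear.has_derivative[OF bounded_linear_vec_nth C1_onD[OF V that]] .
  then show "x \<in> S \<Longrightarrow> frechet_derivative (\<lambda>x. V x $ i) (at x) v = frechet_derivative V (at x) v $ i"
    using frechet_derivative_at[OF der] by metis
  show "C1_on S (\<lambda>x. V x $ i)"
    by (rule C1_onI[OF der]) (use V in \<open>auto simp: C1_on_def intro!: continuous_intros\<close>)
qed

text \<open>The product of a component of \<open>V\<close> and \<phi>, which vanishes off a compact
  subset of \<open>S\<close>, is C1 with compact support on the whole space, and a partial
  derivative of such a function has integral 0. The product rule then splits that integral.\<close>

lemma integral_by_parts_C1:
  fixes V :: "real^'n \<Rightarrow> real^'m"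
  assumes V: "C1_on S V" and S: "open S" and \<phi>: "C1_compact_support S \<phi>"
  shows "integrable (lebesgue_on S) (\<lambda>x. V x $ i * frechet_derivative \<phi> (at x) (axis j 1))"
    and "integrable (lebesgue_on S) (\<lambda>x. jacobian V (at x) $ i $ j * \<phi> x)"
    and "(LINT x|lebesgue_on S. V x $ i * frechet_derivative \<phi> (at x) (axis j 1)) =
      - (LINT x|lebesgue_on S. jacobian V (at x) $ i $ j * \<phi> x)"
proof -
  obtain K where K: "compact K" "K \<subseteq> S" "\<And>x. x \<notin> K \<Longrightarrow> \<phi> x = 0" and C1: "C1_on UNIV \<phi>"
    using \<phi> unfolding C1_compact_support_def by blast
  have D\<phi>0: "frechet_derivative \<phi> (at x) v = 0" if "x \<notin> K" for x v
    using frechet_derivative_zero_outside[OF compact_imp_closed[OF K(1)] that K(3)] .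
  let ?A = "\<lambda>x. V x $ i * frechet_derivative \<phi> (at x) (axis j 1)"
  let ?B = "\<lambda>x. jacobian V (at x) $ i $ j * \<phi> x"
  have int: "integrable (lebesgue_on S) F" "integrable lborel (\<lambda>x. indicator S x *\<^sub>R F x)"
    if "continuous_on S F" "\<And>x. x \<notin> K \<Longrightarrow> F x = 0" for F :: "real^'n \<Rightarrow> real"
  proof -
    have "integrable lborel (\<lambda>x. indicator K x *\<^sub>R F x)"
      using K that by (intro borel_integrable_compact) (auto intro: continuous_on_subset)
    moreover have "(\<lambda>x. indicator K x *\<^sub>R F x) = (\<lambda>x. indicator S x *\<^sub>R F x)"
      using that(2) K by (auto simp: fun_eq_iff split: split_indicator)
    ultimately show *: "integrable lborel (\<lambda>x. indicator S x *\<^sub>R F x)" by simp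
    then show "integrable (lebesgue_on S) F"
      using S by (subst integrable_restrict_space) (auto intro: integrable_completion[THEN iffD2])
  qed
  have jac: "jacobian V (at x) $ i $ j = frechet_derivative V (at x) (axis j 1) $ i" if "x \<in> S" for x
    using V that by (intro jacobian_nth) (simp add: C1_on_def)
  have contA: "continuous_on S ?A"
    using V C1 C1_on_continuous_on[OF V] by (auto simp: C1_on_def intro!: continuous_intros intro: continuous_on_subset)
  have "continuous_on S (\<lambda>x. frechet_derivative V (at x) (axis j 1) $ i * \<phi> x)"
    using V C1_on_continuous_on[OF C1] by (auto simp: C1_on_def intro!: continuous_intros intro: continuous_on_subset)
  then have contB: "continuous_on S ?B"
    using jac by (simp cong: continuous_on_cong)
  show intA: "integrable (lebesgue_on S) ?A" and intB: "integrable (lebesgue_on S) ?B"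
    using contA contB K D\<phi>0 by (auto intro!: int)
  have leb: "(LINT x|lebesgue_on S. F x) = (LINT x|lborel. indicator S x *\<^sub>R F x)"
    if "continuous_on S F" for F :: "real^'n \<Rightarrow> real"
  proof -
    have "(\<lambda>x. indicator S x *\<^sub>R F x) \<in> borel_measurable borel"
      using that S by (intro borel_measurable_continuous_on_indicator) auto
    then show ?thesis
      using S by (subst integral_restrict_space) (auto simp: integral_completion)
  qed
  have "0 = (LINT x|lborel. frechet_derivative (\<lambda>x. V x $ i * \<phi> x) (at x) (axis j 1))"
    by (rule integral_partial_eq_0[symmetric]) (intro C1_compact_support_mult[where S = S] C1_on_nth V S \<phi>)
  also have "\<dots> = (LINT x|lborel. indicator S x *\<^sub>R ?A x + indicator S x *\<^sub>R ?B x)"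
    using C1_compact_support_mult(2,3)[OF C1_on_nth(1)[OF V] S \<phi>] jac
    by (intro Bochner_Integration.integral_cong) (auto simp: C1_on_nth(2)[OF V] split: split_indicator)
  also have "\<dots> = (LINT x|lborel. indicator S x *\<^sub>R ?A x) + (LINT x|lborel. indicator S x *\<^sub>R ?B x)"
    using contA contB K D\<phi>0 by (intro Bochner_Integration.integral_add int) auto
  finally show "(LINT x|lebesgue_on S. ?A x) = - (LINT x|lebesgue_on S. ?B x)"
    unfolding leb[OF contA] leb[OF contB] by linarith
qed

section \<open>Limits in L2 and weak gradients\<close>

lemma tendsto_0_ennreal_of_square:
  fixes f :: "'a \<Rightarrow> ennreal"
  assumes "((\<lambda>n. (f n)\<^sup>2) \<longlongrightarrow> 0) F"
  shows "(f \<longlongrightarrow> 0) F"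
proof (rule order_tendstoI)
  fix y :: ennreal assume "0 < y"
  then have "0 < y\<^sup>2" by (simp add: power2_eq_square ennreal_zero_less_mult_iff)
  then have "\<forall>\<^sub>F n in F. (f n)\<^sup>2 < y\<^sup>2"
    using assms by (rule order_tendstoD(2)[rotated])
  then show "\<forall>\<^sub>F n in F. f n < y"
    by eventually_elim (meson not_le power_mono zero_le)
qed simp

text \<open>Cauchy-Schwarz against the constant 1, whose integral is the finite total mass.\<close>

lemma tendsto_nn_integral_norm_of_square:
  fixes f :: "nat \<Rightarrow> 'a \<Rightarrow> 'b::{real_normed_vector, second_countable_topology}"
  assumes [measurable]: "\<And>n. f n \<in> borel_measurable M" and fin: "emeasure M (space M) < \<infinity>"
    and lim: "(\<lambda>n. \<integral>\<^sup>+x. ennreal ((norm (f n x))\<^sup>2) \<partial>M) \<longlonglongrightarrow> 0"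
  shows "(\<lambda>n. \<integral>\<^sup>+x. ennreal (norm (f n x)) \<partial>M) \<longlonglongrightarrow> 0"
proof (rule tendsto_0_ennreal_of_square, rule tendsto_sandwich[OF _ _ tendsto_const])
  show "\<forall>\<^sub>F n in sequentially. (\<integral>\<^sup>+x. ennreal (norm (f n x)) \<partial>M)\<^sup>2 \<le>
      (\<integral>\<^sup>+x. ennreal ((norm (f n x))\<^sup>2) \<partial>M) * emeasure M (space M)"
  proof (rule always_eventually, rule allI)
    fix n
    have "(\<integral>\<^sup>+x. ennreal (norm (f n x)) * 1 \<partial>M)\<^sup>2 \<le> (\<integral>\<^sup>+x. (ennreal (norm (f n x)))\<^sup>2 \<partial>M) * (\<integral>\<^sup>+x. 1\<^sup>2 \<partial>M)"
      by (rule Cauchy_Schwarz_nn_integral) measurable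
    then show "(\<integral>\<^sup>+x. ennreal (norm (f n x)) \<partial>M)\<^sup>2 \<le>
      (\<integral>\<^sup>+x. ennreal ((norm (f n x))\<^sup>2) \<partial>M) * emeasure M (space M)"
      by (simp add: ennreal_power)
  qed
  have "(\<lambda>n. (\<integral>\<^sup>+x. ennreal ((norm (f n x))\<^sup>2) \<partial>M) * emeasure M (space M)) \<longlonglongrightarrow> 0 * emeasure M (space M)"
    using fin by (intro tendsto_mult_ennreal lim tendsto_const) auto
  then show "(\<lambda>n. (\<integral>\<^sup>+x. ennreal ((norm (f n x))\<^sup>2) \<partial>M) * emeasure M (space M)) \<longlonglongrightarrow> 0" by simp
qed auto

text \<open>A single member of the sequence suffices: it is bounded, lies at finite L2 distance from
  \<open>g\<close>, and |g|^2 \<le> 2 |f - g|^2 + 2 |f|^2.\<close>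

lemma integrable_square_of_L2_limit:
  fixes f :: "nat \<Rightarrow> 'a \<Rightarrow> 'b::euclidean_space"
  assumes [measurable]: "\<And>n. f n \<in> borel_measurable M" "g \<in> borel_measurable M"
    and fin: "emeasure M (space M) < \<infinity>" and bd: "\<And>n. \<exists>B. AE x in M. norm (f n x) \<le> B"
    and lim: "(\<lambda>n. \<integral>\<^sup>+x. ennreal ((norm (f n x - g x))\<^sup>2) \<partial>M) \<longlonglongrightarrow> 0"
  shows "integrable M (\<lambda>x. (norm (g x))\<^sup>2)"
proof (rule integrableI_bounded)
  have "\<forall>\<^sub>F n in sequentially. (\<integral>\<^sup>+x. ennreal ((norm (f n x - g x))\<^sup>2) \<partial>M) < 1"
    using lim by (rule order_tendstoD) simp
  then obtain n where n: "(\<integral>\<^sup>+x. ennreal ((norm (f n x - g x))\<^sup>2) \<partial>M) < 1"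
    by (auto simp: eventually_sequentially)
  obtain B where B: "AE x in M. norm (f n x) \<le> B" using bd by blast
  have "(\<integral>\<^sup>+x. ennreal (norm ((norm (g x))\<^sup>2)) \<partial>M) \<le>
     (\<integral>\<^sup>+x. 2 * ennreal ((norm (f n x - g x))\<^sup>2) + ennreal (2 * B\<^sup>2) \<partial>M)"
  proof (rule nn_integral_mono_AE)
    show "AE x in M. ennreal (norm ((norm (g x))\<^sup>2)) \<le> 2 * ennreal ((norm (f n x - g x))\<^sup>2) + ennreal (2 * B\<^sup>2)"
      using B
    proof eventually_elim
      case (elim x)
      have "norm (g x) \<le> norm (f n x - g x) + norm (f n x)"
        by (metis norm_minus_commute norm_triangle_sub add.commute)
      then have "norm (g x) \<le> norm (f n x - g x) + B" using elim by linarith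
      then have "(norm (g x))\<^sup>2 \<le> (norm (f n x - g x) + B)\<^sup>2"
        by (intro power_mono) auto
      also have "\<dots> \<le> 2 * (norm (f n x - g x))\<^sup>2 + 2 * B\<^sup>2"
        using sum_squares_bound[of "norm (f n x - g x)" B] by (simp add: power2_sum)
      finally have "ennreal ((norm (g x))\<^sup>2) \<le> ennreal (2 * (norm (f n x - g x))\<^sup>2 + 2 * B\<^sup>2)"
        by (rule ennreal_leI)
      then show ?case by (simp add: ennreal_mult' ennreal_plus)
    qed
  qed
  also have "\<dots> = 2 * (\<integral>\<^sup>+x. ennreal ((norm (f n x - g x))\<^sup>2) \<partial>M) + ennreal (2 * B\<^sup>2) * emeasure M (space M)"
    by (subst nn_integral_add) (auto simp: nn_integral_cmult)
  also have "\<dots> < \<infinity>"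
    using n fin by (auto simp: ennreal_mult_less_top less_top intro: order.strict_trans)
  finally show "(\<integral>\<^sup>+x. ennreal (norm ((norm (g x))\<^sup>2)) \<partial>M) < \<infinity>" .
qed measurable

lemma C1_on_jacobian_continuous:
  fixes V :: "real^'n \<Rightarrow> real^'m"
  assumes "C1_on S V"
  shows "continuous_on S (\<lambda>x. jacobian V (at x))"
proof -
  have "continuous_on S (\<lambda>x. jacobian V (at x) $ i $ j)" for i j
  proof -
    have "continuous_on S (\<lambda>x. frechet_derivative V (at x) (axis j 1) $ i)"
      using assms by (auto simp: C1_on_def intro!: continuous_intros)
    then show ?thesis
      using assms by (subst continuous_on_cong[OF refl jacobian_nth]) (auto simp: C1_on_def)
  qed
  then have "continuous_on S (\<lambda>x. \<chi> i j. jacobian V (at x) $ i $ j)"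
    by (intro continuous_on_vec_lambda)
  then show ?thesis by (simp add: vec_lambda_eta)
qed

text \<open>\<open>f\<close> and \<open>g\<close> stand for single entries of the fields
  \<open>f'\<close> and \<open>g'\<close>; L1 convergence of the fields controls every entry, and
  the bounded factor \<eta> costs only the constant \<open>B\<close>.\<close>

lemma tendsto_integral_mult_bounded:
  fixes f :: "nat \<Rightarrow> 'a \<Rightarrow> real" and f' :: "nat \<Rightarrow> 'a \<Rightarrow> 'b::euclidean_space"
  assumes f: "\<And>n. integrable M (\<lambda>x. f n x * \<eta> x)" and g: "integrable M (\<lambda>x. norm (g' x))"
    and [measurable]: "g' \<in> borel_measurable M" "\<eta> \<in> borel_measurable M" "g \<in> borel_measurable M"
        "\<And>n. f' n \<in> borel_measurable M"
    and \<eta>: "\<And>x. \<bar>\<eta> x\<bar> \<le> B" "0 \<le> B"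
    and gg: "\<And>x. \<bar>g x\<bar> \<le> norm (g' x)" and fg: "\<And>n x. x \<in> space M \<Longrightarrow> \<bar>f n x - g x\<bar> \<le> norm (f' n x - g' x)"
    and lim: "(\<lambda>n. \<integral>\<^sup>+x. ennreal (norm (f' n x - g' x)) \<partial>M) \<longlonglongrightarrow> 0"
  shows "(\<lambda>n. LINT x|M. f n x * \<eta> x) \<longlonglongrightarrow> (LINT x|M. g x * \<eta> x)"
proof (rule tendsto_L1_int)
  show "integrable (M) (\<lambda>x. g x * \<eta> x)"
  proof (rule Bochner_Integration.integrable_bound)
    show "integrable (M) (\<lambda>x. B * norm (g' x))" using g by simp
    show "AE x in M. norm (g x * \<eta> x) \<le> norm (B * norm (g' x))"
      using \<eta> gg by (intro AE_I2) (auto simp: abs_mult mult.commute[of B] intro!: mult_mono)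
  qed measurable
  show "(\<lambda>n. \<integral>\<^sup>+x. ennreal (norm (f n x * \<eta> x - g x * \<eta> x)) \<partial>M) \<longlonglongrightarrow> 0"
  proof (rule tendsto_sandwich[OF _ _ tendsto_const])
    have "(\<lambda>n. ennreal B * (\<integral>\<^sup>+x. ennreal (norm (f' n x - g' x)) \<partial>M)) \<longlonglongrightarrow> ennreal B * 0"
      by (intro tendsto_mult_ennreal lim tendsto_const) auto
    then show "(\<lambda>n. ennreal B * (\<integral>\<^sup>+x. ennreal (norm (f' n x - g' x)) \<partial>M)) \<longlonglongrightarrow> 0" by simp
    show "\<forall>\<^sub>F n in sequentially. (\<integral>\<^sup>+x. ennreal (norm (f n x * \<eta> x - g x * \<eta> x)) \<partial>M) \<le>
       ennreal B * (\<integral>\<^sup>+x. ennreal (norm (f' n x - g' x)) \<partial>M)"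
    proof (rule always_eventually, rule allI)
      fix n
      have "(\<integral>\<^sup>+x. ennreal (norm (f n x * \<eta> x - g x * \<eta> x)) \<partial>M) \<le>
        (\<integral>\<^sup>+x. ennreal B * ennreal (norm (f' n x - g' x)) \<partial>M)"
      proof (rule nn_integral_mono)
        fix x assume "x \<in> space (M)"
        then have xM: "x \<in> space M" .
        have "norm (f n x * \<eta> x - g x * \<eta> x) = \<bar>\<eta> x\<bar> * \<bar>f n x - g x\<bar>"
          unfolding left_diff_distrib[symmetric] by (simp add: abs_mult)
        also have "\<dots> \<le> B * norm (f' n x - g' x)"
          using \<eta> fg[OF xM] by (intro mult_mono) auto
        finally have "ennreal (norm (f n x * \<eta> x - g x * \<eta> x)) \<le> ennreal (B * norm (f' n x - g' x))"
          by (rule ennreal_leI)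
        then show "ennreal (norm (f n x * \<eta> x - g x * \<eta> x)) \<le> ennreal B * ennreal (norm (f' n x - g' x))"
          using \<eta> by (simp add: ennreal_mult)
      qed
      also have "\<dots> = ennreal B * (\<integral>\<^sup>+x. ennreal (norm (f' n x - g' x)) \<partial>M)"
        by (rule nn_integral_cmult) measurable
      finally show "(\<integral>\<^sup>+x. ennreal (norm (f n x * \<eta> x - g x * \<eta> x)) \<partial>M) \<le>
       ennreal B * (\<integral>\<^sup>+x. ennreal (norm (f' n x - g' x)) \<partial>M)" .
    qed
  qed auto
qed (use f in auto)

text \<open>Integration by parts for \<open>V n\<close> passes to the limit. The hypotheses have the
  shape of the trace definition, so the same approximations serve for gradient and boundary values.
  Square integrability of \<open>u\<close> and \<open>G\<close> follows because \<open>V n\<close>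
  and its Jacobian are bounded on the compact closure of \<open>S\<close>.\<close>

lemma weak_gradient_limit:
  fixes u :: "real^'n \<Rightarrow> real^'m" and V :: "nat \<Rightarrow> real^'n \<Rightarrow> real^'m"
  assumes S: "open S" "bounded S"
    and u[measurable]: "u \<in> borel_measurable (lebesgue_on S)" and G[measurable]: "G \<in> borel_measurable (lebesgue_on S)"
    and V: "\<And>n. \<exists>W. open W \<and> closure S \<subseteq> W \<and> C1_on W (V n)"
    and limu: "(\<lambda>n. \<integral>\<^sup>+x. ennreal ((norm (V n x - u x))\<^sup>2) \<partial>lebesgue_on S) \<longlonglongrightarrow> 0"
    and limG: "(\<lambda>n. \<integral>\<^sup>+x. ennreal ((norm (jacobian (V n) (at x) - G x))\<^sup>2) \<partial>lebesgue_on S) \<longlonglongrightarrow> 0"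
  shows "weak_gradient S u G"
proof -
  have fin: "emeasure (lebesgue_on S) (space (lebesgue_on S)) < \<infinity>"
    using S emeasure_bounded_finite[of S] by (simp add: emeasure_restrict_space emeasure_completion)
  have C1S: "C1_on S (V n)" for n
    using V[of n] closure_subset by (meson C1_on_subset order_trans)
  have VB: "\<exists>B. AE x in lebesgue_on S. norm (V n x) \<le> B" and JB: "\<exists>B. AE x in lebesgue_on S. norm (jacobian (V n) (at x)) \<le> B" for n
  proof -
    obtain W where W: "closure S \<subseteq> W" "C1_on W (V n)" using V by blast
    have *: "\<exists>B. AE x in lebesgue_on S. norm (f x) \<le> B" if "continuous_on W f" for f :: "real^'n \<Rightarrow> 'b::real_normed_vector"
    proof -
      have "bounded (f ` closure S)"
        using that W S by (intro compact_imp_bounded compact_continuous_image) (auto intro: continuous_on_subset simp: compact_closure)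
      then obtain B where "\<And>x. x \<in> closure S \<Longrightarrow> norm (f x) \<le> B" by (auto simp: bounded_iff)
      then show ?thesis using closure_subset by (intro exI[of _ B] AE_I2) auto
    qed
    show "\<exists>B. AE x in lebesgue_on S. norm (V n x) \<le> B"
      using W by (intro * C1_on_continuous_on)
    show "\<exists>B. AE x in lebesgue_on S. norm (jacobian (V n) (at x)) \<le> B"
      using W by (intro * C1_on_jacobian_continuous)
  qed
  have mV[measurable]: "V n \<in> borel_measurable (lebesgue_on S)" for n
    using C1_on_continuous_on[OF C1S] S by (intro continuous_imp_measurable_on_sets_lebesgue) auto
  have mJ[measurable]: "(\<lambda>x. jacobian (V n) (at x)) \<in> borel_measurable (lebesgue_on S)" for n
    using C1_on_jacobian_continuous[OF C1S] S by (intro continuous_imp_measurable_on_sets_lebesgue) auto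
  have L2u: "L2_on S u"
    unfolding L2_on_def using integrable_square_of_L2_limit[OF mV u fin VB limu] u by simp
  have L2G: "L2_on S G"
    unfolding L2_on_def using integrable_square_of_L2_limit[OF mJ G fin JB limG] G by simp
  have L1: "integrable (lebesgue_on S) (\<lambda>x. norm (f x))"
    if [measurable]: "f \<in> borel_measurable (lebesgue_on S)" and "integrable (lebesgue_on S) (\<lambda>x. (norm (f x))\<^sup>2)"
    for f :: "real^'n \<Rightarrow> 'b::euclidean_space"
  proof (rule Bochner_Integration.integrable_bound)
    show "integrable (lebesgue_on S) (\<lambda>x. 1 + (norm (f x))\<^sup>2)"
      using that fin by (intro Bochner_Integration.integrable_add integrable_const finite_measure.integrable_const)
        (auto intro!: finite_measureI)
    show "AE x in lebesgue_on S. norm (norm (f x)) \<le> norm (1 + (norm (f x))\<^sup>2)"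
    proof (rule AE_I2)
      fix x
      have "norm (f x) \<le> 1 + norm (f x) * norm (f x)"
        using sum_squares_bound[of "norm (f x)" 1] norm_ge_zero[of "f x"] unfolding power2_eq_square by linarith
      then show "norm (norm (f x)) \<le> norm (1 + (norm (f x))\<^sup>2)"
        by (simp add: power2_eq_square)
    qed
  qed measurable
  have L1u: "(\<lambda>n. \<integral>\<^sup>+x. ennreal (norm (V n x - u x)) \<partial>lebesgue_on S) \<longlonglongrightarrow> 0"
    using fin limu by (intro tendsto_nn_integral_norm_of_square) measurable
  have L1G: "(\<lambda>n. \<integral>\<^sup>+x. ennreal (norm (jacobian (V n) (at x) - G x)) \<partial>lebesgue_on S) \<longlonglongrightarrow> 0"
    using fin limG by (intro tendsto_nn_integral_norm_of_square) measurable
  have "(LINT x|lebesgue_on S. u x $ i * frechet_derivative \<phi> (at x) (axis j 1)) =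
        - (LINT x|lebesgue_on S. G x $ i $ j * \<phi> x)" if \<phi>: "C1_compact_support S \<phi>" for \<phi> i j
  proof -
    have \<phi>U: "C1_compact_support UNIV \<phi>" and C1\<phi>: "C1_on UNIV \<phi>"
      using \<phi> by (auto simp: C1_compact_support_def)
    obtain B where B: "\<And>x. \<bar>frechet_derivative \<phi> (at x) (axis j 1)\<bar> \<le> B" "0 \<le> B"
      using C1_compact_support_partial_bounded[OF \<phi>U, of "axis j 1"] by metis
    obtain K where K: "compact K" "\<And>x. x \<notin> K \<Longrightarrow> \<phi> x = 0"
      using \<phi> unfolding C1_compact_support_def by blast
    have "bounded (\<phi> ` K)"
      using K C1_on_continuous_on[OF C1\<phi>] by (intro compact_imp_bounded compact_continuous_image) (auto intro: continuous_on_subset)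
    then obtain B' where B': "B' > 0" "\<And>x. x \<in> K \<Longrightarrow> \<bar>\<phi> x\<bar> \<le> B'" by (auto simp: bounded_pos)
    have B'': "\<bar>\<phi> x\<bar> \<le> B'" for x using B' K(2)[of x] by (cases "x \<in> K") auto
    have [measurable]: "\<phi> \<in> borel_measurable (lebesgue_on S)"
      using C1_on_continuous_on[OF C1\<phi>] by (intro borel_measurable_lebesgue_onI borel_measurable_continuous_onI)
    have [measurable]: "(\<lambda>x. frechet_derivative \<phi> (at x) (axis j 1)) \<in> borel_measurable (lebesgue_on S)"
      using C1\<phi> unfolding C1_on_def by (intro borel_measurable_lebesgue_onI borel_measurable_continuous_onI) auto
    note parts = integral_by_parts_C1[OF C1S S(1) \<phi>]
    have "(\<lambda>n. LINT x|lebesgue_on S. V n x $ i * frechet_derivative \<phi> (at x) (axis j 1)) \<longlonglongrightarrow>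
      (LINT x|lebesgue_on S. u x $ i * frechet_derivative \<phi> (at x) (axis j 1))"
    proof (rule tendsto_integral_mult_bounded[where f' = V and g' = u and B = B])
      show "integrable (lebesgue_on S) (\<lambda>x. norm (u x))"
        using L2u by (intro L1) (auto simp: L2_on_def)
      show "\<bar>u x $ i\<bar> \<le> norm (u x)" for x by (rule component_le_norm_cart)
      show "\<bar>V n x $ i - u x $ i\<bar> \<le> norm (V n x - u x)" for n x
        using component_le_norm_cart[of "V n x - u x" i] by simp
    qed (use parts(1) B L1u in auto)
    moreover have "(\<lambda>n. LINT x|lebesgue_on S. jacobian (V n) (at x) $ i $ j * \<phi> x) \<longlonglongrightarrow>
      (LINT x|lebesgue_on S. G x $ i $ j * \<phi> x)"
    proof (rule tendsto_integral_mult_bounded[where f' = "\<lambda>n x. jacobian (V n) (at x)" and g' = G and B = B'])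
      show "integrable (lebesgue_on S) (\<lambda>x. norm (G x))"
        using L2G by (intro L1) (auto simp: L2_on_def)
      show "\<bar>G x $ i $ j\<bar> \<le> norm (G x)" for x by (rule abs_entry_le_norm)
      show "\<bar>jacobian (V n) (at x) $ i $ j - G x $ i $ j\<bar> \<le> norm (jacobian (V n) (at x) - G x)" for n x
        using abs_entry_le_norm[of "jacobian (V n) (at x) - G x" i j] by simp
    qed (use parts(2) B' B'' L1G in auto)
    ultimately show ?thesis
      unfolding parts(3) using LIMSEQ_unique tendsto_minus by blast
  qed
  with L2u L2G show ?thesis by (simp add: weak_gradient_def)
qed

section \<open>Rotation-equivariant maps\<close>

definition equivariant_map :: "(real \<Rightarrow> complex) \<Rightarrow> real^2 \<Rightarrow> real^2" where
  "equivariant_map w x = vec_of_complex (w (norm x) * sgn (to_complex x))"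

text \<open>The two columns in the frame \<open>e\<close>, \<open>i e\<close> are the radial derivative \<open>g e\<close> and the angular
  derivative \<open>i w e / r\<close>.\<close>

definition equivariant_grad :: "(real \<Rightarrow> complex) \<Rightarrow> (real \<Rightarrow> complex) \<Rightarrow> real^2 \<Rightarrow> real^2^2" where
  "equivariant_grad w g x = (let e = sgn (to_complex x); p = g (norm x) * e; q = \<i> * w (norm x) * e / of_real (norm x)
     in vector [vector [Re p * Re e - Re q * Im e, Re p * Im e + Re q * Re e],
                vector [Im p * Re e - Im q * Im e, Im p * Im e + Im q * Re e]])"

lemma equivariant_map_polar:
  "0 < r \<Longrightarrow> equivariant_map w (polar r \<theta>) = vec_of_complex (w r * cis \<theta>)"
  by (simp add: equivariant_map_def to_complex_polar sgn_mult sgn_of_real)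

lemma norm_equivariant_map: "x \<noteq> 0 \<Longrightarrow> norm (equivariant_map w x) = norm (w (norm x))"
  using norm_to_complex[of x] by (auto simp: equivariant_map_def norm_mult norm_sgn simp del: norm_to_complex)

lemma equivariant_map_diff:
  "equivariant_map w x - equivariant_map v x = equivariant_map (\<lambda>r. w r - v r) x"
  by (simp add: equivariant_map_def left_diff_distrib linear_diff[OF bounded_linear.linear[OF bounded_linear_vec_of_complex]])

lemma equivariant_grad_diff:
  "equivariant_grad w g x - equivariant_grad v h x = equivariant_grad (\<lambda>r. w r - v r) (\<lambda>r. g r - h r) x"
  by (simp add: equivariant_grad_def Let_def vec_eq_iff forall_2 algebra_simps diff_divide_distrib)

lemma norm_square_2x2:
  "(norm (K :: real^2^2))\<^sup>2 = (K$1$1)\<^sup>2 + (K$1$2)\<^sup>2 + (K$2$1)\<^sup>2 + (K$2$2)\<^sup>2"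
  by (simp add: norm_vec_def L2_set_def sum_2)

lemma sgn_to_complex_unit: "x \<noteq> 0 \<Longrightarrow> (Re (sgn (to_complex x)))\<^sup>2 + (Im (sgn (to_complex x)))\<^sup>2 = 1"
  using norm_to_complex[of x] by (metis cmod_power2 norm_eq_zero norm_sgn one_power2)

lemma norm_equivariant_grad:
  assumes "x \<noteq> 0"
  shows "(norm (equivariant_grad w g x))\<^sup>2 = (norm (g (norm x)))\<^sup>2 + (norm (w (norm x)))\<^sup>2 / (norm x)\<^sup>2"
proof -
  define e where "e = sgn (to_complex x)"
  define p where "p = g (norm x) * e"
  define q where "q = \<i> * w (norm x) * e / of_real (norm x)"
  have e: "(Re e)\<^sup>2 + (Im e)\<^sup>2 = 1" "norm e = 1"
    using sgn_to_complex_unit[OF assms] norm_to_complex[of x] assms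
    by (auto simp: e_def norm_sgn simp del: norm_to_complex)
  have "(norm (equivariant_grad w g x))\<^sup>2 = ((Re e)\<^sup>2 + (Im e)\<^sup>2) * ((norm p)\<^sup>2 + (norm q)\<^sup>2)"
    unfolding norm_square_2x2 equivariant_grad_def Let_def e_def[symmetric] p_def[symmetric] q_def[symmetric] cmod_power2
    by (simp add: power2_eq_square algebra_simps)
  then show ?thesis
    using e by (simp add: p_def q_def norm_mult norm_divide power_divide)
qed

lemma det_equivariant_grad:
  assumes "x \<noteq> 0"
  shows "det (equivariant_grad w g x) = Re (cnj (w (norm x)) * g (norm x)) / norm x"
proof -
  define e where "e = sgn (to_complex x)"
  define p where "p = g (norm x) * e"
  define q where "q = \<i> * w (norm x) * e / of_real (norm x)"
  have e: "(Re e)\<^sup>2 + (Im e)\<^sup>2 = 1"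
    using sgn_to_complex_unit[OF assms] by (auto simp: e_def)
  have "det (equivariant_grad w g x) = ((Re e)\<^sup>2 + (Im e)\<^sup>2) * (Re p * Im q - Im p * Re q)"
    unfolding det_2 equivariant_grad_def Let_def e_def[symmetric] p_def[symmetric] q_def[symmetric]
    by (simp add: power2_eq_square algebra_simps)
  also have "Re p * Im q - Im p * Re q = ((Re e)\<^sup>2 + (Im e)\<^sup>2) * (Re (cnj (w (norm x)) * g (norm x)) / norm x)"
    by (simp add: p_def q_def power2_eq_square field_simps) (simp add: algebra_simps add_divide_distrib diff_divide_distrib)
  finally show ?thesis using e by simp
qed

lemma to_complex_equivariant_grad:
  "to_complex (equivariant_grad w g x *v v) =
    g (norm x) * sgn (to_complex x) * of_real (Re (cnj (sgn (to_complex x)) * to_complex v)) +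
    \<i> * w (norm x) * sgn (to_complex x) / of_real (norm x) * of_real (Im (cnj (sgn (to_complex x)) * to_complex v))"
proof -
  define e where "e = sgn (to_complex x)"
  define p where "p = g (norm x) * e"
  define q where "q = \<i> * w (norm x) * e / of_real (norm x)"
  show ?thesis
    unfolding equivariant_grad_def Let_def e_def[symmetric] p_def[symmetric] q_def[symmetric]
    by (simp add: to_complex_def complex_eq_iff matrix_vector_mult_def sum_2 algebra_simps)
qed

lemma has_derivative_equivariant_map:
  assumes x: "x \<noteq> 0" and w: "(w has_vector_derivative g (norm x)) (at (norm x))"
  shows "(equivariant_map w has_derivative (\<lambda>v. equivariant_grad w g x *v v)) (at x)"
proof -
  define r where "r = norm x"
  define e where "e = sgn (to_complex x)"
  have r: "r > 0" using x by (simp add: r_def)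
  have xe: "to_complex x = of_real r * e"
    using x norm_to_complex[of x] by (auto simp: e_def r_def sgn_div_norm scaleR_conv_of_real simp del: norm_to_complex)
  have e: "cnj e * e = 1" using sgn_to_complex_unit[OF x] by (simp add: e_def complex_eq_iff power2_eq_square)
  have inner: "v \<bullet> sgn x = Re (cnj e * to_complex v)" for v
    using r by (simp add: e_def sgn_div_norm to_complex_def inner_vec_def sum_2 r_def algebra_simps norm_vec_def L2_set_def cmod_def)
  have dw: "((\<lambda>y. w (norm y)) has_derivative (\<lambda>v. (v \<bullet> sgn x) *\<^sub>R g r)) (at x)"
    using has_derivative_compose[OF has_derivative_norm[OF x] w[unfolded has_vector_derivative_def]]
    by (simp add: r_def)
  have ds: "((\<lambda>y. to_complex y /\<^sub>R norm y) has_derivative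
     (\<lambda>v. inverse r *\<^sub>R to_complex v + (- (inverse r * (v \<bullet> sgn x) * inverse r)) *\<^sub>R to_complex x)) (at x)"
    unfolding r_def using x
    by (intro has_derivative_scaleR Deriv.has_derivative_inverse has_derivative_norm
         bounded_linear_imp_has_derivative[OF bounded_linear_to_complex]) auto
  have D: "((\<lambda>y. w (norm y) * (to_complex y /\<^sub>R norm y)) has_derivative
     (\<lambda>v. w r * (inverse r *\<^sub>R to_complex v + (- (inverse r * (v \<bullet> sgn x) * inverse r)) *\<^sub>R to_complex x) +
        ((v \<bullet> sgn x) *\<^sub>R g r) * (to_complex x /\<^sub>R r))) (at x)"
    using has_derivative_mult[OF dw ds] by (simp add: r_def)
  have "w r * (inverse r *\<^sub>R to_complex v + (- (inverse r * (v \<bullet> sgn x) * inverse r)) *\<^sub>R to_complex x) +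
        ((v \<bullet> sgn x) *\<^sub>R g r) * (to_complex x /\<^sub>R r) = to_complex (equivariant_grad w g x *v v)" for v
  proof -
    \<comment> \<open>The coordinates of \<open>v\<close> in the frame \<open>e\<close>, i
      \<open>e\<close>: \<open>Re c\<close> is the radial component and \<open>Im c\<close> the
      tangential one.\<close>
    define c where "c = cnj e * to_complex v"
    have v: "to_complex v = e * c" using e by (simp add: c_def mult.assoc[symmetric] mult.commute[of e])
    have c: "of_real (Re c) + \<i> * of_real (Im c) = c" by (simp add: complex_eq_iff)
    have "to_complex (equivariant_grad w g x *v v) = g r * e * of_real (Re c) + \<i> * w r * e / of_real r * of_real (Im c)"
      unfolding to_complex_equivariant_grad e_def[symmetric] c_def[symmetric] r_def[symmetric] ..
    also have "\<i> * w r * e / of_real r * of_real (Im c) = w r * e / of_real r * (c - of_real (Re c))"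
      by (subst c[symmetric]) (simp add: algebra_simps)
    finally have G: "to_complex (equivariant_grad w g x *v v) = g r * e * of_real (Re c) + w r * e / of_real r * (c - of_real (Re c))" .
    have i: "v \<bullet> sgn x = Re c" by (simp add: inner c_def)
    show ?thesis
      unfolding G i v xe using r
      by (simp add: scaleR_conv_of_real field_simps)
  qed
  with D have "((\<lambda>y. w (norm y) * (to_complex y /\<^sub>R norm y)) has_derivative (\<lambda>v. to_complex (equivariant_grad w g x *v v))) (at x)"
    by simp
  from bounded_linear.has_derivative[OF bounded_linear_vec_of_complex this]
  show ?thesis
    by (simp add: equivariant_map_def[abs_def] sgn_div_norm)
qed

lemma continuous_on_equivariant_grad:
  assumes "continuous_on (norm ` S) w" "continuous_on (norm ` S) g" "0 \<notin> S"
  shows "continuous_on S (\<lambda>x. equivariant_grad w g x *v v)"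
proof -
  have cs: "continuous_on S (\<lambda>x. sgn (to_complex x))"
    unfolding sgn_div_norm using assms
    by (intro continuous_intros bounded_linear.continuous_on[OF bounded_linear_to_complex]) auto
  have cw: "continuous_on S (\<lambda>x. w (norm x))" "continuous_on S (\<lambda>x. g (norm x))"
    using assms by (auto intro!: continuous_on_compose2[OF assms(1)] continuous_on_compose2[OF assms(2)] continuous_intros)
  have "continuous_on S (\<lambda>x. vec_of_complex (to_complex (equivariant_grad w g x *v v)))"
    unfolding to_complex_equivariant_grad using assms(3)
    by (intro bounded_linear.continuous_on[OF bounded_linear_vec_of_complex] continuous_intros cs cw) auto
  then show ?thesis by simp
qed

lemma C1_on_equivariant_map:
  assumes "0 \<notin> S" "\<And>r. r \<in> norm ` S \<Longrightarrow> (w has_vector_derivative g r) (at r)" "continuous_on (norm ` S) g"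
  shows "C1_on S (equivariant_map w)"
    and "x \<in> S \<Longrightarrow> jacobian (equivariant_map w) (at x) = equivariant_grad w g x"
proof -
  have der: "(equivariant_map w has_derivative (\<lambda>v. equivariant_grad w g x *v v)) (at x)" if "x \<in> S" for x
    using that assms by (intro has_derivative_equivariant_map) auto
  have "continuous_on (norm ` S) w"
    using assms(2) by (meson continuous_at_imp_continuous_on has_vector_derivative_continuous)
  then show "C1_on S (equivariant_map w)"
    using assms by (intro C1_onI[OF der] continuous_on_equivariant_grad)
  show "x \<in> S \<Longrightarrow> jacobian (equivariant_map w) (at x) = equivariant_grad w g x"
    using frechet_derivative_at[OF der, of x] matrix_of_matrix_vector_mul[of "equivariant_grad w g x"]
    by (simp add: jacobian_def)
qed

lemma measurable_equivariant_map [measurable]: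
  assumes [measurable]: "w \<in> borel_measurable borel"
  shows "equivariant_map w \<in> borel_measurable borel"
  unfolding equivariant_map_def[abs_def] sgn_div_norm by measurable

lemma measurable_vector_2:
  assumes "f \<in> borel_measurable M" "g \<in> borel_measurable M"
  shows "(\<lambda>x. vector [f x, g x] :: 'a::euclidean_space ^ 2) \<in> borel_measurable M"
proof -
  have eq: "(vector [y, z] :: 'a^2) = axis 1 y + axis 2 z" for y z :: 'a
    by (simp add: vec_eq_iff forall_2 axis_def)
  have "continuous_on UNIV (axis i :: 'a \<Rightarrow> 'a^2)" for i
    unfolding axis_def
  proof (intro continuous_on_vec_lambda)
    show "continuous_on UNIV (\<lambda>x :: 'a. if j = i then x else 0)" for j
      by (cases "j = i") auto
  qed
  then have [measurable]: "(axis i :: 'a \<Rightarrow> 'a^2) \<in> borel_measurable borel" for i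
    by (rule borel_measurable_continuous_onI)
  show ?thesis unfolding eq using assms by measurable
qed

lemma measurable_equivariant_grad [measurable]:
  assumes [measurable]: "w \<in> borel_measurable borel" "g \<in> borel_measurable borel"
  shows "equivariant_grad w g \<in> borel_measurable borel"
  unfolding equivariant_grad_def[abs_def] sgn_div_norm Let_def by (intro measurable_vector_2) measurable

section \<open>Plane rotations as matrices\<close>

definition rot_matrix :: "real \<Rightarrow> real^2^2" where
  "rot_matrix \<alpha> = vector [vector [cos \<alpha>, - sin \<alpha>], vector [sin \<alpha>, cos \<alpha>]]"

lemma rot_matrix_mult: "rot_matrix \<alpha> *v x = rot \<alpha> x"
  by (simp add: rot_matrix_def rot_def vec_of_complex_def to_complex_def matrix_vector_mult_def vec_eq_iff forall_2 sum_2)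

lemma transpose_rot_matrix: "transpose (rot_matrix \<alpha>) = rot_matrix (- \<alpha>)"
  by (simp add: rot_matrix_def transpose_def vec_eq_iff forall_2)

lemma rotation_matrix_2x2: "rotation_matrix (Q :: real^2^2) \<longleftrightarrow> (\<exists>\<alpha>. Q = rot_matrix \<alpha>)"
proof
  assume "\<exists>\<alpha>. Q = rot_matrix \<alpha>"
  then obtain \<alpha> where [simp]: "Q = rot_matrix \<alpha>" by blast
  have "transpose Q ** Q = mat 1"
    using sin_cos_squared_add[of \<alpha>]
    by (simp add: rot_matrix_def transpose_def matrix_matrix_mult_def mat_def vec_eq_iff forall_2 sum_2 power2_eq_square algebra_simps)
  then have "orthogonal_matrix Q"
    by (simp add: orthogonal_matrix)
  moreover have "det Q = 1"
    using sin_cos_squared_add[of \<alpha>] by (simp add: rot_matrix_def det_2 power2_eq_square algebra_simps)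
  ultimately show "rotation_matrix Q" by (simp add: rotation_matrix_def)
next
  assume "rotation_matrix Q"
  then have "transpose Q ** Q = mat 1" and det: "Q$1$1 * Q$2$2 - Q$1$2 * Q$2$1 = 1"
    by (auto simp: rotation_matrix_def orthogonal_matrix det_2)
  then have a: "(Q$1$1)\<^sup>2 + (Q$2$1)\<^sup>2 = 1" and b: "(Q$1$2)\<^sup>2 + (Q$2$2)\<^sup>2 = 1"
    by (simp_all add: transpose_def matrix_matrix_mult_def mat_def vec_eq_iff forall_2 sum_2 power2_eq_square)
  \<comment> \<open>This sum of squares is the squared norm of \<open>Q\<close>, which is 2, minus
    twice the determinant, which is 1. Its vanishing gives \<open>Q\<close> the shape of
    multiplication by a complex number.\<close>
  have "(Q$1$1 - Q$2$2)\<^sup>2 + (Q$1$2 + Q$2$1)\<^sup>2 = 0"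
    using a b det by (simp add: power2_eq_square algebra_simps)
  then have "Q$1$1 = Q$2$2" "Q$1$2 = - Q$2$1"
    by (auto simp: sum_power2_eq_zero_iff)
  moreover obtain \<alpha> where "Q$1$1 = cos \<alpha>" "Q$2$1 = sin \<alpha>"
    using sincos_total_2pi[OF a] by metis
  ultimately show "\<exists>\<alpha>. Q = rot_matrix \<alpha>"
    by (intro exI[of _ \<alpha>]) (simp add: rot_matrix_def vec_eq_iff forall_2)
qed

lemma norm_rot [simp]: "norm (rot \<alpha> x) = norm x"
  by (simp add: rot_def norm_mult)

lemma equivariant_map_rot: "equivariant_map w (rot \<alpha> x) = rot \<alpha> (equivariant_map w x)"
  by (simp add: equivariant_map_def rot_def sgn_mult norm_mult mult_ac)

lemma rot_rot: "rot \<alpha> (rot \<beta> x) = rot (\<alpha> + \<beta>) x"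
  by (simp add: rot_def mult.assoc[symmetric] cis_mult)

lemma rot_0 [simp]: "rot 0 x = x"
  by (simp add: rot_def)

lemma equivariant_map_symmetric:
  "rotation_matrix Q \<Longrightarrow> transpose Q *v equivariant_map w (Q *v x) = equivariant_map w x"
proof -
  assume "rotation_matrix Q"
  then obtain \<alpha> where Q: "Q = rot_matrix \<alpha>" by (auto simp: rotation_matrix_2x2)
  show ?thesis
    unfolding Q transpose_rot_matrix rot_matrix_mult by (simp add: equivariant_map_rot rot_rot)
qed

section \<open>Sobolev curves and equivariant Sobolev maps\<close>

text \<open>\<open>w\<close> is, on \<open>[a, b]\<close>, the continuous representative of a \<open>W\<^sup>1\<^sup>,\<^sup>2\<close> function with weak derivative \<open>g\<close>, given
  through the approximation by \<open>C\<^sup>1\<close> curves that the trace condition also provides.\<close>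

definition sobolev_curve :: "real \<Rightarrow> real \<Rightarrow> (real \<Rightarrow> complex) \<Rightarrow> (real \<Rightarrow> complex) \<Rightarrow> bool" where
  "sobolev_curve a b w g \<longleftrightarrow> continuous_on UNIV w \<and> g \<in> borel_measurable borel \<and>
    (\<exists>W D. (\<forall>n r. (W n has_vector_derivative D n r) (at r)) \<and> (\<forall>n::nat. continuous_on UNIV (D n)) \<and>
      uniform_limit {a..b} W w sequentially \<and>
      (\<lambda>n. \<integral>\<^sup>+r\<in>{a..b}. ennreal ((norm (D n r - g r))\<^sup>2) \<partial>lborel) \<longlonglongrightarrow> 0)"

lemma sobolev_curveE:
  assumes "sobolev_curve a b w g"
  obtains W D where "\<And>n r. (W n has_vector_derivative D n r) (at r)" "\<And>n::nat. continuous_on UNIV (D n)"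
    "uniform_limit {a..b} W w sequentially"
    "(\<lambda>n. \<integral>\<^sup>+r\<in>{a..b}. ennreal ((norm (D n r - g r))\<^sup>2) \<partial>lborel) \<longlonglongrightarrow> 0"
  using assms unfolding sobolev_curve_def by (elim conjE exE) (rule that, blast+)

lemma tendsto_nn_integral_uniform_0:
  assumes fin: "emeasure M (space M) < \<infinity>"
    and unif: "\<And>e. e > 0 \<Longrightarrow> \<forall>\<^sub>F n in F. \<forall>x\<in>space M. f n x \<le> e"
  shows "((\<lambda>n. \<integral>\<^sup>+x. ennreal (f n x) \<partial>M) \<longlongrightarrow> 0) F"
proof (rule tendsto_sandwich[OF _ _ tendsto_const])
  let ?c = "\<lambda>n. SUP x\<in>space M. ennreal (f n x)"
  have "(?c \<longlongrightarrow> 0) F"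
  proof (rule order_tendstoI)
    fix y :: ennreal assume "0 < y"
    then obtain z where z: "0 < z" "z < y" using dense by blast
    then obtain e where e: "z = ennreal e" "e > 0"
      by (cases z) auto
    have "\<forall>\<^sub>F n in F. ?c n \<le> ennreal e"
      using unif[OF e(2)] by eventually_elim (auto intro!: SUP_least ennreal_leI)
    then show "\<forall>\<^sub>F n in F. ?c n < y"
      using z e by (auto elim!: eventually_mono)
  qed simp
  then have "((\<lambda>n. ?c n * emeasure M (space M)) \<longlongrightarrow> 0 * emeasure M (space M)) F"
    using fin by (intro tendsto_mult_ennreal tendsto_const) auto
  then show "((\<lambda>n. ?c n * emeasure M (space M)) \<longlongrightarrow> 0) F" by simp
  show "\<forall>\<^sub>F n in F. (\<integral>\<^sup>+x. ennreal (f n x) \<partial>M) \<le> ?c n * emeasure M (space M)"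
  proof (rule always_eventually, rule allI)
    fix n
    have "(\<integral>\<^sup>+x. ennreal (f n x) \<partial>M) \<le> (\<integral>\<^sup>+x. ?c n \<partial>M)"
      by (intro nn_integral_mono SUP_upper)
    then show "(\<integral>\<^sup>+x. ennreal (f n x) \<partial>M) \<le> ?c n * emeasure M (space M)"
      by simp
  qed
qed auto

text \<open>The fundamental theorem of calculus holds for each C1 curve \<open>W n\<close>. On a
  bounded interval L2 convergence of the derivatives implies convergence of their integrals over
  every subinterval, and uniform convergence handles the end values.\<close>

lemma sobolev_curve_integrable:
  assumes "sobolev_curve a b w g"
  shows "set_integrable lborel {a..b} (\<lambda>r. (norm (g r))\<^sup>2)" "set_integrable lborel {a..b} g"
    and "a \<le> x \<Longrightarrow> x \<le> y \<Longrightarrow> y \<le> b \<Longrightarrow> (LINT r:{x..y}|lborel. g r) = w y - w x"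
proof -
  obtain W D where W: "\<And>n r. (W n has_vector_derivative D n r) (at r)" and D: "\<And>n::nat. continuous_on UNIV (D n)"
    and unif: "uniform_limit {a..b} W w sequentially"
    and lim: "(\<lambda>n. \<integral>\<^sup>+r\<in>{a..b}. ennreal ((norm (D n r - g r))\<^sup>2) \<partial>lborel) \<longlonglongrightarrow> 0"
    by (rule sobolev_curveE[OF assms]) (rule that)
  have g[measurable]: "g \<in> borel_measurable borel"
    using assms by (simp add: sobolev_curve_def)
  define M where "M = restrict_space lborel {a..b}"
  have [measurable]: "D n \<in> borel_measurable borel" for n
    using D by (rule borel_measurable_continuous_onI)
  have [measurable]: "g \<in> borel_measurable M" "D n \<in> borel_measurable M" for n
    unfolding M_def by (auto intro!: measurable_restrict_space1)
  have fin: "emeasure M (space M) < \<infinity>"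
    by (simp add: M_def emeasure_restrict_space space_restrict_space emeasure_lborel_Icc_eq)
  have limM: "(\<lambda>n. \<integral>\<^sup>+r. ennreal ((norm (D n r - g r))\<^sup>2) \<partial>M) \<longlonglongrightarrow> 0"
    using lim by (simp add: M_def nn_integral_restrict_space)
  have BD: "\<exists>B. AE r in M. norm (D n r) \<le> B" for n
  proof -
    have "bounded (D n ` {a..b})"
      using D by (intro compact_imp_bounded compact_continuous_image) (auto intro: continuous_on_subset)
    then obtain B where "\<forall>r\<in>{a..b}. norm (D n r) \<le> B" by (auto simp: bounded_iff)
    then show ?thesis by (intro exI[of _ B] AE_I2) (simp add: M_def space_restrict_space)
  qed
  have intg2: "integrable M (\<lambda>r. (norm (g r))\<^sup>2)"
    by (rule integrable_square_of_L2_limit[OF _ _ fin BD limM]) measurable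
  have intg: "integrable M g"
  proof (rule Bochner_Integration.integrable_bound)
    show "integrable M (\<lambda>r. 1 + (norm (g r))\<^sup>2)"
      using fin intg2 by (intro Bochner_Integration.integrable_add finite_measure.integrable_const) (auto intro!: finite_measureI)
    show "AE r in M. norm (g r) \<le> norm (1 + (norm (g r))\<^sup>2)"
    proof (rule AE_I2)
      fix r
      have "norm (g r) \<le> 1 + norm (g r) * norm (g r)"
        using sum_squares_bound[of "norm (g r)" 1] norm_ge_zero[of "g r"] unfolding power2_eq_square by linarith
      then show "norm (g r) \<le> norm (1 + (norm (g r))\<^sup>2)"
        by (simp add: power2_eq_square)
    qed
  qed measurable
  show "set_integrable lborel {a..b} (\<lambda>r. (norm (g r))\<^sup>2)" "set_integrable lborel {a..b} g"
    using intg intg2 by (simp_all add: M_def integrable_restrict_space set_integrable_def)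
  have L1: "(\<lambda>n. \<integral>\<^sup>+r. ennreal (norm (D n r - g r)) \<partial>M) \<longlonglongrightarrow> 0"
    using fin limM by (intro tendsto_nn_integral_norm_of_square) measurable
  assume xy: "a \<le> x" "x \<le> y" "y \<le> b"
  have sub: "set_integrable lborel {x..y} g"
    using \<open>set_integrable lborel {a..b} g\<close> xy by (rule_tac set_integrable_subset) auto
  have Dint: "integrable lborel (\<lambda>r. indicator {x..y} r *\<^sub>R D n r)" for n
    using D by (intro borel_integrable_compact) (auto intro: continuous_on_subset)
  have "(\<lambda>n. LINT r|lborel. indicator {x..y} r *\<^sub>R D n r) \<longlonglongrightarrow> (LINT r|lborel. indicator {x..y} r *\<^sub>R g r)"
  proof (rule tendsto_L1_int)
    show "(\<lambda>n. \<integral>\<^sup>+r. ennreal (norm (indicator {x..y} r *\<^sub>R D n r - indicator {x..y} r *\<^sub>R g r)) \<partial>lborel) \<longlonglongrightarrow> 0"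
    proof (rule tendsto_sandwich[OF _ _ tendsto_const L1])
      show "\<forall>\<^sub>F n in sequentially. (\<integral>\<^sup>+r. ennreal (norm (indicator {x..y} r *\<^sub>R D n r - indicator {x..y} r *\<^sub>R g r)) \<partial>lborel) \<le>
          (\<integral>\<^sup>+r. ennreal (norm (D n r - g r)) \<partial>M)"
        using xy by (auto simp: M_def nn_integral_restrict_space intro!: always_eventually nn_integral_mono split: split_indicator)
    qed auto
  qed (use Dint sub in \<open>auto simp: set_integrable_def\<close>)
  moreover have "(LINT r|lborel. indicator {x..y} r *\<^sub>R D n r) = W n y - W n x" for n
    using xy W D by (intro integral_FTC_Icc) (auto intro: has_vector_derivative_at_within continuous_on_subset)
  moreover have "(\<lambda>n. W n y - W n x) \<longlonglongrightarrow> w y - w x"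
    using xy by (intro tendsto_diff tendsto_uniform_limitI[OF unif]) auto
  ultimately show "(LINT r:{x..y}|lborel. g r) = w y - w x"
    unfolding set_lebesgue_integral_def by (simp add: LIMSEQ_unique)
qed

section \<open>From Sobolev curves to Sobolev maps on the annulus\<close>

lemma nn_integral_annulus_radial:
  fixes F :: "real \<Rightarrow> ennreal"
  assumes [measurable]: "F \<in> borel_measurable borel" and "0 \<le> a"
  shows "(\<integral>\<^sup>+x\<in>annulus a b. F (norm x) \<partial>lborel) = (\<integral>\<^sup>+r\<in>{a<..<b}. ennreal (2 * pi * r) * F r \<partial>lborel)"
proof -
  have "(\<integral>\<^sup>+x\<in>annulus a b. F (norm x) \<partial>lborel) = (\<integral>\<^sup>+x. F (norm x) * indicator {a<..<b} (norm x) \<partial>(lborel :: (real^2) measure))"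
    by (intro nn_integral_cong) (auto simp: annulus_def split: split_indicator)
  also have "\<dots> = (\<integral>\<^sup>+r. ennreal (2 * pi * r) * (F r * indicator {a<..<b} r) * indicator {0..} r \<partial>lborel)"
    by (rule nn_integral_radial) measurable
  also have "\<dots> = (\<integral>\<^sup>+r\<in>{a<..<b}. ennreal (2 * pi * r) * F r \<partial>lborel)"
    using assms(2) by (intro nn_integral_cong) (auto split: split_indicator)
  finally show ?thesis .
qed

lemma open_annulus: "open (annulus a b)"
  unfolding annulus_def by (intro open_Collect_conj open_Collect_less continuous_intros)

lemma bounded_annulus: "bounded (annulus a b)"
  by (rule bounded_subset[OF bounded_cball[of 0 b]]) (auto simp: annulus_def)

lemma closure_annulus_subset: "0 < a \<Longrightarrow> closure (annulus a b) \<subseteq> - {0}"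
proof -
  assume a: "0 < a"
  have "closed {x :: real^2. a \<le> norm x}"
    by (intro closed_Collect_le continuous_intros)
  then have "closure (annulus a b) \<subseteq> {x. a \<le> norm x}"
    by (intro closure_minimal) (auto simp: annulus_def)
  then show ?thesis using a by auto
qed

lemma emeasure_annulus_finite: "emeasure lborel (annulus a b) < \<infinity>"
  using emeasure_bounded_finite[OF bounded_annulus] .

text \<open>The gradient error is |D n - g|^2 + |W n - w|^2 / r^2. After polar integration the first
  term carries the weight 2 pi r \<le> 2 pi b; the second tends to 0 uniformly because r stays above
  \<open>a\<close> > 0. The maps are C1 off the origin, which the closed annulus avoids.\<close>

lemma equivariant_map_approximation:
  assumes ab: "0 < a" "a < b" and w: "sobolev_curve a b w g"
  obtains W where "\<And>n::nat. C1_on (- {0}) (equivariant_map (W n))"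
    "(\<lambda>n. \<integral>\<^sup>+x. ennreal ((norm (equivariant_map (W n) x - equivariant_map w x))\<^sup>2) \<partial>lebesgue_on (annulus a b)) \<longlonglongrightarrow> 0"
    "(\<lambda>n. \<integral>\<^sup>+x. ennreal ((norm (jacobian (equivariant_map (W n)) (at x) - equivariant_grad w g x))\<^sup>2) \<partial>lebesgue_on (annulus a b)) \<longlonglongrightarrow> 0"
    "(\<lambda>n. W n a) \<longlonglongrightarrow> w a" "(\<lambda>n. W n b) \<longlonglongrightarrow> w b"
proof -
  obtain W D where W: "\<And>n r. (W n has_vector_derivative D n r) (at r)" and D: "\<And>n::nat. continuous_on UNIV (D n)"
    and unif: "uniform_limit {a..b} W w sequentially"
    and lim: "(\<lambda>n. \<integral>\<^sup>+r\<in>{a..b}. ennreal ((norm (D n r - g r))\<^sup>2) \<partial>lborel) \<longlonglongrightarrow> 0"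
    by (rule sobolev_curveE[OF w]) (rule that)
  have g[measurable]: "g \<in> borel_measurable borel" and wc: "continuous_on UNIV w"
    using w by (simp_all add: sobolev_curve_def)
  let ?A = "annulus a b"
  have [measurable]: "D n \<in> borel_measurable borel" for n
    using D by (rule borel_measurable_continuous_onI)
  have [measurable]: "W n \<in> borel_measurable borel" for n
    using W has_vector_derivative_continuous
    by (intro borel_measurable_continuous_onI continuous_at_imp_continuous_on) blast
  have [measurable]: "w \<in> borel_measurable borel"
    using wc by (rule borel_measurable_continuous_onI)
  have fin: "emeasure (lebesgue_on ?A) (space (lebesgue_on ?A)) < \<infinity>"
    using emeasure_annulus_finite[of a b] by (simp add: emeasure_restrict_space emeasure_completion)
  have nz: "norm x \<in> {a..b}" "x \<noteq> 0" "norm x > a" if "x \<in> ?A" for x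
    using that ab by (auto simp: annulus_def)
  have small: "\<forall>\<^sub>F n in sequentially. \<forall>r\<in>{a..b}. (norm (W n r - w r))\<^sup>2 \<le> e" if "e > 0" for e
  proof -
    have "\<forall>\<^sub>F n in sequentially. \<forall>r\<in>{a..b}. dist (W n r) (w r) < sqrt e"
      using unif that by (auto simp: uniform_limit_iff)
    then show ?thesis
    proof eventually_elim
      case (elim n)
      show ?case
      proof
        fix r assume "r \<in> {a..b}"
        then have "norm (W n r - w r) \<le> sqrt e" using elim by (auto simp: dist_norm less_imp_le)
        then have "(norm (W n r - w r))\<^sup>2 \<le> (sqrt e)\<^sup>2" by (intro power_mono) auto
        then show "(norm (W n r - w r))\<^sup>2 \<le> e" using that by simp
      qed
    qed
  qed
  have C1: "C1_on (- {0}) (equivariant_map (W n))" and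
    jac: "x \<noteq> 0 \<Longrightarrow> jacobian (equivariant_map (W n)) (at x) = equivariant_grad (W n) (D n) x" for n x
    using C1_on_equivariant_map[of "- {0}" "W n" "D n"] W continuous_on_subset[OF D, of "norm ` (- {0})"] by auto
  show thesis
  proof (rule that[of W])
    show "C1_on (- {0}) (equivariant_map (W n))" for n by (rule C1)
    show "(\<lambda>n. \<integral>\<^sup>+x. ennreal ((norm (equivariant_map (W n) x - equivariant_map w x))\<^sup>2) \<partial>lebesgue_on ?A) \<longlonglongrightarrow> 0"
    proof (rule tendsto_nn_integral_uniform_0[OF fin])
      fix e :: real assume "e > 0"
      from small[OF this]
      show "\<forall>\<^sub>F n in sequentially. \<forall>x\<in>space (lebesgue_on ?A). (norm (equivariant_map (W n) x - equivariant_map w x))\<^sup>2 \<le> e"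
        by eventually_elim (use nz in \<open>auto simp: equivariant_map_diff norm_equivariant_map\<close>)
    qed
    have split: "(\<integral>\<^sup>+x. ennreal ((norm (jacobian (equivariant_map (W n)) (at x) - equivariant_grad w g x))\<^sup>2) \<partial>lebesgue_on ?A) \<le>
       ennreal (2 * pi * b) * (\<integral>\<^sup>+r\<in>{a..b}. ennreal ((norm (D n r - g r))\<^sup>2) \<partial>lborel) +
       (\<integral>\<^sup>+x. ennreal ((norm (W n (norm x) - w (norm x)))\<^sup>2 / a\<^sup>2) \<partial>lebesgue_on ?A)" for n
    proof -
      have "(\<integral>\<^sup>+x. ennreal ((norm (jacobian (equivariant_map (W n)) (at x) - equivariant_grad w g x))\<^sup>2) \<partial>lebesgue_on ?A) \<le>
        (\<integral>\<^sup>+x. ennreal ((norm (D n (norm x) - g (norm x)))\<^sup>2) + ennreal ((norm (W n (norm x) - w (norm x)))\<^sup>2 / a\<^sup>2) \<partial>lebesgue_on ?A)"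
      proof (rule nn_integral_mono)
        fix x assume "x \<in> space (lebesgue_on ?A)"
        then have x: "x \<in> ?A" by simp
        have "(norm (jacobian (equivariant_map (W n)) (at x) - equivariant_grad w g x))\<^sup>2 \<le>
          (norm (D n (norm x) - g (norm x)))\<^sup>2 + (norm (W n (norm x) - w (norm x)))\<^sup>2 / a\<^sup>2"
          unfolding jac[OF nz(2)[OF x]] equivariant_grad_diff norm_equivariant_grad[OF nz(2)[OF x]]
          using nz[OF x] ab by (intro add_left_mono divide_left_mono power_mono) (auto intro!: mult_pos_pos)
        from ennreal_leI[OF this]
        show "ennreal ((norm (jacobian (equivariant_map (W n)) (at x) - equivariant_grad w g x))\<^sup>2) \<le>
          ennreal ((norm (D n (norm x) - g (norm x)))\<^sup>2) + ennreal ((norm (W n (norm x) - w (norm x)))\<^sup>2 / a\<^sup>2)"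
          by (subst (asm) ennreal_plus) auto
      qed
      also have "\<dots> = (\<integral>\<^sup>+x. ennreal ((norm (D n (norm x) - g (norm x)))\<^sup>2) \<partial>lebesgue_on ?A) +
         (\<integral>\<^sup>+x. ennreal ((norm (W n (norm x) - w (norm x)))\<^sup>2 / a\<^sup>2) \<partial>lebesgue_on ?A)"
        by (intro nn_integral_add) (auto intro!: borel_measurable_lebesgue_onI)
      also have "(\<integral>\<^sup>+x. ennreal ((norm (D n (norm x) - g (norm x)))\<^sup>2) \<partial>lebesgue_on ?A) =
         (\<integral>\<^sup>+x\<in>?A. ennreal ((norm (D n (norm x) - g (norm x)))\<^sup>2) \<partial>lborel)"
        by (rule nn_integral_lebesgue_on) measurable
      also have "\<dots> = (\<integral>\<^sup>+r\<in>{a<..<b}. ennreal (2 * pi * r) * ennreal ((norm (D n r - g r))\<^sup>2) \<partial>lborel)"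
        using ab by (intro nn_integral_annulus_radial[where F = "\<lambda>r. ennreal ((norm (D n r - g r))\<^sup>2)"]) auto
      also have "\<dots> \<le> (\<integral>\<^sup>+r. ennreal (2 * pi * b) * (ennreal ((norm (D n r - g r))\<^sup>2) * indicator {a..b} r) \<partial>lborel)"
        using ab by (intro nn_integral_mono) (auto split: split_indicator intro!: mult_right_mono ennreal_leI)
      also have "\<dots> = ennreal (2 * pi * b) * (\<integral>\<^sup>+r\<in>{a..b}. ennreal ((norm (D n r - g r))\<^sup>2) \<partial>lborel)"
        by (rule nn_integral_cmult) measurable
      finally show ?thesis by (simp add: add_right_mono)
    qed
    have "(\<lambda>n. \<integral>\<^sup>+x. ennreal ((norm (W n (norm x) - w (norm x)))\<^sup>2 / a\<^sup>2) \<partial>lebesgue_on ?A) \<longlonglongrightarrow> 0"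
    proof (rule tendsto_nn_integral_uniform_0[OF fin])
      fix e :: real assume "e > 0"
      then have "e * a\<^sup>2 > 0" using ab by simp
      from small[OF this]
      show "\<forall>\<^sub>F n in sequentially. \<forall>x\<in>space (lebesgue_on ?A). (norm (W n (norm x) - w (norm x)))\<^sup>2 / a\<^sup>2 \<le> e"
        by eventually_elim (use nz ab in \<open>auto simp: field_simps\<close>)
    qed
    then have "(\<lambda>n. ennreal (2 * pi * b) * (\<integral>\<^sup>+r\<in>{a..b}. ennreal ((norm (D n r - g r))\<^sup>2) \<partial>lborel) +
       (\<integral>\<^sup>+x. ennreal ((norm (W n (norm x) - w (norm x)))\<^sup>2 / a\<^sup>2) \<partial>lebesgue_on ?A)) \<longlonglongrightarrow> ennreal (2 * pi * b) * 0 + 0"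
      by (intro tendsto_add tendsto_mult_ennreal lim tendsto_const) auto
    then have "(\<lambda>n. ennreal (2 * pi * b) * (\<integral>\<^sup>+r\<in>{a..b}. ennreal ((norm (D n r - g r))\<^sup>2) \<partial>lborel) +
       (\<integral>\<^sup>+x. ennreal ((norm (W n (norm x) - w (norm x)))\<^sup>2 / a\<^sup>2) \<partial>lebesgue_on ?A)) \<longlonglongrightarrow> 0"
      by simp
    then show "(\<lambda>n. \<integral>\<^sup>+x. ennreal ((norm (jacobian (equivariant_map (W n)) (at x) - equivariant_grad w g x))\<^sup>2) \<partial>lebesgue_on ?A) \<longlonglongrightarrow> 0"
      by (rule tendsto_sandwich[OF _ _ tendsto_const, rotated 2]) (auto intro!: always_eventually split)
    show "(\<lambda>n. W n a) \<longlonglongrightarrow> w a" "(\<lambda>n. W n b) \<longlonglongrightarrow> w b"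
      using ab by (auto intro!: tendsto_uniform_limitI[OF unif])
  qed
qed

lemma weak_gradient_equivariant_map:
  assumes ab: "0 < a" "a < b" and w: "sobolev_curve a b w g"
  shows "weak_gradient (annulus a b) (equivariant_map w) (equivariant_grad w g)"
proof -
  obtain W where W: "\<And>n::nat. C1_on (- {0}) (equivariant_map (W n))"
    "(\<lambda>n. \<integral>\<^sup>+x. ennreal ((norm (equivariant_map (W n) x - equivariant_map w x))\<^sup>2) \<partial>lebesgue_on (annulus a b)) \<longlonglongrightarrow> 0"
    "(\<lambda>n. \<integral>\<^sup>+x. ennreal ((norm (jacobian (equivariant_map (W n)) (at x) - equivariant_grad w g x))\<^sup>2) \<partial>lebesgue_on (annulus a b)) \<longlonglongrightarrow> 0"
    "(\<lambda>n. W n a) \<longlonglongrightarrow> w a" "(\<lambda>n. W n b) \<longlonglongrightarrow> w b"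
    by (rule equivariant_map_approximation[OF assms]) (rule that)
  have [measurable]: "w \<in> borel_measurable borel" "g \<in> borel_measurable borel"
    using w by (auto simp: sobolev_curve_def intro: borel_measurable_continuous_onI)
  show ?thesis
    using closure_annulus_subset[OF ab(1)] W
    by (intro weak_gradient_limit[where V = "\<lambda>n. equivariant_map (W n)"] open_annulus bounded_annulus borel_measurable_lebesgue_onI)
       (auto intro!: exI[of _ "- {0}"])
qed

text \<open>\<open>wgrad\<close> is an arbitrary choice of a weak gradient, and uniqueness makes it
  computable. Integrals against test functions do not see null sets, so the formula also holds for
  every \<open>u\<close> that agrees with the equivariant map almost everywhere.\<close>

lemma wgrad_equivariant_map:
  assumes ab: "0 < a" "a < b" and w: "sobolev_curve a b w g"
    and u: "AE x in lebesgue_on (annulus a b). equivariant_map w x = u x" "u \<in> W12 (annulus a b)"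
  shows "AE x in lebesgue_on (annulus a b). wgrad (annulus a b) u x = equivariant_grad w g x"
proof -
  have wg: "weak_gradient (annulus a b) u (wgrad (annulus a b) u)"
    using someI_ex[of "weak_gradient (annulus a b) u"] u(2) unfolding W12_def wgrad_def by simp
  have w': "weak_gradient (annulus a b) (equivariant_map w) (equivariant_grad w g)"
    by (rule weak_gradient_equivariant_map[OF ab w])
  have [measurable]: "u \<in> borel_measurable (lebesgue_on (annulus a b))" "equivariant_map w \<in> borel_measurable (lebesgue_on (annulus a b))"
    using wg w' by (auto simp: weak_gradient_def L2_on_def)
  have "weak_gradient (annulus a b) u (equivariant_grad w g)"
    unfolding weak_gradient_def
  proof (intro conjI allI impI)
    show "L2_on (annulus a b) u" "L2_on (annulus a b) (equivariant_grad w g)"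
      using wg w' by (auto simp: weak_gradient_def)
    fix \<phi> :: "real^2 \<Rightarrow> real" and i j assume \<phi>: "C1_compact_support (annulus a b) \<phi>"
    have [measurable]: "(\<lambda>x. frechet_derivative \<phi> (at x) (axis j 1)) \<in> borel_measurable (lebesgue_on (annulus a b))"
      using \<phi> unfolding C1_compact_support_def C1_on_def
      by (intro borel_measurable_lebesgue_onI borel_measurable_continuous_onI) auto
    have "(LINT x|lebesgue_on (annulus a b). u x $ i * frechet_derivative \<phi> (at x) (axis j 1)) =
       (LINT x|lebesgue_on (annulus a b). equivariant_map w x $ i * frechet_derivative \<phi> (at x) (axis j 1))"
      using u(1) by (intro integral_cong_AE) (auto elim!: eventually_mono)
    then show "(LINT x|lebesgue_on (annulus a b). u x $ i * frechet_derivative \<phi> (at x) (axis j 1)) =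
      - (LINT x|lebesgue_on (annulus a b). equivariant_grad w g x $ i $ j * \<phi> x)"
      using w' \<phi> by (simp add: weak_gradient_def)
  qed
  from weak_gradient_unique[OF open_annulus wg this] show ?thesis .
qed

text \<open>On the circle of radius \<open>R\<close> the error of the approximation has constant
  norm |W n R - R|, so convergence of the curves at the two endpoints is all that the boundary
  condition asks for.\<close>

lemma has_trace_equivariant_map:
  assumes ab: "0 < a" "a < b" and w: "sobolev_curve a b w g" and bc: "w a = of_real a" "w b = of_real b"
  shows "has_trace a b (equivariant_map w) (\<lambda>x. x)"
proof -
  obtain W where W: "\<And>n::nat. C1_on (- {0}) (equivariant_map (W n))"
    "(\<lambda>n. \<integral>\<^sup>+x. ennreal ((norm (equivariant_map (W n) x - equivariant_map w x))\<^sup>2) \<partial>lebesgue_on (annulus a b)) \<longlonglongrightarrow> 0"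
    "(\<lambda>n. \<integral>\<^sup>+x. ennreal ((norm (jacobian (equivariant_map (W n)) (at x) - equivariant_grad w g x))\<^sup>2) \<partial>lebesgue_on (annulus a b)) \<longlonglongrightarrow> 0"
    "(\<lambda>n. W n a) \<longlonglongrightarrow> w a" "(\<lambda>n. W n b) \<longlonglongrightarrow> w b"
    by (rule equivariant_map_approximation[OF ab w]) (rule that)
  have "equivariant_map w \<in> W12 (annulus a b)"
    using weak_gradient_equivariant_map[OF ab w] by (auto simp: W12_def)
  then have wg: "AE x in lebesgue_on (annulus a b). wgrad (annulus a b) (equivariant_map w) x = equivariant_grad w g x"
    by (intro wgrad_equivariant_map[OF ab w]) auto
  have wg_eq: "(\<integral>\<^sup>+x. ennreal ((norm (jacobian (equivariant_map (W n)) (at x) - wgrad (annulus a b) (equivariant_map w) x))\<^sup>2) \<partial>lebesgue_on (annulus a b)) =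
     (\<integral>\<^sup>+x. ennreal ((norm (jacobian (equivariant_map (W n)) (at x) - equivariant_grad w g x))\<^sup>2) \<partial>lebesgue_on (annulus a b))" for n
    using wg by (intro nn_integral_cong_AE) (auto elim!: eventually_mono)
  have bdry: "(\<lambda>n. \<integral>\<^sup>+\<theta>. ennreal ((norm (equivariant_map (W n) (polar R \<theta>) - polar R \<theta>))\<^sup>2) \<partial>lebesgue_on {0..2 * pi}) \<longlonglongrightarrow> 0"
    if "R > 0" "(\<lambda>n. W n R) \<longlonglongrightarrow> of_real R" for R
  proof (rule tendsto_nn_integral_uniform_0)
    show "emeasure (lebesgue_on {0..2 * pi}) (space (lebesgue_on {0..2 * pi})) < \<infinity>"
      by (simp add: emeasure_restrict_space emeasure_completion)
    fix e :: real assume e: "e > 0"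
    have nrm: "norm (equivariant_map (W n) (polar R \<theta>) - polar R \<theta>) = dist (W n R) (of_real R)" for n \<theta>
    proof -
      have "equivariant_map (W n) (polar R \<theta>) - polar R \<theta> = vec_of_complex ((W n R - of_real R) * cis \<theta>)"
        unfolding equivariant_map_polar[OF that(1)] by (simp add: polar_eq left_diff_distrib linear_diff[OF bounded_linear.linear[OF bounded_linear_vec_of_complex]])
      then show ?thesis by (simp add: norm_mult dist_norm)
    qed
    have "\<forall>\<^sub>F n in sequentially. dist (W n R) (of_real R) < sqrt e"
      using that(2) e by (intro tendstoD) auto
    then show "\<forall>\<^sub>F n in sequentially. \<forall>\<theta>\<in>space (lebesgue_on {0..2 * pi}). (norm (equivariant_map (W n) (polar R \<theta>) - polar R \<theta>))\<^sup>2 \<le> e"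
    proof eventually_elim
      case (elim n)
      then have "(dist (W n R) (of_real R))\<^sup>2 \<le> (sqrt e)\<^sup>2" by (intro power_mono) auto
      then show ?case using e by (simp add: nrm)
    qed
  qed
  show ?thesis
    unfolding has_trace_def
  proof (intro exI[of _ "\<lambda>n. equivariant_map (W n)"] conjI ballI allI)
    show "\<exists>U. open U \<and> closure (annulus a b) \<subseteq> U \<and> C1_on U (equivariant_map (W n))" for n
      using W(1) closure_annulus_subset[OF ab(1)] by (intro exI[of _ "- {0}"]) auto
    show "(\<lambda>n. \<integral>\<^sup>+\<theta>. ennreal ((norm (equivariant_map (W n) (polar R \<theta>) - polar R \<theta>))\<^sup>2) \<partial>lebesgue_on {0..2 * pi}) \<longlonglongrightarrow> 0"
      if "R \<in> {a, b}" for R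
      using that ab W(4,5) bc by (intro bdry) auto
  qed (use W wg_eq in auto)
qed

section \<open>Winding numbers and admissible equivariant maps\<close>

lemma AE_imp_ex:
  assumes "AE x in M. P x" "emeasure M (space M) \<noteq> 0"
  shows "\<exists>x\<in>space M. P x"
proof (rule ccontr)
  assume "\<not> ?thesis"
  then have "AE x in M. False"
    using assms(1) by (auto elim: AE_mp intro!: AE_I2)
  then have "space M \<in> null_sets M"
    by (subst (asm) AE_iff_null) auto
  then show False using assms(2) by auto
qed

text \<open>Fubini in polar coordinates: a planar null set meets almost every ray in a null set of
  radii.\<close>

lemma AE_annulus_polar:
  assumes a: "0 \<le> a" and ae: "AE x in lebesgue_on (annulus a b). P x"
  shows "AE \<theta> in lborel. \<theta> \<in> {0..2*pi} \<longrightarrow> (AE r in lborel. r \<in> {a<..<b} \<longrightarrow> P (polar r \<theta>))"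
proof -
  have "AE x in lborel. x \<in> annulus a b \<longrightarrow> P x"
    using ae by (simp add: AE_lebesgue_on_iff)
  then obtain N where N: "{x \<in> space lborel. \<not> (x \<in> annulus a b \<longrightarrow> P x)} \<subseteq> N" "emeasure lborel N = 0" "N \<in> sets lborel"
    by (rule AE_E)
  then have [measurable]: "N \<in> sets borel" by simp
  have "0 = (\<integral>\<^sup>+x\<in>annulus a b. indicator N x \<partial>lborel)"
  proof -
    have "(\<integral>\<^sup>+x\<in>annulus a b. indicator N x \<partial>lborel) \<le> (\<integral>\<^sup>+x. indicator N x \<partial>lborel)"
      by (intro nn_integral_mono) (auto split: split_indicator)
    then show ?thesis using N by simp
  qed
  also have "\<dots> = (\<integral>\<^sup>+r\<in>{a<..<b}. (\<integral>\<^sup>+\<theta>\<in>{0..2*pi}. ennreal r * indicator N (polar r \<theta>) \<partial>lborel) \<partial>lborel)"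
    by (rule nn_integral_annulus_polar[OF _ a]) measurable
  also have "\<dots> = (\<integral>\<^sup>+r. (\<integral>\<^sup>+\<theta>. ennreal r * indicator N (polar r \<theta>) * indicator {0..2*pi} \<theta> * indicator {a<..<b} r \<partial>lborel) \<partial>lborel)"
    by (intro nn_integral_cong nn_integral_multc[symmetric]) measurable
  also have "\<dots> = (\<integral>\<^sup>+\<theta>. (\<integral>\<^sup>+r. ennreal r * indicator N (polar r \<theta>) * indicator {0..2*pi} \<theta> * indicator {a<..<b} r \<partial>lborel) \<partial>lborel)"
    by (rule lborel_pair.Fubini'[symmetric]) measurable
  finally have "AE \<theta> in lborel. (\<integral>\<^sup>+r. ennreal r * indicator N (polar r \<theta>) * indicator {0..2*pi} \<theta> * indicator {a<..<b} r \<partial>lborel) = 0"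
    by (subst (asm) eq_commute, subst (asm) nn_integral_0_iff_AE) auto
  then show ?thesis
  proof eventually_elim
    case (elim \<theta>)
    show ?case
    proof
      assume \<theta>: "\<theta> \<in> {0..2*pi}"
      have "AE r in lborel. ennreal r * indicator N (polar r \<theta>) * indicator {0..2*pi} \<theta> * indicator {a<..<b} r = (0::ennreal)"
        using elim by (subst (asm) nn_integral_0_iff_AE) auto
      then show "AE r in lborel. r \<in> {a<..<b} \<longrightarrow> P (polar r \<theta>)"
      proof eventually_elim
        case (elim r)
        show ?case
        proof
          assume r: "r \<in> {a<..<b}"
          then have "polar r \<theta> \<notin> N" using elim \<theta> a by (auto split: split_indicator_asm)
          moreover have "polar r \<theta> \<in> annulus a b" using r a by (simp add: annulus_def)
          ultimately show "P (polar r \<theta>)" using N(1) by auto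
        qed
      qed
    qed
  qed
qed

lemma ex_angle:
  assumes "AE \<theta> in lborel. \<theta> \<in> {0..2*pi} \<longrightarrow> P \<theta>"
  shows "\<exists>\<theta>\<in>{0..2*pi}. P \<theta>"
proof -
  have "AE \<theta> in lebesgue_on {0..2*pi}. P \<theta>"
    using assms by (simp add: AE_lebesgue_on_iff)
  from AE_imp_ex[OF this] show ?thesis
    by (auto simp: emeasure_restrict_space emeasure_completion)
qed

lemma AE_annulus_radial:
  assumes a: "0 \<le> a"
  shows "(AE x in lebesgue_on (annulus a b). P (norm x)) \<longleftrightarrow> (AE r in lborel. r \<in> {a<..<b} \<longrightarrow> P r)"
proof
  assume "AE x in lebesgue_on (annulus a b). P (norm x)"
  from ex_angle[OF AE_annulus_polar[OF a this]]
  obtain \<theta> where "AE r in lborel. r \<in> {a<..<b} \<longrightarrow> P (norm (polar r \<theta>))" by blast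
  then show "AE r in lborel. r \<in> {a<..<b} \<longrightarrow> P r"
    using a by (auto elim!: eventually_mono)
next
  assume "AE r in lborel. r \<in> {a<..<b} \<longrightarrow> P r"
  then obtain N where N: "{r \<in> space lborel. \<not> (r \<in> {a<..<b} \<longrightarrow> P r)} \<subseteq> N" "emeasure lborel N = 0" "N \<in> sets lborel"
    by (rule AE_E)
  then have [measurable]: "N \<in> sets borel" by simp
  have "AE r in lborel. r \<notin> N" using N by (intro AE_not_in) auto
  then have "(\<integral>\<^sup>+r. ennreal (2 * pi * r) * indicator N r * indicator {a<..<b} r \<partial>lborel) = (\<integral>\<^sup>+r. 0 \<partial>(lborel :: real measure))"
    by (intro nn_integral_cong_AE) (auto elim!: eventually_mono)
  then have "(\<integral>\<^sup>+x\<in>annulus a b. indicator N (norm x) \<partial>lborel) = 0"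
    using a by (subst nn_integral_annulus_radial) auto
  then have "AE x in lborel. indicator N (norm x) * indicator (annulus a b) x = (0::ennreal)"
    by (subst (asm) nn_integral_0_iff_AE) auto
  then have "AE x in lborel. x \<in> annulus a b \<longrightarrow> P (norm x)"
  proof eventually_elim
    case (elim x)
    then show ?case using N(1) by (auto simp: annulus_def split: split_indicator_asm)
  qed
  then show "AE x in lebesgue_on (annulus a b). P (norm x)"
    by (simp add: AE_lebesgue_on_iff)
qed

text \<open>The subset of the open interval where the functions differ is open and null, hence
  empty; the endpoints follow by continuity.\<close>

lemma continuous_AE_eq_imp_eq:
  fixes f g :: "real \<Rightarrow> 'b::real_normed_vector"
  assumes ab: "a < b" and f: "continuous_on {a..b} f" and g: "continuous_on {a..b} g"
    and ae: "AE r in lborel. r \<in> {a<..<b} \<longrightarrow> f r = g r" and r: "r \<in> {a..b}"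
  shows "f r = g r"
proof -
  have fg: "continuous_on {a<..<b} (\<lambda>r. f r - g r)"
    using f g by (intro continuous_intros) (auto intro: continuous_on_subset)
  define S where "S = {a<..<b} \<inter> (\<lambda>r. f r - g r) -` (- {0})"
  have op: "open S"
    unfolding S_def by (rule continuous_open_preimage[OF fg]) auto
  have "AE r in lborel. r \<notin> S"
    using ae by (auto elim!: eventually_mono simp: S_def)
  then have "S \<in> null_sets lborel"
    using op by (subst AE_iff_null_sets) auto
  then have "negligible S"
    unfolding negligible_iff_null_sets by (rule null_sets_completionI)
  then have "S = {}" using op open_not_negligible by blast
  then have const: "f r - g r = 0" if "r \<in> {a<..<b}" for r using that by (auto simp: S_def)
  have cont: "continuous_on (closure {a<..<b}) (\<lambda>r. f r - g r)"
    unfolding closure_greaterThanLessThan[OF ab] by (intro continuous_intros f g)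
  have "f r - g r = 0"
    using continuous_constant_on_closure[OF cont const, of r] r closure_greaterThanLessThan[OF ab] by simp
  then show ?thesis by simp
qed

section \<open>Winding numbers of curves and of rays\<close>

lemma measurable_cnj [measurable]: "cnj \<in> borel_measurable borel"
  by (intro borel_measurable_continuous_onI continuous_intros)

text \<open>Letting the angle grow from 0 to \<theta> is a homotopy of loops that avoids 0.\<close>

lemma winding_number_rotate:
  assumes \<gamma>: "path \<gamma>" "pathfinish \<gamma> = pathstart \<gamma>" "0 \<notin> path_image \<gamma>"
  shows "winding_number (\<lambda>t. cis \<theta> * \<gamma> t) 0 = winding_number \<gamma> 0"
proof (rule winding_number_homotopic_loops[symmetric])
  let ?h = "\<lambda>z. cis (fst z * \<theta>) * \<gamma> (snd z)"
  have cont: "continuous_on ({0..1} \<times> {0..1}) ?h"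
  proof -
    have "continuous_on ({0..1} \<times> {0..1}) (\<lambda>z::real\<times>real. \<gamma> (snd z))"
      using \<gamma>(1) unfolding path_def by (rule continuous_on_compose2) (auto intro: continuous_intros)
    then show ?thesis by (intro continuous_intros)
  qed
  have im: "?h \<in> ({0..1} \<times> {0..1}) \<rightarrow> - {0}"
  proof (rule funcsetI)
    fix z :: "real \<times> real" assume "z \<in> {0..1} \<times> {0..1}"
    then have "\<gamma> (snd z) \<in> path_image \<gamma>" by (auto simp: path_image_def)
    then show "?h z \<in> - {0}" using \<gamma>(3) by auto
  qed
  have loop: "pathfinish (?h \<circ> Pair t) = pathstart (?h \<circ> Pair t)" for t
    using \<gamma>(2) by (simp add: pathfinish_def pathstart_def)
  show "homotopic_loops (- {0}) \<gamma> (\<lambda>t. cis \<theta> * \<gamma> t)"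
    unfolding homotopic_loops using cont im loop by (intro exI[of _ ?h]) auto
qed

lemma to_complex_sgn: "to_complex (sgn v) = sgn (to_complex v)"
  by (simp add: sgn_div_norm linear_scale[OF bounded_linear.linear[OF bounded_linear_to_complex]])

lemma ray_curve_equivariant_map:
  assumes "0 < a" "a < b" "t \<in> {0..1}"
  shows "ray_curve a b (equivariant_map w) \<theta> t = cis \<theta> * sgn (w (linepath a b t))"
proof -
  have "linepath a b t \<in> {a..b}"
    using assms linepath_in_path[of t a b] by (simp add: closed_segment_eq_real_ivl)
  then have "0 < linepath a b t" using assms by auto
  then show ?thesis
    by (simp add: ray_curve_def to_complex_sgn equivariant_map_polar sgn_mult)
qed

text \<open>All rays of an equivariant map carry rotated copies of one curve, so the condition for
  almost every \<theta> in \<open>ray_winding\<close> becomes a condition on \<open>w\<close> alone.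
  Closedness is left to the boundary values, which make w/|w| equal to 1 at both ends.\<close>

definition curve_winding :: "real \<Rightarrow> real \<Rightarrow> (real \<Rightarrow> complex) \<Rightarrow> int \<Rightarrow> bool" where
  "curve_winding a b w N \<longleftrightarrow> (\<forall>r\<in>{a..b}. w r \<noteq> 0) \<and> winding_number (\<lambda>t. sgn (w (linepath a b t))) 0 = of_int N"

lemma linepath_Icc: "a < b \<Longrightarrow> t \<in> {0..1} \<Longrightarrow> linepath a b t \<in> {a..b::real}"
  using linepath_in_path[of t a b] by (simp add: closed_segment_eq_real_ivl)

lemma path_sgn_curve:
  fixes a b :: real
  assumes ab: "a < b" and w: "continuous_on {a..b} w" "\<forall>r\<in>{a..b}. w r \<noteq> (0::complex)"
  shows "path (\<lambda>t. sgn (w (linepath a b t)))" "0 \<notin> path_image (\<lambda>t. sgn (w (linepath a b t)))"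
proof -
  show "path (\<lambda>t. sgn (w (linepath a b t)))"
    unfolding path_def
    using linepath_Icc[OF ab] w by (intro continuous_intros continuous_on_compose2[OF w(1)] continuous_on_linepath) auto
  show "0 \<notin> path_image (\<lambda>t. sgn (w (linepath a b t)))"
    using linepath_Icc[OF ab] w(2) by (auto simp: path_image_def sgn_zero_iff)
qed

lemma ray_winding_equivariant_map:
  assumes ab: "0 < a" "a < b" and w: "continuous_on UNIV w"
    and bc: "w a = of_real a" "w b = of_real b" and N: "curve_winding a b w N"
  shows "ray_winding a b (equivariant_map w) N"
  unfolding ray_winding_def
proof (intro exI[of _ "equivariant_map w"] conjI AE_I2)
  fix \<theta>
  let ?\<gamma> = "\<lambda>t. sgn (w (linepath a b t))"
  have nz: "\<forall>r\<in>{a..b}. w r \<noteq> 0" and wn: "winding_number ?\<gamma> 0 = of_int N"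
    using N by (auto simp: curve_winding_def)
  have polar_eq': "equivariant_map w (polar r \<theta>) = vec_of_complex (w r * cis \<theta>)" if "r \<in> {a..b}" for r
    using that ab by (intro equivariant_map_polar) auto
  have "continuous_on {a..b} (\<lambda>r. vec_of_complex (w r * cis \<theta>))"
    using w by (intro bounded_linear.continuous_on[OF bounded_linear_vec_of_complex] continuous_intros) (auto intro: continuous_on_subset)
  then show "continuous_on {a..b} (\<lambda>r. equivariant_map w (polar r \<theta>))"
    by (rule continuous_on_eq) (simp only: polar_eq')
  show "\<forall>r\<in>{a..b}. equivariant_map w (polar r \<theta>) \<noteq> 0"
  proof
    fix r assume r: "r \<in> {a..b}"
    have "norm (equivariant_map w (polar r \<theta>)) \<noteq> 0"
      using nz r by (simp add: polar_eq' norm_mult)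
    then show "equivariant_map w (polar r \<theta>) \<noteq> 0" by auto
  qed
  show "pathfinish (ray_curve a b (equivariant_map w) \<theta>) = pathstart (ray_curve a b (equivariant_map w) \<theta>)"
    using ab bc by (simp add: pathfinish_def pathstart_def ray_curve_equivariant_map sgn_of_real linepath_def)
  have "winding_number (ray_curve a b (equivariant_map w) \<theta>) 0 = winding_number (\<lambda>t. cis \<theta> * ?\<gamma> t) 0"
    using ab by (intro winding_number_cong ray_curve_equivariant_map) auto
  also have "\<dots> = winding_number ?\<gamma> 0"
    using path_sgn_curve[OF ab(2) continuous_on_subset[OF w] nz] ab bc
    by (intro winding_number_rotate) (auto simp: pathfinish_def pathstart_def sgn_of_real linepath_def)
  finally show "winding_number (ray_curve a b (equivariant_map w) \<theta>) 0 = of_int N"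
    using wn by simp
qed simp

text \<open>The representative \<open>v\<close> in \<open>ray_winding\<close> is arbitrary, so one
  angle is chosen at which \<open>v\<close> has the required properties and agrees with the
  equivariant map at almost every radius. Continuity of both extends the agreement to all of [a,b],
  including the ends.\<close>

lemma curve_winding_of_ray_winding:
  assumes ab: "0 < a" "a < b" and w: "continuous_on UNIV w"
    and bc: "w a = of_real a" "w b = of_real b" and u: "AE x in lebesgue_on (annulus a b). equivariant_map w x = u x"
    and N: "ray_winding a b u N"
  shows "curve_winding a b w N"
proof -
  let ?\<gamma> = "\<lambda>t. sgn (w (linepath a b t))"
  obtain v where v: "AE x in lebesgue_on (annulus a b). v x = u x"
     and ray: "AE \<theta> in lebesgue_on {0..2 * pi}.
        continuous_on {a..b} (\<lambda>r. v (polar r \<theta>)) \<and>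
        (\<forall>r\<in>{a..b}. v (polar r \<theta>) \<noteq> 0) \<and>
        pathfinish (ray_curve a b v \<theta>) = pathstart (ray_curve a b v \<theta>) \<and>
        winding_number (ray_curve a b v \<theta>) 0 = of_int N"
    using N unfolding ray_winding_def by (elim exE conjE) (rule that)
  have "AE x in lebesgue_on (annulus a b). equivariant_map w x = v x"
    using u v by eventually_elim simp
  from AE_annulus_polar[OF less_imp_le[OF ab(1)] this]
  have "AE \<theta> in lborel. \<theta> \<in> {0..2*pi} \<longrightarrow> (AE r in lborel. r \<in> {a<..<b} \<longrightarrow> equivariant_map w (polar r \<theta>) = v (polar r \<theta>))" .
  moreover have "AE \<theta> in lborel. \<theta> \<in> {0..2*pi} \<longrightarrow> (continuous_on {a..b} (\<lambda>r. v (polar r \<theta>)) \<and>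
        (\<forall>r\<in>{a..b}. v (polar r \<theta>) \<noteq> 0) \<and>
        pathfinish (ray_curve a b v \<theta>) = pathstart (ray_curve a b v \<theta>) \<and>
        winding_number (ray_curve a b v \<theta>) 0 = of_int N)"
    by (rule iffD1[OF AE_lebesgue_on_iff ray]) simp
  ultimately have "AE \<theta> in lborel. \<theta> \<in> {0..2*pi} \<longrightarrow> ((AE r in lborel. r \<in> {a<..<b} \<longrightarrow> equivariant_map w (polar r \<theta>) = v (polar r \<theta>)) \<and>
      continuous_on {a..b} (\<lambda>r. v (polar r \<theta>)) \<and> (\<forall>r\<in>{a..b}. v (polar r \<theta>) \<noteq> 0) \<and>
        winding_number (ray_curve a b v \<theta>) 0 = of_int N)"
    by eventually_elim blast
  from ex_angle[OF this] obtain \<theta> where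
    ae: "AE r in lborel. r \<in> {a<..<b} \<longrightarrow> equivariant_map w (polar r \<theta>) = v (polar r \<theta>)" and
    cv: "continuous_on {a..b} (\<lambda>r. v (polar r \<theta>))" and nzv: "\<forall>r\<in>{a..b}. v (polar r \<theta>) \<noteq> 0" and
    wv: "winding_number (ray_curve a b v \<theta>) 0 = of_int N"
    by blast
  have polar_eq': "equivariant_map w (polar r \<theta>) = vec_of_complex (w r * cis \<theta>)" if "r \<in> {a..b}" for r
    using that ab by (intro equivariant_map_polar) auto
  have "continuous_on {a..b} (\<lambda>r. vec_of_complex (w r * cis \<theta>))"
    using w by (intro bounded_linear.continuous_on[OF bounded_linear_vec_of_complex] continuous_intros) (auto intro: continuous_on_subset)
  then have cw: "continuous_on {a..b} (\<lambda>r. equivariant_map w (polar r \<theta>))"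
    by (rule continuous_on_eq) (simp only: polar_eq')
  have eq: "equivariant_map w (polar r \<theta>) = v (polar r \<theta>)" if "r \<in> {a..b}" for r
    by (rule continuous_AE_eq_imp_eq[OF ab(2) cw cv ae that])
  have nz: "\<forall>r\<in>{a..b}. w r \<noteq> 0"
  proof
    fix r assume r: "r \<in> {a..b}"
    then have "vec_of_complex (w r * cis \<theta>) \<noteq> 0" using nzv eq polar_eq' by metis
    then show "w r \<noteq> 0"
      using linear_0[OF bounded_linear.linear[OF bounded_linear_vec_of_complex]] by auto
  qed
  have "of_int N = winding_number (ray_curve a b v \<theta>) 0" using wv by simp
  also have "\<dots> = winding_number (\<lambda>t. cis \<theta> * ?\<gamma> t) 0"
  proof (rule winding_number_cong)
    fix t :: real assume "0 \<le> t" "t \<le> 1"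
    then have t: "t \<in> {0..1}" by simp
    show "ray_curve a b v \<theta> t = cis \<theta> * ?\<gamma> t"
      using ray_curve_equivariant_map[OF ab t, of w \<theta>] eq[OF linepath_Icc[OF ab(2) t]] by (simp add: ray_curve_def)
  qed
  also have "\<dots> = winding_number ?\<gamma> 0"
    using path_sgn_curve[OF ab(2) continuous_on_subset[OF w] nz] ab bc
    by (intro winding_number_rotate) (auto simp: pathfinish_def pathstart_def sgn_of_real linepath_def)
  finally show ?thesis using nz by (simp add: curve_winding_def)
qed

text \<open>Unit vectors at distance less than 1 are joined by a segment that misses 0. This is how
  both families of variations are seen to keep the winding number.\<close>

lemma curve_winding_nearby:
  fixes a b :: real
  assumes ab: "a < b" and w: "continuous_on UNIV w" "continuous_on UNIV v"
    and bc: "w a = v a" "w b = v b" and N: "curve_winding a b w N"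
    and near: "\<And>r. r \<in> {a..b} \<Longrightarrow> v r \<noteq> 0 \<and> norm (sgn (v r) - sgn (w r)) < 1"
  shows "curve_winding a b v N"
proof -
  have nz: "\<forall>r\<in>{a..b}. w r \<noteq> 0" and nzv: "\<forall>r\<in>{a..b}. v r \<noteq> 0" and
    wn: "winding_number (\<lambda>t. sgn (w (linepath a b t))) 0 = of_int N"
    using N near by (auto simp: curve_winding_def)
  have "winding_number (\<lambda>t. sgn (v (linepath a b t))) 0 = winding_number (\<lambda>t. sgn (w (linepath a b t))) 0"
  proof (rule winding_number_nearby_paths_eq)
    show "path (\<lambda>t. sgn (w (linepath a b t)))" "path (\<lambda>t. sgn (v (linepath a b t)))"
      using path_sgn_curve[OF ab continuous_on_subset[OF w(1)] nz] path_sgn_curve[OF ab continuous_on_subset[OF w(2)] nzv] by auto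
    fix t :: real assume "t \<in> {0..1}"
    then have "linepath a b t \<in> {a..b}" by (rule linepath_Icc[OF ab])
    then show "norm (sgn (v (linepath a b t)) - sgn (w (linepath a b t))) < norm (sgn (w (linepath a b t)) - 0)"
      using near nz by (simp add: norm_sgn)
  qed (use bc in \<open>auto simp: pathstart_def pathfinish_def linepath_def\<close>)
  then show ?thesis using wn nzv by (simp add: curve_winding_def)
qed

section \<open>Admissible maps and their energy in terms of the curve\<close>

lemma equivariant_map_admissible:
  assumes ab: "0 < a" "a < b" and w: "sobolev_curve a b w g"
    and bc: "w a = of_real a" "w b = of_real b" and N: "curve_winding a b w N"
    and pos: "AE r in lborel. r \<in> {a<..<b} \<longrightarrow> 0 \<le> Re (cnj (w r) * g r)"
  shows "equivariant_map w \<in> admissible_sym a b N"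
proof -
  have W: "equivariant_map w \<in> W12 (annulus a b)"
    using weak_gradient_equivariant_map[OF ab w] by (auto simp: W12_def)
  have wc: "continuous_on UNIV w" using w by (simp add: sobolev_curve_def)
  have "AE x in lebesgue_on (annulus a b). wgrad (annulus a b) (equivariant_map w) x = equivariant_grad w g x"
    using W by (intro wgrad_equivariant_map[OF ab w]) auto
  moreover have "AE x in lebesgue_on (annulus a b). 0 \<le> Re (cnj (w (norm x)) * g (norm x))"
    using pos ab by (subst AE_annulus_radial) auto
  moreover have "AE x in lebesgue_on (annulus a b). x \<in> annulus a b"
    by (rule AE_I2) simp
  ultimately have "AE x in lebesgue_on (annulus a b). 0 \<le> det (wgrad (annulus a b) (equivariant_map w) x)"
  proof eventually_elim
    case (elim x)
    then have "x \<noteq> 0" using ab by (auto simp: annulus_def)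
    show ?case
      unfolding elim(1) det_equivariant_grad[OF \<open>x \<noteq> 0\<close>] using elim(2) by simp
  qed
  moreover have "AE x in lebesgue_on (annulus a b). equivariant_map w x = transpose Q *v equivariant_map w (Q *v x)"
    if "rotation_matrix Q" for Q
    by (rule AE_I2) (simp only: equivariant_map_symmetric[OF that])
  ultimately show ?thesis
    using W has_trace_equivariant_map[OF ab w bc] ray_winding_equivariant_map[OF ab wc bc N]
    unfolding admissible_sym_def admissible_def by blast
qed

text \<open>The energy of the equivariant map divided by 2 pi. \<open>h\<close> is kept with its
  infinite values, so that finiteness of this integral forces the determinant to be
  positive.\<close>

definition reduced_energy :: "real \<Rightarrow> real \<Rightarrow> (real \<Rightarrow> ennreal) \<Rightarrow> (real \<Rightarrow> complex) \<Rightarrow> (real \<Rightarrow> complex) \<Rightarrow> ennreal" where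
  "reduced_energy a b h w g = (\<integral>\<^sup>+r\<in>{a<..<b}. ennreal r * (ennreal (1 / 2 * ((norm (g r))\<^sup>2 + (norm (w r))\<^sup>2 / r\<^sup>2)) +
     h (Re (cnj (w r) * g r) / r)) \<partial>lborel)"

lemma energy_equivariant_map:
  assumes ab: "0 < a" "a < b" and w: "sobolev_curve a b w g"
    and u: "AE x in lebesgue_on (annulus a b). equivariant_map w x = u x" "u \<in> W12 (annulus a b)"
    and h[measurable]: "h \<in> borel_measurable borel"
  shows "energy a b h u = ennreal (2 * pi) * reduced_energy a b h w g"
proof -
  have [measurable]: "w \<in> borel_measurable borel" "g \<in> borel_measurable borel"
    using w by (auto simp: sobolev_curve_def intro: borel_measurable_continuous_onI)
  define F where "F r = ennreal (1 / 2 * ((norm (g r))\<^sup>2 + (norm (w r))\<^sup>2 / r\<^sup>2)) + h (Re (cnj (w r) * g r) / r)" for r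
  have [measurable]: "F \<in> borel_measurable borel" unfolding F_def by measurable
  have "energy a b h u = (\<integral>\<^sup>+x. F (norm x) \<partial>lebesgue_on (annulus a b))"
    unfolding energy_def
  proof (rule nn_integral_cong_AE)
    have "AE x in lebesgue_on (annulus a b). x \<in> annulus a b"
      by (rule AE_I2) simp
    with wgrad_equivariant_map[OF ab w u]
    show "AE x in lebesgue_on (annulus a b). ennreal (1 / 2 * (norm (wgrad (annulus a b) u x))\<^sup>2) +
      h (det (wgrad (annulus a b) u x)) = F (norm x)"
    proof eventually_elim
      case (elim x)
      then have "x \<noteq> 0" using ab by (auto simp: annulus_def)
      then show ?case
        by (simp add: elim(1) det_equivariant_grad norm_equivariant_grad F_def)
    qed
  qed
  also have "\<dots> = (\<integral>\<^sup>+x\<in>annulus a b. F (norm x) \<partial>lborel)"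
    by (rule nn_integral_lebesgue_on) measurable
  also have "\<dots> = (\<integral>\<^sup>+r\<in>{a<..<b}. ennreal (2 * pi * r) * F r \<partial>lborel)"
    using ab by (intro nn_integral_annulus_radial) auto
  also have "\<dots> = (\<integral>\<^sup>+r. ennreal (2 * pi) * (ennreal r * F r * indicator {a<..<b} r) \<partial>lborel)"
    by (intro nn_integral_cong) (simp add: ennreal_mult' mult.assoc)
  also have "\<dots> = ennreal (2 * pi) * reduced_energy a b h w g"
    unfolding reduced_energy_def F_def by (rule nn_integral_cmult) measurable
  finally show ?thesis .
qed

section \<open>Reduction of symmetric admissible maps to curves\<close>

lemma continuous_antiderivative:
  fixes f :: "real \<Rightarrow> 'a::euclidean_space"
  assumes "continuous_on UNIV f"
  obtains F where "\<And>x. (F has_vector_derivative f x) (at x)" "F c = C"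
proof -
  define F where "F x = C + (LBINT y=ereal c..ereal x. f y)" for x
  have "(F has_vector_derivative f x) (at x)" for x
  proof -
    let ?I = "{min c x - 1..max c x + 1}"
    have "((\<lambda>x. LBINT y=ereal c..ereal x. f y) has_vector_derivative f x) (at x within ?I)"
      using assms by (intro interval_integral_FTC2) (auto intro: continuous_on_subset)
    moreover have "at x within ?I = at x"
      by (rule at_within_interior) (auto simp: interior_atLeastAtMost_real)
    ultimately show ?thesis
      unfolding F_def by (auto intro!: derivative_eq_intros)
  qed
  then show thesis by (rule that) (simp add: F_def)
qed

text \<open>Convergence of the derivatives in L2 and of the values at the single point
  \<open>a\<close> already gives uniform convergence: the limit is c plus the integral of
  \<open>g\<close> from \<open>a\<close>, and the error is bounded by the L1 distance of the
  derivatives.\<close>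

lemma sobolev_curveI:
  assumes ab: "a < b" and [measurable]: "g \<in> borel_measurable borel"
    and der: "\<And>n r. r \<in> {a..b} \<Longrightarrow> (W n has_vector_derivative D n r) (at r within {a..b})"
    and D: "\<And>n::nat. continuous_on {a..b} (D n)"
    and lim: "(\<lambda>n. \<integral>\<^sup>+r\<in>{a..b}. ennreal ((norm (D n r - g r))\<^sup>2) \<partial>lborel) \<longlonglongrightarrow> 0"
    and lim_a: "(\<lambda>n. W n a) \<longlonglongrightarrow> c"
  obtains w where "sobolev_curve a b w g" "uniform_limit {a..b} W w sequentially"
proof -
  \<comment> \<open>\<open>sobolev_curve\<close> asks for curves on the whole line, while the data
    live on [a,b]. The derivatives are extended by their end values and integrated again; on [a,b]
    this returns \<open>W\<close>.\<close>
  define cl where "cl r = max a (min b r)" for r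
  have cl: "cl r \<in> {a..b}" "r \<in> {a..b} \<Longrightarrow> cl r = r" for r using ab by (auto simp: cl_def)
  have ccl: "continuous_on UNIV cl" unfolding cl_def by (intro continuous_intros)
  define D' where "D' n r = D n (cl r)" for n r
  have D'c: "continuous_on UNIV (D' n)" for n
    unfolding D'_def by (rule continuous_on_compose2[OF D ccl]) (use cl in auto)
  have "\<exists>F. (\<forall>x. (F has_vector_derivative D' n x) (at x)) \<and> F a = W n a" for n
    using continuous_antiderivative[OF D'c, of n a "W n a"] by metis
  then obtain W' where W': "\<And>n x. (W' n has_vector_derivative D' n x) (at x)" "\<And>n. W' n a = W n a"
    by metis
  have FTC: "(LINT s:{a..r}|lborel. D' n s) = W' n r - W' n a" if "r \<in> {a..b}" for n r
    unfolding set_lebesgue_integral_def using that W' continuous_on_subset[OF D'c]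
    by (intro integral_FTC_Icc) (auto intro: has_vector_derivative_at_within)
  have WW': "W' n r = W n r" if r: "r \<in> {a..b}" for n r
  proof -
    have "(LINT s:{a..r}|lborel. D' n s) = W n r - W n a"
      unfolding set_lebesgue_integral_def
    proof (rule integral_FTC_Icc)
      show "a \<le> r" using r by simp
      show "continuous_on {a..r} (D' n)" using D'c by (rule continuous_on_subset) simp
      show "(W n has_vector_derivative D' n x) (at x within {a..r})" if "a \<le> x" "x \<le> r" for x
        using der[of x n] that r cl(2)[of x] unfolding D'_def
        by (auto intro: has_vector_derivative_within_subset)
    qed
    then show ?thesis using FTC[OF r] W'(2) by simp
  qed
  define M where "M = restrict_space lborel {a..b}"
  have [measurable]: "D' n \<in> borel_measurable borel" for n
    using D'c by (rule borel_measurable_continuous_onI)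
  have [measurable]: "g \<in> borel_measurable M" "D' n \<in> borel_measurable M" for n
    unfolding M_def by (auto intro!: measurable_restrict_space1)
  have fin: "emeasure M (space M) < \<infinity>"
    by (simp add: M_def emeasure_restrict_space space_restrict_space emeasure_lborel_Icc_eq)
  have lim': "(\<lambda>n. \<integral>\<^sup>+r\<in>{a..b}. ennreal ((norm (D' n r - g r))\<^sup>2) \<partial>lborel) \<longlonglongrightarrow> 0"
  proof -
    have "(\<integral>\<^sup>+r\<in>{a..b}. ennreal ((norm (D' n r - g r))\<^sup>2) \<partial>lborel) = (\<integral>\<^sup>+r\<in>{a..b}. ennreal ((norm (D n r - g r))\<^sup>2) \<partial>lborel)" for n
      by (intro nn_integral_cong) (use cl in \<open>auto simp: D'_def split: split_indicator\<close>)
    with lim show ?thesis by simp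
  qed
  have limM: "(\<lambda>n. \<integral>\<^sup>+r. ennreal ((norm (D' n r - g r))\<^sup>2) \<partial>M) \<longlonglongrightarrow> 0"
    using lim' by (simp add: M_def nn_integral_restrict_space)
  have L1: "(\<lambda>n. \<integral>\<^sup>+r. ennreal (norm (D' n r - g r)) \<partial>M) \<longlonglongrightarrow> 0"
    using fin limM by (intro tendsto_nn_integral_norm_of_square) measurable
  have BD: "\<exists>B. AE r in M. norm (D' n r) \<le> B" for n
  proof -
    have "bounded (D' n ` {a..b})"
      using D'c by (intro compact_imp_bounded compact_continuous_image) (auto intro: continuous_on_subset)
    then obtain B where "\<forall>r\<in>{a..b}. norm (D' n r) \<le> B" by (auto simp: bounded_iff)
    then show ?thesis by (intro exI[of _ B] AE_I2) (simp add: M_def space_restrict_space)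
  qed
  have intg2: "integrable M (\<lambda>r. (norm (g r))\<^sup>2)"
    by (rule integrable_square_of_L2_limit[OF _ _ fin BD limM]) measurable
  have "integrable M g"
  proof (rule Bochner_Integration.integrable_bound)
    show "integrable M (\<lambda>r. 1 + (norm (g r))\<^sup>2)"
      using fin intg2 by (intro Bochner_Integration.integrable_add finite_measure.integrable_const) (auto intro!: finite_measureI)
    show "AE r in M. norm (g r) \<le> norm (1 + (norm (g r))\<^sup>2)"
    proof (rule AE_I2)
      fix r
      have "norm (g r) \<le> 1 + norm (g r) * norm (g r)"
        using sum_squares_bound[of "norm (g r)" 1] norm_ge_zero[of "g r"] unfolding power2_eq_square by linarith
      then show "norm (g r) \<le> norm (1 + (norm (g r))\<^sup>2)"
        by (simp add: power2_eq_square)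
    qed
  qed measurable
  then have gi: "set_integrable lborel {a..b} g"
    by (simp add: M_def integrable_restrict_space set_integrable_def)
  define w0 where "w0 r = c + (LINT s:{a..r}|lborel. g s)" for r
  have diff: "ennreal (norm ((LINT s:{a..r}|lborel. D' n s) - (LINT s:{a..r}|lborel. g s))) \<le>
      (\<integral>\<^sup>+r. ennreal (norm (D' n r - g r)) \<partial>M)" if r: "r \<in> {a..b}" for n r
  proof -
    have i1: "integrable lborel (\<lambda>s. indicator {a..r} s *\<^sub>R D' n s)"
      using D'c by (intro borel_integrable_compact) (auto intro: continuous_on_subset)
    have i2: "integrable lborel (\<lambda>s. indicator {a..r} s *\<^sub>R g s)"
      using set_integrable_subset[OF gi, of "{a..r}"] r by (auto simp: set_integrable_def)
    have "(LINT s:{a..r}|lborel. D' n s) - (LINT s:{a..r}|lborel. g s) =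
       (LINT s|lborel. indicator {a..r} s *\<^sub>R D' n s - indicator {a..r} s *\<^sub>R g s)"
      unfolding set_lebesgue_integral_def using i1 i2 by simp
    also have "ennreal (norm \<dots>) \<le> (\<integral>\<^sup>+s. ennreal (norm (indicator {a..r} s *\<^sub>R D' n s - indicator {a..r} s *\<^sub>R g s)) \<partial>lborel)"
      using i1 i2 by (intro integral_norm_bound_ennreal) auto
    also have "\<dots> \<le> (\<integral>\<^sup>+r. ennreal (norm (D' n r - g r)) \<partial>M)"
      using r by (auto simp: M_def nn_integral_restrict_space intro!: nn_integral_mono split: split_indicator)
    finally show ?thesis .
  qed
  have unif: "uniform_limit {a..b} W' w0 sequentially"
  proof (rule uniform_limitI)
    fix e :: real assume e: "e > 0"
    have "\<forall>\<^sub>F n in sequentially. (\<integral>\<^sup>+r. ennreal (norm (D' n r - g r)) \<partial>M) < ennreal (e / 2)"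
      using L1 e by (intro order_tendstoD) auto
    moreover have "\<forall>\<^sub>F n in sequentially. dist (W n a) c < e / 2"
      using lim_a e by (intro tendstoD) auto
    ultimately show "\<forall>\<^sub>F n in sequentially. \<forall>r\<in>{a..b}. dist (W' n r) (w0 r) < e"
    proof eventually_elim
      case (elim n)
      show ?case
      proof
        fix r assume r: "r \<in> {a..b}"
        have "W' n r - w0 r = (W n a - c) + ((LINT s:{a..r}|lborel. D' n s) - (LINT s:{a..r}|lborel. g s))"
          using FTC[OF r, of n] W'(2)[of n] by (simp add: w0_def)
        then have "dist (W' n r) (w0 r) \<le> dist (W n a) c + norm ((LINT s:{a..r}|lborel. D' n s) - (LINT s:{a..r}|lborel. g s))"
          unfolding dist_norm by (metis norm_triangle_ineq)
        moreover have "ennreal (norm ((LINT s:{a..r}|lborel. D' n s) - (LINT s:{a..r}|lborel. g s))) < ennreal (e / 2)"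
          using diff[OF r, of n] elim(1) by (rule le_less_trans)
        then have "norm ((LINT s:{a..r}|lborel. D' n s) - (LINT s:{a..r}|lborel. g s)) < e / 2"
          using e by (simp add: ennreal_less_iff)
        ultimately show "dist (W' n r) (w0 r) < e" using elim(2) by linarith
      qed
    qed
  qed
  define w where "w r = w0 (cl r)" for r
  have ww: "w r = w0 r" if "r \<in> {a..b}" for r using cl(2)[OF that] by (simp add: w_def)
  have unif': "uniform_limit {a..b} W' w sequentially"
    using unif by (rule uniform_limit_cong'[THEN iffD1, rotated 2]) (auto simp: ww)
  have "continuous_on {a..b} w0"
  proof (rule uniform_limit_theorem[OF _ unif])
    show "\<forall>\<^sub>F n in sequentially. continuous_on {a..b} (W' n)"
      using has_vector_derivative_continuous[OF W'(1)] by (intro always_eventually allI continuous_at_imp_continuous_on ballI)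
  qed simp
  then have "continuous_on UNIV w"
    unfolding w_def by (rule continuous_on_compose2[OF _ ccl]) (use cl in auto)
  then have "sobolev_curve a b w g"
    unfolding sobolev_curve_def using W'(1) D'c unif' lim' by (intro conjI exI[of _ W'] exI[of _ D']) auto
  moreover have "uniform_limit {a..b} W w sequentially"
    using unif' by (rule uniform_limit_cong'[THEN iffD1, rotated 2]) (auto simp: WW')
  ultimately show thesis by (rule that)
qed

text \<open>It is applied to fields that have been turned back by the angle of the point. For these
  the mean over a circle is the mean over all rotations of the original field.\<close>

definition circle_mean :: "(real^2 \<Rightarrow> complex) \<Rightarrow> real \<Rightarrow> complex" where
  "circle_mean H r = (LINT \<theta>:{0..2*pi}|lborel. H (polar r \<theta>)) /\<^sub>R (2 * pi)"

lemma measurable_circle_mean [measurable]: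
  assumes [measurable]: "H \<in> borel_measurable borel"
  shows "circle_mean H \<in> borel_measurable borel"
  unfolding circle_mean_def[abs_def] set_lebesgue_integral_def by measurable

text \<open>Cauchy-Schwarz for the difference. If the L1 distance of the two functions is infinite,
  the same inequality makes the right side infinite; otherwise \<open>g\<close> is integrable
  because \<open>f\<close> and the difference are.\<close>

lemma norm_integral_diff_square_le:
  fixes f g :: "'a \<Rightarrow> 'b::euclidean_space"
  assumes [measurable]: "f \<in> borel_measurable M" "g \<in> borel_measurable M"
    and fin: "emeasure M (space M) < \<infinity>" and f: "integrable M f"
  shows "ennreal ((norm ((LINT x|M. f x) - (LINT x|M. g x)))\<^sup>2) \<le>
    emeasure M (space M) * (\<integral>\<^sup>+x. ennreal ((norm (f x - g x))\<^sup>2) \<partial>M)"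
proof -
  have CS: "(\<integral>\<^sup>+x. ennreal (norm (f x - g x)) \<partial>M)\<^sup>2 \<le> emeasure M (space M) * (\<integral>\<^sup>+x. ennreal ((norm (f x - g x))\<^sup>2) \<partial>M)"
  proof -
    have "(\<integral>\<^sup>+x. 1 * ennreal (norm (f x - g x)) \<partial>M)\<^sup>2 \<le> (\<integral>\<^sup>+x. 1\<^sup>2 \<partial>M) * (\<integral>\<^sup>+x. (ennreal (norm (f x - g x)))\<^sup>2 \<partial>M)"
      by (rule Cauchy_Schwarz_nn_integral) measurable
    then show ?thesis by (simp add: ennreal_power)
  qed
  show ?thesis
  proof (cases "(\<integral>\<^sup>+x. ennreal (norm (f x - g x)) \<partial>M) < \<infinity>")
    case True
    then have "integrable M (\<lambda>x. f x - g x)"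
      by (intro integrableI_bounded) auto
    then have g: "integrable M g"
      using Bochner_Integration.integrable_diff[OF f, of "\<lambda>x. f x - g x"] by simp
    have "ennreal (norm ((LINT x|M. f x) - (LINT x|M. g x))) \<le> (\<integral>\<^sup>+x. ennreal (norm (f x - g x)) \<partial>M)"
      using integral_norm_bound_ennreal[OF \<open>integrable M (\<lambda>x. f x - g x)\<close>] f g by simp
    then have "(ennreal (norm ((LINT x|M. f x) - (LINT x|M. g x))))\<^sup>2 \<le> (\<integral>\<^sup>+x. ennreal (norm (f x - g x)) \<partial>M)\<^sup>2"
      by (intro power_mono) auto
    with CS show ?thesis by (simp add: ennreal_power)
  next
    case False
    then have "(\<integral>\<^sup>+x. ennreal (norm (f x - g x)) \<partial>M)\<^sup>2 = \<infinity>"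
      by (simp add: less_top[symmetric])
    with CS show ?thesis by (simp add: top_unique)
  qed
qed

lemma circle_mean_diff_square_le:
  assumes [measurable]: "H \<in> borel_measurable borel" "K \<in> borel_measurable borel"
    and H: "set_integrable lborel {0..2*pi} (\<lambda>\<theta>. H (polar r \<theta>))"
  shows "ennreal ((norm (circle_mean H r - circle_mean K r))\<^sup>2) \<le>
    ennreal (1 / (2 * pi)) * (\<integral>\<^sup>+\<theta>\<in>{0..2*pi}. ennreal ((norm (H (polar r \<theta>) - K (polar r \<theta>)))\<^sup>2) \<partial>lborel)"
proof -
  let ?M = "restrict_space lborel {0..2*pi}"
  have M: "emeasure ?M (space ?M) = ennreal (2 * pi)"
    by (simp add: emeasure_restrict_space space_restrict_space)
  have L: "circle_mean H r = (LINT \<theta>|?M. H (polar r \<theta>)) /\<^sub>R (2 * pi)" for H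
    by (simp add: circle_mean_def set_lebesgue_integral_def integral_restrict_space)
  have "ennreal ((norm (circle_mean H r - circle_mean K r))\<^sup>2) =
     ennreal ((1 / (2 * pi))\<^sup>2) * ennreal ((norm ((LINT \<theta>|?M. H (polar r \<theta>)) - (LINT \<theta>|?M. K (polar r \<theta>))))\<^sup>2)"
    unfolding L scaleR_diff_right[symmetric] by (simp add: power_mult_distrib power_divide inverse_eq_divide flip: ennreal_mult')
  also have "\<dots> \<le> ennreal ((1 / (2 * pi))\<^sup>2) * (ennreal (2 * pi) * (\<integral>\<^sup>+\<theta>. ennreal ((norm (H (polar r \<theta>) - K (polar r \<theta>)))\<^sup>2) \<partial>?M))"
  proof (rule mult_left_mono)
    have "integrable ?M (\<lambda>\<theta>. H (polar r \<theta>))"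
      using H by (simp add: integrable_restrict_space set_integrable_def)
    from norm_integral_diff_square_le[OF _ _ _ this, of "\<lambda>\<theta>. K (polar r \<theta>)"]
    show "ennreal ((norm ((LINT \<theta>|?M. H (polar r \<theta>)) - (LINT \<theta>|?M. K (polar r \<theta>))))\<^sup>2) \<le>
      ennreal (2 * pi) * (\<integral>\<^sup>+\<theta>. ennreal ((norm (H (polar r \<theta>) - K (polar r \<theta>)))\<^sup>2) \<partial>?M)"
      unfolding M by (simp add: measurable_restrict_space1)
  qed simp
  also have "\<dots> = ennreal (1 / (2 * pi)) * (\<integral>\<^sup>+\<theta>. ennreal ((norm (H (polar r \<theta>) - K (polar r \<theta>)))\<^sup>2) \<partial>?M)"
    by (simp add: mult.assoc[symmetric] ennreal_mult'[symmetric] power2_eq_square)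
  finally show ?thesis
    by (simp add: nn_integral_restrict_space)
qed

text \<open>The mean over a circle contracts the L2 norm. The constant 1 / (2 pi a) combines the
  factor 1 / (2 pi) of the mean with r / a \<ge> 1, which supplies the weight r of polar
  integration.\<close>

lemma nn_integral_circle_mean_diff_le:
  assumes ab: "0 < a" "a < b" and [measurable]: "H \<in> borel_measurable borel" "K \<in> borel_measurable borel"
    and H: "\<And>r. r \<in> {a<..<b} \<Longrightarrow> set_integrable lborel {0..2*pi} (\<lambda>\<theta>. H (polar r \<theta>))"
  shows "(\<integral>\<^sup>+r\<in>{a..b}. ennreal ((norm (circle_mean H r - circle_mean K r))\<^sup>2) \<partial>lborel) \<le>
    ennreal (1 / (2 * pi * a)) * (\<integral>\<^sup>+x\<in>annulus a b. ennreal ((norm (H x - K x))\<^sup>2) \<partial>lborel)"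
proof -
  let ?F = "\<lambda>x. ennreal ((norm (H x - K x))\<^sup>2)"
  have "(\<integral>\<^sup>+r\<in>{a..b}. ennreal ((norm (circle_mean H r - circle_mean K r))\<^sup>2) \<partial>lborel) =
     (\<integral>\<^sup>+r\<in>{a<..<b}. ennreal ((norm (circle_mean H r - circle_mean K r))\<^sup>2) \<partial>lborel)"
  proof (rule nn_integral_cong_AE)
    show "AE r in lborel. ennreal ((norm (circle_mean H r - circle_mean K r))\<^sup>2) * indicator {a..b} r =
       ennreal ((norm (circle_mean H r - circle_mean K r))\<^sup>2) * indicator {a<..<b} r"
      using AE_lborel_singleton[of a] AE_lborel_singleton[of b]
      by eventually_elim (auto split: split_indicator)
  qed
  also have "\<dots> \<le> (\<integral>\<^sup>+r. ennreal (1 / (2 * pi * a)) * ((\<integral>\<^sup>+\<theta>\<in>{0..2*pi}. ennreal r * ?F (polar r \<theta>) \<partial>lborel) * indicator {a<..<b} r) \<partial>lborel)"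
  proof (rule nn_integral_mono)
    fix r
    show "ennreal ((norm (circle_mean H r - circle_mean K r))\<^sup>2) * indicator {a<..<b} r \<le>
      ennreal (1 / (2 * pi * a)) * ((\<integral>\<^sup>+\<theta>\<in>{0..2*pi}. ennreal r * ?F (polar r \<theta>) \<partial>lborel) * indicator {a<..<b} r)"
    proof (cases "r \<in> {a<..<b}")
      case True
      have "ennreal ((norm (circle_mean H r - circle_mean K r))\<^sup>2) \<le> ennreal (1 / (2 * pi)) * (\<integral>\<^sup>+\<theta>\<in>{0..2*pi}. ?F (polar r \<theta>) \<partial>lborel)"
        by (rule circle_mean_diff_square_le[OF _ _ H[OF True]]) measurable
      also have "\<dots> \<le> ennreal (1 / (2 * pi * a) * r) * (\<integral>\<^sup>+\<theta>\<in>{0..2*pi}. ?F (polar r \<theta>) \<partial>lborel)"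
        using True ab by (intro mult_right_mono ennreal_leI) (auto simp: field_simps)
      also have "\<dots> = ennreal (1 / (2 * pi * a)) * (\<integral>\<^sup>+\<theta>\<in>{0..2*pi}. ennreal r * ?F (polar r \<theta>) \<partial>lborel)"
        using True ab by (subst ennreal_mult) (auto simp: mult.assoc nn_integral_cmult)
      finally show ?thesis using True by simp
    qed simp
  qed
  also have "\<dots> = ennreal (1 / (2 * pi * a)) * (\<integral>\<^sup>+r\<in>{a<..<b}. (\<integral>\<^sup>+\<theta>\<in>{0..2*pi}. ennreal r * ?F (polar r \<theta>) \<partial>lborel) \<partial>lborel)"
    by (rule nn_integral_cmult) measurable
  also have "(\<integral>\<^sup>+r\<in>{a<..<b}. (\<integral>\<^sup>+\<theta>\<in>{0..2*pi}. ennreal r * ?F (polar r \<theta>) \<partial>lborel) \<partial>lborel) = (\<integral>\<^sup>+x\<in>annulus a b. ?F x \<partial>lborel)"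
    using ab by (intro nn_integral_annulus_polar[symmetric]) auto
  finally show ?thesis .
qed

lemma AE_rot:
  assumes "AE x in lborel. P x"
  shows "AE x in lborel. P (rot \<alpha> x)"
proof -
  obtain N where N: "{x \<in> space lborel. \<not> P x} \<subseteq> N" "emeasure lborel N = 0" "N \<in> sets lborel"
    using assms by (rule AE_E)
  then have [measurable]: "N \<in> sets borel" by simp
  have "(\<integral>\<^sup>+x. indicator N (rot \<alpha> x) \<partial>lborel) = (0::ennreal)"
    using N by (subst nn_integral_rot) auto
  then have "AE x in lborel. indicator N (rot \<alpha> x) = (0::ennreal)"
    by (subst (asm) nn_integral_0_iff_AE) auto
  then show ?thesis
    using N(1) by (auto elim!: eventually_mono split: split_indicator_asm)
qed

text \<open>For each angle \<alpha> the symmetry may fail on a null set depending on \<alpha>.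
  Fubini exchanges the roles: for almost every x it holds for almost every \<alpha>, so on the
  circle through x the turned-back values are almost everywhere constant and equal to their
  mean.\<close>

lemma rotation_invariant_eq_equivariant_map:
  fixes u :: "real^2 \<Rightarrow> real^2"
  assumes a: "0 < a" and [measurable]: "u \<in> borel_measurable borel"
    and sym: "\<And>\<alpha>. AE x in lborel. x \<in> annulus a b \<longrightarrow> u x = rot (- \<alpha>) (u (rot \<alpha> x))"
  shows "AE x in lborel. x \<in> annulus a b \<longrightarrow>
    equivariant_map (circle_mean (\<lambda>x. cnj (sgn (to_complex x)) * to_complex (u x))) x = u x"
proof -
  let ?F = "\<lambda>\<alpha> x. ennreal (norm (u x - rot (- \<alpha>) (u (rot \<alpha> x))))"
  have "(\<integral>\<^sup>+x. ?F \<alpha> x * indicator {0..2*pi} \<alpha> * indicator (annulus a b) x \<partial>lborel) = 0" for \<alpha>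
    using sym[of \<alpha>] by (subst nn_integral_0_iff_AE) (auto elim!: eventually_mono)
  then have "0 = (\<integral>\<^sup>+\<alpha>. (\<integral>\<^sup>+x. ?F \<alpha> x * indicator {0..2*pi} \<alpha> * indicator (annulus a b) x \<partial>lborel) \<partial>lborel)"
    by simp
  also have "\<dots> = (\<integral>\<^sup>+x. (\<integral>\<^sup>+\<alpha>. ?F \<alpha> x * indicator {0..2*pi} \<alpha> * indicator (annulus a b) x \<partial>lborel) \<partial>lborel)"
    by (rule lborel_pair.Fubini') measurable
  finally have "AE x in lborel. (\<integral>\<^sup>+\<alpha>. ?F \<alpha> x * indicator {0..2*pi} \<alpha> * indicator (annulus a b) x \<partial>lborel) = 0"
    by (subst (asm) eq_commute, subst (asm) nn_integral_0_iff_AE) auto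
  then show ?thesis
  proof eventually_elim
    case (elim x)
    show ?case
    proof
      assume x: "x \<in> annulus a b"
      obtain \<phi> where \<phi>: "\<phi> \<in> {0..2*pi}" "x = polar (norm x) \<phi>"
        using ex_polar by blast
      define r where "r = norm x"
      have r: "r > 0" using x a by (simp add: r_def annulus_def del: zero_less_norm_iff)
      \<comment> \<open>The defect of symmetry written in the polar angle t of the rotated point
        instead of the angle of rotation; being periodic, its integral over a full turn does not
        depend on the starting angle.\<close>
      define P where "P t = ennreal (norm (u x - rot (\<phi> - t) (u (polar r t))))" for t
      have [measurable]: "P \<in> borel_measurable borel" unfolding P_def by measurable
      have per: "P (t + 2 * pi) = P t" for t
        by (simp add: P_def polar_periodic rot_def) (simp add: cis.ctr sin_diff cos_diff sin_add cos_add)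
      have "P (t + \<phi>) = ?F t x" for t
        by (subst (2) \<phi>(2)) (simp add: P_def rot_polar r_def)
      then have "(\<integral>\<^sup>+t\<in>{0..2*pi}. P (t + \<phi>) \<partial>lborel) = 0"
        using elim x by simp
      then have "(\<integral>\<^sup>+t\<in>{0..2*pi}. P t \<partial>lborel) = 0"
        using nn_integral_periodic_shift[of P "2*pi" \<phi>] per \<phi>(1) by simp
      then have "AE t in lborel. P t * indicator {0..2*pi} t = 0"
        by (subst (asm) nn_integral_0_iff_AE) auto
      moreover have "cnj (sgn (to_complex (polar r t))) * to_complex (u (polar r t)) = cis (- \<phi>) * to_complex (u x)"
        if "P t = 0" for t
      proof -
        have "u x = rot (\<phi> - t) (u (polar r t))" using that by (simp add: P_def)
        then have "to_complex (u x) = cis (\<phi> - t) * to_complex (u (polar r t))" by (simp add: rot_def)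
        then have "cis (- \<phi>) * to_complex (u x) = cis (- t) * to_complex (u (polar r t))"
          by (simp add: mult.assoc[symmetric] cis_mult)
        then show ?thesis using r by (simp add: to_complex_polar sgn_mult sgn_of_real cis_cnj)
      qed
      ultimately have "AE t in lborel. indicator {0..2*pi} t *\<^sub>R (cnj (sgn (to_complex (polar r t))) * to_complex (u (polar r t))) =
          indicator {0..2*pi} t *\<^sub>R (cis (- \<phi>) * to_complex (u x))"
        by (auto elim!: eventually_mono split: split_indicator_asm)
      then have "(LINT t:{0..2*pi}|lborel. cnj (sgn (to_complex (polar r t))) * to_complex (u (polar r t))) =
          (LINT t:{0..2*pi}|lborel. cis (- \<phi>) * to_complex (u x))"
        unfolding set_lebesgue_integral_def sgn_div_norm by (intro integral_cong_AE) measurable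
      also have "\<dots> = (2 * pi) *\<^sub>R (cis (- \<phi>) * to_complex (u x))"
        by (simp add: set_lebesgue_integral_def)
      finally have "circle_mean (\<lambda>x. cnj (sgn (to_complex x)) * to_complex (u x)) r = cis (- \<phi>) * to_complex (u x)"
        by (simp add: circle_mean_def)
      then have "equivariant_map (circle_mean (\<lambda>x. cnj (sgn (to_complex x)) * to_complex (u x))) (polar r \<phi>) = u x"
        using r by (simp add: equivariant_map_polar mult.commute mult.left_commute cis_mult flip: mult.assoc)
      then show "equivariant_map (circle_mean (\<lambda>x. cnj (sgn (to_complex x)) * to_complex (u x))) x = u x"
        using \<phi>(2) by (simp add: r_def)
    qed
  qed
qed

lemma norm_matrix_vector_le: "norm (A *v x) \<le> norm A * norm (x :: real^'n)" for A :: "real^'n^'m"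
proof -
  have "norm (A *v x) = L2_set (\<lambda>i. norm ((A *v x) $ i)) UNIV"
    by (rule norm_vec_def)
  also have "\<dots> \<le> L2_set (\<lambda>i. norm (A $ i) * norm x) UNIV"
    by (rule L2_set_mono) (simp_all add: matrix_vector_mul_component Cauchy_Schwarz_ineq2)
  also have "\<dots> = norm A * norm x"
    by (simp add: L2_set_left_distrib norm_vec_def[of A])
  finally show ?thesis .
qed

lemma continuous_on_matrix_vector_mult:
  fixes A :: "'a::topological_space \<Rightarrow> real^'n^'m"
  assumes "continuous_on S A" "continuous_on S v"
  shows "continuous_on S (\<lambda>x. A x *v v x)"
  unfolding matrix_vector_mult_def using assms
  by (intro continuous_on_vec_lambda continuous_intros)

lemma measurable_matrix_vector_mult [measurable (raw)]:
  fixes A :: "'a \<Rightarrow> real^'n^'m"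
  assumes "A \<in> borel_measurable M" "v \<in> borel_measurable M"
  shows "(\<lambda>x. A x *v v x) \<in> borel_measurable M"
  using assms by (rule borel_measurable_continuous_Pair)
    (intro continuous_on_matrix_vector_mult continuous_intros)

lemma AE_eq_of_L2_limits:
  fixes f :: "nat \<Rightarrow> 'a \<Rightarrow> 'b::euclidean_space"
  assumes [measurable]: "\<And>n. f n \<in> borel_measurable M" "g \<in> borel_measurable M" "h \<in> borel_measurable M"
    and g: "(\<lambda>n. \<integral>\<^sup>+x. ennreal ((norm (f n x - g x))\<^sup>2) \<partial>M) \<longlonglongrightarrow> 0"
    and h: "(\<lambda>n. \<integral>\<^sup>+x. ennreal ((norm (f n x - h x))\<^sup>2) \<partial>M) \<longlonglongrightarrow> 0"
  shows "AE x in M. g x = h x"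
proof -
  let ?I = "\<integral>\<^sup>+x. ennreal ((norm (g x - h x))\<^sup>2) \<partial>M"
  have "?I \<le> 2 * (\<integral>\<^sup>+x. ennreal ((norm (f n x - g x))\<^sup>2) \<partial>M) + 2 * (\<integral>\<^sup>+x. ennreal ((norm (f n x - h x))\<^sup>2) \<partial>M)" for n
  proof -
    have "?I \<le> (\<integral>\<^sup>+x. 2 * ennreal ((norm (f n x - g x))\<^sup>2) + 2 * ennreal ((norm (f n x - h x))\<^sup>2) \<partial>M)"
    proof (rule nn_integral_mono)
      fix x
      have "norm (g x - h x) \<le> norm (f n x - g x) + norm (f n x - h x)"
        using norm_triangle_ineq4[of "f n x - h x" "f n x - g x"] by simp
      then have "(norm (g x - h x))\<^sup>2 \<le> (norm (f n x - g x) + norm (f n x - h x))\<^sup>2"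
        by (intro power_mono) auto
      also have "\<dots> \<le> 2 * (norm (f n x - g x))\<^sup>2 + 2 * (norm (f n x - h x))\<^sup>2"
        using sum_squares_bound[of "norm (f n x - g x)" "norm (f n x - h x)"] by (simp add: power2_sum)
      finally have "ennreal ((norm (g x - h x))\<^sup>2) \<le> ennreal (2 * (norm (f n x - g x))\<^sup>2 + 2 * (norm (f n x - h x))\<^sup>2)"
        by (rule ennreal_leI)
      then show "ennreal ((norm (g x - h x))\<^sup>2) \<le> 2 * ennreal ((norm (f n x - g x))\<^sup>2) + 2 * ennreal ((norm (f n x - h x))\<^sup>2)"
        by (simp add: ennreal_mult' ennreal_plus)
    qed
    then show ?thesis by (simp add: nn_integral_add nn_integral_cmult)
  qed
  moreover have "(\<lambda>n. 2 * (\<integral>\<^sup>+x. ennreal ((norm (f n x - g x))\<^sup>2) \<partial>M) + 2 * (\<integral>\<^sup>+x. ennreal ((norm (f n x - h x))\<^sup>2) \<partial>M)) \<longlonglongrightarrow> 2 * 0 + 2 * 0"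
    by (intro tendsto_add tendsto_mult_ennreal tendsto_const g h) auto
  ultimately have "?I \<le> 2 * 0 + 2 * 0"
    by (intro tendsto_lowerbound[where F = sequentially]) (auto intro!: always_eventually)
  then have "?I = 0" by simp
  then show ?thesis
    by (subst (asm) nn_integral_0_iff_AE) auto
qed

lemma closed_annulus_subset_closure:
  assumes ab: "0 < a" "a < b"
  shows "{x. a \<le> norm x \<and> norm x \<le> b} \<subseteq> closure (annulus a b)"
proof
  fix x :: "real^2" assume "x \<in> {x. a \<le> norm x \<and> norm x \<le> b}"
  then have x: "norm x \<in> closure {a<..<b}" using ab by simp
  obtain \<theta> where \<theta>: "x = polar (norm x) \<theta>" using ex_polar by blast
  have "(\<lambda>r. polar r \<theta>) ` closure {a<..<b} \<subseteq> closure (annulus a b)"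
  proof (rule image_closure_subset)
    show "continuous_on (closure {a<..<b}) (\<lambda>r. polar r \<theta>)"
      unfolding polar_eq by (intro bounded_linear.continuous_on[OF bounded_linear_vec_of_complex] continuous_intros)
    show "(\<lambda>r. polar r \<theta>) ` {a<..<b} \<subseteq> closure (annulus a b)"
      using ab by (intro subset_trans[OF _ closure_subset]) (auto simp: annulus_def)
  qed simp
  then show "x \<in> closure (annulus a b)" using x \<theta> by blast
qed

lemma continuous_on_polar:
  assumes "continuous_on S f" "continuous_on S g"
  shows "continuous_on S (\<lambda>x. polar (f x) (g x))"
  unfolding polar_eq by (intro bounded_linear.continuous_on[OF bounded_linear_vec_of_complex] continuous_intros assms)

lemma has_vector_derivative_polar: "((\<lambda>r. polar r \<theta>) has_vector_derivative polar 1 \<theta>) (at r within S)"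
proof -
  have "((\<lambda>r. of_real r * cis \<theta>) has_vector_derivative cis \<theta>) (at r within S)"
    by (auto intro!: derivative_eq_intros)
  from bounded_linear.has_vector_derivative[OF bounded_linear_vec_of_complex this]
  show ?thesis by (simp add: polar_eq)
qed

lemma circle_mean_eq_integral:
  assumes "continuous_on {0..2*pi} f" "\<And>\<theta>. H (polar r \<theta>) = f \<theta>"
  shows "set_integrable lborel {0..2*pi} (\<lambda>\<theta>. H (polar r \<theta>))"
    "circle_mean H r = integral {0..2*pi} f /\<^sub>R (2 * pi)"
proof -
  have "set_integrable lborel {0..2*pi} f"
    unfolding set_integrable_def using assms(1) by (intro borel_integrable_compact) auto
  then show "set_integrable lborel {0..2*pi} (\<lambda>\<theta>. H (polar r \<theta>))"
    "circle_mean H r = integral {0..2*pi} f /\<^sub>R (2 * pi)"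
    unfolding circle_mean_def assms(2) by (simp_all add: set_borel_integral_eq_integral(2))
qed

lemma norm_sgn_cnj_mult: "x \<noteq> 0 \<Longrightarrow> norm (cnj (sgn (to_complex x)) * y) = norm y"
  using norm_to_complex[of x] by (auto simp: norm_mult norm_sgn simp del: norm_to_complex)

text \<open>The curve is the limit of the averages over rotations of the maps \<open>V n\<close> in the definition of the
  trace; averaging is an \<open>L\<^sup>2\<close> contraction and fixes the symmetric map \<open>u\<close>.\<close>

lemma admissible_sym_reduction:
  assumes ab: "0 < a" "a < b" and u: "u \<in> admissible_sym a b N"
  obtains w g where "sobolev_curve a b w g" "w a = of_real a" "w b = of_real b"
    "AE x in lebesgue_on (annulus a b). equivariant_map w x = u x" "curve_winding a b w N"
proof -
  let ?A = "annulus a b"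
  define C where "C = {x :: real^2. a \<le> norm x \<and> norm x \<le> b}"
  have AC: "?A \<subseteq> C" by (auto simp: annulus_def C_def)
  have C0: "0 \<notin> C" using ab by (auto simp: C_def)
  have Ccl: "closed C" unfolding C_def by (intro closed_Collect_conj closed_Collect_le continuous_intros)
  have polC: "polar r \<theta> \<in> C" if "r \<in> {a..b}" for r \<theta> using that ab by (auto simp: C_def)
  have W12: "u \<in> W12 ?A" and tr: "has_trace a b u (\<lambda>x. x)" and wind: "ray_winding a b u N"
    and sym: "\<And>Q. rotation_matrix Q \<Longrightarrow> AE x in lebesgue_on ?A. u x = transpose Q *v u (Q *v x)"
    using u by (auto simp: admissible_sym_def admissible_def simp del: transpose_matrix_vector)
  obtain V where V: "\<And>n::nat. \<exists>W. open W \<and> closure ?A \<subseteq> W \<and> C1_on W (V n)"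
    and limV: "(\<lambda>n. \<integral>\<^sup>+x. ennreal ((norm (V n x - u x))\<^sup>2) \<partial>lebesgue_on ?A) \<longlonglongrightarrow> 0"
    and limJ: "(\<lambda>n. \<integral>\<^sup>+x. ennreal ((norm (jacobian (V n) (at x) - wgrad ?A u x))\<^sup>2) \<partial>lebesgue_on ?A) \<longlonglongrightarrow> 0"
    and bdry: "\<And>R. R \<in> {a, b} \<Longrightarrow> (\<lambda>n. \<integral>\<^sup>+\<theta>. ennreal ((norm (V n (polar R \<theta>) - polar R \<theta>))\<^sup>2) \<partial>lebesgue_on {0..2 * pi}) \<longlonglongrightarrow> 0"
    using tr unfolding has_trace_def
    by (elim exE conjE) (rule that, (erule spec | assumption | (erule bspec, assumption))+)
  have wg: "weak_gradient ?A u (wgrad ?A u)"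
    using someI_ex[of "weak_gradient ?A u"] W12 unfolding W12_def wgrad_def by simp
  have C1C: "C1_on C (V n)" for n
    using V[of n] closed_annulus_subset_closure[OF ab] unfolding C_def[symmetric] by (meson C1_on_subset order_trans)
  have Vc: "continuous_on C (V n)" for n by (rule C1_on_continuous_on[OF C1C])
  define J where "J n x = jacobian (V n) (at x)" for n x
  have Jc: "continuous_on C (J n)" for n unfolding J_def by (rule C1_on_jacobian_continuous[OF C1C])
  have Jd: "(V n has_derivative (\<lambda>h. J n x *v h)) (at x)" if "x \<in> C" for n x
    using C1C that unfolding J_def C1_on_def by (simp add: jacobian_works)
  obtain u' where u'[measurable]: "u' \<in> borel_measurable borel" and uu': "AE x in lebesgue_on ?A. u x = u' x"
    using wg by (auto simp: weak_gradient_def L2_on_def intro: ex_borel_eq_lebesgue_on[OF annulus_sets])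
  obtain G where G[measurable]: "G \<in> borel_measurable borel" and GG': "AE x in lebesgue_on ?A. wgrad ?A u x = G x"
    using wg by (auto simp: weak_gradient_def L2_on_def intro: ex_borel_eq_lebesgue_on[OF annulus_sets])
  let ?e = "\<lambda>x. cnj (sgn (to_complex x))"
  \<comment> \<open>Multiplying by \<open>?e\<close> turns a value back to polar angle 0, so
    averaging over rotations becomes \<open>circle_mean\<close>. \<open>HJ\<close> is the
    turned-back radial derivative. The value 0 outside the closed set \<open>C\<close> makes both
    functions Borel.\<close>
  define HV where "HV n x = (if x \<in> C then ?e x * to_complex (V n x) else 0)" for n x
  define HJ where "HJ n x = (if x \<in> C then ?e x * to_complex (J n x *v sgn x) else 0)" for n x
  define Hu where "Hu x = ?e x * to_complex (u' x)" for x
  define HG where "HG x = ?e x * to_complex (G x *v sgn x)" for x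
  have ec: "continuous_on C ?e" "continuous_on C sgn"
    unfolding sgn_div_norm using C0
    by (intro continuous_intros bounded_linear.continuous_on[OF bounded_linear_to_complex]; auto)+
  have [measurable]: "HV n \<in> borel_measurable borel" for n
    unfolding HV_def[abs_def] using Ccl
    by (intro borel_measurable_continuous_on_if continuous_intros ec bounded_linear.continuous_on[OF bounded_linear_to_complex] Vc) auto
  have [measurable]: "HJ n \<in> borel_measurable borel" for n
    unfolding HJ_def[abs_def] using Ccl
    by (intro borel_measurable_continuous_on_if continuous_intros ec bounded_linear.continuous_on[OF bounded_linear_to_complex]
        continuous_on_matrix_vector_mult Jc) auto
  have [measurable]: "Hu \<in> borel_measurable borel" "HG \<in> borel_measurable borel"
    unfolding Hu_def[abs_def] HG_def[abs_def] sgn_div_norm by measurable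
  have epol: "?e (polar r \<theta>) = cis (- \<theta>)" "sgn (polar r \<theta>) = polar 1 \<theta>" if "r \<in> {a..b}" for r \<theta>
  proof -
    have r: "r > 0" using that ab by auto
    then show "?e (polar r \<theta>) = cis (- \<theta>)" by (simp add: to_complex_polar sgn_mult sgn_of_real cis_cnj)
    have "to_complex (sgn (polar r \<theta>)) = to_complex (polar 1 \<theta>)"
      using r by (simp add: to_complex_sgn to_complex_polar sgn_mult sgn_of_real)
    then show "sgn (polar r \<theta>) = polar 1 \<theta>" by (metis vec_of_complex_to_complex)
  qed
  define fV where "fV n r \<theta> = cis (- \<theta>) * to_complex (V n (polar r \<theta>))" for n r \<theta>
  define fJ where "fJ n r \<theta> = cis (- \<theta>) * to_complex (J n (polar r \<theta>) *v polar 1 \<theta>)" for n r \<theta>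
  have HVf: "HV n (polar r \<theta>) = fV n r \<theta>" and HJf: "HJ n (polar r \<theta>) = fJ n r \<theta>" if "r \<in> {a..b}" for n r \<theta>
    using that polC epol by (simp_all add: HV_def HJ_def fV_def fJ_def)
  have fVc: "continuous_on {0..2*pi} (fV n r)" if "r \<in> {a..b}" for n r
    unfolding fV_def using polC that
    by (intro continuous_intros bounded_linear.continuous_on[OF bounded_linear_to_complex] continuous_on_polar
        continuous_on_compose2[OF Vc]) auto
  have fJc: "continuous_on ({a..b} \<times> {0..2*pi}) (\<lambda>(r, \<theta>). fJ n r \<theta>)" for n
    unfolding fJ_def split_def using polC
    by (intro continuous_intros bounded_linear.continuous_on[OF bounded_linear_to_complex] continuous_on_polar
        continuous_on_matrix_vector_mult continuous_on_compose2[OF Jc]) auto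
  have fJc': "continuous_on {0..2*pi} (fJ n r)" if "r \<in> {a..b}" for n r
    unfolding fJ_def using polC that
    by (intro continuous_intros bounded_linear.continuous_on[OF bounded_linear_to_complex] continuous_on_polar
        continuous_on_matrix_vector_mult continuous_on_compose2[OF Jc]) auto
  note meanV = circle_mean_eq_integral[OF fVc HVf]
  note meanJ = circle_mean_eq_integral[OF fJc' HJf]
  \<comment> \<open>Differentiation under the integral sign works up to both ends, since
    \<open>V n\<close> is C1 on a neighbourhood of the closed annulus.\<close>
  have der: "(circle_mean (HV n) has_vector_derivative circle_mean (HJ n) r) (at r within {a..b})" if r: "r \<in> {a..b}" for n r
  proof -
    have "((\<lambda>r. integral (cbox 0 (2*pi)) (fV n r)) has_vector_derivative integral (cbox 0 (2*pi)) (fJ n r)) (at r within {a..b})"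
    proof (rule leibniz_rule_vector_derivative)
      show "((\<lambda>r. fV n r \<theta>) has_vector_derivative fJ n r \<theta>) (at r within {a..b})" if r: "r \<in> {a..b}" for r \<theta>
      proof -
        have "((\<lambda>r. V n (polar r \<theta>)) has_vector_derivative J n (polar r \<theta>) *v polar 1 \<theta>) (at r within {a..b})"
          using has_derivative_compose[OF has_vector_derivative_polar[of \<theta> r "{a..b}", unfolded has_vector_derivative_def] Jd[OF polC[OF r]]]
          by (simp add: has_vector_derivative_def linear_scale[OF matrix_vector_mul_linear])
        from bounded_linear.has_vector_derivative[OF bounded_linear_compose[OF bounded_linear_mult_right bounded_linear_to_complex] this]
        show ?thesis unfolding fV_def fJ_def .
      qed
      show "(fV n r) integrable_on cbox 0 (2*pi)" if "r \<in> {a..b}" for r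
        using fVc[OF that] by (intro integrable_continuous) simp
      show "continuous_on ({a..b} \<times> cbox 0 (2*pi)) (\<lambda>(r, \<theta>). fJ n r \<theta>)" using fJc by simp
    qed (use r in auto)
    then have "((\<lambda>r. integral {0..2*pi} (fV n r) /\<^sub>R (2*pi)) has_vector_derivative integral {0..2*pi} (fJ n r) /\<^sub>R (2*pi)) (at r within {a..b})"
      by (auto intro!: derivative_eq_intros)
    then show ?thesis
      unfolding meanJ(2)[OF r r] by (rule has_vector_derivative_transform[OF r, rotated]) (use meanV in auto)
  qed
  have Dc: "continuous_on {a..b} (circle_mean (HJ n))" for n
  proof -
    have "continuous_on {a..b} (\<lambda>r. integral (cbox 0 (2*pi)) (fJ n r) /\<^sub>R (2*pi))"
      by (intro continuous_intros integral_continuous_on_param) (use fJc in \<open>simp add: split_def\<close>)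
    then show ?thesis by (rule continuous_on_eq) (use meanJ in auto)
  qed
  have lim0: "(\<lambda>n. ennreal c * f n) \<longlonglongrightarrow> 0" if "f \<longlonglongrightarrow> (0::ennreal)" for c f
    using tendsto_mult_ennreal[OF tendsto_const that, of "ennreal c"] by simp
  have limD: "(\<lambda>n. \<integral>\<^sup>+r\<in>{a..b}. ennreal ((norm (circle_mean (HJ n) r - circle_mean HG r))\<^sup>2) \<partial>lborel) \<longlonglongrightarrow> 0"
  proof (rule tendsto_sandwich[OF _ _ tendsto_const lim0[OF limJ, of "1 / (2 * pi * a)"]])
    show "\<forall>\<^sub>F n in sequentially. (\<integral>\<^sup>+r\<in>{a..b}. ennreal ((norm (circle_mean (HJ n) r - circle_mean HG r))\<^sup>2) \<partial>lborel) \<le>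
      ennreal (1 / (2 * pi * a)) * (\<integral>\<^sup>+x. ennreal ((norm (jacobian (V n) (at x) - wgrad ?A u x))\<^sup>2) \<partial>lebesgue_on ?A)"
    proof (rule always_eventually, rule allI)
      fix n
      have "(\<integral>\<^sup>+r\<in>{a..b}. ennreal ((norm (circle_mean (HJ n) r - circle_mean HG r))\<^sup>2) \<partial>lborel) \<le>
        ennreal (1 / (2 * pi * a)) * (\<integral>\<^sup>+x\<in>?A. ennreal ((norm (HJ n x - HG x))\<^sup>2) \<partial>lborel)"
        by (rule nn_integral_circle_mean_diff_le[OF ab]) (use meanJ(1) in auto)
      also have "(\<integral>\<^sup>+x\<in>?A. ennreal ((norm (HJ n x - HG x))\<^sup>2) \<partial>lborel) = (\<integral>\<^sup>+x. ennreal ((norm (HJ n x - HG x))\<^sup>2) \<partial>lebesgue_on ?A)"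
        by (rule nn_integral_lebesgue_on[symmetric]) measurable
      also have "\<dots> \<le> (\<integral>\<^sup>+x. ennreal ((norm (jacobian (V n) (at x) - wgrad ?A u x))\<^sup>2) \<partial>lebesgue_on ?A)"
      proof (rule nn_integral_mono_AE)
        have "AE x in lebesgue_on ?A. x \<in> ?A" by (rule AE_I2) simp
        with GG' show "AE x in lebesgue_on ?A. ennreal ((norm (HJ n x - HG x))\<^sup>2) \<le> ennreal ((norm (jacobian (V n) (at x) - wgrad ?A u x))\<^sup>2)"
        proof eventually_elim
          case (elim x)
          then have x: "x \<in> C" "x \<noteq> 0" using AC C0 by auto
          have "HJ n x - HG x = ?e x * to_complex ((J n x - G x) *v sgn x)"
            using x(1) by (simp add: HJ_def HG_def matrix_vector_mult_diff_rdistrib right_diff_distrib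
              linear_diff[OF bounded_linear.linear[OF bounded_linear_to_complex]])
          then have "norm (HJ n x - HG x) = norm ((J n x - G x) *v sgn x)"
            by (simp add: norm_sgn_cnj_mult[OF x(2)])
          also have "\<dots> \<le> norm (J n x - G x)"
            using norm_matrix_vector_le[of "J n x - G x" "sgn x"] x(2) by (simp add: norm_sgn)
          finally show ?case
            using elim(1) by (intro ennreal_leI power_mono) (auto simp: J_def)
        qed
      qed
      finally show "(\<integral>\<^sup>+r\<in>{a..b}. ennreal ((norm (circle_mean (HJ n) r - circle_mean HG r))\<^sup>2) \<partial>lborel) \<le>
        ennreal (1 / (2 * pi * a)) * (\<integral>\<^sup>+x. ennreal ((norm (jacobian (V n) (at x) - wgrad ?A u x))\<^sup>2) \<partial>lebesgue_on ?A)"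
        by (simp add: mult_left_mono)
    qed
  qed auto
  have limW: "(\<lambda>n. \<integral>\<^sup>+r\<in>{a..b}. ennreal ((norm (circle_mean (HV n) r - circle_mean Hu r))\<^sup>2) \<partial>lborel) \<longlonglongrightarrow> 0"
  proof (rule tendsto_sandwich[OF _ _ tendsto_const lim0[OF limV, of "1 / (2 * pi * a)"]])
    show "\<forall>\<^sub>F n in sequentially. (\<integral>\<^sup>+r\<in>{a..b}. ennreal ((norm (circle_mean (HV n) r - circle_mean Hu r))\<^sup>2) \<partial>lborel) \<le>
      ennreal (1 / (2 * pi * a)) * (\<integral>\<^sup>+x. ennreal ((norm (V n x - u x))\<^sup>2) \<partial>lebesgue_on ?A)"
    proof (rule always_eventually, rule allI)
      fix n
      have "(\<integral>\<^sup>+r\<in>{a..b}. ennreal ((norm (circle_mean (HV n) r - circle_mean Hu r))\<^sup>2) \<partial>lborel) \<le>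
        ennreal (1 / (2 * pi * a)) * (\<integral>\<^sup>+x\<in>?A. ennreal ((norm (HV n x - Hu x))\<^sup>2) \<partial>lborel)"
        by (rule nn_integral_circle_mean_diff_le[OF ab]) (use meanV(1) in auto)
      also have "(\<integral>\<^sup>+x\<in>?A. ennreal ((norm (HV n x - Hu x))\<^sup>2) \<partial>lborel) = (\<integral>\<^sup>+x. ennreal ((norm (HV n x - Hu x))\<^sup>2) \<partial>lebesgue_on ?A)"
        by (rule nn_integral_lebesgue_on[symmetric]) measurable
      also have "\<dots> \<le> (\<integral>\<^sup>+x. ennreal ((norm (V n x - u x))\<^sup>2) \<partial>lebesgue_on ?A)"
      proof (rule nn_integral_mono_AE)
        have "AE x in lebesgue_on ?A. x \<in> ?A" by (rule AE_I2) simp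
        with uu' show "AE x in lebesgue_on ?A. ennreal ((norm (HV n x - Hu x))\<^sup>2) \<le> ennreal ((norm (V n x - u x))\<^sup>2)"
        proof eventually_elim
          case (elim x)
          then have x: "x \<in> C" "x \<noteq> 0" using AC C0 by auto
          have "HV n x - Hu x = ?e x * to_complex (V n x - u' x)"
            using x(1) by (simp add: HV_def Hu_def right_diff_distrib
              linear_diff[OF bounded_linear.linear[OF bounded_linear_to_complex]])
          then have "norm (HV n x - Hu x) = norm (V n x - u' x)"
            by (simp add: norm_sgn_cnj_mult[OF x(2)])
          then show ?case using elim(1) by simp
        qed
      qed
      finally show "(\<integral>\<^sup>+r\<in>{a..b}. ennreal ((norm (circle_mean (HV n) r - circle_mean Hu r))\<^sup>2) \<partial>lborel) \<le>
        ennreal (1 / (2 * pi * a)) * (\<integral>\<^sup>+x. ennreal ((norm (V n x - u x))\<^sup>2) \<partial>lebesgue_on ?A)"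
        by (simp add: mult_left_mono)
    qed
  qed auto
  \<comment> \<open>The trace condition gives only L2 convergence on the two circles. The averages
    are single numbers there, so the same estimate gives their convergence and, with uniform
    convergence, the boundary values of \<open>w\<close>.\<close>
  have lim_bdry: "(\<lambda>n. circle_mean (HV n) R) \<longlonglongrightarrow> of_real R" if R: "R \<in> {a, b}" for R
  proof -
    have Rab: "R \<in> {a..b}" using R ab by auto
    have eq: "norm (HV n (polar R \<theta>) - of_real R) = norm (V n (polar R \<theta>) - polar R \<theta>)" for n \<theta>
    proof -
      have "HV n (polar R \<theta>) - of_real R = cis (- \<theta>) * to_complex (V n (polar R \<theta>) - polar R \<theta>)"
        unfolding HVf[OF Rab] fV_def
        by (simp add: right_diff_distrib to_complex_polar cis_mult mult.left_commute[of "cis (- \<theta>)"]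
              linear_diff[OF bounded_linear.linear[OF bounded_linear_to_complex]])
      then show ?thesis by (simp add: norm_mult)
    qed
    have const: "circle_mean (\<lambda>_. of_real R) R = of_real R"
      by (simp add: circle_mean_def set_lebesgue_integral_def)
    have "(\<lambda>n. (ennreal (norm (circle_mean (HV n) R - of_real R)))\<^sup>2) \<longlonglongrightarrow> 0"
    proof (rule tendsto_sandwich[OF _ _ tendsto_const lim0[OF bdry[OF R], of "1 / (2 * pi)"]])
      show "\<forall>\<^sub>F n in sequentially. (ennreal (norm (circle_mean (HV n) R - of_real R)))\<^sup>2 \<le>
        ennreal (1 / (2 * pi)) * (\<integral>\<^sup>+\<theta>. ennreal ((norm (V n (polar R \<theta>) - polar R \<theta>))\<^sup>2) \<partial>lebesgue_on {0..2 * pi})"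
      proof (rule always_eventually, rule allI)
        fix n
        have "ennreal ((norm (circle_mean (HV n) R - circle_mean (\<lambda>_. of_real R) R))\<^sup>2) \<le>
          ennreal (1 / (2 * pi)) * (\<integral>\<^sup>+\<theta>\<in>{0..2*pi}. ennreal ((norm (HV n (polar R \<theta>) - of_real R))\<^sup>2) \<partial>lborel)"
          by (rule circle_mean_diff_square_le[OF _ _ meanV(1)[OF Rab Rab]]) measurable
        also have "(\<integral>\<^sup>+\<theta>\<in>{0..2*pi}. ennreal ((norm (HV n (polar R \<theta>) - of_real R))\<^sup>2) \<partial>lborel) =
          (\<integral>\<^sup>+\<theta>. ennreal ((norm (HV n (polar R \<theta>) - of_real R))\<^sup>2) \<partial>lebesgue_on {0..2*pi})"
          by (rule nn_integral_lebesgue_on[symmetric]) measurable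
        finally show "(ennreal (norm (circle_mean (HV n) R - of_real R)))\<^sup>2 \<le>
          ennreal (1 / (2 * pi)) * (\<integral>\<^sup>+\<theta>. ennreal ((norm (V n (polar R \<theta>) - polar R \<theta>))\<^sup>2) \<partial>lebesgue_on {0..2 * pi})"
          unfolding eq const by (simp add: ennreal_power)
      qed
    qed auto
    then have "(\<lambda>n. ennreal (norm (circle_mean (HV n) R - of_real R))) \<longlonglongrightarrow> ennreal 0"
      unfolding ennreal_0 by (rule tendsto_0_ennreal_of_square)
    then have "(\<lambda>n. norm (circle_mean (HV n) R - of_real R)) \<longlonglongrightarrow> 0"
      by (rule tendsto_ennrealD) (auto intro!: always_eventually)
    then show ?thesis
      by (simp add: tendsto_norm_zero_iff LIM_zero_iff)
  qed
  obtain w where w: "sobolev_curve a b w (circle_mean HG)" and unif: "uniform_limit {a..b} (\<lambda>n. circle_mean (HV n)) w sequentially"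
  proof (rule sobolev_curveI[OF ab(2) _ der Dc limD])
    show "(\<lambda>n. circle_mean (HV n) a) \<longlonglongrightarrow> of_real a" by (rule lim_bdry) simp
  qed (auto intro: that)
  have bc: "w R = of_real R" if R: "R \<in> {a, b}" for R
    using R ab by (intro LIMSEQ_unique[OF tendsto_uniform_limitI[OF unif] lim_bdry[OF R]]) auto
  have wc: "continuous_on UNIV w" using w by (simp add: sobolev_curve_def)
  have [measurable]: "w \<in> borel_measurable borel" using wc by (rule borel_measurable_continuous_onI)
  \<comment> \<open>The averages converge in L2 both to \<open>w\<close>, by uniform convergence,
    and to the mean of \<open>u\<close>, by contraction.\<close>
  have "AE r in restrict_space lborel {a..b}. w r = circle_mean Hu r"
  proof (rule AE_eq_of_L2_limits[where f = "\<lambda>n. circle_mean (HV n)"])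
    show "(\<lambda>n. \<integral>\<^sup>+r. ennreal ((norm (circle_mean (HV n) r - circle_mean Hu r))\<^sup>2) \<partial>restrict_space lborel {a..b}) \<longlonglongrightarrow> 0"
      using limW by (simp add: nn_integral_restrict_space)
    show "(\<lambda>n. \<integral>\<^sup>+r. ennreal ((norm (circle_mean (HV n) r - w r))\<^sup>2) \<partial>restrict_space lborel {a..b}) \<longlonglongrightarrow> 0"
    proof (rule tendsto_nn_integral_uniform_0)
      fix e :: real assume e: "e > 0"
      have "\<forall>\<^sub>F n in sequentially. \<forall>r\<in>{a..b}. dist (circle_mean (HV n) r) (w r) < sqrt e"
        using unif e by (auto simp: uniform_limit_iff)
      then show "\<forall>\<^sub>F n in sequentially. \<forall>r\<in>space (restrict_space lborel {a..b}). (norm (circle_mean (HV n) r - w r))\<^sup>2 \<le> e"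
      proof eventually_elim
        case (elim n)
        show ?case
        proof
          fix r assume "r \<in> space (restrict_space lborel {a..b})"
          then have "norm (circle_mean (HV n) r - w r) \<le> sqrt e"
            using elim by (auto simp: space_restrict_space dist_norm less_imp_le)
          then have "(norm (circle_mean (HV n) r - w r))\<^sup>2 \<le> (sqrt e)\<^sup>2" by (intro power_mono) auto
          then show "(norm (circle_mean (HV n) r - w r))\<^sup>2 \<le> e" using e by simp
        qed
      qed
    qed (simp add: emeasure_restrict_space space_restrict_space emeasure_lborel_Icc_eq)
  qed (auto intro!: measurable_restrict_space1)
  then have "AE r in lborel. r \<in> {a..b} \<longrightarrow> w r = circle_mean Hu r"
    by (simp add: AE_restrict_space_iff)
  then have "AE r in lborel. r \<in> {a<..<b} \<longrightarrow> w r = circle_mean Hu r"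
    by (auto elim!: eventually_mono)
  then have wHu: "AE x in lebesgue_on ?A. w (norm x) = circle_mean Hu (norm x)"
    using AE_annulus_radial[where a = a and b = b and P = "\<lambda>r. w r = circle_mean Hu r"] ab by simp
  have "AE x in lborel. x \<in> ?A \<longrightarrow> equivariant_map (circle_mean Hu) x = u' x"
    unfolding Hu_def[abs_def]
  proof (rule rotation_invariant_eq_equivariant_map[OF ab(1) u'])
    fix \<alpha>
    have 1: "AE x in lborel. x \<in> ?A \<longrightarrow> u x = u' x"
      using uu' by (simp add: AE_lebesgue_on_iff)
    \<comment> \<open>Passing from \<open>u\<close> to its Borel version \<open>u'\<close> must be
      justified at the rotated point as well; rotations map null sets to null sets.\<close>
    have 2: "AE x in lborel. rot \<alpha> x \<in> ?A \<longrightarrow> u (rot \<alpha> x) = u' (rot \<alpha> x)"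
      by (rule AE_rot[OF 1])
    have "AE x in lebesgue_on ?A. u x = rot (- \<alpha>) (u (rot \<alpha> x))"
      using sym[of "rot_matrix \<alpha>"] unfolding transpose_rot_matrix rot_matrix_mult by (auto simp: rotation_matrix_2x2)
    then have 3: "AE x in lborel. x \<in> ?A \<longrightarrow> u x = rot (- \<alpha>) (u (rot \<alpha> x))"
      by (simp add: AE_lebesgue_on_iff)
    show "AE x in lborel. x \<in> ?A \<longrightarrow> u' x = rot (- \<alpha>) (u' (rot \<alpha> x))"
      using 1 2 3 by eventually_elim (auto simp: annulus_def)
  qed
  then have "AE x in lebesgue_on ?A. equivariant_map (circle_mean Hu) x = u' x"
    by (simp add: AE_lebesgue_on_iff)
  with wHu uu' have ueq: "AE x in lebesgue_on ?A. equivariant_map w x = u x"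
    by eventually_elim (simp add: equivariant_map_def)
  have "curve_winding a b w N"
    by (rule curve_winding_of_ray_winding[OF ab wc _ _ ueq wind]) (use bc in auto)
  with w bc ueq show thesis by (intro that[of w "circle_mean HG"]) auto
qed

section \<open>The stored energy\<close>

locale stored_energy =
  fixes h :: "real \<Rightarrow> ennreal"
  assumes H1: "H1 h" and H2: "H2 h" and H3: "H3 h" and H4: "H4 h"
begin

abbreviation "hr \<equiv> finite_part h"
abbreviation "h' \<equiv> deriv hr"
abbreviation "h'' \<equiv> deriv h'"

lemma hr_nonneg: "0 \<le> hr t"
  by simp

lemma h_eq: "0 < t \<Longrightarrow> h t = ennreal (hr t)"
  using H2 by (simp add: H2_def)

lemma h_nonpos: "t \<le> 0 \<Longrightarrow> h t = \<infinity>"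
  using H3 by (simp add: H3_def)

lemma diff_hr: "0 < t \<Longrightarrow> (hr has_real_derivative h' t) (at t)"
  and diff_h': "0 < t \<Longrightarrow> (h' has_real_derivative h'' t) (at t)"
proof -
  have *: "j < 3 \<Longrightarrow> 0 < t \<Longrightarrow> (deriv ^^ j) hr field_differentiable (at t)" for j :: nat and t
    using H2 by (simp add: H2_def)
  show "0 < t \<Longrightarrow> (hr has_real_derivative h' t) (at t)" "0 < t \<Longrightarrow> (h' has_real_derivative h'' t) (at t)"
    using *[of 0 t] *[of 1 t] by (simp_all add: DERIV_deriv_iff_field_differentiable)
qed

lemma cont_hr: "continuous_on {0<..} hr" and cont_h': "continuous_on {0<..} h'"
  by (rule DERIV_continuous_on[where D = h'], auto intro: has_field_derivative_at_within diff_hr)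
     (rule DERIV_continuous_on[where D = h''], auto intro: has_field_derivative_at_within diff_h')

lemma measurable_h [measurable]: "h \<in> borel_measurable borel"
proof -
  have "(\<lambda>t. if t \<in> {0<..} then hr t else 0) \<in> borel_measurable borel"
    by (rule borel_measurable_continuous_on_if) (auto intro: cont_hr)
  then have "(\<lambda>t. if t \<in> {0<..} then ennreal (if t \<in> {0<..} then hr t else 0) else \<infinity>) \<in> borel_measurable borel"
    by measurable
  also have "(\<lambda>t. if t \<in> {0<..} then ennreal (if t \<in> {0<..} then hr t else 0) else \<infinity>) = h"
  proof (rule ext)
    show "(if t \<in> {0<..} then ennreal (if t \<in> {0<..} then hr t else 0) else \<infinity>) = h t" for t
      by (cases "0 < t") (simp_all add: h_eq[symmetric] h_nonpos)
  qed
  finally show ?thesis .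
qed

lemma convex_hr: "convex_on {0<..} hr"
proof (rule convex_onI)
  fix t x y :: real assume t: "0 < t" "t < 1" and xy: "x \<in> {0<..}" "y \<in> {0<..}"
  have pos: "0 < (1 - t) * x + t * y" using t xy by (simp add: add_pos_pos)
  have "ennreal (hr ((1 - t) * x + t * y)) = h ((1 - t) * x + t * y)"
    by (rule h_eq[OF pos, symmetric])
  also have "\<dots> \<le> ennreal (1 - t) * h x + ennreal t * h y"
    using H1 t by (simp add: H1_def)
  also have "ennreal (1 - t) * h x = ennreal ((1 - t) * hr x)"
    using t xy by (subst ennreal_mult) (auto simp: h_eq[symmetric])
  also have "ennreal t * h y = ennreal (t * hr y)"
    using t xy by (subst ennreal_mult) (auto simp: h_eq[symmetric])
  also have "ennreal ((1 - t) * hr x) + ennreal (t * hr y) = ennreal ((1 - t) * hr x + t * hr y)"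
    using t by (subst ennreal_plus) auto
  finally show "hr ((1 - t) *\<^sub>R x + t *\<^sub>R y) \<le> (1 - t) * hr x + t * hr y"
    using t by (subst (asm) ennreal_le_iff) auto
qed simp

lemma tangent_hr: "0 < c \<Longrightarrow> 0 < x \<Longrightarrow> h' c * (x - c) \<le> hr x - hr c"
  by (rule convex_on_imp_above_tangent[OF convex_hr])
     (auto simp: interior_open intro: diff_hr has_field_derivative_at_within)

text \<open>Adding the tangent inequalities at the two points removes the values of the
  function.\<close>

lemma mono_h': "0 < x \<Longrightarrow> x \<le> y \<Longrightarrow> h' x \<le> h' y"
proof (cases "x = y")
  case False
  assume "0 < x" "x \<le> y"
  then have "(h' x - h' y) * (y - x) \<le> 0"
    using tangent_hr[of x y] tangent_hr[of y x] by (simp add: algebra_simps)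
  then show ?thesis using False \<open>x \<le> y\<close> by (simp add: mult_le_0_iff)
qed simp

lemma h''_nonneg: "0 < x \<Longrightarrow> 0 \<le> h'' x"
proof -
  assume x: "0 < x"
  have "mono_on {0<..} h'" by (auto intro!: mono_onI mono_h')
  then show ?thesis
    using mono_on_imp_deriv_nonneg[of "{0<..}" h' "h'' x" x] diff_h'[OF x] x by (simp add: interior_open)
qed

section \<open>The function f and the growth of the stored energy\<close>

abbreviation "F \<equiv> f_of h"

lemma F_def': "F t = t * h' t - hr t"
  by (simp add: f_of_def)

lemma diff_F: "0 < t \<Longrightarrow> (F has_real_derivative t * h'' t) (at t)"
  unfolding f_of_def[abs_def] by (auto intro!: derivative_eq_intros diff_hr diff_h')

text \<open>The tangent at y bounds the increase of \<open>hr\<close>, which leaves x times the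
  increase of \<open>h'\<close>. Only weak monotonicity results, since (H1) allows the second
  derivative to vanish.\<close>

lemma mono_F: "0 < x \<Longrightarrow> x \<le> y \<Longrightarrow> F x \<le> F y"
proof -
  assume xy: "0 < x" "x \<le> y"
  have "F y - F x \<ge> x * (h' y - h' x)"
    using tangent_hr[of y x] xy by (simp add: F_def' algebra_simps)
  moreover have "0 \<le> x * (h' y - h' x)"
    using xy mono_h' by simp
  ultimately show ?thesis by linarith
qed

lemma H2_bounds:
  obtains s c1 c2 \<delta> where "s > 0" "c1 > 0" "c2 > 0" "\<delta> > 0"
    "\<And>t j. 0 < t \<Longrightarrow> t < \<delta> \<Longrightarrow> j \<le> 2 \<Longrightarrow> c1 * t powr (- s - real j) \<le> (- 1) ^ j * (deriv ^^ j) hr t \<and>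
       (- 1) ^ j * (deriv ^^ j) hr t \<le> c2 * t powr (- s - real j)"
proof -
  have "\<exists>s>0. \<exists>c1>0. \<exists>c2>0. \<exists>d0>0. \<forall>t j. 0 < t \<and> t < d0 \<and> j \<le> 2 \<longrightarrow>
        c1 * t powr (- s - real j) \<le> (- 1) ^ j * (deriv ^^ j) hr t \<and>
        (- 1) ^ j * (deriv ^^ j) hr t \<le> c2 * t powr (- s - real j)"
    by (rule H2[unfolded H2_def, THEN conjunct2, THEN conjunct2, THEN conjunct2])
  then show thesis by (elim exE conjE) (rule that, assumption+, simp)
qed

text \<open>Near 0 the bound on the first derivative gives t h'(t) \<le> - c1 t^(-s), and
  subtracting the nonnegative \<open>hr\<close> preserves this. It is what makes the pointwise
  equation for the determinant solvable for every right side.\<close>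

lemma F_unbounded_below: "\<exists>t>0. F t < K"
proof -
  obtain s c1 c2 \<delta> where s: "s > 0" "c1 > 0" "c2 > 0" "\<delta> > 0" and
    B: "\<And>t j. 0 < t \<Longrightarrow> t < \<delta> \<Longrightarrow> j \<le> 2 \<Longrightarrow> c1 * t powr (- s - real j) \<le> (- 1) ^ j * (deriv ^^ j) hr t \<and>
       (- 1) ^ j * (deriv ^^ j) hr t \<le> c2 * t powr (- s - real j)"
    by (rule H2_bounds) (rule that)
  have bound: "F t \<le> - c1 * t powr (- s)" if t: "0 < t" "t < \<delta>" for t
  proof -
    have "c1 * t powr (- s - 1) \<le> - h' t" using B[OF t, of 1] by simp
    then have "t * (c1 * t powr (- s - 1)) \<le> t * (- h' t)" using t by (intro mult_left_mono) auto
    moreover have "t * t powr (- s - 1) = t powr (- s)"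
      using t by (simp add: powr_diff)
    ultimately have "c1 * t powr (- s) \<le> - (t * h' t)" by (simp add: mult.left_commute)
    then show ?thesis using hr_nonneg[of t] unfolding F_def' by linarith
  qed
  \<comment> \<open>Chosen so that c1 X exceeds |K|; then t \<le> X^(-1/s) gives t^(-s) \<ge>
    X.\<close>
  define X where "X = \<bar>K\<bar> / c1 + 1"
  define t where "t = min (\<delta> / 2) (X powr (- 1 / s))"
  have X: "1 \<le> X" using s by (simp add: X_def)
  have t: "0 < t" "t < \<delta>" using s X by (auto simp: t_def)
  have "X = (X powr (- 1 / s)) powr (- s)" using s X by (simp add: powr_powr)
  also have "\<dots> \<le> t powr (- s)"
    using s t by (intro powr_mono2') (auto simp: t_def)
  finally have tX: "\<bar>K\<bar> / c1 + 1 \<le> t powr (- s)" by (simp add: X_def)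
  have "\<bar>K\<bar> + c1 = c1 * (\<bar>K\<bar> / c1 + 1)" using s by (simp add: field_simps)
  also have "\<dots> \<le> c1 * t powr (- s)" using tX s by (intro mult_left_mono) auto
  finally have "F t < K" using bound[OF t(1,2)] s by linarith
  then show ?thesis using t by blast
qed

text \<open>The growth conditions make \<open>\<epsilon> \<mapsto> h\<^sub>0 ((1 + \<epsilon>) t)\<close> differentiable with a derivative dominated
  by the integrand, which is what the inner variations need.\<close>

lemma h'_growth: "\<exists>C\<ge>0. \<forall>t>0. \<forall>l\<in>{1/2..2}. t * \<bar>h' (l * t)\<bar> \<le> C * (1 + t + hr t)"
proof -
  obtain s c1 c2 \<delta> where s: "s > 0" "c1 > 0" "c2 > 0" "\<delta> > 0" and
    B: "\<And>t j. 0 < t \<Longrightarrow> t < \<delta> \<Longrightarrow> j \<le> 2 \<Longrightarrow> c1 * t powr (- s - real j) \<le> (- 1) ^ j * (deriv ^^ j) hr t \<and>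
       (- 1) ^ j * (deriv ^^ j) hr t \<le> c2 * t powr (- s - real j)"
    by (rule H2_bounds) (rule that)
  obtain \<tau> c3 c4 d1 where c34: "c3 > 0" "c4 > 0" "d1 > 0" and
    B4: "\<And>t. t \<ge> d1 \<Longrightarrow> c3 * t powr \<tau> \<le> (deriv ^^ 2) hr t \<and> (deriv ^^ 2) hr t \<le> c4 * t powr \<tau>"
    using H4 unfolding H4_def by blast
  have h2: "(deriv ^^ 2) hr = h''" by (simp add: numeral_2_eq_2)
  \<comment> \<open>Near 0 both t |h'| and \<open>hr\<close> have order t^(-s) by (H2), hence are
    comparable. The power of 2 pays for the worst case l t = t/2.\<close>
  define C1 where "C1 = c2 * 2 powr (s + 1) / c1"
  have R1: "t * \<bar>h' (l * t)\<bar> \<le> C1 * hr t" if t: "0 < t" "t < \<delta> / 2" and l: "l \<in> {1/2..2}" for t l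
  proof -
    have "l * t \<le> 2 * t" "1/2 * t \<le> l * t" using t l by (auto intro!: mult_right_mono)
    then have lt: "0 < l * t" "l * t < \<delta>" "t / 2 \<le> l * t" using t by linarith+
    have "c1 * (l * t) powr (- s - 1) \<le> - h' (l * t)" "- h' (l * t) \<le> c2 * (l * t) powr (- s - 1)"
      using B[OF lt(1,2), of 1] by simp_all
    moreover have "0 \<le> c1 * (l * t) powr (- s - 1)" using s by simp
    ultimately have "\<bar>h' (l * t)\<bar> \<le> c2 * (l * t) powr (- s - 1)" by linarith
    also have "\<dots> \<le> c2 * (t / 2) powr (- s - 1)"
      using s t lt by (intro mult_left_mono powr_mono2') auto
    finally have "t * \<bar>h' (l * t)\<bar> \<le> t * (c2 * (t / 2) powr (- s - 1))"
      using t by (intro mult_left_mono) auto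
    also have "t * (c2 * (t / 2) powr (- s - 1)) = c2 * 2 powr (s + 1) * t powr (- s)"
    proof -
      have "(t / 2) powr (- s - 1) = t powr (- s - 1) * 2 powr (s + 1)"
      proof -
        have "(2::real) powr (- s - 1) = inverse (2 powr (s + 1))"
          using powr_minus[of "2::real" "s + 1"] by simp
        moreover have "(t / 2) powr (- s - 1) = t powr (- s - 1) / 2 powr (- s - 1)"
          by (rule powr_divide)
        ultimately show ?thesis by (simp only: divide_inverse inverse_inverse_eq)
      qed
      moreover have "t * t powr (- s - 1) = t powr (- s)" using t by (simp add: powr_diff)
      ultimately show ?thesis by (simp add: mult_ac)
    qed
    also have "\<dots> = C1 * (c1 * t powr (- s))" using s by (simp add: C1_def)
    also have "\<dots> \<le> C1 * hr t"
      using B[of t 0] t s by (intro mult_left_mono) (auto simp: C1_def)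
    finally show ?thesis .
  qed
  \<comment> \<open>This compact interval contains every l t with t between \<delta>/2 and 2 d1 and
    l in [1/2,2]; there a bound on \<open>h'\<close> by continuity is enough.\<close>
  obtain C2 where C2: "0 \<le> C2" "\<And>x. x \<in> {\<delta>/4..4*d1} \<Longrightarrow> \<bar>h' x\<bar> \<le> C2"
  proof -
    have "bounded (h' ` {\<delta>/4..4*d1})"
      using s by (intro compact_imp_bounded compact_continuous_image continuous_on_subset[OF cont_h']) auto
    then obtain K where "\<forall>x\<in>{\<delta>/4..4*d1}. \<bar>h' x\<bar> \<le> K" by (auto simp: bounded_iff)
    then show thesis by (intro that[of "max 0 K"]) force+
  qed
  \<comment> \<open>For large t, h'(2t) is compared with h'(t/2), because the tangent at t/2,
    evaluated at t, bounds (t/2) h'(t/2) by \<open>hr t\<close>. This is a dilation by 4: it costs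
    4^\<tau> c4/c3 for the second derivative by (H4), and one more factor 4 from the chain
    rule.\<close>
  define K where "K = 4 * (c4 * 4 powr \<tau> / c3)"
  have K: "K > 0" using c34 by (simp add: K_def)
  define A0 where "A0 = h' (4 * d1) - K * h' d1"
  have R3': "h' (4 * x) \<le> K * h' x + A0" if x: "d1 \<le> x" for x
  proof -
    have der: "((\<lambda>x. h' (4 * x) - K * h' x) has_real_derivative h'' (4 * y) * 4 - K * h'' y) (at y)" if "d1 \<le> y" for y
    proof -
      have "0 < y" "0 < 4 * y" using that c34 by linarith+
      then show ?thesis
        by (auto intro!: derivative_eq_intros DERIV_chain2[OF diff_h'] diff_h')
    qed
    moreover have "h'' (4 * y) * 4 - K * h'' y \<le> 0" if y: "d1 \<le> y" for y
    proof -
      have "0 < y" using y c34 by linarith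
      have "h'' (4 * y) \<le> c4 * (4 * y) powr \<tau>" using B4[of "4 * y"] y c34 unfolding h2 by simp
      also have "\<dots> = (c4 * 4 powr \<tau> / c3) * (c3 * y powr \<tau>)" using \<open>0 < y\<close> c34 by (simp add: powr_mult)
      also have "\<dots> \<le> (c4 * 4 powr \<tau> / c3) * h'' y"
        using B4[OF y] c34 unfolding h2 by (intro mult_left_mono) auto
      finally show ?thesis by (simp add: K_def)
    qed
    ultimately have "h' (4 * x) - K * h' x \<le> h' (4 * d1) - K * h' d1"
      by (intro DERIV_nonpos_imp_nonincreasing[OF x, of "\<lambda>x. h' (4 * x) - K * h' x"]) blast
    then show ?thesis by (simp add: A0_def)
  qed
  have R3: "t * \<bar>h' (l * t)\<bar> \<le> 2 * K * hr t + (\<bar>A0\<bar> + \<bar>h' d1\<bar>) * t" if t: "2 * d1 \<le> t" and l: "l \<in> {1/2..2}" for t l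
  proof -
    have t0: "0 < t" using t c34 by linarith
    have "l * t \<le> 2 * t" "1/2 * t \<le> l * t" using t0 l by (auto intro!: mult_right_mono)
    then have lt: "0 < l * t" "l * t \<le> 2 * t" "d1 \<le> l * t" using t t0 by linarith+
    have low: "h' d1 \<le> h' (l * t)" using mono_h' lt c34 by blast
    have "h' (l * t) \<le> h' (4 * (t / 2))" using mono_h'[OF lt(1)] lt by simp
    also have "\<dots> \<le> K * h' (t / 2) + A0" using t by (intro R3') simp
    finally have "t * h' (l * t) \<le> t * (K * h' (t / 2) + A0)" using t0 by (intro mult_left_mono) auto
    also have "\<dots> = 2 * K * (h' (t / 2) * (t - t / 2)) + A0 * t" by (simp add: algebra_simps)
    also have "\<dots> \<le> 2 * K * hr t + A0 * t"
    proof -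
      have "h' (t / 2) * (t - t / 2) \<le> hr t"
        using tangent_hr[of "t / 2" t] t0 hr_nonneg[of "t / 2"] by linarith
      then show ?thesis using K by simp
    qed
    also have "\<dots> \<le> 2 * K * hr t + (\<bar>A0\<bar> + \<bar>h' d1\<bar>) * t"
      using t0 by (intro add_left_mono mult_right_mono) auto
    finally have up: "t * h' (l * t) \<le> 2 * K * hr t + (\<bar>A0\<bar> + \<bar>h' d1\<bar>) * t" .
    have "t * (- h' (l * t)) \<le> t * \<bar>h' d1\<bar>" using t0 low by (intro mult_left_mono) auto
    also have "\<dots> \<le> 2 * K * hr t + (\<bar>A0\<bar> + \<bar>h' d1\<bar>) * t"
      using t0 K hr_nonneg[of t] by (simp add: algebra_simps)
    finally have "t * (- h' (l * t)) \<le> 2 * K * hr t + (\<bar>A0\<bar> + \<bar>h' d1\<bar>) * t" .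
    with up show ?thesis by (cases "h' (l * t) \<ge> 0") (auto simp: abs_if)
  qed
  have C10: "0 \<le> C1" using s by (simp add: C1_def)
  define C where "C = C1 + C2 + 2 * K + \<bar>A0\<bar> + \<bar>h' d1\<bar>"
  have "t * \<bar>h' (l * t)\<bar> \<le> C * (1 + t + hr t)" if t: "0 < t" and l: "l \<in> {1/2..2}" for t l
  proof -
    have mono: "c * x \<le> C * (1 + t + hr t)" if "0 \<le> c" "c \<le> C" "0 \<le> x" "x \<le> 1 + t + hr t" for c x
      using that by (intro mult_mono) auto
    consider "t < \<delta> / 2" | "2 * d1 \<le> t" | "\<delta> / 2 \<le> t" "t \<le> 2 * d1" by linarith
    then show ?thesis
    proof cases
      case 1
      have "C1 * hr t \<le> C * (1 + t + hr t)"
        using C10 C2 K t hr_nonneg[of t] by (intro mono) (auto simp: C_def)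
      with R1[OF t 1 l] show ?thesis by linarith
    next
      case 2
      have "2 * K * hr t + (\<bar>A0\<bar> + \<bar>h' d1\<bar>) * t \<le> (2 * K + (\<bar>A0\<bar> + \<bar>h' d1\<bar>)) * (1 + t + hr t)"
      proof -
        have "2 * K * hr t \<le> 2 * K * (1 + t + hr t)" using K t by (intro mult_left_mono) auto
        moreover have "(\<bar>A0\<bar> + \<bar>h' d1\<bar>) * t \<le> (\<bar>A0\<bar> + \<bar>h' d1\<bar>) * (1 + t + hr t)"
          using t hr_nonneg[of t] by (intro mult_left_mono) auto
        ultimately show ?thesis by (simp only: distrib_right)
      qed
      also have "\<dots> \<le> C * (1 + t + hr t)"
        using C10 C2 K t hr_nonneg[of t] by (intro mono) (auto simp: C_def)
      finally show ?thesis using R3[OF 2 l] by linarith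
    next
      case 3
      have "1/2 * (\<delta> / 2) \<le> l * t"
        by (rule mult_mono) (use 3 l t s in auto)
      moreover have "l * t \<le> 2 * (2 * d1)"
        by (rule mult_mono) (use 3 l t s in auto)
      ultimately have "\<bar>h' (l * t)\<bar> \<le> C2" by (intro C2(2)) auto
      then have "t * \<bar>h' (l * t)\<bar> \<le> C2 * t" using t by (simp add: mult.commute)
      also have "\<dots> \<le> C * (1 + t + hr t)"
        using C10 C2 K t hr_nonneg[of t] by (intro mono) (auto simp: C_def)
      finally show ?thesis .
    qed
  qed
  moreover have "0 \<le> C" using C10 C2 K by (simp add: C_def)
  ultimately show ?thesis by blast
qed

text \<open>The tangent at l t, evaluated at t, bounds \<open>hr (l * t)\<close> by
  \<open>hr t\<close> plus |l - 1| t |h'(l t)|, and |l - 1| \<le> 1.\<close>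

lemma hr_growth: "\<exists>C\<ge>0. \<forall>t>0. \<forall>l\<in>{1/2..2}. hr (l * t) + \<bar>l * t * h' (l * t)\<bar> \<le> C * (1 + t + hr t)"
proof -
  obtain C where C: "0 \<le> C" "\<And>t l. 0 < t \<Longrightarrow> l \<in> {1/2..2} \<Longrightarrow> t * \<bar>h' (l * t)\<bar> \<le> C * (1 + t + hr t)"
    using h'_growth by blast
  have "hr (l * t) + \<bar>l * t * h' (l * t)\<bar> \<le> (3 * C + 1) * (1 + t + hr t)" if t: "0 < t" and l: "l \<in> {1/2..2}" for t l
  proof -
    have lt: "0 < l * t" using t l by (auto intro!: mult_pos_pos)
    have 1: "\<bar>l * t * h' (l * t)\<bar> \<le> 2 * (C * (1 + t + hr t))"
    proof -
      have "\<bar>l * t * h' (l * t)\<bar> = l * (t * \<bar>h' (l * t)\<bar>)" using l t by (simp add: abs_mult)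
      also have "\<dots> \<le> 2 * (C * (1 + t + hr t))"
        by (rule mult_mono) (use C(2)[OF t l] l t in auto)
      finally show ?thesis .
    qed
    have "hr (l * t) \<le> hr t + h' (l * t) * (l * t - t)"
      using tangent_hr[OF lt t] by (simp add: algebra_simps)
    also have "h' (l * t) * (l * t - t) = (l - 1) * (t * h' (l * t))" by (simp add: algebra_simps)
    also have "\<dots> \<le> \<bar>l - 1\<bar> * (t * \<bar>h' (l * t)\<bar>)"
      using t by (metis abs_ge_self abs_mult abs_of_pos)
    also have "\<dots> \<le> 1 * (C * (1 + t + hr t))"
      by (rule mult_mono) (use C(2)[OF t l] l t in auto)
    finally have "hr (l * t) \<le> hr t + C * (1 + t + hr t)" by simp
    moreover have "hr t \<le> 1 * (1 + t + hr t)" using t by simp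
    ultimately show ?thesis using 1 by (simp only: distrib_right)
  qed
  then show ?thesis using C(1) by (intro exI[of _ "3 * C + 1"]) auto
qed

end

section \<open>Tools from the calculus of variations\<close>

text \<open>A bound on the derivative that is uniform in the parameter dominates the difference
  quotients and also makes the competitors integrable, so minimality can be applied to them.
  Sequences tending to 0 from both sides give the two inequalities for the derivative of the
  integral.\<close>

lemma first_variation:
  fixes \<Phi> \<Phi>d :: "real \<Rightarrow> 'a \<Rightarrow> real"
  assumes e0: "e0 > 0" and [measurable]: "\<And>e. \<Phi> e \<in> borel_measurable M" "\<Phi>d 0 \<in> borel_measurable M"
    and der: "AE x in M. \<forall>e. \<bar>e\<bar> < e0 \<longrightarrow> ((\<lambda>e. \<Phi> e x) has_real_derivative \<Phi>d e x) (at e) \<and> \<bar>\<Phi>d e x\<bar> \<le> B x"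
    and B: "integrable M B" and \<Phi>0: "integrable M (\<Phi> 0)"
    and min: "\<And>e. \<bar>e\<bar> < e0 \<Longrightarrow> integrable M (\<Phi> e) \<Longrightarrow> (LINT x|M. \<Phi> 0 x) \<le> (LINT x|M. \<Phi> e x)"
  shows "integrable M (\<Phi>d 0)" "(LINT x|M. \<Phi>d 0 x) = 0"
proof -
  have [measurable]: "B \<in> borel_measurable M" using B by (rule borel_measurable_integrable)
  have lip: "AE x in M. \<bar>\<Phi> e x - \<Phi> 0 x\<bar> \<le> \<bar>e\<bar> * B x" if e: "\<bar>e\<bar> < e0" for e
    using der
  proof eventually_elim
    case (elim x)
    consider "e = 0" | "e > 0" | "e < 0" by linarith
    then show ?case
    proof cases
      case 2
      have "\<exists>z>0. z < e \<and> \<Phi> e x - \<Phi> 0 x = (e - 0) * \<Phi>d z x"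
        by (rule MVT2[OF 2]) (use elim e in auto)
      then obtain z where z: "0 < z" "z < e" "\<Phi> e x - \<Phi> 0 x = e * \<Phi>d z x" by auto
      then have "\<bar>\<Phi>d z x\<bar> \<le> B x" using elim e by auto
      then show ?thesis using z 2 by (simp add: abs_mult)
    next
      case 3
      have "\<exists>z>e. z < 0 \<and> \<Phi> 0 x - \<Phi> e x = (0 - e) * \<Phi>d z x"
        by (rule MVT2[OF 3]) (use elim e in auto)
      then obtain z where z: "e < z" "z < 0" "\<Phi> 0 x - \<Phi> e x = (- e) * \<Phi>d z x" by auto
      then have "\<bar>\<Phi>d z x\<bar> \<le> B x" using elim e by auto
      moreover have "\<bar>\<Phi> e x - \<Phi> 0 x\<bar> = \<bar>\<Phi> 0 x - \<Phi> e x\<bar>" by simp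
      ultimately show ?thesis using z(3) 3 by (simp add: abs_mult)
    qed simp
  qed
  have int: "integrable M (\<Phi> e)" if e: "\<bar>e\<bar> < e0" for e
  proof (rule Bochner_Integration.integrable_bound)
    show "integrable M (\<lambda>x. \<bar>\<Phi> 0 x\<bar> + \<bar>e\<bar> * B x)" using \<Phi>0 B by auto
    show "AE x in M. norm (\<Phi> e x) \<le> norm (\<bar>\<Phi> 0 x\<bar> + \<bar>e\<bar> * B x)"
      using lip[OF e] by eventually_elim auto
  qed measurable
  have Bd: "AE x in M. norm (\<Phi>d 0 x) \<le> norm (B x)"
    using der
  proof eventually_elim
    case (elim x)
    then have "\<bar>\<Phi>d 0 x\<bar> \<le> B x" using e0 by auto
    then show ?case by simp
  qed
  show "integrable M (\<Phi>d 0)"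
    by (rule Bochner_Integration.integrable_bound[OF B _ Bd]) measurable
  have conv: "(\<lambda>n. LINT x|M. (\<Phi> (t n) x - \<Phi> 0 x) / t n) \<longlonglongrightarrow> (LINT x|M. \<Phi>d 0 x)"
    if t: "\<And>n. \<bar>t n\<bar> < e0" "\<And>n. t n \<noteq> 0" "t \<longlonglongrightarrow> 0" for t :: "nat \<Rightarrow> real"
  proof (rule integral_dominated_convergence[OF _ _ B])
    show "AE x in M. (\<lambda>n. (\<Phi> (t n) x - \<Phi> 0 x) / t n) \<longlonglongrightarrow> \<Phi>d 0 x"
      using der
    proof eventually_elim
      case (elim x)
      then have "((\<lambda>e. \<Phi> e x) has_real_derivative \<Phi>d 0 x) (at 0)"
        using e0 by auto
      then have "((\<lambda>h. (\<Phi> h x - \<Phi> 0 x) / h) \<longlongrightarrow> \<Phi>d 0 x) (at 0)"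
        by (simp add: DERIV_def)
      moreover have "filterlim t (at 0) sequentially"
        using t by (auto simp: filterlim_at)
      ultimately show ?case by (rule filterlim_compose)
    qed
    show "AE x in M. norm ((\<Phi> (t n) x - \<Phi> 0 x) / t n) \<le> B x" for n
      using lip[OF t(1)[of n]] by eventually_elim (use t(2)[of n] in \<open>auto simp: field_simps\<close>)
  qed measurable
  have quot: "(LINT x|M. (\<Phi> e x - \<Phi> 0 x) / e) = ((LINT x|M. \<Phi> e x) - (LINT x|M. \<Phi> 0 x)) / e" if "\<bar>e\<bar> < e0" for e
    using int[OF that] \<Phi>0 by (simp add: Bochner_Integration.integral_diff)
  \<comment> \<open>With n + 2 in the denominator every term, also for n = 0, lies strictly between
    0 and \<open>e0\<close>.\<close>
  define t where "t n = e0 / real (n + 2)" for n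
  have t: "0 < t n" "t n < e0" for n
    using e0 by (auto simp: t_def divide_less_eq)
  have "(\<lambda>n. e0 * (1 / real (n + 2))) \<longlonglongrightarrow> e0 * 0"
    by (intro tendsto_mult tendsto_const LIMSEQ_ignore_initial_segment lim_1_over_n)
  then have t0: "t \<longlonglongrightarrow> 0" by (simp add: t_def[abs_def])
  have "0 \<le> (LINT x|M. \<Phi>d 0 x)"
  proof (rule LIMSEQ_le_const[OF conv[of t]])
    show "\<exists>N. \<forall>n\<ge>N. 0 \<le> (LINT x|M. (\<Phi> (t n) x - \<Phi> 0 x) / t n)"
    proof (intro exI allI impI)
      fix n :: nat
      have "\<bar>t n\<bar> < e0" using t[of n] by simp
      from quot[OF this] min[OF this int[OF this]] t(1)[of n]
      show "0 \<le> (LINT x|M. (\<Phi> (t n) x - \<Phi> 0 x) / t n)" by simp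
    qed
    show "\<bar>t n\<bar> < e0" for n using t[of n] by simp
    show "t n \<noteq> 0" for n using t(1)[of n] by simp
  qed (rule t0)
  moreover have "(LINT x|M. \<Phi>d 0 x) \<le> 0"
  proof (rule LIMSEQ_le_const2[OF conv[of "\<lambda>n. - t n"]])
    show "\<exists>N. \<forall>n\<ge>N. (LINT x|M. (\<Phi> (- t n) x - \<Phi> 0 x) / (- t n)) \<le> 0"
    proof (intro exI allI impI)
      fix n :: nat
      have "\<bar>- t n\<bar> < e0" using t[of n] by simp
      from quot[OF this] min[OF this int[OF this]] t(1)[of n]
      show "(LINT x|M. (\<Phi> (- t n) x - \<Phi> 0 x) / (- t n)) \<le> 0"
        by (simp add: divide_nonneg_neg divide_nonpos_pos)
    qed
    show "\<bar>- t n\<bar> < e0" for n using t[of n] by simp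
    show "- t n \<noteq> 0" for n using t(1)[of n] by simp
    show "(\<lambda>n. - t n) \<longlonglongrightarrow> 0" using tendsto_minus[OF t0] by simp
  qed
  ultimately show "(LINT x|M. \<Phi>d 0 x) = 0" by simp
qed

section \<open>The fundamental lemma and integration by parts on an interval\<close>

lemma interval_indicator_approx:
  fixes s t :: real
  obtains \<phi> :: "nat \<Rightarrow> real \<Rightarrow> real" where "\<And>k. continuous_on UNIV (\<phi> k)"
    "\<And>k x. 0 \<le> \<phi> k x \<and> \<phi> k x \<le> 1" "\<And>x. (\<lambda>k. \<phi> k x) \<longlonglongrightarrow> indicator {s<..<t} x"
proof -
  define \<phi> where "\<phi> k x = min 1 (real k * max 0 (min (x - s) (t - x)))" for k x
  show thesis
  proof (rule that[of \<phi>])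
    show "continuous_on UNIV (\<phi> k)" for k unfolding \<phi>_def by (intro continuous_intros)
    show "0 \<le> \<phi> k x \<and> \<phi> k x \<le> 1" for k x by (simp add: \<phi>_def)
    show "(\<lambda>k. \<phi> k x) \<longlonglongrightarrow> indicator {s<..<t} x" for x
    proof (cases "x \<in> {s<..<t}")
      case True
      then have y: "0 < min (x - s) (t - x)" by simp
      obtain n where n: "1 \<le> real n * min (x - s) (t - x)"
        using reals_Archimedean3[OF y] less_imp_le by blast
      have "\<phi> k x = 1" if "n \<le> k" for k
      proof -
        have "1 \<le> real k * min (x - s) (t - x)"
          using n that y by (meson mult_right_mono of_nat_le_iff order_trans less_imp_le)
        then show ?thesis
          unfolding \<phi>_def max_absorb2[OF less_imp_le[OF y]] by (rule min_absorb1)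
      qed
      then have "\<forall>\<^sub>F k in sequentially. \<phi> k x = 1" by (auto simp: eventually_sequentially)
      then show ?thesis using True by (simp add: tendsto_eventually)
    next
      case False
      then have "min (x - s) (t - x) \<le> 0" by (auto simp: min_le_iff_disj)
      then have "\<phi> k x = 0" for k by (simp add: \<phi>_def max_absorb1)
      then show ?thesis using False by simp
    qed
  qed
qed

text \<open>Test functions with mean 0 are the derivatives of variations that vanish at both ends.
  With c the mean of \<open>K\<close>, subtracting its mean from an arbitrary bounded continuous
  \<xi> shows that \<open>K - c\<close> integrates to 0 against it, and such functions approximate
  indicators of intervals.\<close>

lemma du_Bois_Reymond:
  fixes K :: "real \<Rightarrow> real"
  assumes ab: "a < b" and K: "set_integrable lborel {a<..<b} K"
    and test: "\<And>\<xi> B. continuous_on UNIV \<xi> \<Longrightarrow> (\<And>x. \<bar>\<xi> x\<bar> \<le> B) \<Longrightarrow> (LINT r:{a<..<b}|lborel. \<xi> r) = 0 \<Longrightarrow>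
      (LINT r:{a<..<b}|lborel. K r * \<xi> r) = 0"
  obtains c where "AE r in lborel. r \<in> {a<..<b} \<longrightarrow> K r = c"
proof -
  let ?I = "{a<..<b}"
  define c where "c = (LINT r:?I|lborel. K r) / (b - a)"
  have iI: "integrable lborel (\<lambda>r. indicator ?I r * m)" for m :: real
    using ab by (intro integrable_mult_left) (auto simp: integrable_indicator_iff)
  have one: "(LINT r|lborel. indicator ?I r) = b - a"
    using ab by simp
  have i\<xi>: "integrable lborel (\<lambda>r. indicator ?I r * \<xi> r)" "integrable lborel (\<lambda>r. indicator ?I r * (K r * \<xi> r))"
    if \<xi>: "continuous_on UNIV \<xi>" "\<And>x. \<bar>\<xi> x\<bar> \<le> B" for \<xi> B
  proof -
    have [measurable]: "\<xi> \<in> borel_measurable borel" using \<xi>(1) by (rule borel_measurable_continuous_onI)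
    show "integrable lborel (\<lambda>r. indicator ?I r * \<xi> r)"
      by (rule Bochner_Integration.integrable_bound[OF iI[of B]])
         (use \<xi>(2) in \<open>auto intro!: AE_I2 simp: abs_mult split: split_indicator intro: order_trans[OF _ abs_ge_self]\<close>)
    have Ki: "integrable lborel (\<lambda>r. indicator ?I r * K r)" using K by (simp add: set_integrable_def)
    have "integrable lborel (\<lambda>r. \<xi> r * (indicator ?I r * K r))"
    proof (rule Bochner_Integration.integrable_bound)
      show "integrable lborel (\<lambda>r. B * (indicator ?I r * K r))" using Ki by simp
      show "(\<lambda>r. \<xi> r * (indicator ?I r * K r)) \<in> borel_measurable lborel"
        using borel_measurable_integrable[OF Ki] by measurable
      show "AE r in lborel. norm (\<xi> r * (indicator ?I r * K r)) \<le> norm (B * (indicator ?I r * K r))"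
        using \<xi>(2) by (intro AE_I2) (auto simp: abs_mult intro!: mult_right_mono intro: order_trans[OF _ abs_ge_self])
    qed
    then show "integrable lborel (\<lambda>r. indicator ?I r * (K r * \<xi> r))" by (simp add: mult_ac)
  qed
  have zero: "(LINT r|lborel. indicator ?I r * ((K r - c) * \<xi> r)) = 0"
    if \<xi>: "continuous_on UNIV \<xi>" "\<And>x. \<bar>\<xi> x\<bar> \<le> B" for \<xi> B
  proof -
    define m where "m = (LINT r|lborel. indicator ?I r * \<xi> r) / (b - a)"
    have "(LINT r:?I|lborel. K r * (\<xi> r - m)) = 0"
    proof (rule test)
      show "continuous_on UNIV (\<lambda>r. \<xi> r - m)" by (intro continuous_intros \<xi>)
      show "\<bar>\<xi> x - m\<bar> \<le> B + \<bar>m\<bar>" for x using \<xi>(2)[of x] by linarith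
      have "(LINT r:?I|lborel. \<xi> r - m) = (LINT r|lborel. indicator ?I r * \<xi> r - indicator ?I r * m)"
        by (simp add: set_lebesgue_integral_def right_diff_distrib)
      also have "\<dots> = (LINT r|lborel. indicator ?I r * \<xi> r) - (LINT r|lborel. indicator ?I r * m)"
        by (rule Bochner_Integration.integral_diff[OF i\<xi>(1)[OF \<xi>] iI])
      also have "\<dots> = 0" using ab one by (simp add: m_def)
      finally show "(LINT r:?I|lborel. \<xi> r - m) = 0" .
    qed
    moreover have "(LINT r:?I|lborel. K r * (\<xi> r - m)) =
        (LINT r|lborel. indicator ?I r * (K r * \<xi> r) - m * (indicator ?I r * K r))"
      unfolding set_lebesgue_integral_def by (intro Bochner_Integration.integral_cong) (auto simp: algebra_simps)
    moreover have "\<dots> = (LINT r|lborel. indicator ?I r * (K r * \<xi> r)) - m * (LINT r:?I|lborel. K r)"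
      using i\<xi>(2)[OF \<xi>] K by (simp add: set_lebesgue_integral_def set_integrable_def)
    ultimately have 1: "(LINT r|lborel. indicator ?I r * (K r * \<xi> r)) = m * (LINT r:?I|lborel. K r)" by simp
    have "(LINT r|lborel. indicator ?I r * ((K r - c) * \<xi> r)) =
       (LINT r|lborel. indicator ?I r * (K r * \<xi> r) - c * (indicator ?I r * \<xi> r))"
      by (intro Bochner_Integration.integral_cong) (auto simp: algebra_simps)
    also have "\<dots> = (LINT r|lborel. indicator ?I r * (K r * \<xi> r)) - c * (LINT r|lborel. indicator ?I r * \<xi> r)"
      using i\<xi>[OF \<xi>] by simp
    also have "\<dots> = 0" unfolding 1 using ab by (simp add: m_def c_def)
    finally show ?thesis .
  qed
  have iKc: "integrable lborel (\<lambda>r. indicator ?I r * (K r - c))"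
    using K iI[of c] by (simp add: set_integrable_def right_diff_distrib)
  have "AE r in lborel. indicator ?I r * (K r - c) = 0"
  proof (rule AE_zero_of_box_integrals[OF iKc])
    fix s t :: real
    obtain \<phi> :: "nat \<Rightarrow> real \<Rightarrow> real" where \<phi>: "\<And>k. continuous_on UNIV (\<phi> k)"
      "\<And>k x. 0 \<le> \<phi> k x \<and> \<phi> k x \<le> 1" "\<And>x. (\<lambda>k. \<phi> k x) \<longlonglongrightarrow> indicator {s<..<t} x"
      by (rule interval_indicator_approx[of s t]) (rule that)
    have [measurable]: "\<phi> k \<in> borel_measurable borel" for k using \<phi>(1) by (rule borel_measurable_continuous_onI)
    have [measurable]: "(\<lambda>r. indicator ?I r * (K r - c)) \<in> borel_measurable borel"
      using borel_measurable_integrable[OF iKc] by simp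
    have "(\<lambda>k. LINT r|lborel. \<phi> k r * (indicator ?I r * (K r - c))) \<longlonglongrightarrow>
      (LINT r|lborel. indicator {s<..<t} r * (indicator ?I r * (K r - c)))"
    proof (rule integral_dominated_convergence[where w = "\<lambda>r. \<bar>indicator ?I r * (K r - c)\<bar>"])
      show "integrable lborel (\<lambda>r. \<bar>indicator ?I r * (K r - c)\<bar>)" using iKc by simp
      show "AE r in lborel. (\<lambda>k. \<phi> k r * (indicator ?I r * (K r - c))) \<longlonglongrightarrow> indicator {s<..<t} r * (indicator ?I r * (K r - c))"
        by (intro AE_I2 tendsto_intros \<phi>)
      show "AE r in lborel. norm (\<phi> k r * (indicator ?I r * (K r - c))) \<le> \<bar>indicator ?I r * (K r - c)\<bar>" for k
        using \<phi>(2) by (intro AE_I2) (auto simp: abs_mult intro!: mult_left_le_one_le)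
    qed measurable
    moreover have "(LINT r|lborel. \<phi> k r * (indicator ?I r * (K r - c))) = 0" for k
    proof -
      have "(LINT r|lborel. \<phi> k r * (indicator ?I r * (K r - c))) = (LINT r|lborel. indicator ?I r * ((K r - c) * \<phi> k r))"
        by (simp add: mult_ac)
      also have "\<dots> = 0" by (rule zero[where B = 1]) (use \<phi> in \<open>auto simp: abs_le_iff intro: order_trans[of _ 0]\<close>)
      finally show ?thesis .
    qed
    ultimately show "(LINT r:box s t|lborel. indicator ?I r * (K r - c)) = 0"
      by (simp add: set_lebesgue_integral_def LIMSEQ_const_iff)
  qed
  then have "AE r in lborel. r \<in> ?I \<longrightarrow> K r = c"
    by (auto elim!: eventually_mono)
  then show thesis by (rule that)
qed

text \<open>Integration by parts for a merely integrable \<open>M\<close>: both sides are integrals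
  of M(r) \<xi>(s) over the triangle a < s < r < b, taken in the two orders.\<close>

lemma integral_by_parts_primitive:
  fixes M \<xi> :: "real \<Rightarrow> real"
  assumes ab: "a < b" and M: "set_integrable lborel {a<..<b} M" and \<xi>: "continuous_on UNIV \<xi>" "\<And>x. \<bar>\<xi> x\<bar> \<le> B"
  shows "(LINT r:{a<..<b}|lborel. M r * (LINT s:{a<..<r}|lborel. \<xi> s)) =
    (LINT s:{a<..<b}|lborel. \<xi> s * ((LINT r:{a<..<b}|lborel. M r) - (LINT r:{a<..<s}|lborel. M r)))"
proof -
  let ?I = "{a<..<b}"
  define m where "m r = indicator ?I r * M r" for r
  have mi: "integrable lborel m" using M by (simp add: m_def[abs_def] set_integrable_def)
  have [measurable]: "m \<in> borel_measurable borel" using borel_measurable_integrable[OF mi] by simp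
  have [measurable]: "\<xi> \<in> borel_measurable borel" using \<xi>(1) by (rule borel_measurable_continuous_onI)
  have B0: "0 \<le> B" using \<xi>(2)[of 0] by linarith
  define f where "f r s = indicator {(x, y). a < y \<and> y < x} (r, s) * (m r * \<xi> s)" for r s :: real
  have [measurable]: "(\<lambda>p. f (fst p) (snd p)) \<in> borel_measurable (lborel \<Otimes>\<^sub>M lborel)"
    unfolding f_def by measurable
  have i\<xi>: "integrable lborel (\<lambda>s. indicator {a<..<r} s * \<xi> s)" for r
  proof (rule Bochner_Integration.integrable_bound)
    show "integrable lborel (\<lambda>s. indicator {a<..<r} s * B)"
      by (intro integrable_mult_left) (cases "a \<le> r"; auto simp: integrable_indicator_iff)
    show "AE s in lborel. norm (indicator {a<..<r} s * \<xi> s) \<le> norm (indicator {a<..<r} s * B)"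
      using \<xi>(2) by (intro AE_I2) (auto split: split_indicator intro: order_trans[OF _ abs_ge_self])
  qed measurable
  have f1: "f r s = m r * (indicator {a<..<r} s * \<xi> s)" for r s
    by (auto simp: f_def split: split_indicator)
  have int: "integrable (lborel \<Otimes>\<^sub>M lborel) (\<lambda>p. f (fst p) (snd p))"
  proof (rule lborel_pair.Fubini_integrable)
    show "AE x in lborel. integrable lborel (\<lambda>y. f (fst (x, y)) (snd (x, y)))"
      using i\<xi> by (intro AE_I2) (simp add: f1)
    show "integrable lborel (\<lambda>x. LINT y|lborel. norm (f (fst (x, y)) (snd (x, y))))"
    proof (rule Bochner_Integration.integrable_bound)
      show "integrable lborel (\<lambda>r. (b - a) * B * m r)" using mi by simp
      show "AE r in lborel. norm (LINT y|lborel. norm (f (fst (r, y)) (snd (r, y)))) \<le> norm ((b - a) * B * m r)"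
      proof (rule AE_I2)
        fix r
        have "(LINT y|lborel. norm (f r y)) \<le> (LINT y|lborel. \<bar>m r\<bar> * (B * indicator ?I y))"
        proof (rule integral_mono)
          show "integrable lborel (\<lambda>y. norm (f r y))" using i\<xi> by (simp add: f1)
          show "integrable lborel (\<lambda>y. \<bar>m r\<bar> * (B * indicator ?I y))"
            using ab by (intro integrable_mult_right) (auto simp: integrable_indicator_iff)
          show "norm (f r y) \<le> \<bar>m r\<bar> * (B * indicator ?I y)" for y
          proof (cases "a < y \<and> y < r \<and> r < b")
            case True
            then show ?thesis using \<xi>(2)[of y] by (auto simp: f1 abs_mult intro!: mult_left_mono)
          next
            case False
            then have "f r y = 0" by (auto simp: f1 m_def split: split_indicator)
            then show ?thesis using B0 by simp
          qed
        qed
        also have "\<dots> = \<bar>m r\<bar> * (B * (b - a))" using ab by simp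
        finally show "norm (LINT y|lborel. norm (f (fst (r, y)) (snd (r, y)))) \<le> norm ((b - a) * B * m r)"
          using B0 ab by (simp add: abs_mult mult_ac integral_nonneg_AE)
      qed
    qed measurable
  qed measurable
  have "(LINT r:?I|lborel. M r * (LINT s:{a<..<r}|lborel. \<xi> s)) = (LINT r|lborel. (LINT s|lborel. f r s))"
  proof -
    have "(LINT s|lborel. f r s) = m r * (LINT s:{a<..<r}|lborel. \<xi> s)" for r
      by (simp add: f1 set_lebesgue_integral_def)
    then show ?thesis
      by (simp add: set_lebesgue_integral_def[of lborel ?I] m_def mult.assoc)
  qed
  also have "\<dots> = (LINT s|lborel. (LINT r|lborel. f r s))"
    using lborel_pair.Fubini_integral[of f] int by (simp add: split_def)
  also have "\<dots> = (LINT s:?I|lborel. \<xi> s * ((LINT r:?I|lborel. M r) - (LINT r:{a<..<s}|lborel. M r)))"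
    unfolding set_lebesgue_integral_def[of lborel ?I "\<lambda>s. \<xi> s * _ s"]
  proof (rule integral_cong_AE)
    have "(LINT r|lborel. f r s) = indicator ?I s * (\<xi> s * ((LINT r:?I|lborel. M r) - (LINT r:{a<..<s}|lborel. M r)))" for s
    proof (cases "s \<in> ?I")
      case True
      have "AE r in lborel. f r s = \<xi> s * (m r - indicator {a<..<s} r * m r)"
        using AE_lborel_singleton[of s] by eventually_elim (use True in \<open>auto simp: f1 m_def split: split_indicator\<close>)
      then have "(LINT r|lborel. f r s) = (LINT r|lborel. \<xi> s * (m r - indicator {a<..<s} r * m r))"
        by (intro integral_cong_AE) (auto simp: f_def)
      also have "\<dots> = \<xi> s * ((LINT r|lborel. m r) - (LINT r|lborel. indicator {a<..<s} r * m r))"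
        using mi integrable_real_mult_indicator[OF _ mi, of "{a<..<s}"] by (simp add: mult.commute)
      also have "(LINT r|lborel. indicator {a<..<s} r * m r) = (LINT r:{a<..<s}|lborel. M r)"
        unfolding set_lebesgue_integral_def using True
        by (intro Bochner_Integration.integral_cong) (auto simp: m_def split: split_indicator)
      finally show ?thesis using True by (simp add: m_def set_lebesgue_integral_def)
    next
      case False
      then have "f r s = 0" for r by (auto simp: f1 m_def split: split_indicator)
      then show ?thesis using False by simp
    qed
    then show "AE s in lborel. (LINT r|lborel. f r s) = indicator ?I s *\<^sub>R (\<xi> s * ((LINT r:?I|lborel. M r) - (LINT r:{a<..<s}|lborel. M r)))"
      by simp
    show "(\<lambda>s. LINT r|lborel. f r s) \<in> borel_measurable lborel"
      unfolding f_def by measurable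
    then show "(\<lambda>s. indicator ?I s *\<^sub>R (\<xi> s * ((LINT r:?I|lborel. M r) - (LINT r:{a<..<s}|lborel. M r)))) \<in> borel_measurable lborel"
      using \<open>\<And>s. (LINT r|lborel. f r s) = indicator ?I s * (\<xi> s * ((LINT r:?I|lborel. M r) - (LINT r:{a<..<s}|lborel. M r)))\<close>
      by simp
  qed
  finally show ?thesis .
qed

section \<open>Changes of variable on the line\<close>

lemma nn_integral_substitution_ennreal:
  fixes F :: "real \<Rightarrow> ennreal"
  assumes [measurable]: "F \<in> borel_measurable borel" and ab: "a \<le> b"
    and k: "\<And>x. (k has_real_derivative k' x) (at x)" "continuous_on UNIV k'" "\<And>x. 0 \<le> k' x"
  shows "(\<integral>\<^sup>+x\<in>{k a..k b}. F x \<partial>lborel) = (\<integral>\<^sup>+x\<in>{a..b}. F (k x) * ennreal (k' x) \<partial>lborel)"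
proof -
  have [measurable]: "k \<in> borel_measurable borel"
    using k(1) by (intro borel_measurable_continuous_onI continuous_at_imp_continuous_on) (auto intro: DERIV_isCont)
  have [measurable]: "k' \<in> borel_measurable borel" using k(2) by (rule borel_measurable_continuous_onI)
  define M where "M = density lborel (indicator {k a..k b} :: real \<Rightarrow> ennreal)"
  define N where "N = distr (density lborel (\<lambda>x. ennreal (k' x) * indicator {a..b} x)) borel k"
  \<comment> \<open>Substitution for real indicators identifies two measures; integrals of all
    functions with values in [0,\<infinity>] follow from that.\<close>
  have "M = N"
  proof (rule measure_eqI)
    show "sets M = sets N" by (simp add: M_def N_def)
    fix A assume "A \<in> sets M"
    then have [measurable]: "A \<in> sets borel" by (simp add: M_def)
    have "emeasure M A = (\<integral>\<^sup>+x. ennreal (indicator A x * indicator {k a..k b} x) \<partial>lborel)"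
      unfolding M_def by (subst emeasure_density) (auto intro!: nn_integral_cong split: split_indicator)
    also have "\<dots> = (\<integral>\<^sup>+x. ennreal (indicator A (k x) * k' x * indicator {a..b} x) \<partial>lborel)"
    proof (rule nn_integral_substitution)
      show "set_borel_measurable borel {k a..k b} (indicator A :: real \<Rightarrow> real)"
        unfolding set_borel_measurable_def by measurable
    qed (use k ab in \<open>auto intro: continuous_on_subset\<close>)
    also have "\<dots> = emeasure N A"
    proof -
      have [measurable]: "k -` A \<in> sets borel"
        by (rule measurable_sets_borel[of k borel]) auto
      show ?thesis
        unfolding N_def by (subst emeasure_distr, simp_all, subst emeasure_density)
          (auto intro!: nn_integral_cong split: split_indicator)
    qed
    finally show "emeasure M A = emeasure N A" .
  qed
  have "(\<integral>\<^sup>+x\<in>{k a..k b}. F x \<partial>lborel) = (\<integral>\<^sup>+x. F x \<partial>M)"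
    unfolding M_def by (subst nn_integral_density) (auto simp: mult.commute)
  also have "\<dots> = (\<integral>\<^sup>+x\<in>{a..b}. F (k x) * ennreal (k' x) \<partial>lborel)"
    unfolding \<open>M = N\<close> N_def
    by (subst nn_integral_distr, simp_all, subst nn_integral_density) (auto simp: mult_ac)
  finally show ?thesis .
qed

lemma C1_inverse:
  fixes k :: "real \<Rightarrow> real"
  assumes k: "\<And>x. (k has_real_derivative k' x) (at x)" "continuous_on UNIV k'" and c: "c > 0" "\<And>x. c \<le> k' x"
  obtains p where "\<And>x. p (k x) = x" "\<And>y. k (p y) = y" "\<And>y. (p has_real_derivative 1 / k' (p y)) (at y)" "continuous_on UNIV p"
proof -
  have inc: "c * (y - x) \<le> k y - k x" if "x \<le> y" for x y
  proof (cases "x = y")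
    case False
    then have "x < y" using that by simp
    from MVT2[OF this, of k k'] k(1) obtain z where "k y - k x = (y - x) * k' z" by blast
    then show ?thesis using c(2)[of z] \<open>x < y\<close> by (simp add: mult.commute mult_left_mono)
  qed simp
  have kc: "isCont k x" for x using k(1) by (rule DERIV_isCont)
  have inj: "inj k"
  proof (rule injI)
    fix x y assume "k x = k y"
    then show "x = y" using inc[of x y] inc[of y x] c(1)
      by (cases x y rule: linorder_cases) (auto simp: mult_le_0_iff)
  qed
  have surj: "\<exists>x. k x = y" for y
  proof -
    \<comment> \<open>Growth at rate at least c makes k(-R) \<le> y \<le> k(R), so the intermediate
      value theorem finds a preimage of any y. A global inverse keeps the ends of [a,b] from playing
      a special role.\<close>
    define R where "R = \<bar>y - k 0\<bar> / c"
    have R: "0 \<le> R" "c * R = \<bar>y - k 0\<bar>" using c(1) by (auto simp: R_def)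
    have "k (- R) \<le> y" "y \<le> k R" using inc[of "- R" 0] inc[of 0 R] R by auto
    then have "\<exists>x\<ge>- R. x \<le> R \<and> k x = y" using R kc by (intro IVT) auto
    then show ?thesis by blast
  qed
  define p where "p = inv k"
  have pk: "p (k x) = x" for x using inj by (simp add: p_def)
  have kp: "k (p y) = y" for y using surj[of y] by (auto simp: p_def intro: f_inv_into_f)
  have pc: "isCont p y" for y
    using isCont_inverse_function[of 1 "p y" p k] pk kc kp by simp
  have "(p has_real_derivative inverse (k' (p y))) (at y)" for y
    by (rule DERIV_inverse_function[where f = k and a = "y - 1" and b = "y + 1"])
       (use k(1) c[of] kp pc in \<open>auto simp: less_le_trans[THEN less_imp_neq, symmetric, OF c(1) c(2)] intro: less_imp_neq[symmetric, OF less_le_trans[OF c(1) c(2)]]\<close>)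
  then show thesis
    using pk kp pc by (intro that[of p]) (auto simp: inverse_eq_divide intro: continuous_at_imp_continuous_on)
qed

section \<open>Minimal curves\<close>

lemma has_vector_derivative_cis_compose:
  assumes "(\<eta> has_real_derivative x) (at r)"
  shows "((\<lambda>r. cis (\<eta> r)) has_vector_derivative (\<i> * of_real x * cis (\<eta> r))) (at r)"
proof -
  have "((\<lambda>z. exp (\<i> * z)) has_field_derivative \<i> * exp (\<i> * of_real (\<eta> r))) (at (of_real (\<eta> r)))"
    by (auto intro!: derivative_eq_intros)
  from has_vector_derivative_real_field[OF this, of UNIV]
  have "((\<lambda>t. cis t) has_vector_derivative \<i> * cis (\<eta> r)) (at (\<eta> r))"
    by (simp add: cis_conv_exp)
  from vector_diff_chain_at[OF assms[unfolded has_real_derivative_iff_has_vector_derivative] this]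
  show ?thesis by (simp add: o_def scaleR_conv_of_real mult_ac)
qed

text \<open>The approximating C1 curves are rotated along with \<open>w\<close>; the error of their
  derivatives is at most |D n - g| + B |W n - w|, both parts of which tend to 0.\<close>

lemma sobolev_curve_rotate:
  assumes w: "sobolev_curve a b w g" and \<eta>: "\<And>r. (\<eta> has_real_derivative \<xi> r) (at r)"
    and \<xi>: "continuous_on UNIV \<xi>" "\<And>r. \<bar>\<xi> r\<bar> \<le> B"
  shows "sobolev_curve a b (\<lambda>r. cis (\<eta> r) * w r) (\<lambda>r. cis (\<eta> r) * (g r + \<i> * of_real (\<xi> r) * w r))"
proof -
  obtain W D where W: "\<And>n r. (W n has_vector_derivative D n r) (at r)" and D: "\<And>n::nat. continuous_on UNIV (D n)"
    and unif: "uniform_limit {a..b} W w sequentially"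
    and lim: "(\<lambda>n. \<integral>\<^sup>+r\<in>{a..b}. ennreal ((norm (D n r - g r))\<^sup>2) \<partial>lborel) \<longlonglongrightarrow> 0"
    by (rule sobolev_curveE[OF w]) (rule that)
  have g[measurable]: "g \<in> borel_measurable borel" and wc: "continuous_on UNIV w"
    using w by (simp_all add: sobolev_curve_def)
  have Wc: "continuous_on UNIV (W n)" for n
    using has_vector_derivative_continuous[OF W] by (intro continuous_at_imp_continuous_on ballI)
  have \<eta>c: "continuous_on UNIV \<eta>"
    using \<eta> by (intro continuous_at_imp_continuous_on) (auto intro: DERIV_isCont)
  have [measurable]: "w \<in> borel_measurable borel" "\<xi> \<in> borel_measurable borel" "\<eta> \<in> borel_measurable borel"
     "W n \<in> borel_measurable borel" "D n \<in> borel_measurable borel" for n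
    using wc \<xi>(1) \<eta>c Wc D by (auto intro: borel_measurable_continuous_onI)
  have B0: "0 \<le> B" using \<xi>(2)[of 0] by linarith
  let ?W = "\<lambda>n r. cis (\<eta> r) * W n r" and ?D = "\<lambda>n r. cis (\<eta> r) * (D n r + \<i> * of_real (\<xi> r) * W n r)"
  have 1: "(?W n has_vector_derivative ?D n r) (at r)" for n r
    using has_vector_derivative_mult[OF has_vector_derivative_cis_compose[OF \<eta>[of r]] W[of n r]]
    by (simp add: algebra_simps)
  have 2: "continuous_on UNIV (?D n)" for n
    by (intro continuous_intros D Wc \<xi>(1) \<eta>c)
  have 3: "uniform_limit {a..b} ?W (\<lambda>r. cis (\<eta> r) * w r) sequentially"
  proof (rule uniform_limitI)
    fix e :: real assume "e > 0"
    then show "\<forall>\<^sub>F n in sequentially. \<forall>r\<in>{a..b}. dist (?W n r) (cis (\<eta> r) * w r) < e"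
      using unif by (auto simp: uniform_limit_iff dist_norm norm_mult simp flip: right_diff_distrib)
  qed
  have 4: "(\<lambda>n. \<integral>\<^sup>+r\<in>{a..b}. ennreal ((norm (?D n r - cis (\<eta> r) * (g r + \<i> * of_real (\<xi> r) * w r)))\<^sup>2) \<partial>lborel) \<longlonglongrightarrow> 0"
  proof (rule tendsto_sandwich[OF _ _ tendsto_const])
    let ?M = "restrict_space lborel {a..b}"
    let ?R = "\<lambda>n. 2 * (\<integral>\<^sup>+r\<in>{a..b}. ennreal ((norm (D n r - g r))\<^sup>2) \<partial>lborel) +
       ennreal (2 * B\<^sup>2) * (\<integral>\<^sup>+r. ennreal ((norm (W n r - w r))\<^sup>2) \<partial>?M)"
    have "(\<lambda>n. \<integral>\<^sup>+r. ennreal ((norm (W n r - w r))\<^sup>2) \<partial>?M) \<longlonglongrightarrow> 0"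
    proof (rule tendsto_nn_integral_uniform_0)
      fix e :: real assume e: "e > 0"
      have "\<forall>\<^sub>F n in sequentially. \<forall>r\<in>{a..b}. dist (W n r) (w r) < sqrt e"
        using unif e by (auto simp: uniform_limit_iff)
      then show "\<forall>\<^sub>F n in sequentially. \<forall>r\<in>space ?M. (norm (W n r - w r))\<^sup>2 \<le> e"
      proof eventually_elim
        case (elim n)
        show ?case
        proof
          fix r assume "r \<in> space ?M"
          then have "norm (W n r - w r) \<le> sqrt e"
            using elim by (auto simp: space_restrict_space dist_norm less_imp_le)
          then have "(norm (W n r - w r))\<^sup>2 \<le> (sqrt e)\<^sup>2" by (intro power_mono) auto
          then show "(norm (W n r - w r))\<^sup>2 \<le> e" using e by simp
        qed
      qed
    qed (cases "a \<le> b"; simp add: emeasure_restrict_space space_restrict_space emeasure_lborel_Icc_eq)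
    then have "?R \<longlonglongrightarrow> 2 * 0 + ennreal (2 * B\<^sup>2) * 0"
      by (intro tendsto_add tendsto_mult_ennreal tendsto_const lim) auto
    then show "?R \<longlonglongrightarrow> 0" by simp
    show "\<forall>\<^sub>F n in sequentially. (\<integral>\<^sup>+r\<in>{a..b}. ennreal ((norm (?D n r - cis (\<eta> r) * (g r + \<i> * of_real (\<xi> r) * w r)))\<^sup>2) \<partial>lborel) \<le> ?R n"
    proof (rule always_eventually, rule allI)
      fix n
      have "(\<integral>\<^sup>+r\<in>{a..b}. ennreal ((norm (?D n r - cis (\<eta> r) * (g r + \<i> * of_real (\<xi> r) * w r)))\<^sup>2) \<partial>lborel) \<le>
        (\<integral>\<^sup>+r. 2 * (ennreal ((norm (D n r - g r))\<^sup>2) * indicator {a..b} r) + ennreal (2 * B\<^sup>2) * (ennreal ((norm (W n r - w r))\<^sup>2) * indicator {a..b} r) \<partial>lborel)"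
      proof (rule nn_integral_mono)
        fix r
        have "?D n r - cis (\<eta> r) * (g r + \<i> * of_real (\<xi> r) * w r) = cis (\<eta> r) * ((D n r - g r) + \<i> * of_real (\<xi> r) * (W n r - w r))"
          by (simp add: algebra_simps)
        then have "norm (?D n r - cis (\<eta> r) * (g r + \<i> * of_real (\<xi> r) * w r)) \<le> norm (D n r - g r) + B * norm (W n r - w r)"
          using norm_triangle_ineq[of "D n r - g r" "\<i> * of_real (\<xi> r) * (W n r - w r)"] mult_right_mono[OF \<xi>(2)[of r] norm_ge_zero[of "W n r - w r"]]
          by (simp add: norm_mult)
        then have "(norm (?D n r - cis (\<eta> r) * (g r + \<i> * of_real (\<xi> r) * w r)))\<^sup>2 \<le> (norm (D n r - g r) + B * norm (W n r - w r))\<^sup>2"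
          by (intro power_mono) auto
        also have "\<dots> \<le> 2 * (norm (D n r - g r))\<^sup>2 + 2 * B\<^sup>2 * (norm (W n r - w r))\<^sup>2"
          using sum_squares_bound[of "norm (D n r - g r)" "B * norm (W n r - w r)"] by (simp add: power2_sum power_mult_distrib)
        finally have "ennreal ((norm (?D n r - cis (\<eta> r) * (g r + \<i> * of_real (\<xi> r) * w r)))\<^sup>2) \<le>
           ennreal (2 * (norm (D n r - g r))\<^sup>2 + 2 * B\<^sup>2 * (norm (W n r - w r))\<^sup>2)"
          by (rule ennreal_leI)
        also have "\<dots> = 2 * ennreal ((norm (D n r - g r))\<^sup>2) + ennreal (2 * B\<^sup>2) * ennreal ((norm (W n r - w r))\<^sup>2)"
          by (subst ennreal_plus) (auto simp: ennreal_mult' ennreal_mult'')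
        finally show "ennreal ((norm (?D n r - cis (\<eta> r) * (g r + \<i> * of_real (\<xi> r) * w r)))\<^sup>2) * indicator {a..b} r \<le>
          2 * (ennreal ((norm (D n r - g r))\<^sup>2) * indicator {a..b} r) + ennreal (2 * B\<^sup>2) * (ennreal ((norm (W n r - w r))\<^sup>2) * indicator {a..b} r)"
          by (auto split: split_indicator)
      qed
      also have "\<dots> = ?R n"
        by (subst nn_integral_add) (auto simp: nn_integral_cmult nn_integral_restrict_space)
      finally show "(\<integral>\<^sup>+r\<in>{a..b}. ennreal ((norm (?D n r - cis (\<eta> r) * (g r + \<i> * of_real (\<xi> r) * w r)))\<^sup>2) \<partial>lborel) \<le> ?R n" .
    qed
  qed auto
  have 5: "continuous_on UNIV (\<lambda>r. cis (\<eta> r) * w r)" by (intro continuous_intros \<eta>c wc)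
  have 6: "(\<lambda>r. cis (\<eta> r) * (g r + \<i> * of_real (\<xi> r) * w r)) \<in> borel_measurable borel" by measurable
  show ?thesis
    unfolding sobolev_curve_def
  proof (rule conjI[OF 5 conjI[OF 6]], rule exI[of _ ?W], rule exI[of _ ?D], intro conjI allI)
    show "(?W n has_vector_derivative ?D n r) (at r)" for n r by (rule 1)
    show "continuous_on UNIV (?D n)" for n by (rule 2)
  qed (rule 3, rule 4)
qed

text \<open>The squared error contains the square of \<open>p'\<close>. One factor is bounded by
  \<open>B\<close>; the other is the density of the substitution that carries the integral back to
  the original parameter.\<close>

lemma sobolev_curve_reparametrize:
  assumes ab: "a \<le> b" and w: "sobolev_curve a b w g" and p: "\<And>r. (p has_real_derivative p' r) (at r)"
    and p': "continuous_on UNIV p'" "\<And>r. 0 \<le> p' r" "\<And>r. p' r \<le> B" and bc: "p a = a" "p b = b"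
  shows "sobolev_curve a b (\<lambda>r. w (p r)) (\<lambda>r. p' r *\<^sub>R g (p r))"
proof -
  obtain W D where W: "\<And>n r. (W n has_vector_derivative D n r) (at r)" and D: "\<And>n::nat. continuous_on UNIV (D n)"
    and unif: "uniform_limit {a..b} W w sequentially"
    and lim: "(\<lambda>n. \<integral>\<^sup>+r\<in>{a..b}. ennreal ((norm (D n r - g r))\<^sup>2) \<partial>lborel) \<longlonglongrightarrow> 0"
    by (rule sobolev_curveE[OF w]) (rule that)
  have g[measurable]: "g \<in> borel_measurable borel" and wc: "continuous_on UNIV w"
    using w by (simp_all add: sobolev_curve_def)
  have pc: "continuous_on UNIV p"
    using p by (intro continuous_at_imp_continuous_on) (auto intro: DERIV_isCont)
  have [measurable]: "p \<in> borel_measurable borel" "p' \<in> borel_measurable borel" "D n \<in> borel_measurable borel" for n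
    using pc p'(1) D by (auto intro: borel_measurable_continuous_onI)
  have B0: "0 \<le> B" using p'(2,3)[of 0] by linarith
  have mono: "p x \<le> p y" if "x \<le> y" for x y
    by (rule DERIV_nonneg_imp_nondecreasing[OF that]) (intro exI conjI, rule p, rule p'(2))
  have pab: "p r \<in> {a..b}" if "r \<in> {a..b}" for r
    using mono[of a r] mono[of r b] that bc by simp
  let ?W = "\<lambda>n r. W n (p r)" and ?D = "\<lambda>n r. p' r *\<^sub>R D n (p r)"
  have 1: "(?W n has_vector_derivative ?D n r) (at r)" for n r
    using vector_diff_chain_at[OF p[unfolded has_real_derivative_iff_has_vector_derivative] W] by (simp add: o_def)
  have 2: "continuous_on UNIV (?D n)" for n
    by (intro continuous_intros p' continuous_on_compose2[OF D pc]) auto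
  have 3: "uniform_limit {a..b} ?W (\<lambda>r. w (p r)) sequentially"
  proof (rule uniform_limitI)
    fix e :: real assume "e > 0"
    then have "\<forall>\<^sub>F n in sequentially. \<forall>r\<in>{a..b}. dist (W n r) (w r) < e"
      using unif by (auto simp: uniform_limit_iff)
    then show "\<forall>\<^sub>F n in sequentially. \<forall>r\<in>{a..b}. dist (?W n r) (w (p r)) < e"
      by eventually_elim (use pab in blast)
  qed
  have 4: "(\<lambda>n. \<integral>\<^sup>+r\<in>{a..b}. ennreal ((norm (?D n r - p' r *\<^sub>R g (p r)))\<^sup>2) \<partial>lborel) \<longlonglongrightarrow> 0"
  proof (rule tendsto_sandwich[OF _ _ tendsto_const])
    have "(\<lambda>n. ennreal B * (\<integral>\<^sup>+r\<in>{a..b}. ennreal ((norm (D n r - g r))\<^sup>2) \<partial>lborel)) \<longlonglongrightarrow> ennreal B * 0"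
      by (intro tendsto_mult_ennreal tendsto_const lim) auto
    then show "(\<lambda>n. ennreal B * (\<integral>\<^sup>+r\<in>{a..b}. ennreal ((norm (D n r - g r))\<^sup>2) \<partial>lborel)) \<longlonglongrightarrow> 0" by simp
    show "\<forall>\<^sub>F n in sequentially. (\<integral>\<^sup>+r\<in>{a..b}. ennreal ((norm (?D n r - p' r *\<^sub>R g (p r)))\<^sup>2) \<partial>lborel) \<le>
      ennreal B * (\<integral>\<^sup>+r\<in>{a..b}. ennreal ((norm (D n r - g r))\<^sup>2) \<partial>lborel)"
    proof (rule always_eventually, rule allI)
      fix n
      have "(\<integral>\<^sup>+r\<in>{a..b}. ennreal ((norm (?D n r - p' r *\<^sub>R g (p r)))\<^sup>2) \<partial>lborel) \<le>
        (\<integral>\<^sup>+r. ennreal B * (ennreal ((norm (D n (p r) - g (p r)))\<^sup>2) * ennreal (p' r) * indicator {a..b} r) \<partial>lborel)"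
      proof (rule nn_integral_mono)
        fix r
        have "(norm (?D n r - p' r *\<^sub>R g (p r)))\<^sup>2 = p' r * p' r * (norm (D n (p r) - g (p r)))\<^sup>2"
          by (simp add: power_mult_distrib power2_eq_square flip: scaleR_diff_right)
        also have "\<dots> \<le> B * p' r * (norm (D n (p r) - g (p r)))\<^sup>2"
          using p'(2,3)[of r] by (intro mult_right_mono) auto
        finally have "ennreal ((norm (?D n r - p' r *\<^sub>R g (p r)))\<^sup>2) \<le> ennreal (B * p' r * (norm (D n (p r) - g (p r)))\<^sup>2)"
          by (rule ennreal_leI)
        also have "\<dots> = ennreal B * (ennreal ((norm (D n (p r) - g (p r)))\<^sup>2) * ennreal (p' r))"
          using B0 p'(2)[of r] by (simp add: ennreal_mult mult_ac)
        finally show "ennreal ((norm (?D n r - p' r *\<^sub>R g (p r)))\<^sup>2) * indicator {a..b} r \<le>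
           ennreal B * (ennreal ((norm (D n (p r) - g (p r)))\<^sup>2) * ennreal (p' r) * indicator {a..b} r)"
          by (auto split: split_indicator)
      qed
      also have "\<dots> = ennreal B * (\<integral>\<^sup>+r\<in>{a..b}. ennreal ((norm (D n (p r) - g (p r)))\<^sup>2) * ennreal (p' r) \<partial>lborel)"
        by (rule nn_integral_cmult) measurable
      also have "(\<integral>\<^sup>+r\<in>{a..b}. ennreal ((norm (D n (p r) - g (p r)))\<^sup>2) * ennreal (p' r) \<partial>lborel) =
         (\<integral>\<^sup>+r\<in>{p a..p b}. ennreal ((norm (D n r - g r))\<^sup>2) \<partial>lborel)"
        using p p' ab by (intro nn_integral_substitution_ennreal[symmetric]) auto
      finally show "(\<integral>\<^sup>+r\<in>{a..b}. ennreal ((norm (?D n r - p' r *\<^sub>R g (p r)))\<^sup>2) \<partial>lborel) \<le>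
        ennreal B * (\<integral>\<^sup>+r\<in>{a..b}. ennreal ((norm (D n r - g r))\<^sup>2) \<partial>lborel)"
        unfolding bc .
    qed
  qed auto
  have 5: "continuous_on UNIV (\<lambda>r. w (p r))" by (rule continuous_on_compose2[OF wc pc]) auto
  have 6: "(\<lambda>r. p' r *\<^sub>R g (p r)) \<in> borel_measurable borel" by measurable
  show ?thesis
    unfolding sobolev_curve_def
  proof (rule conjI[OF 5 conjI[OF 6]], rule exI[of _ ?W], rule exI[of _ ?D], intro conjI allI)
    show "(?W n has_vector_derivative ?D n r) (at r)" for n r by (rule 1)
    show "continuous_on UNIV (?D n)" for n by (rule 2)
  qed (rule 3, rule 4)
qed

lemma set_integral_FTC_Ioo:
  fixes \<xi> :: "real \<Rightarrow> real"
  assumes "a \<le> r" "\<And>x. (\<eta> has_real_derivative \<xi> x) (at x)" "continuous_on UNIV \<xi>"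
  shows "(LINT s:{a<..<r}|lborel. \<xi> s) = \<eta> r - \<eta> a"
proof -
  have [measurable]: "\<xi> \<in> borel_measurable borel" using assms(3) by (rule borel_measurable_continuous_onI)
  have "(LINT s:{a<..<r}|lborel. \<xi> s) = (LINT s|lborel. indicator {a..r} s *\<^sub>R \<xi> s)"
    unfolding set_lebesgue_integral_def
  proof (rule integral_cong_AE)
    show "AE s in lborel. indicator {a<..<r} s *\<^sub>R \<xi> s = indicator {a..r} s *\<^sub>R \<xi> s"
      using AE_lborel_singleton[of a] AE_lborel_singleton[of r] by eventually_elim (auto split: split_indicator)
  qed measurable
  also have "\<dots> = \<eta> r - \<eta> a"
    using assms(1) assms(2)[unfolded has_real_derivative_iff_has_vector_derivative] continuous_on_subset[OF assms(3)]
    by (intro integral_FTC_Icc) (auto intro: has_vector_derivative_at_within)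
  finally show ?thesis .
qed

lemma linear_term_zero:
  fixes X Y :: real
  assumes e0: "e0 > 0" and le: "\<And>e. \<bar>e\<bar> < e0 \<Longrightarrow> 0 \<le> e * X + e\<^sup>2 * Y"
  shows "X = 0"
proof -
  have der: "((\<lambda>e. e * X + e\<^sup>2 * Y) has_real_derivative X) (at 0)"
    by (auto intro!: derivative_eq_intros)
  show ?thesis
    by (rule DERIV_local_min[OF der e0]) (use le in auto)
qed

text \<open>The minimization problem on the interval. Competitors are pairs of a curve and its weak
  derivative, and the sign condition almost everywhere is the determinant constraint of the plane
  problem.\<close>

locale radial_minimizer = stored_energy +
  fixes a b :: real and N :: int and w g :: "real \<Rightarrow> complex"
  assumes a_pos: "0 < a" and a_less_b: "a < b" and curve: "sobolev_curve a b w g"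
    and w_a: "w a = of_real a" and w_b: "w b = of_real b" and winding: "curve_winding a b w N"
    and finite_energy: "reduced_energy a b h w g < \<infinity>"
    and minimal: "\<And>v k. sobolev_curve a b v k \<Longrightarrow> v a = of_real a \<Longrightarrow> v b = of_real b \<Longrightarrow> curve_winding a b v N \<Longrightarrow>
      (AE r in lborel. r \<in> {a<..<b} \<longrightarrow> 0 \<le> Re (cnj (v r) * k r)) \<Longrightarrow> reduced_energy a b h w g \<le> reduced_energy a b h v k"
begin

abbreviation "I \<equiv> {a<..<b}"
abbreviation "M\<^sub>I \<equiv> restrict_space lborel I"
text \<open>With w = \<rho> e^(i\<psi>) one has cnj w g = \<rho> \<rho>' + i \<rho>^2 \<psi>'. Thus
  \<open>d\<close> is the determinant, and r times the imaginary part \<open>m\<close> is the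
  angular momentum r \<rho>^2 \<psi>'.\<close>

definition "q r = Re (cnj (w r) * g r)"
definition "m r = Im (cnj (w r) * g r)"
definition "d r = q r / r"

text \<open>Real valued through \<open>hr\<close>, which is 0 where \<open>h\<close> is infinite. It
  therefore represents the energy density only where the determinant is positive.\<close>

definition lagrangian :: "(real \<Rightarrow> complex) \<Rightarrow> (real \<Rightarrow> complex) \<Rightarrow> real \<Rightarrow> real" where
  "lagrangian v k r = r * (1 / 2 * ((norm (k r))\<^sup>2 + (norm (v r))\<^sup>2 / r\<^sup>2) + hr (Re (cnj (v r) * k r) / r))"

lemma w_cont: "continuous_on UNIV w" and g_meas [measurable]: "g \<in> borel_measurable borel"
  using curve by (simp_all add: sobolev_curve_def)

lemma w_meas [measurable]: "w \<in> borel_measurable borel"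
  using w_cont by (rule borel_measurable_continuous_onI)

lemma w_nz: "r \<in> {a..b} \<Longrightarrow> w r \<noteq> 0"
  using winding by (simp add: curve_winding_def)

lemma q_meas [measurable]: "q \<in> borel_measurable borel" and m_meas [measurable]: "m \<in> borel_measurable borel"
  and d_meas [measurable]: "d \<in> borel_measurable borel" and hr_meas [measurable]: "hr \<in> borel_measurable borel"
  unfolding q_def[abs_def] m_def[abs_def] d_def[abs_def] by measurable

lemma lagrangian_nonneg: "0 \<le> r \<Longrightarrow> 0 \<le> lagrangian v k r"
  by (simp add: lagrangian_def)

lemma reduced_energy_eq:
  assumes [measurable]: "v \<in> borel_measurable borel" "k \<in> borel_measurable borel"
    and pos: "AE r in lborel. r \<in> I \<longrightarrow> 0 < Re (cnj (v r) * k r)"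
  shows "reduced_energy a b h v k = (\<integral>\<^sup>+r\<in>I. ennreal (lagrangian v k r) \<partial>lborel)"
  unfolding reduced_energy_def
proof (rule nn_integral_cong_AE)
  show "AE r in lborel. ennreal r * (ennreal (1 / 2 * ((norm (k r))\<^sup>2 + (norm (v r))\<^sup>2 / r\<^sup>2)) + h (Re (cnj (v r) * k r) / r)) *
     indicator I r = ennreal (lagrangian v k r) * indicator I r"
    using pos
  proof eventually_elim
    case (elim r)
    show ?case
    proof (cases "r \<in> I")
      case True
      then have r: "0 < r" and "0 < Re (cnj (v r) * k r) / r" using elim a_pos by auto
      then have "h (Re (cnj (v r) * k r) / r) = ennreal (hr (Re (cnj (v r) * k r) / r))" by (intro h_eq)
      then have "ennreal (1 / 2 * ((norm (k r))\<^sup>2 + (norm (v r))\<^sup>2 / r\<^sup>2)) + h (Re (cnj (v r) * k r) / r) =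
         ennreal (1 / 2 * ((norm (k r))\<^sup>2 + (norm (v r))\<^sup>2 / r\<^sup>2)) + ennreal (hr (Re (cnj (v r) * k r) / r))"
        by (rule arg_cong)
      also have "\<dots> = ennreal (1 / 2 * ((norm (k r))\<^sup>2 + (norm (v r))\<^sup>2 / r\<^sup>2) + hr (Re (cnj (v r) * k r) / r))"
        by (rule ennreal_plus[symmetric]) auto
      finally have eq: "ennreal (1 / 2 * ((norm (k r))\<^sup>2 + (norm (v r))\<^sup>2 / r\<^sup>2)) + h (Re (cnj (v r) * k r) / r) =
         ennreal (1 / 2 * ((norm (k r))\<^sup>2 + (norm (v r))\<^sup>2 / r\<^sup>2) + hr (Re (cnj (v r) * k r) / r))" .
      show ?thesis
        unfolding eq lagrangian_def using r True by (simp only: ennreal_mult'[OF less_imp_le[OF r]])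
    qed simp
  qed
qed

text \<open>(H3) makes the integrand infinite where the determinant is not positive, and the energy
  is finite.\<close>

lemma q_pos: "AE r in lborel. r \<in> I \<longrightarrow> 0 < q r"
proof -
  have "AE r in lborel. ennreal r * (ennreal (1 / 2 * ((norm (g r))\<^sup>2 + (norm (w r))\<^sup>2 / r\<^sup>2)) + h (Re (cnj (w r) * g r) / r)) *
     indicator I r \<noteq> \<infinity>"
    using finite_energy unfolding reduced_energy_def by (intro nn_integral_PInf_AE) auto
  then show ?thesis
  proof eventually_elim
    case (elim r)
    show ?case
    proof (rule impI, rule ccontr)
      assume r: "r \<in> I" and "\<not> 0 < q r"
      then have "h (Re (cnj (w r) * g r) / r) = \<infinity>"
        using a_pos by (intro h_nonpos) (auto simp: q_def divide_nonpos_pos)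
      then show False using elim r a_pos by (simp add: ennreal_mult_top)
    qed
  qed
qed

lemma lagrangian_integral:
  "set_integrable lborel I (lagrangian w g)" "reduced_energy a b h w g = ennreal (LINT r:I|lborel. lagrangian w g r)"
proof -
  have [measurable]: "lagrangian w g \<in> borel_measurable borel"
    unfolding lagrangian_def[abs_def] by measurable
  have e: "reduced_energy a b h w g = (\<integral>\<^sup>+r\<in>I. ennreal (lagrangian w g r) \<partial>lborel)"
    using q_pos by (intro reduced_energy_eq) (auto simp: q_def)
  also have "\<dots> = (\<integral>\<^sup>+r. ennreal (indicator I r * lagrangian w g r) \<partial>lborel)"
    by (intro nn_integral_cong) (auto split: split_indicator)
  finally have e': "reduced_energy a b h w g = (\<integral>\<^sup>+r. ennreal (indicator I r * lagrangian w g r) \<partial>lborel)" .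
  have nn: "0 \<le> indicator I r * lagrangian w g r" for r
    using a_pos lagrangian_nonneg[of r w g] by (auto split: split_indicator)
  have i: "integrable lborel (\<lambda>r. indicator I r * lagrangian w g r)"
    using finite_energy nn unfolding e' by (intro integrableI_nonneg) auto
  then show "set_integrable lborel I (lagrangian w g)" by (simp add: set_integrable_def)
  show "reduced_energy a b h w g = ennreal (LINT r:I|lborel. lagrangian w g r)"
    unfolding e' using nn_integral_eq_integral[OF i] nn by (simp add: set_lebesgue_integral_def)
qed

lemma w_bounded: obtains Bw where "0 < Bw" "\<And>r. r \<in> {a..b} \<Longrightarrow> norm (w r) \<le> Bw"
proof -
  have "bounded (w ` {a..b})"
    by (intro compact_imp_bounded compact_continuous_image continuous_on_subset[OF w_cont]) auto
  then show thesis using that by (auto simp: bounded_pos)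
qed

lemma g2_integrable: "integrable M\<^sub>I (\<lambda>r. (norm (g r))\<^sup>2)"
proof -
  have "set_integrable lborel I (\<lambda>r. (norm (g r))\<^sup>2)"
    by (rule set_integrable_subset[OF sobolev_curve_integrable(1)[OF curve]]) auto
  then show ?thesis by (simp add: set_integrable_def integrable_restrict_space)
qed

lemma hr_d_integrable: "integrable M\<^sub>I (\<lambda>r. hr (d r))"
proof (rule Bochner_Integration.integrable_bound)
  show "integrable M\<^sub>I (\<lambda>r. 1 / a * lagrangian w g r)"
    using lagrangian_integral(1) by (simp add: set_integrable_def integrable_restrict_space)
  show "(\<lambda>r. hr (d r)) \<in> borel_measurable M\<^sub>I"
    by (intro measurable_restrict_space1) measurable
  show "AE r in M\<^sub>I. norm (hr (d r)) \<le> norm (1 / a * lagrangian w g r)"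
  proof (rule AE_I2)
    fix r assume "r \<in> space M\<^sub>I"
    then have r: "a < r" "0 < r" using a_pos by (auto simp: space_restrict_space)
    have "hr (d r) * a \<le> hr (d r) * r" using r by (intro mult_left_mono) auto
    also have "\<dots> \<le> lagrangian w g r"
      using r by (simp add: lagrangian_def d_def q_def distrib_left mult.commute)
    finally show "norm (hr (d r)) \<le> norm (1 / a * lagrangian w g r)"
      using a_pos lagrangian_nonneg[of r w g] r by (simp add: field_simps)
  qed
qed

lemma integrable_const_MI: "integrable M\<^sub>I (\<lambda>r. c :: real)"
proof -
  have "integrable lborel (\<lambda>r. indicator I r *\<^sub>R c)"
    using a_less_b by (intro integrable_scaleR_left) (auto simp: integrable_indicator_iff)
  then show ?thesis by (simp add: integrable_restrict_space)
qed

lemma norm_g_bound: "norm (g r) \<le> 1 + (norm (g r))\<^sup>2"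
  using sum_squares_bound[of "norm (g r)" 1] norm_ge_zero[of "g r"] unfolding power2_eq_square by linarith

lemma cnj_w_g_integrable: "integrable M\<^sub>I q" "integrable M\<^sub>I m" "integrable M\<^sub>I d"
proof -
  obtain Bw where Bw: "0 < Bw" "\<And>r. r \<in> {a..b} \<Longrightarrow> norm (w r) \<le> Bw" by (rule w_bounded) (rule that)
  have dom: "integrable M\<^sub>I (\<lambda>r. Bw * (1 + (norm (g r))\<^sup>2))"
    by (intro Bochner_Integration.integrable_mult_right Bochner_Integration.integrable_add integrable_const_MI g2_integrable)
  have le: "norm (cnj (w r) * g r) \<le> Bw * (1 + (norm (g r))\<^sup>2)" if "r \<in> I" for r
    using that Bw norm_g_bound[of r] by (auto simp: norm_mult intro!: mult_mono)
  have Iab: "r \<in> I" if "r \<in> space M\<^sub>I" for r using that by (simp add: space_restrict_space)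
  show q: "integrable M\<^sub>I q"
  proof (rule Bochner_Integration.integrable_bound[OF dom])
    show "AE r in M\<^sub>I. norm (q r) \<le> norm (Bw * (1 + (norm (g r))\<^sup>2))"
    proof (rule AE_I2)
      fix r assume "r \<in> space M\<^sub>I"
      have "norm (q r) \<le> norm (cnj (w r) * g r)" unfolding q_def real_norm_def by (rule abs_Re_le_cmod)
      also have "\<dots> \<le> Bw * (1 + (norm (g r))\<^sup>2)" by (rule le[OF Iab]) fact
      also have "\<dots> \<le> norm (Bw * (1 + (norm (g r))\<^sup>2))" by simp
      finally show "norm (q r) \<le> norm (Bw * (1 + (norm (g r))\<^sup>2))" .
    qed
  qed (intro measurable_restrict_space1, measurable)
  show "integrable M\<^sub>I m"
  proof (rule Bochner_Integration.integrable_bound[OF dom])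
    show "AE r in M\<^sub>I. norm (m r) \<le> norm (Bw * (1 + (norm (g r))\<^sup>2))"
    proof (rule AE_I2)
      fix r assume "r \<in> space M\<^sub>I"
      have "norm (m r) \<le> norm (cnj (w r) * g r)" unfolding m_def real_norm_def by (rule abs_Im_le_cmod)
      also have "\<dots> \<le> Bw * (1 + (norm (g r))\<^sup>2)" by (rule le[OF Iab]) fact
      also have "\<dots> \<le> norm (Bw * (1 + (norm (g r))\<^sup>2))" by simp
      finally show "norm (m r) \<le> norm (Bw * (1 + (norm (g r))\<^sup>2))" .
    qed
  qed (intro measurable_restrict_space1, measurable)
  have "integrable M\<^sub>I (\<lambda>r. 1 / a * q r)" using q by simp
  then show "integrable M\<^sub>I d"
  proof (rule Bochner_Integration.integrable_bound)
    show "AE r in M\<^sub>I. norm (d r) \<le> norm (1 / a * q r)"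
    proof (rule AE_I2)
      fix r assume "r \<in> space M\<^sub>I"
      then have "a \<le> r" by (simp add: space_restrict_space)
      then show "norm (d r) \<le> norm (1 / a * q r)"
        using a_pos by (auto simp: d_def abs_mult intro!: divide_left_mono)
    qed
  qed (intro measurable_restrict_space1, measurable)
qed

lemma set_integrable_MI: "set_integrable lborel I f \<longleftrightarrow> integrable M\<^sub>I f" for f :: "real \<Rightarrow> real"
  by (simp add: set_integrable_def integrable_restrict_space)

lemma set_integral_MI: "(LINT r:I|lborel. f r) = (LINT r|M\<^sub>I. f r)" for f :: "real \<Rightarrow> real"
  by (simp add: set_lebesgue_integral_def integral_restrict_space)

lemma AE_MI: "(AE r in M\<^sub>I. P r) \<longleftrightarrow> (AE r in lborel. r \<in> I \<longrightarrow> P r)"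
  by (simp add: AE_restrict_space_iff)

lemma integrable_bounded_mult:
  assumes f: "integrable M\<^sub>I f" and \<xi>: "\<xi> \<in> borel_measurable borel" "\<And>r. r \<in> I \<Longrightarrow> \<bar>\<xi> r\<bar> \<le> B"
  shows "integrable M\<^sub>I (\<lambda>r. \<xi> r * f r :: real)"
proof (rule Bochner_Integration.integrable_bound)
  show "integrable M\<^sub>I (\<lambda>r. B * f r)" using f by simp
  have [measurable]: "\<xi> \<in> borel_measurable M\<^sub>I" using \<xi>(1) by (simp add: measurable_restrict_space1)
  show "(\<lambda>r. \<xi> r * f r) \<in> borel_measurable M\<^sub>I"
    using borel_measurable_integrable[OF f] by measurable
  show "AE r in M\<^sub>I. norm (\<xi> r * f r) \<le> norm (B * f r)"
    using \<xi>(2) by (intro AE_I2) (auto simp: space_restrict_space abs_mult intro!: mult_right_mono order_trans[OF \<xi>(2) abs_ge_self])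
qed

text \<open>Rotating \<open>w\<close> by the angle e \<eta>(r), with \<eta> vanishing at both ends,
  leaves the determinant unchanged. The energy becomes a quadratic polynomial in e whose linear
  coefficient pairs \<eta>' with r \<open>m\<close>, so no growth condition on \<open>h\<close>
  enters this variation.\<close>

lemma angular_momentum_constant: obtains \<omega> where "AE r in lborel. r \<in> I \<longrightarrow> r * m r = \<omega>"
proof (rule du_Bois_Reymond[OF a_less_b, of "\<lambda>r. r * m r"])
  have rb: "\<bar>r\<bar> \<le> b" if "r \<in> I" for r using that a_pos by auto
  show rm: "set_integrable lborel I (\<lambda>r. r * m r)"
    unfolding set_integrable_MI by (rule integrable_bounded_mult[OF cnj_w_g_integrable(2) _ rb]) auto
  fix \<xi> :: "real \<Rightarrow> real" and B
  assume \<xi>: "continuous_on UNIV \<xi>" "\<And>x. \<bar>\<xi> x\<bar> \<le> B" "(LINT r:I|lborel. \<xi> r) = 0"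
  have [measurable]: "\<xi> \<in> borel_measurable borel" using \<xi>(1) by (rule borel_measurable_continuous_onI)
  obtain \<eta> where \<eta>': "\<And>x. (\<eta> has_vector_derivative \<xi> x) (at x)" and \<eta>a: "\<eta> a = 0"
    by (rule continuous_antiderivative[OF \<xi>(1), of a 0]) (rule that)
  then have \<eta>: "\<And>x. (\<eta> has_real_derivative \<xi> x) (at x)" by (simp add: has_real_derivative_iff_has_vector_derivative)
  have \<eta>b: "\<eta> b = 0"
    using set_integral_FTC_Ioo[OF less_imp_le[OF a_less_b] \<eta> \<xi>(1)] \<xi>(3) \<eta>a by simp
  have "bounded (\<eta> ` {a..b})"
    using \<eta> by (intro compact_imp_bounded compact_continuous_image) (auto intro!: DERIV_continuous_on intro: has_field_derivative_at_within)
  then obtain H where H: "0 < H" "\<And>r. r \<in> {a..b} \<Longrightarrow> \<bar>\<eta> r\<bar> \<le> H" by (auto simp: bounded_pos)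
  obtain Bw where Bw: "0 < Bw" "\<And>r. r \<in> {a..b} \<Longrightarrow> norm (w r) \<le> Bw" by (rule w_bounded) (rule that)
  \<comment> \<open>\<open>X\<close> and the integral \<open>Y\<close> of \<open>y\<close> are the
    coefficients of e and e^2 in the energy of the rotated curve.\<close>
  define X where "X = (LINT r|M\<^sub>I. \<xi> r * (r * m r))"
  define y where "y r = 1/2 * r * (\<xi> r)\<^sup>2 * (norm (w r))\<^sup>2" for r
  have [measurable]: "y \<in> borel_measurable borel" unfolding y_def[abs_def] by measurable
  define Y where "Y = (LINT r|M\<^sub>I. y r)"
  have iX: "integrable M\<^sub>I (\<lambda>r. \<xi> r * (r * m r))"
    by (rule integrable_bounded_mult[OF rm[unfolded set_integrable_MI] _ \<xi>(2)]) auto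
  have "integrable M\<^sub>I (\<lambda>r. y r * 1)"
  proof (rule integrable_bounded_mult[OF integrable_const_MI])
    fix r assume r: "r \<in> I"
    have "\<bar>\<xi> r\<bar>\<^sup>2 \<le> B\<^sup>2" by (intro power_mono \<xi>(2)) auto
    moreover have "(norm (w r))\<^sup>2 \<le> Bw\<^sup>2" using r by (intro power_mono Bw(2)) auto
    ultimately show "\<bar>y r\<bar> \<le> 1/2 * b * B\<^sup>2 * Bw\<^sup>2"
      unfolding y_def using r a_pos by (auto simp: abs_mult intro!: mult_mono)
  qed measurable
  then have iY: "integrable M\<^sub>I y" by simp
  have "X = 0"
  proof (rule linear_term_zero)
    \<comment> \<open>For |e| < 1/H one has |cis (e \<eta>) - 1| \<le> |e| H < 1, the distance that
      keeps the winding number.\<close>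
    show "0 < 1 / H" using H by simp
    fix e :: real assume e: "\<bar>e\<bar> < 1 / H"
    let ?v = "\<lambda>r. cis (e * \<eta> r) * w r" and ?k = "\<lambda>r. cis (e * \<eta> r) * (g r + \<i> * of_real (e * \<xi> r) * w r)"
    have v: "sobolev_curve a b ?v ?k"
    proof (rule sobolev_curve_rotate[OF curve])
      show "((\<lambda>r. e * \<eta> r) has_real_derivative e * \<xi> r) (at r)" for r by (intro DERIV_cmult \<eta>)
      show "continuous_on UNIV (\<lambda>r. e * \<xi> r)" by (intro continuous_intros \<xi>)
      show "\<bar>e * \<xi> r\<bar> \<le> \<bar>e\<bar> * B" for r using \<xi>(2) by (simp add: abs_mult mult_left_mono)
    qed
    have vc: "continuous_on UNIV ?v" and [measurable]: "?v \<in> borel_measurable borel" "?k \<in> borel_measurable borel"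
      using v by (auto simp: sobolev_curve_def intro: borel_measurable_continuous_onI)
    have "curve_winding a b ?v N"
    proof (rule curve_winding_nearby[OF a_less_b w_cont vc _ _ winding])
      fix r assume r: "r \<in> {a..b}"
      have "norm (sgn (?v r) - sgn (w r)) = norm (cis (e * \<eta> r) - 1) * norm (sgn (w r))"
        by (simp add: sgn_mult left_diff_distrib flip: norm_mult)
      also have "norm (cis (e * \<eta> r) - 1) = 2 * \<bar>sin (e * \<eta> r / 2)\<bar>"
        using dist_exp_i_1[of "e * \<eta> r"] by (simp add: cis_conv_exp)
      also have "norm (sgn (w r)) = 1" using w_nz[OF r] by (simp add: norm_sgn)
      also have "2 * \<bar>sin (e * \<eta> r / 2)\<bar> * 1 \<le> 2 * \<bar>e * \<eta> r / 2\<bar>"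
        using abs_sin_x_le_abs_x[of "e * \<eta> r / 2"] by simp
      also have "\<dots> = \<bar>e\<bar> * \<bar>\<eta> r\<bar>" by (simp add: abs_mult)
      also have "\<dots> \<le> \<bar>e\<bar> * H" using H(2)[OF r] by (intro mult_left_mono) auto
      also have "\<dots> < 1" using e H(1) by (simp add: field_simps)
      finally show "?v r \<noteq> 0 \<and> norm (sgn (?v r) - sgn (w r)) < 1" using w_nz[OF r] by simp
    qed (use \<eta>a \<eta>b in auto)
    \<comment> \<open>The rotation adds i e \<xi> |w|^2 to the product, which is purely
      imaginary.\<close>
    have qv: "Re (cnj (?v r) * ?k r) = q r" for r
    proof -
      have "cnj (?v r) * ?k r = (cnj (cis (e * \<eta> r)) * cis (e * \<eta> r)) * (cnj (w r) * g r + \<i> * of_real (e * \<xi> r) * (w r * cnj (w r)))"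
        by (simp add: algebra_simps)
      also have "cnj (cis (e * \<eta> r)) * cis (e * \<eta> r) = 1" by (simp add: cis_cnj cis_mult)
      finally show ?thesis by (simp add: q_def complex_mult_cnj)
    qed
    have nk: "(norm (?k r))\<^sup>2 = (norm (g r))\<^sup>2 + 2 * e * \<xi> r * m r + e\<^sup>2 * (\<xi> r)\<^sup>2 * (norm (w r))\<^sup>2" for r
      unfolding norm_mult norm_cis mult_1 cmod_power2 by (simp add: m_def power2_eq_square algebra_simps)
    have lag: "lagrangian ?v ?k r = lagrangian w g r + (e * (\<xi> r * (r * m r)) + e\<^sup>2 * y r)" for r
      unfolding lagrangian_def qv nk q_def[symmetric] y_def by (simp add: norm_mult algebra_simps)
    have iv: "integrable M\<^sub>I (lagrangian ?v ?k)" and Ev: "(LINT r|M\<^sub>I. lagrangian ?v ?k r) = (LINT r|M\<^sub>I. lagrangian w g r) + (e * X + e\<^sup>2 * Y)"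
      unfolding lag X_def Y_def using lagrangian_integral(1)[unfolded set_integrable_MI] iX iY by simp_all
    have nnv: "0 \<le> (LINT r|M\<^sub>I. lagrangian ?v ?k r)"
      using a_pos by (intro integral_nonneg_AE AE_I2 lagrangian_nonneg) (auto simp: space_restrict_space)
    have "reduced_energy a b h ?v ?k = (\<integral>\<^sup>+r\<in>I. ennreal (lagrangian ?v ?k r) \<partial>lborel)"
      by (rule reduced_energy_eq) (measurable, unfold qv, rule q_pos)
    also have "\<dots> = (\<integral>\<^sup>+r. ennreal (lagrangian ?v ?k r) \<partial>M\<^sub>I)"
      by (simp add: nn_integral_restrict_space)
    also have "\<dots> = ennreal (LINT r|M\<^sub>I. lagrangian ?v ?k r)"
      using a_pos by (intro nn_integral_eq_integral iv AE_I2 lagrangian_nonneg) (auto simp: space_restrict_space)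
    finally have "reduced_energy a b h ?v ?k = ennreal (LINT r|M\<^sub>I. lagrangian ?v ?k r)" .
    moreover have "reduced_energy a b h w g \<le> reduced_energy a b h ?v ?k"
    proof (rule minimal[OF v _ _ \<open>curve_winding a b ?v N\<close>])
      show "AE r in lborel. r \<in> I \<longrightarrow> 0 \<le> Re (cnj (?v r) * ?k r)"
        unfolding qv using q_pos by (auto elim!: eventually_mono)
    qed (use \<eta>a \<eta>b w_a w_b in auto)
    ultimately have "(LINT r|M\<^sub>I. lagrangian w g r) \<le> (LINT r|M\<^sub>I. lagrangian ?v ?k r)"
      using nnv unfolding lagrangian_integral(2) set_integral_MI by (simp add: ennreal_le_iff)
    then show "0 \<le> e * X + e\<^sup>2 * Y" using Ev by simp
  qed
  then show "(LINT r:I|lborel. r * m r * \<xi> r) = 0"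
    unfolding X_def set_integral_MI by (simp add: mult_ac)
qed (rule that)

end

section \<open>Inner variations\<close>

context radial_minimizer
begin

lemma integrable_bounded:
  assumes "\<xi> \<in> borel_measurable borel" "\<And>r. r \<in> I \<Longrightarrow> \<bar>\<xi> r\<bar> \<le> B"
  shows "integrable M\<^sub>I (\<xi> :: real \<Rightarrow> real)"
proof -
  have "integrable M\<^sub>I (\<lambda>r. \<xi> r * 1)"
    by (rule integrable_bounded_mult[OF integrable_const_MI assms])
  then show ?thesis by simp
qed

text \<open>The competitor is \<open>w\<close> composed with the inverse of \<open>k\<close>, and
  the substitution r = k(s) then undoes the composition inside \<open>w\<close> and
  \<open>g\<close>. Only explicit powers of \<open>k\<close> and \<open>k'\<close> remain, and the
  determinant becomes q / (k k'). The assumption on unit vectors keeps the winding number.\<close>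

lemma reparametrized_energy:
  assumes k: "\<And>x. (k has_real_derivative k' x) (at x)" "continuous_on UNIV k'" "\<And>x. 3/4 \<le> k' x \<and> k' x \<le> 5/4"
    and bc: "k a = a" "k b = b"
    and near: "\<And>s. s \<in> {a..b} \<Longrightarrow> k s \<in> {a..b} \<Longrightarrow> norm (sgn (w s) - sgn (w (k s))) < 1"
  shows "reduced_energy a b h w g \<le> (\<integral>\<^sup>+s. ennreal (1/2 * (norm (g s))\<^sup>2 * (k s / k' s) +
     1/2 * (norm (w s))\<^sup>2 * (k' s / k s) + k s * k' s * hr (q s / (k s * k' s))) \<partial>M\<^sub>I)"
proof -
  have c: "(0::real) < 3/4" "\<And>x. 3/4 \<le> k' x" using k(3) by auto
  obtain p where p: "\<And>x. p (k x) = x" "\<And>y. k (p y) = y" "\<And>y. (p has_real_derivative 1 / k' (p y)) (at y)" "continuous_on UNIV p"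
    by (rule C1_inverse[OF k(1,2) c]) (rule that)
  define p' where "p' r = 1 / k' (p r)" for r
  have k'pos: "0 < k' x" for x using k(3)[of x] by linarith
  have p'b: "0 < p' r" "p' r \<le> 4/3" for r
    using k(3)[of "p r"] k'pos[of "p r"] by (auto simp: p'_def field_simps)
  have p'c: "continuous_on UNIV p'"
    unfolding p'_def using k'pos by (intro continuous_intros continuous_on_compose2[OF k(2) p(4)]) (auto simp: less_imp_neq[symmetric])
  have pbc: "p a = a" "p b = b" using p(1)[of a] p(1)[of b] bc by simp_all
  have kc: "continuous_on UNIV k"
    using k(1) by (intro continuous_at_imp_continuous_on) (auto intro: DERIV_isCont)
  have [measurable]: "p \<in> borel_measurable borel" "p' \<in> borel_measurable borel" "k \<in> borel_measurable borel" "k' \<in> borel_measurable borel"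
    using p(4) p'c kc k(2) by (auto intro: borel_measurable_continuous_onI)
  have kmono: "k x < k y" if "x < y" for x y
    by (rule DERIV_pos_imp_increasing[OF that]) (intro exI conjI, rule k(1), rule k'pos)
  have pmono: "p x < p y" if "x < y" for x y
    by (rule DERIV_pos_imp_increasing[OF that]) (intro exI conjI, rule p(3)[folded p'_def], rule p'b(1))
  have pI: "p r \<in> I" if "r \<in> I" for r using pmono[of a r] pmono[of r b] that pbc by simp
  have pab: "p r \<in> {a..b}" if "r \<in> {a..b}" for r
    using that pI[of r] pbc a_less_b by (cases "r = a"; cases "r = b") auto
  have kI: "k s \<in> I" if "s \<in> I" for s using kmono[of a s] kmono[of s b] that bc by simp
  let ?v = "\<lambda>r. w (p r)" and ?g = "\<lambda>r. p' r *\<^sub>R g (p r)"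
  have v: "sobolev_curve a b ?v ?g"
    using a_less_b less_imp_le[OF p'b(1)] p'b(2) pbc
    by (intro sobolev_curve_reparametrize[where B = "4/3", OF _ curve p(3)[folded p'_def] p'c]) auto
  have vc: "continuous_on UNIV ?v" using v by (simp add: sobolev_curve_def)
  have cw: "curve_winding a b ?v N"
  proof (rule curve_winding_nearby[OF a_less_b w_cont vc _ _ winding])
    fix r assume r: "r \<in> {a..b}"
    show "?v r \<noteq> 0 \<and> norm (sgn (?v r) - sgn (w r)) < 1"
      using near[of "p r"] pab[OF r] r w_nz[OF pab[OF r]] by (simp add: p(2))
  qed (use pbc in auto)
  have qv: "Re (cnj (?v r) * ?g r) = p' r * q (p r)" for r
    by (simp add: q_def algebra_simps)
  \<comment> \<open>Positivity is known off a null set \<open>S\<close>. Its preimage under the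
    reparametrization is null because, by substitution, the positive function \<open>p'\<close>
    integrates to 0 over it.\<close>
  have pos: "AE r in lborel. r \<in> I \<longrightarrow> 0 < Re (cnj (?v r) * ?g r)"
  proof -
    obtain S where S: "{r \<in> space lborel. \<not> (r \<in> I \<longrightarrow> 0 < q r)} \<subseteq> S" "emeasure lborel S = 0" "S \<in> sets lborel"
      using q_pos by (rule AE_E)
    then have [measurable]: "S \<in> sets borel" by simp
    have "(\<integral>\<^sup>+r\<in>{a..b}. indicator S (p r) * ennreal (p' r) \<partial>lborel) = (\<integral>\<^sup>+r\<in>{p a..p b}. indicator S r \<partial>lborel)"
      using a_less_b p(3)[folded p'_def] p'c less_imp_le[OF p'b(1)]
      by (intro nn_integral_substitution_ennreal[symmetric]) auto
    also have "\<dots> \<le> (\<integral>\<^sup>+r. indicator S r \<partial>lborel)"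
      by (intro nn_integral_mono) (auto split: split_indicator)
    also have "\<dots> = 0" using S by simp
    finally have "(\<integral>\<^sup>+r\<in>{a..b}. indicator S (p r) * ennreal (p' r) \<partial>lborel) = 0" by simp
    then have "AE r in lborel. indicator S (p r) * ennreal (p' r) * indicator {a..b} r = 0"
      by (subst (asm) nn_integral_0_iff_AE) auto
    then show ?thesis
    proof eventually_elim
      case (elim r)
      show ?case
      proof
        assume r: "r \<in> I"
        then have "p r \<notin> S" using elim p'b(1)[of r] by (auto split: split_indicator_asm)
        then have "0 < q (p r)" using S(1) pI[OF r] by auto
        then show "0 < Re (cnj (?v r) * ?g r)" unfolding qv using p'b(1)[of r] by simp
      qed
    qed
  qed
  have "reduced_energy a b h w g \<le> reduced_energy a b h ?v ?g"
  proof (rule minimal[OF v _ _ cw])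
    show "AE r in lborel. r \<in> I \<longrightarrow> 0 \<le> Re (cnj (?v r) * ?g r)"
      using pos by eventually_elim (auto simp: less_imp_le)
  qed (use pbc w_a w_b in auto)
  also have "\<dots> = (\<integral>\<^sup>+r\<in>I. ennreal (lagrangian ?v ?g r) \<partial>lborel)"
    by (rule reduced_energy_eq[OF _ _ pos]) measurable
  also have "\<dots> = (\<integral>\<^sup>+r\<in>{k a..k b}. ennreal (lagrangian ?v ?g r) \<partial>lborel)"
    unfolding bc
  proof (rule nn_integral_cong_AE)
    show "AE r in lborel. ennreal (lagrangian ?v ?g r) * indicator I r = ennreal (lagrangian ?v ?g r) * indicator {a..b} r"
      using AE_lborel_singleton[of a] AE_lborel_singleton[of b] by eventually_elim (auto split: split_indicator)
  qed
  also have "\<dots> = (\<integral>\<^sup>+s\<in>{a..b}. ennreal (lagrangian ?v ?g (k s)) * ennreal (k' s) \<partial>lborel)"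
  proof (rule nn_integral_substitution_ennreal[OF _ _ k(1,2)])
    show "(\<lambda>r. ennreal (lagrangian ?v ?g r)) \<in> borel_measurable borel"
      unfolding lagrangian_def by measurable
  qed (use a_less_b less_imp_le[OF k'pos] in auto)
  also have "\<dots> = (\<integral>\<^sup>+s\<in>I. ennreal (lagrangian ?v ?g (k s)) * ennreal (k' s) \<partial>lborel)"
  proof (rule nn_integral_cong_AE)
    show "AE s in lborel. ennreal (lagrangian ?v ?g (k s)) * ennreal (k' s) * indicator {a..b} s =
        ennreal (lagrangian ?v ?g (k s)) * ennreal (k' s) * indicator I s"
      using AE_lborel_singleton[of a] AE_lborel_singleton[of b] by eventually_elim (auto split: split_indicator)
  qed
  also have "\<dots> = (\<integral>\<^sup>+s\<in>I. ennreal (1/2 * (norm (g s))\<^sup>2 * (k s / k' s) +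
     1/2 * (norm (w s))\<^sup>2 * (k' s / k s) + k s * k' s * hr (q s / (k s * k' s))) \<partial>lborel)"
  proof (rule nn_integral_cong)
    fix s
    show "ennreal (lagrangian ?v ?g (k s)) * ennreal (k' s) * indicator I s =
      ennreal (1/2 * (norm (g s))\<^sup>2 * (k s / k' s) +
        1/2 * (norm (w s))\<^sup>2 * (k' s / k s) + k s * k' s * hr (q s / (k s * k' s))) * indicator I s"
    proof (cases "s \<in> I")
      case True
      then have ks: "0 < k s" using kI[OF True] a_pos by auto
      have "lagrangian ?v ?g (k s) * k' s = 1/2 * (norm (g s))\<^sup>2 * (k s / k' s) +
         1/2 * (norm (w s))\<^sup>2 * (k' s / k s) + k s * k' s * hr (q s / (k s * k' s))"
      proof -
        have "p' (k s) * q s / k s = q s / (k s * k' s)" using k'pos[of s] by (simp add: p'_def p(1))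
        moreover have "(norm (p' (k s) *\<^sub>R g s))\<^sup>2 = (norm (g s))\<^sup>2 / (k' s)\<^sup>2"
          using k'pos[of s] by (simp add: p'_def p(1) power_mult_distrib power_divide)
        moreover have "lagrangian ?v ?g (k s) = k s * (1/2 * ((norm (p' (k s) *\<^sub>R g s))\<^sup>2 + (norm (w s))\<^sup>2 / (k s)\<^sup>2) +
            hr (p' (k s) * q s / k s))"
          unfolding lagrangian_def by (subst qv) (simp only: p(1))
        moreover have "K * (1/2 * (A / K'\<^sup>2 + W / K\<^sup>2) + X) * K' = 1/2 * A * (K / K') + 1/2 * W * (K' / K) + K * K' * X"
          if "0 < K" "0 < K'" for K K' A W X :: real
          using that by (simp add: field_simps power2_eq_square)
        ultimately show ?thesis using ks k'pos[of s] by simp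
      qed
      then show ?thesis
        using True k'pos[of s] by (simp add: ennreal_mult''[symmetric] less_imp_le)
    qed simp
  qed
  also have "\<dots> = (\<integral>\<^sup>+s. ennreal (1/2 * (norm (g s))\<^sup>2 * (k s / k' s) +
     1/2 * (norm (w s))\<^sup>2 * (k' s / k s) + k s * k' s * hr (q s / (k s * k' s))) \<partial>M\<^sub>I)"
    by (simp add: nn_integral_restrict_space)
  finally show ?thesis .
qed

text \<open>\<open>radial_stress\<close> is r times the radial component of the energy-momentum
  tensor, and \<open>radial_source\<close> is minus its tangential component. With these signs the
  derivative of the stress is minus the source.\<close>

definition "radial_stress r = r * (1/2 * (norm (g r))\<^sup>2 - (norm (w r))\<^sup>2 / (2 * r\<^sup>2) + F (d r))"
definition "radial_source r = 1/2 * (norm (g r))\<^sup>2 - (norm (w r))\<^sup>2 / (2 * r\<^sup>2) - F (d r)"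

text \<open>At nonpositive arguments \<open>F\<close> contains derivatives over which the hypotheses
  give no control; a Borel function that agrees with it on the positive axis is used
  instead.\<close>

lemma F_d_measurable: "\<exists>f\<in>borel_measurable borel. \<forall>t>0. f t = F t"
proof -
  have "continuous_on {0<..} F"
    using diff_F by (auto intro!: DERIV_continuous_on intro: has_field_derivative_at_within)
  then have "(\<lambda>t. if t \<in> {0<..} then F t else 0) \<in> borel_measurable borel"
    by (intro borel_measurable_continuous_on_if) auto
  then show ?thesis by (intro bexI[of _ "\<lambda>t. if t \<in> {0<..} then F t else 0"]) auto
qed

lemma d_pos: "AE r in M\<^sub>I. 0 < d r"
  unfolding AE_MI using q_pos by eventually_elim (use a_pos in \<open>auto simp: d_def\<close>)

text \<open>The competitor is \<open>w\<close> composed with the inverse of \<open>\<kappa> e s = s + e * \<eta> s\<close>; after substitution the energy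
  density depends differentiably on \<open>e\<close> with no derivative of \<open>g\<close> involved.\<close>

lemma inner_variation_equation:
  obtains T c where "set_integrable lborel I T" "AE r in lborel. r \<in> I \<longrightarrow> T r = radial_source r"
    "AE r in lborel. r \<in> I \<longrightarrow> radial_stress r + (LINT s:{a<..<r}|lborel. T s) = c"
proof -
  obtain f where f[measurable]: "f \<in> borel_measurable borel" and fF: "\<And>t. 0 < t \<Longrightarrow> f t = F t"
    using F_d_measurable by blast
  obtain C where C: "0 \<le> C" "\<And>t l. 0 < t \<Longrightarrow> l \<in> {1/2..2} \<Longrightarrow> hr (l * t) + \<bar>l * t * h' (l * t)\<bar> \<le> C * (1 + t + hr t)"
    using hr_growth by blast
  have Cf: "\<bar>f (l * t)\<bar> \<le> C * (1 + t + hr t)" if "0 < t" "l \<in> {1/2..2}" for t l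
  proof -
    have "0 < l * t" using that by (auto intro: mult_pos_pos)
    then have "f (l * t) = l * t * h' (l * t) - hr (l * t)" by (simp add: fF F_def')
    then have "\<bar>f (l * t)\<bar> \<le> hr (l * t) + \<bar>l * t * h' (l * t)\<bar>" using hr_nonneg[of "l * t"] by linarith
    then show ?thesis using C(2)[OF that] by linarith
  qed
  obtain Bw where Bw: "0 < Bw" "\<And>r. r \<in> {a..b} \<Longrightarrow> norm (w r) \<le> Bw" by (rule w_bounded) (rule that)
  have Bw2: "(norm (w r))\<^sup>2 \<le> Bw\<^sup>2" if "r \<in> I" for r using that Bw by (intro power_mono) auto
  have Isp: "r \<in> I" if "r \<in> space M\<^sub>I" for r using that by (simp add: space_restrict_space)
  have fd: "integrable M\<^sub>I (\<lambda>r. f (d r))"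
  proof (rule Bochner_Integration.integrable_bound)
    show "integrable M\<^sub>I (\<lambda>r. C * (1 + d r + hr (d r)))"
      by (intro Bochner_Integration.integrable_mult_right Bochner_Integration.integrable_add integrable_const_MI cnj_w_g_integrable hr_d_integrable)
    show "AE r in M\<^sub>I. norm (f (d r)) \<le> norm (C * (1 + d r + hr (d r)))"
      using d_pos by eventually_elim (use Cf[of _ 1] C(1) in \<open>auto intro: order_trans[OF _ abs_ge_self]\<close>)
  qed (intro measurable_restrict_space1, measurable)
  have wr: "integrable M\<^sub>I (\<lambda>r. (norm (w r))\<^sup>2 / (2 * r\<^sup>2) * 1)"
  proof (rule integrable_bounded_mult[OF integrable_const_MI])
    fix r assume r: "r \<in> I"
    have "a\<^sup>2 \<le> r\<^sup>2" using r a_pos by (intro power_mono) auto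
    then show "\<bar>(norm (w r))\<^sup>2 / (2 * r\<^sup>2)\<bar> \<le> Bw\<^sup>2 / (2 * a\<^sup>2)"
      using Bw2[OF r] a_pos r by (auto intro!: frac_le)
  qed measurable
  \<comment> \<open>\<open>T\<close> and \<open>E\<close> are Borel versions of source and stress;
    they differ from these only where the determinant fails to be positive, which is a null
    set.\<close>
  define T where "T r = 1/2 * (norm (g r))\<^sup>2 - (norm (w r))\<^sup>2 / (2 * r\<^sup>2) - f (d r)" for r
  define E where "E r = r * (1/2 * (norm (g r))\<^sup>2 - (norm (w r))\<^sup>2 / (2 * r\<^sup>2) + f (d r))" for r
  have Ti: "integrable M\<^sub>I T"
    unfolding T_def using g2_integrable wr fd by simp
  have Ei: "integrable M\<^sub>I E"
    unfolding E_def
  proof (rule integrable_bounded_mult)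
    show "integrable M\<^sub>I (\<lambda>r. 1/2 * (norm (g r))\<^sup>2 - (norm (w r))\<^sup>2 / (2 * r\<^sup>2) + f (d r))"
      using g2_integrable wr fd by simp
    show "\<bar>r\<bar> \<le> b" if "r \<in> I" for r using that a_pos by auto
  qed measurable
  have [measurable]: "T \<in> borel_measurable borel" "E \<in> borel_measurable borel"
    unfolding T_def[abs_def] E_def[abs_def] by measurable
  define P where "P r = (LINT s:{a<..<r}|lborel. T s)" for r
  have [measurable]: "P \<in> borel_measurable borel"
  proof -
    have "P = (\<lambda>r. LINT s|lborel. indicator {(x, y). a < y \<and> y < x} (r, s) * T s)"
      unfolding P_def[abs_def] set_lebesgue_integral_def
      by (intro ext Bochner_Integration.integral_cong) (auto split: split_indicator)
    then show ?thesis by simp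
  qed
  have Tset: "set_integrable lborel I T" using Ti by (simp add: set_integrable_MI)
  have Pb: "\<bar>P r\<bar> \<le> (LINT s|M\<^sub>I. \<bar>T s\<bar>)" if "r \<in> I" for r
  proof -
    have s: "set_integrable lborel {a<..<r} T" by (rule set_integrable_subset[OF Tset]) (use that in auto)
    have "\<bar>P r\<bar> \<le> (LINT s|lborel. \<bar>indicator {a<..<r} s * T s\<bar>)"
      using s unfolding P_def set_lebesgue_integral_def set_integrable_def by (simp add: integral_abs_bound)
    also have "\<dots> \<le> (LINT s|lborel. \<bar>indicator I s * T s\<bar>)"
      using s Tset that unfolding set_integrable_def by (intro integral_mono) (auto split: split_indicator)
    also have "\<dots> = (LINT s|M\<^sub>I. \<bar>T s\<bar>)"
      by (simp add: integral_restrict_space abs_mult)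
    finally show ?thesis .
  qed
  have Pi: "integrable M\<^sub>I P"
    by (rule integrable_bounded[OF _ Pb]) measurable
  have test: "(LINT r:I|lborel. (E r + P r) * \<xi> r) = 0"
    if \<xi>: "continuous_on UNIV \<xi>" "\<And>x. \<bar>\<xi> x\<bar> \<le> B" "(LINT r:I|lborel. \<xi> r) = 0" for \<xi> B
  proof -
    have [measurable]: "\<xi> \<in> borel_measurable borel" using \<xi>(1) by (rule borel_measurable_continuous_onI)
    have B0: "0 \<le> B" using \<xi>(2)[of 0] by linarith
    obtain \<eta> where \<eta>': "\<And>x. (\<eta> has_vector_derivative \<xi> x) (at x)" and \<eta>a: "\<eta> a = 0"
      by (rule continuous_antiderivative[OF \<xi>(1), of a 0]) (rule that)
    then have \<eta>: "\<And>x. (\<eta> has_real_derivative \<xi> x) (at x)" by (simp add: has_real_derivative_iff_has_vector_derivative)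
    have \<eta>r: "(LINT s:{a<..<r}|lborel. \<xi> s) = \<eta> r" if "a \<le> r" for r
      using set_integral_FTC_Ioo[OF that \<eta> \<xi>(1)] \<eta>a by simp
    have \<eta>b: "\<eta> b = 0" using \<eta>r[of b] \<xi>(3) a_less_b by simp
    have \<eta>c: "continuous_on UNIV \<eta>"
      using \<eta> by (intro continuous_at_imp_continuous_on) (auto intro: DERIV_isCont)
    have [measurable]: "\<eta> \<in> borel_measurable borel" using \<eta>c by (rule borel_measurable_continuous_onI)
    have "bounded (\<eta> ` {a..b})"
      by (intro compact_imp_bounded compact_continuous_image continuous_on_subset[OF \<eta>c]) auto
    then obtain H where H: "0 < H" "\<And>r. r \<in> {a..b} \<Longrightarrow> \<bar>\<eta> r\<bar> \<le> H" by (auto simp: bounded_pos)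
    \<comment> \<open>A displacement of the radius by less than \<delta> moves w/|w| by less than 1,
      so the winding number is kept.\<close>
    have "uniformly_continuous_on {a..b} (\<lambda>r. sgn (w r))"
      using w_nz by (intro compact_uniformly_continuous continuous_intros continuous_on_subset[OF w_cont]) auto
    from this[unfolded uniformly_continuous_on_def, rule_format, OF zero_less_one]
    obtain \<delta> where "0 < \<delta>" "\<forall>x\<in>{a..b}. \<forall>y\<in>{a..b}. dist y x < \<delta> \<longrightarrow> dist (sgn (w y)) (sgn (w x)) < 1"
      by blast
    then have \<delta>: "0 < \<delta>" "\<And>x y. x \<in> {a..b} \<Longrightarrow> y \<in> {a..b} \<Longrightarrow> dist y x < \<delta> \<Longrightarrow> dist (sgn (w y)) (sgn (w x)) < 1"
      by blast+
    \<comment> \<open>Three demands on |e| < e0: e \<xi> is at most 1/4, so the change of radius has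
      derivative in [3/4,5/4]; e \<eta> is at most a/4, so the new radius lies between 3/4 and 5/4
      of the old one; and e \<eta> is below \<delta>.\<close>
    define e0 where "e0 = min (1 / (4 * (B + 1))) (min (a / (4 * H)) (\<delta> / H))"
    have e0: "0 < e0" using B0 H(1) a_pos \<delta>(1) by (simp add: e0_def)
    define \<kappa> where "\<kappa> e s = s + e * \<eta> s" for e s
    define \<kappa>' where "\<kappa>' e s = 1 + e * \<xi> s" for e s
    have small: "\<bar>e * \<xi> s\<bar> \<le> 1/4" "s \<in> {a..b} \<Longrightarrow> \<bar>e * \<eta> s\<bar> \<le> a / 4" "s \<in> {a..b} \<Longrightarrow> \<bar>e * \<eta> s\<bar> < \<delta>"
      if e: "\<bar>e\<bar> < e0" for e s
    proof -
      have "\<bar>e * \<xi> s\<bar> \<le> 1 / (4 * (B + 1)) * (B + 1)"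
        unfolding abs_mult using e \<xi>(2)[of s] B0 by (intro mult_mono) (auto simp: e0_def)
      also have "1 / (4 * (B + 1)) * (B + 1) = 1/4" using B0 by (simp add: divide_simps)
      finally show "\<bar>e * \<xi> s\<bar> \<le> 1/4" .
      assume s: "s \<in> {a..b}"
      have "\<bar>e * \<eta> s\<bar> \<le> a / (4 * H) * H"
        unfolding abs_mult using e H(2)[OF s] H(1) a_pos by (intro mult_mono) (auto simp: e0_def)
      then show "\<bar>e * \<eta> s\<bar> \<le> a / 4" using H(1) by simp
      have "\<bar>e * \<eta> s\<bar> \<le> \<bar>e\<bar> * H"
        unfolding abs_mult using H(2)[OF s] by (intro mult_left_mono) auto
      also have "\<dots> < \<delta> / H * H" using e H(1) by (intro mult_strict_right_mono) (auto simp: e0_def)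
      finally show "\<bar>e * \<eta> s\<bar> < \<delta>" using H(1) by simp
    qed
    have \<kappa>'b: "3/4 \<le> \<kappa>' e s \<and> \<kappa>' e s \<le> 5/4" if "\<bar>e\<bar> < e0" for e s
      using small(1)[OF that, of s] unfolding \<kappa>'_def abs_le_iff by linarith
    have \<kappa>b: "3/4 * s \<le> \<kappa> e s \<and> \<kappa> e s \<le> 5/4 * s" if "\<bar>e\<bar> < e0" "s \<in> {a..b}" for e s
      using small(2)[OF that(1) that(2)] that(2) unfolding \<kappa>_def abs_le_iff by auto
    have [measurable]: "\<kappa> e \<in> borel_measurable borel" "\<kappa>' e \<in> borel_measurable borel" for e
      unfolding \<kappa>_def[abs_def] \<kappa>'_def[abs_def] by measurable
    define \<Phi> where "\<Phi> e s = 1/2 * (norm (g s))\<^sup>2 * (\<kappa> e s / \<kappa>' e s) +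
       1/2 * (norm (w s))\<^sup>2 * (\<kappa>' e s / \<kappa> e s) + \<kappa> e s * \<kappa>' e s * hr (q s / (\<kappa> e s * \<kappa>' e s))" for e s
    define \<Phi>d where "\<Phi>d e s = 1/2 * (norm (g s))\<^sup>2 * (\<eta> s / \<kappa>' e s - \<kappa> e s * \<xi> s / (\<kappa>' e s)\<^sup>2) +
       1/2 * (norm (w s))\<^sup>2 * (\<xi> s / \<kappa> e s - \<kappa>' e s * \<eta> s / (\<kappa> e s)\<^sup>2) -
       (\<eta> s * \<kappa>' e s + \<kappa> e s * \<xi> s) * f (q s / (\<kappa> e s * \<kappa>' e s))" for e s
    \<comment> \<open>\<open>C1\<close>, \<open>C2\<close>, \<open>C3\<close> bound the parts of the
      derivative that carry |g|^2, |w|^2 and f respectively, by the two-sided bounds on \<kappa> and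
      \<kappa>'; the growth estimate supplies the remaining factor of the third.\<close>
    define C1 where "C1 = H + 2 * b * B"
    define C2 where "C2 = 1/2 * Bw\<^sup>2 * (B * (4 / (3 * a)) + 5/4 * H * (16 / (9 * a\<^sup>2)))"
    define C3 where "C3 = 5/4 * H + 5/4 * b * B"
    define Bnd where "Bnd s = C1 * (norm (g s))\<^sup>2 + C2 + C3 * (C * (1 + d s + hr (d s)))" for s
    have \<Phi>0: "\<Phi> 0 s = lagrangian w g s" if "s \<in> I" for s
      using that a_pos by (simp add: \<Phi>_def \<kappa>_def \<kappa>'_def lagrangian_def q_def power2_eq_square field_simps)
    \<comment> \<open>At e = 0 the coefficient of \<eta> is the source and that of \<xi> = \<eta>'
      is minus the stress.\<close>
    have \<Phi>d0: "\<Phi>d 0 s = T s * \<eta> s - E s * \<xi> s" if "s \<in> I" for s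
    proof -
      have "0 < s" using that a_pos by auto
      then show ?thesis
        by (simp add: \<Phi>d_def \<kappa>_def \<kappa>'_def T_def E_def d_def power2_eq_square algebra_simps add_divide_distrib diff_divide_distrib)
    qed
    have \<Phi>0i: "integrable M\<^sub>I (\<Phi> 0)"
      using lagrangian_integral(1)[unfolded set_integrable_MI] \<Phi>0 Isp
        Bochner_Integration.integrable_cong[of "M\<^sub>I" "M\<^sub>I" "\<Phi> 0" "lagrangian w g"] by simp
    have \<Phi>m: "\<Phi> e \<in> borel_measurable M\<^sub>I" "\<Phi>d e \<in> borel_measurable M\<^sub>I" for e
      unfolding \<Phi>_def[abs_def] \<Phi>d_def[abs_def] by (intro measurable_restrict_space1, measurable)+
    have der: "((\<lambda>e. \<Phi> e s) has_real_derivative \<Phi>d e s) (at e) \<and> \<bar>\<Phi>d e s\<bar> \<le> Bnd s"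
      if s: "s \<in> I" and ds: "0 < d s" and e: "\<bar>e\<bar> < e0" for s e
    proof -
      have sab: "s \<in> {a..b}" and s0: "0 < s" using s a_pos by auto
      have qs: "0 < q s" using ds s0 by (simp add: d_def zero_less_divide_iff)
      have k: "3/4 * s \<le> \<kappa> e s" "\<kappa> e s \<le> 5/4 * s" "3/4 \<le> \<kappa>' e s" "\<kappa>' e s \<le> 5/4"
        using \<kappa>b[OF e sab] \<kappa>'b[OF e, of s] by auto
      have k0: "0 < \<kappa> e s" "0 < \<kappa>' e s" using k s0 by linarith+
      have kk: "0 < \<kappa> e s * \<kappa>' e s" using k0 by simp
      define \<theta> where "\<theta> = q s / (\<kappa> e s * \<kappa>' e s)"
      have \<theta>0: "0 < \<theta>" using qs kk by (simp add: \<theta>_def)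
      have d\<kappa>: "((\<lambda>e. \<kappa> e s) has_real_derivative \<eta> s) (at e)" "((\<lambda>e. \<kappa>' e s) has_real_derivative \<xi> s) (at e)"
        unfolding \<kappa>_def \<kappa>'_def by (auto intro!: derivative_eq_intros)
      have dP: "((\<lambda>e. \<kappa> e s * \<kappa>' e s) has_real_derivative (\<eta> s * \<kappa>' e s + \<kappa> e s * \<xi> s)) (at e)"
        using DERIV_mult[OF d\<kappa>] by (simp add: mult.commute)
      have dh: "((\<lambda>e. \<kappa> e s * \<kappa>' e s * hr (q s / (\<kappa> e s * \<kappa>' e s))) has_real_derivative
         - (\<eta> s * \<kappa>' e s + \<kappa> e s * \<xi> s) * f \<theta>) (at e)"
      proof -
        have "((\<lambda>e. q s / (\<kappa> e s * \<kappa>' e s)) has_real_derivative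
           (- (q s * (\<eta> s * \<kappa>' e s + \<kappa> e s * \<xi> s)) / (\<kappa> e s * \<kappa>' e s)\<^sup>2)) (at e)"
          by (rule DERIV_cong[OF DERIV_divide[OF DERIV_const dP]]) (use k0 in \<open>auto simp: power2_eq_square\<close>)
        from DERIV_mult[OF dP DERIV_chain2[OF diff_hr[OF \<theta>0, unfolded \<theta>_def] this]]
        have D1: "((\<lambda>e. \<kappa> e s * \<kappa>' e s * hr (q s / (\<kappa> e s * \<kappa>' e s))) has_real_derivative
           ((\<eta> s * \<kappa>' e s + \<kappa> e s * \<xi> s) * hr \<theta> + h' \<theta> * (- (q s * (\<eta> s * \<kappa>' e s + \<kappa> e s * \<xi> s)) / (\<kappa> e s * \<kappa>' e s)\<^sup>2) * (\<kappa> e s * \<kappa>' e s))) (at e)"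
          by (simp add: \<theta>_def)
        have D2: "h' \<theta> * (- (q s * (\<eta> s * \<kappa>' e s + \<kappa> e s * \<xi> s)) / (\<kappa> e s * \<kappa>' e s)\<^sup>2) * (\<kappa> e s * \<kappa>' e s) =
           - (\<eta> s * \<kappa>' e s + \<kappa> e s * \<xi> s) * (\<theta> * h' \<theta>)"
        proof -
          have "x * (- (y * z) / p\<^sup>2) * p = - z * (y / p * x)" if "p \<noteq> 0" for x y z p :: real
            using that by (simp add: power2_eq_square field_simps)
          from this[OF less_imp_neq[OF kk, symmetric], of "h' \<theta>" "q s" "\<eta> s * \<kappa>' e s + \<kappa> e s * \<xi> s"] show ?thesis
            unfolding \<theta>_def .
        qed
        show ?thesis
          by (rule DERIV_cong[OF D1], unfold D2 fF[OF \<theta>0] F_def') (simp add: algebra_simps)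
      qed
      have "((\<lambda>e. \<Phi> e s) has_real_derivative \<Phi>d e s) (at e)"
      proof -
        have A1: "((\<lambda>e. \<kappa> e s / \<kappa>' e s) has_real_derivative (\<eta> s / \<kappa>' e s - \<kappa> e s * \<xi> s / (\<kappa>' e s)\<^sup>2)) (at e)"
          by (rule DERIV_cong[OF DERIV_divide[OF d\<kappa>]]) (use k0 in \<open>auto simp: power2_eq_square field_simps\<close>)
        have A2: "((\<lambda>e. \<kappa>' e s / \<kappa> e s) has_real_derivative (\<xi> s / \<kappa> e s - \<kappa>' e s * \<eta> s / (\<kappa> e s)\<^sup>2)) (at e)"
          by (rule DERIV_cong[OF DERIV_divide[OF d\<kappa>(2,1)]]) (use k0 in \<open>auto simp: power2_eq_square field_simps\<close>)
        show ?thesis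
          unfolding \<Phi>_def \<Phi>d_def
          by (rule DERIV_cong[OF DERIV_add[OF DERIV_add[OF DERIV_cmult[OF A1] DERIV_cmult[OF A2]] dh]]) (simp add: \<theta>_def algebra_simps)
      qed
      moreover have "\<bar>\<Phi>d e s\<bar> \<le> Bnd s"
      proof -
        have Hs: "\<bar>\<eta> s\<bar> \<le> H" "\<bar>\<xi> s\<bar> \<le> B" using H(2)[OF sab] \<xi>(2) by auto
        have i\<kappa>': "1 / \<kappa>' e s \<le> 4/3" "1 / (\<kappa>' e s)\<^sup>2 \<le> 16/9"
        proof -
          show "1 / \<kappa>' e s \<le> 4/3" using k k0 by (simp add: field_simps)
          then have "(1 / \<kappa>' e s)\<^sup>2 \<le> (4/3)\<^sup>2" using k0 by (intro power_mono) auto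
          then show "1 / (\<kappa>' e s)\<^sup>2 \<le> 16/9" by (simp add: power_divide)
        qed
        have i\<kappa>: "1 / \<kappa> e s \<le> 4 / (3 * a)" "1 / (\<kappa> e s)\<^sup>2 \<le> 16 / (9 * a\<^sup>2)"
        proof -
          have "3/4 * a \<le> \<kappa> e s" using k(1) s by auto
          then show "1 / \<kappa> e s \<le> 4 / (3 * a)" using k0 a_pos by (simp add: field_simps)
          then have "(1 / \<kappa> e s)\<^sup>2 \<le> (4 / (3 * a))\<^sup>2" using k0 by (intro power_mono) auto
          then show "1 / (\<kappa> e s)\<^sup>2 \<le> 16 / (9 * a\<^sup>2)" by (simp add: power_divide power_mult_distrib)
        qed
        have kb: "\<kappa> e s \<le> 5/4 * b" using k(2) s by auto
        have b1: "\<bar>1/2 * (norm (g s))\<^sup>2 * (\<eta> s / \<kappa>' e s - \<kappa> e s * \<xi> s / (\<kappa>' e s)\<^sup>2)\<bar> \<le> C1 * (norm (g s))\<^sup>2"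
        proof -
          have "\<bar>\<eta> s / \<kappa>' e s\<bar> \<le> H * (4/3)"
          proof -
            have "\<bar>\<eta> s\<bar> * (1 / \<kappa>' e s) \<le> H * (4/3)" using Hs i\<kappa>' k0 H(1) by (intro mult_mono) auto
            then show ?thesis using k0 by simp
          qed
          moreover have "\<bar>\<kappa> e s * \<xi> s / (\<kappa>' e s)\<^sup>2\<bar> \<le> (5/4 * b) * B * (16/9)"
          proof -
            have "\<kappa> e s * \<bar>\<xi> s\<bar> * (1 / (\<kappa>' e s)\<^sup>2) \<le> (5/4 * b) * B * (16/9)"
              using Hs i\<kappa>' k0 kb B0 a_pos a_less_b by (intro mult_mono) auto
            then show ?thesis using k0 by (simp add: abs_mult)
          qed
          ultimately have "\<bar>\<eta> s / \<kappa>' e s - \<kappa> e s * \<xi> s / (\<kappa>' e s)\<^sup>2\<bar> \<le> H * (4/3) + (5/4 * b) * B * (16/9)" by linarith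
          also have "\<dots> \<le> 2 * C1"
          proof -
            have "0 \<le> b * B" using B0 a_pos a_less_b by simp
            moreover have "H * (4/3) + (5/4 * b) * B * (16/9) = 4/3 * H + 20/9 * (b * B)" "2 * C1 = 2 * H + 4 * (b * B)"
              by (simp_all add: C1_def mult.commute)
            ultimately show ?thesis using H(1) by linarith
          qed
          finally have "1/2 * (norm (g s))\<^sup>2 * \<bar>\<eta> s / \<kappa>' e s - \<kappa> e s * \<xi> s / (\<kappa>' e s)\<^sup>2\<bar> \<le> 1/2 * (norm (g s))\<^sup>2 * (2 * C1)"
            by (intro mult_left_mono) auto
          then show ?thesis by (simp add: abs_mult mult.commute)
        qed
        have b2: "\<bar>1/2 * (norm (w s))\<^sup>2 * (\<xi> s / \<kappa> e s - \<kappa>' e s * \<eta> s / (\<kappa> e s)\<^sup>2)\<bar> \<le> C2"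
        proof -
          have "\<bar>\<xi> s / \<kappa> e s\<bar> \<le> B * (4 / (3 * a))"
          proof -
            have "\<bar>\<xi> s\<bar> * (1 / \<kappa> e s) \<le> B * (4 / (3 * a))" using Hs i\<kappa> k0 B0 by (intro mult_mono) auto
            then show ?thesis using k0 by simp
          qed
          moreover have "\<bar>\<kappa>' e s * \<eta> s / (\<kappa> e s)\<^sup>2\<bar> \<le> 5/4 * H * (16 / (9 * a\<^sup>2))"
          proof -
            have "\<kappa>' e s * \<bar>\<eta> s\<bar> * (1 / (\<kappa> e s)\<^sup>2) \<le> 5/4 * H * (16 / (9 * a\<^sup>2))"
              using Hs i\<kappa> k0 k H(1) by (intro mult_mono) auto
            then show ?thesis using k0 by (simp add: abs_mult)
          qed
          ultimately have "\<bar>\<xi> s / \<kappa> e s - \<kappa>' e s * \<eta> s / (\<kappa> e s)\<^sup>2\<bar> \<le> B * (4 / (3 * a)) + 5/4 * H * (16 / (9 * a\<^sup>2))" by linarith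
          then have "1/2 * (norm (w s))\<^sup>2 * \<bar>\<xi> s / \<kappa> e s - \<kappa>' e s * \<eta> s / (\<kappa> e s)\<^sup>2\<bar> \<le> C2"
            unfolding C2_def using Bw2[OF s] by (intro mult_mono) auto
          then show ?thesis by (simp add: abs_mult)
        qed
        have b3: "\<bar>(\<eta> s * \<kappa>' e s + \<kappa> e s * \<xi> s) * f \<theta>\<bar> \<le> C3 * (C * (1 + d s + hr (d s)))"
        proof -
          have "\<bar>\<eta> s * \<kappa>' e s\<bar> \<le> 5/4 * H"
          proof -
            have "\<kappa>' e s * \<bar>\<eta> s\<bar> \<le> 5/4 * H" using Hs k0 k by (intro mult_mono) auto
            then show ?thesis using k0 by (simp add: abs_mult mult.commute)
          qed
          moreover have "\<bar>\<kappa> e s * \<xi> s\<bar> \<le> 5/4 * b * B"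
          proof -
            have "\<kappa> e s * \<bar>\<xi> s\<bar> \<le> 5/4 * b * B" using Hs k0 kb by (intro mult_mono) auto
            then show ?thesis using k0 by (simp add: abs_mult)
          qed
          ultimately have 1: "\<bar>\<eta> s * \<kappa>' e s + \<kappa> e s * \<xi> s\<bar> \<le> C3" unfolding C3_def by linarith
          \<comment> \<open>The perturbed determinant is l times the old one. The product of
            \<kappa> and \<kappa>' lies between 9/16 and 25/16 of s, so l is in [16/25,16/9], inside
            the range [1/2,2] of the growth bound.\<close>
          define l where "l = s / (\<kappa> e s * \<kappa>' e s)"
          have \<theta>l: "\<theta> = l * d s" using s0 by (simp add: \<theta>_def l_def d_def)
          have "3/4 * s * (3/4) \<le> \<kappa> e s * \<kappa>' e s" "\<kappa> e s * \<kappa>' e s \<le> 5/4 * s * (5/4)"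
            using k k0 s0 by (intro mult_mono; auto)+
          then have "l \<in> {1/2..2}" using kk s0 by (simp add: l_def field_simps)
          then have 2: "\<bar>f \<theta>\<bar> \<le> C * (1 + d s + hr (d s))" unfolding \<theta>l using ds by (intro Cf)
          have "0 \<le> C3" using 1 by linarith
          then show ?thesis unfolding abs_mult using 1 2 by (intro mult_mono) auto
        qed
        show ?thesis
          using b1 b2 b3 unfolding \<Phi>d_def Bnd_def \<theta>_def by linarith
      qed
      ultimately show ?thesis by blast
    qed
    have fv: "(LINT s|M\<^sub>I. \<Phi>d 0 s) = 0"
    proof (rule first_variation(2)[OF e0, where B = Bnd and \<Phi> = \<Phi>])
      show "AE s in M\<^sub>I. \<forall>e. \<bar>e\<bar> < e0 \<longrightarrow> ((\<lambda>e. \<Phi> e s) has_real_derivative \<Phi>d e s) (at e) \<and> \<bar>\<Phi>d e s\<bar> \<le> Bnd s"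
      proof -
        have "AE s in M\<^sub>I. s \<in> I" by (rule AE_I2) (rule Isp)
        with d_pos show ?thesis by eventually_elim (use der in blast)
      qed
      show "integrable M\<^sub>I Bnd"
        unfolding Bnd_def
        by (intro Bochner_Integration.integrable_mult_right Bochner_Integration.integrable_add integrable_const_MI cnj_w_g_integrable hr_d_integrable g2_integrable)
      fix e assume e: "\<bar>e\<bar> < e0" and int: "integrable M\<^sub>I (\<Phi> e)"
      have nn: "0 \<le> \<Phi> e s" if "s \<in> I" for s
      proof -
        have "0 < \<kappa> e s" "0 < \<kappa>' e s" using \<kappa>b[OF e, of s] \<kappa>'b[OF e, of s] that a_pos by auto
        then show ?thesis by (simp add: \<Phi>_def)
      qed
      have "reduced_energy a b h w g \<le> (\<integral>\<^sup>+s. ennreal (\<Phi> e s) \<partial>M\<^sub>I)"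
        unfolding \<Phi>_def
      proof (rule reparametrized_energy)
        show "(\<kappa> e has_real_derivative \<kappa>' e x) (at x)" for x
          unfolding \<kappa>_def[abs_def] \<kappa>'_def by (auto intro!: derivative_eq_intros \<eta>)
        show "continuous_on UNIV (\<kappa>' e)" unfolding \<kappa>'_def[abs_def] by (intro continuous_intros \<xi>(1))
        show "3/4 \<le> \<kappa>' e x \<and> \<kappa>' e x \<le> 5/4" for x by (rule \<kappa>'b[OF e])
        show "\<kappa> e a = a" "\<kappa> e b = b" by (simp_all add: \<kappa>_def \<eta>a \<eta>b)
        fix s assume s: "s \<in> {a..b}" "\<kappa> e s \<in> {a..b}"
        have "dist s (\<kappa> e s) < \<delta>" using small(3)[OF e s(1)] by (simp add: \<kappa>_def dist_real_def)
        then show "norm (sgn (w s) - sgn (w (\<kappa> e s))) < 1" using \<delta>(2)[OF s(2,1)] by (simp add: dist_norm)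
      qed
      also have "\<dots> = ennreal (LINT s|M\<^sub>I. \<Phi> e s)"
        using nn Isp by (intro nn_integral_eq_integral[OF int] AE_I2) auto
      finally have "ennreal (LINT s|M\<^sub>I. lagrangian w g s) \<le> ennreal (LINT s|M\<^sub>I. \<Phi> e s)"
        unfolding lagrangian_integral(2) set_integral_MI .
      moreover have "0 \<le> (LINT s|M\<^sub>I. \<Phi> e s)" using nn Isp by (intro integral_nonneg_AE AE_I2) auto
      ultimately have "(LINT s|M\<^sub>I. lagrangian w g s) \<le> (LINT s|M\<^sub>I. \<Phi> e s)" by (simp add: ennreal_le_iff)
      moreover have "(LINT s|M\<^sub>I. \<Phi> 0 s) = (LINT s|M\<^sub>I. lagrangian w g s)"
        using \<Phi>0 Isp by (intro Bochner_Integration.integral_cong) auto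
      ultimately show "(LINT s|M\<^sub>I. \<Phi> 0 s) \<le> (LINT s|M\<^sub>I. \<Phi> e s)" by simp
    qed (use \<Phi>m \<Phi>0i in auto)
    have \<xi>E: "integrable M\<^sub>I (\<lambda>s. \<xi> s * E s)" by (rule integrable_bounded_mult[OF Ei _ \<xi>(2)]) measurable
    have \<xi>P: "integrable M\<^sub>I (\<lambda>s. \<xi> s * P s)" by (rule integrable_bounded_mult[OF Pi _ \<xi>(2)]) measurable
    have \<xi>1: "integrable M\<^sub>I \<xi>" by (rule integrable_bounded[OF _ \<xi>(2)]) measurable
    have \<eta>T: "integrable M\<^sub>I (\<lambda>s. \<eta> s * T s)"
      by (rule integrable_bounded_mult[OF Ti _ H(2)]) auto
    have "(LINT s|M\<^sub>I. \<eta> s * T s - \<xi> s * E s) = (LINT s|M\<^sub>I. \<Phi>d 0 s)"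
      by (intro Bochner_Integration.integral_cong) (use \<Phi>d0 Isp in \<open>auto simp: mult.commute\<close>)
    then have "0 = (LINT s|M\<^sub>I. \<eta> s * T s - \<xi> s * E s)" using fv by simp
    also have "\<dots> = (LINT s|M\<^sub>I. \<eta> s * T s) - (LINT s|M\<^sub>I. \<xi> s * E s)"
      by (rule Bochner_Integration.integral_diff[OF \<eta>T \<xi>E])
    also have "(LINT s|M\<^sub>I. \<eta> s * T s) = (LINT s|M\<^sub>I. T s * (LINT r:{a<..<s}|lborel. \<xi> r))"
    proof (rule Bochner_Integration.integral_cong[OF refl])
      fix s assume "s \<in> space M\<^sub>I"
      then have "a \<le> s" using Isp[of s] by simp
      then show "\<eta> s * T s = T s * (LINT r:{a<..<s}|lborel. \<xi> r)" by (simp add: \<eta>r)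
    qed
    also have "\<dots> = (LINT r:I|lborel. T r * (LINT s:{a<..<r}|lborel. \<xi> s))"
      by (rule set_integral_MI[symmetric])
    \<comment> \<open>Everything is now tested against \<xi> instead of \<eta>. The total integral
      of \<open>T\<close> is a constant and pairs to 0 with \<xi>, whose mean is 0; what remains is
      \<open>E + P\<close>.\<close>
    also have "\<dots> = (LINT s:I|lborel. \<xi> s * ((LINT r:I|lborel. T r) - P s))"
      unfolding P_def by (rule integral_by_parts_primitive[OF a_less_b Tset \<xi>(1,2)])
    also have "\<dots> = (LINT s|M\<^sub>I. \<xi> s * ((LINT r:I|lborel. T r) - P s))"
      by (rule set_integral_MI)
    also have "\<dots> = (LINT s|M\<^sub>I. (LINT r:I|lborel. T r) * \<xi> s - \<xi> s * P s)"
      by (intro Bochner_Integration.integral_cong refl) (simp add: right_diff_distrib mult.commute)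
    also have "\<dots> = (LINT r:I|lborel. T r) * (LINT s|M\<^sub>I. \<xi> s) - (LINT s|M\<^sub>I. \<xi> s * P s)"
      using \<xi>1 \<xi>P by simp
    also have "(LINT s|M\<^sub>I. \<xi> s) = 0" using \<xi>(3) by (simp add: set_integral_MI)
    finally have "(LINT s|M\<^sub>I. \<xi> s * E s) + (LINT s|M\<^sub>I. \<xi> s * P s) = 0" by simp
    then have "(LINT s|M\<^sub>I. \<xi> s * E s + \<xi> s * P s) = 0"
      using \<xi>E \<xi>P by simp
    also have "(LINT s|M\<^sub>I. \<xi> s * E s + \<xi> s * P s) = (LINT s|M\<^sub>I. (E s + P s) * \<xi> s)"
      by (intro Bochner_Integration.integral_cong refl) (simp add: distrib_left mult.commute)
    also have "\<dots> = (LINT s:I|lborel. (E s + P s) * \<xi> s)"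
      by (rule set_integral_MI[symmetric])
    finally show ?thesis .
  qed
  obtain c where c: "AE r in lborel. r \<in> I \<longrightarrow> E r + P r = c"
  proof (rule du_Bois_Reymond[OF a_less_b, of "\<lambda>r. E r + P r"])
    show "set_integrable lborel I (\<lambda>r. E r + P r)"
      unfolding set_integrable_MI using Ei Pi by simp
  qed (use test that in auto)
  show thesis
  proof (rule that[OF Tset])
    show "AE r in lborel. r \<in> I \<longrightarrow> T r = radial_source r"
      using d_pos unfolding AE_MI by eventually_elim (auto simp: T_def radial_source_def fF)
    show "AE r in lborel. r \<in> I \<longrightarrow> radial_stress r + (LINT s:{a<..<r}|lborel. T s) = c"
      using d_pos c unfolding AE_MI by eventually_elim (auto simp: E_def radial_stress_def P_def fF)
  qed
qed

end

section \<open>Regularity and monotonicity\<close>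

lemma has_vector_derivative_of_AE_continuous:
  fixes f f0 :: "real \<Rightarrow> 'a::euclidean_space"
  assumes diff: "\<And>x y. a < x \<Longrightarrow> x \<le> y \<Longrightarrow> y < b \<Longrightarrow> (LINT r:{x..y}|lborel. f r) = W y - W x"
    and [measurable]: "f \<in> borel_measurable borel" and ae: "AE r in lborel. r \<in> {a<..<b} \<longrightarrow> f r = f0 r"
    and f0: "continuous_on {a<..<b} f0" and r: "r \<in> {a<..<b}"
  shows "(W has_vector_derivative f0 r) (at r)"
proof -
  obtain x where x: "a < x" "x < r" using r dense[of a r] by auto
  obtain y where y: "r < y" "y < b" using r dense[of r b] by auto
  have f0c: "continuous_on {x..y} f0" using f0 by (rule continuous_on_subset) (use x y in auto)
  \<comment> \<open>An integral does not change when the integrand is replaced by its continuous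
    representative, so \<open>W\<close> is also a primitive of \<open>f0\<close>, to which the
    classical fundamental theorem applies.\<close>
  have W: "W s = W x + integral {x..s} f0" if s: "s \<in> {x..y}" for s
  proof -
    have c: "continuous_on {x..s} f0" using f0c by (rule continuous_on_subset) (use s in auto)
    have "W s - W x = (LINT r|lborel. indicator {x..s} r *\<^sub>R f r)"
      using diff[of x s] s x y by (simp add: set_lebesgue_integral_def)
    also have "\<dots> = (LINT r|lborel. indicator {x..s} r *\<^sub>R f0 r)"
    proof (rule integral_cong_AE)
      show "AE r in lborel. indicator {x..s} r *\<^sub>R f r = indicator {x..s} r *\<^sub>R f0 r"
        using ae by eventually_elim (use s x y in \<open>auto split: split_indicator\<close>)
      show "(\<lambda>r. indicator {x..s} r *\<^sub>R f0 r) \<in> borel_measurable lborel"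
        using borel_measurable_continuous_on_indicator[OF _ c] by simp
    qed measurable
    also have "\<dots> = integral {x..s} f0"
      using set_borel_integral_eq_integral(2)[OF borel_integrable_atLeastAtMost'[OF c]]
      by (simp add: set_lebesgue_integral_def)
    finally show ?thesis by (simp add: algebra_simps)
  qed
  have "((\<lambda>s. integral {x..s} f0) has_vector_derivative f0 r) (at r within {x..y})"
    by (rule integral_has_vector_derivative[OF f0c]) (use x y in auto)
  then have "((\<lambda>s. integral {x..s} f0) has_vector_derivative f0 r) (at r)"
    using x y by (simp add: at_within_Icc_at)
  from has_vector_derivative_add[OF has_vector_derivative_const[of "W x" "at r"] this]
  have "((\<lambda>s. W x + integral {x..s} f0) has_vector_derivative f0 r) (at r)" by simp
  then show ?thesis
    by (rule has_vector_derivative_transform_within_open[where S = "{x<..<y}"]) (use x y W[symmetric] in auto)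
qed

lemma set_integrable_primitive:
  fixes T :: "real \<Rightarrow> real"
  assumes T: "set_integrable lborel {a<..<b} T"
  defines "P \<equiv> \<lambda>r. LINT s:{a<..<r}|lborel. T s"
  shows "continuous_on {a<..<b} P"
    and "\<And>x y. a < x \<Longrightarrow> x \<le> y \<Longrightarrow> y < b \<Longrightarrow> (LINT r:{x..y}|lborel. T r) = P y - P x"
proof -
  have int: "T integrable_on {a..y}" if "y \<le> b" for y
  proof -
    have "set_integrable lborel {a<..<y} T" by (rule set_integrable_subset[OF T]) (use that in auto)
    then have "T integrable_on {a<..<y}" by (rule set_borel_integral_eq_integral(1))
    then show ?thesis by (simp add: integrable_on_open_interval_real)
  qed
  have P: "P r = integral {a..r} T" if "r \<le> b" for r
  proof -
    have "set_integrable lborel {a<..<r} T" by (rule set_integrable_subset[OF T]) (use that in auto)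
    then have "P r = integral {a<..<r} T" unfolding P_def by (rule set_borel_integral_eq_integral(2))
    then show ?thesis by (simp add: integral_open_interval_real)
  qed
  have "continuous_on {a..b} (\<lambda>r. integral {a..r} T)"
    by (rule indefinite_integral_continuous_1[OF int]) simp
  then have "continuous_on {a<..<b} (\<lambda>r. integral {a..r} T)" by (rule continuous_on_subset) auto
  then show "continuous_on {a<..<b} P" by (rule continuous_on_eq) (simp add: P)
  fix x y assume xy: "a < x" "x \<le> y" "y < b"
  have "set_integrable lborel {x..y} T" by (rule set_integrable_subset[OF T]) (use xy in auto)
  then have "(LINT r:{x..y}|lborel. T r) = integral {x..y} T" by (rule set_borel_integral_eq_integral(2))
  also have "\<dots> = integral {a..y} T - integral {a..x} T"
    using Henstock_Kurzweil_Integration.integral_combine[of a x y T] int[of y] xy by simp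
  finally show "(LINT r:{x..y}|lborel. T r) = P y - P x" using xy by (simp add: P)
qed

context stored_energy
begin

lemma cont_F: "continuous_on {0<..} F"
  by (intro continuous_at_imp_continuous_on ballI DERIV_isCont[OF diff_F]) auto

text \<open>The quadratic term is strictly increasing on the positive axis and \<open>F\<close>
  nondecreasing; the equation for the determinant thus has at most one positive solution.\<close>

lemma quadratic_plus_F_less_iff:
  assumes "0 < A" "0 < x" "0 < y"
  shows "A * x\<^sup>2 + F x < A * y\<^sup>2 + F y \<longleftrightarrow> x < y"
proof -
  have mono: "A * x\<^sup>2 + F x < A * y\<^sup>2 + F y" if "0 < x" "x < y" for x y
  proof -
    have "A * x\<^sup>2 < A * y\<^sup>2" using assms(1) that by (intro mult_strict_left_mono power_strict_mono) auto
    moreover have "F x \<le> F y" using that by (intro mono_F) auto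
    ultimately show ?thesis by linarith
  qed
  show ?thesis using mono[of x y] mono[of y x] assms by (cases x y rule: linorder_cases) auto
qed

text \<open>The left side falls below any bound near 0 because \<open>F\<close> does, and exceeds
  any bound for large t because of the quadratic term; the intermediate value theorem does the
  rest.\<close>

lemma quadratic_plus_F_surj:
  assumes "0 < A"
  shows "\<exists>t>0. A * t\<^sup>2 + F t = K"
proof -
  obtain t0 where t0: "0 < t0" "F t0 < - \<bar>K\<bar> - A" using F_unbounded_below by blast
  define x where "x = min t0 1"
  have x: "0 < x" "x \<le> t0" "x \<le> 1" using t0 by (auto simp: x_def)
  have "F x \<le> F t0" using x by (intro mono_F) auto
  moreover have "A * x\<^sup>2 \<le> A * 1" using assms x by (intro mult_left_mono) (auto simp: power_le_one)
  ultimately have lo: "A * x\<^sup>2 + F x \<le> K" using t0 by linarith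
  \<comment> \<open>Large enough for A y to absorb |K| and |F 1|, and at least 1, so that y^2 \<ge>
    y and F y \<ge> F 1.\<close>
  define y where "y = 1 + (\<bar>K\<bar> + \<bar>F 1\<bar>) / A"
  have y: "1 \<le> y" using assms by (simp add: y_def)
  have "\<bar>K\<bar> + \<bar>F 1\<bar> \<le> A * y" using assms by (simp add: y_def field_simps)
  also have "\<dots> \<le> A * y\<^sup>2" using assms y self_le_power[of y 2] by simp
  finally have "\<bar>K\<bar> + \<bar>F 1\<bar> \<le> A * y\<^sup>2" .
  moreover have "F 1 \<le> F y" using y by (intro mono_F) auto
  ultimately have hi: "K \<le> A * y\<^sup>2 + F y" by linarith
  have "\<exists>t. x \<le> t \<and> t \<le> y \<and> A * t\<^sup>2 + F t = K"
  proof (rule IVT')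
    show "continuous_on {x..y} (\<lambda>t. A * t\<^sup>2 + F t)"
      by (intro continuous_intros continuous_on_subset[OF cont_F]) (use x in auto)
  qed (use lo hi x y in auto)
  then obtain t where "x \<le> t" "A * t\<^sup>2 + F t = K" by blast
  then show ?thesis using x by (intro exI[of _ t]) auto
qed

text \<open>For fixed t the sign of A t^2 + F t - K tells on which side of t the solution lies. A
  nonzero sign persists for nearby coefficients, which traps the solution between any two numbers
  around \<delta>.\<close>

lemma quadratic_plus_F_solution_tendsto:
  assumes sol: "\<forall>\<^sub>F s in G. 0 < A s \<and> 0 < D s \<and> A s * (D s)\<^sup>2 + F (D s) = K s"
    and lim: "(A \<longlongrightarrow> \<alpha>) G" "(K \<longlongrightarrow> \<kappa>) G" and \<alpha>: "0 < \<alpha>" and \<delta>: "0 < \<delta>" "\<alpha> * \<delta>\<^sup>2 + F \<delta> = \<kappa>"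
  shows "(D \<longlongrightarrow> \<delta>) G"
proof (rule order_tendstoI)
  have ev: "\<forall>\<^sub>F s in G. D s \<noteq> t \<and> (D s < t \<longleftrightarrow> \<delta> < t)" if t: "0 < t" "t \<noteq> \<delta>" for t
  proof -
    have lim': "((\<lambda>s. A s * t\<^sup>2 + F t - K s) \<longlongrightarrow> \<alpha> * t\<^sup>2 + F t - \<kappa>) G"
      by (intro tendsto_intros lim)
    show ?thesis
    proof (cases "\<delta> < t")
      case True
      then have "0 < \<alpha> * t\<^sup>2 + F t - \<kappa>" using quadratic_plus_F_less_iff[OF \<alpha> \<delta>(1) t(1)] \<delta>(2) by simp
      from order_tendstoD(1)[OF lim' this] sol show ?thesis
      proof eventually_elim
        case (elim s)
        then have "D s < t" using quadratic_plus_F_less_iff[of "A s" "D s" t] t by simp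
        then show ?case using True by simp
      qed
    next
      case False
      then have "\<alpha> * t\<^sup>2 + F t - \<kappa> < 0" using quadratic_plus_F_less_iff[OF \<alpha> t(1) \<delta>(1)] \<delta>(2) t by simp
      from order_tendstoD(2)[OF lim' this] sol show ?thesis
      proof eventually_elim
        case (elim s)
        then have "t < D s" using quadratic_plus_F_less_iff[of "A s" t "D s"] t by simp
        then show ?case using False by simp
      qed
    qed
  qed
  fix t
  show "\<forall>\<^sub>F s in G. D s < t" if "\<delta> < t"
    using ev[of t] that \<delta>(1) by (auto elim: eventually_mono)
  show "\<forall>\<^sub>F s in G. t < D s" if "t < \<delta>"
  proof (cases "0 < t")
    case True
    then show ?thesis using ev[of t] that by (auto elim!: eventually_mono)
  next
    case False
    then show ?thesis using sol by (auto elim!: eventually_mono)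
  qed
qed

text \<open>Implicit differentiation at one point, with Caratheodory slopes in place of derivatives:
  the coefficients are assumed differentiable only at r itself. The denominator is positive because
  2 A D > 0 and the second derivative of \<open>hr\<close> is nonnegative.\<close>

lemma quadratic_plus_F_solution_derivative:
  assumes S: "open S" "r \<in> S" and sol: "\<And>s. s \<in> S \<Longrightarrow> 0 < A s \<and> 0 < D s \<and> A s * (D s)\<^sup>2 + F (D s) = K s"
    and A: "(A has_real_derivative A') (at r)" and K: "(K has_real_derivative K') (at r)"
  shows "(D has_real_derivative (K' - A' * (D r)\<^sup>2) / (2 * A r * D r + D r * h'' (D r))) (at r)"
proof -
  have r: "0 < A r" "0 < D r" "A r * (D r)\<^sup>2 + F (D r) = K r" using sol[OF S(2)] by auto
  have evS: "\<forall>\<^sub>F s in at r. s \<in> S" by (rule eventually_at_in_open'[OF S])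
  have evs: "\<forall>\<^sub>F s in at r. 0 < A s \<and> 0 < D s \<and> A s * (D s)\<^sup>2 + F (D s) = K s"
    using evS by eventually_elim (rule sol)
  have D: "(D \<longlongrightarrow> D r) (at r)"
    using DERIV_isCont[OF A] DERIV_isCont[OF K] r
    by (intro quadratic_plus_F_solution_tendsto[OF evs]) (auto simp: isCont_def)
  obtain \<alpha> where \<alpha>: "\<And>s. A s - A r = \<alpha> s * (s - r)" "isCont \<alpha> r" "\<alpha> r = A'"
    using A unfolding CARAT_DERIV by blast
  obtain \<kappa> where \<kappa>: "\<And>s. K s - K r = \<kappa> s * (s - r)" "isCont \<kappa> r" "\<kappa> r = K'"
    using K unfolding CARAT_DERIV by blast
  obtain \<phi> where \<phi>: "\<And>t. F t - F (D r) = \<phi> t * (t - D r)" "isCont \<phi> (D r)" "\<phi> (D r) = D r * h'' (D r)"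
    using diff_F[OF r(2)] unfolding CARAT_DERIV by blast
  \<comment> \<open>Subtracting the equations at s and r and factoring out D s - D r leaves this
    quotient, whose limit is the denominator of the formula.\<close>
  define den where "den s = A r * (D s + D r) + \<phi> (D s)" for s
  have denlim: "(den \<longlongrightarrow> A r * (D r + D r) + D r * h'' (D r)) (at r)"
    unfolding den_def using isCont_tendsto_compose[OF \<phi>(2) D] \<phi>(3) by (intro tendsto_intros D) simp
  have pos: "0 < A r * (D r + D r) + D r * h'' (D r)"
    using r h''_nonneg[OF r(2)] by (intro add_pos_nonneg) auto
  have "((\<lambda>s. (\<kappa> s - \<alpha> s * (D s)\<^sup>2) / den s) \<longlongrightarrow> (K' - A' * (D r)\<^sup>2) / (A r * (D r + D r) + D r * h'' (D r))) (at r)"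
    using \<alpha>(2,3) \<kappa>(2,3) pos by (intro tendsto_intros D denlim) (auto simp: isCont_def)
  moreover have "\<forall>\<^sub>F s in at r. (\<kappa> s - \<alpha> s * (D s)\<^sup>2) / den s = (D s - D r) / (s - r)"
    using order_tendstoD(1)[OF denlim pos] evs eventually_neq_at_within[of r r UNIV]
  proof eventually_elim
    case (elim s)
    have "(D s - D r) * den s = (K s - K r) - (A s - A r) * (D s)\<^sup>2"
      unfolding den_def using r(3) elim \<phi>(1)[of "D s"] by (simp add: algebra_simps power2_eq_square)
    also have "\<dots> = (\<kappa> s - \<alpha> s * (D s)\<^sup>2) * (s - r)"
      unfolding \<alpha> \<kappa> by (simp add: algebra_simps)
    finally show ?case using elim by (simp add: frac_eq_eq)
  qed
  ultimately have "((\<lambda>s. (D s - D r) / (s - r)) \<longlongrightarrow> (K' - A' * (D r)\<^sup>2) / (A r * (D r + D r) + D r * h'' (D r))) (at r)"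
    by (rule Lim_transform_eventually)
  then show ?thesis unfolding has_field_derivative_iff by (simp add: algebra_simps)
qed

end

section \<open>Regularity of the minimal curve and monotonicity\<close>

context radial_minimizer
begin

text \<open>\<open>D\<close> and \<open>g0\<close> are built at every radius from continuous
  coefficients alone, so no null set enters their construction; uniqueness of the solution
  identifies them with \<open>d\<close> and \<open>g\<close> almost everywhere. The function
  \<open>e\<close> is obtained as (c - P)/r, which is differentiable although \<open>g0\<close> is
  so far only continuous.\<close>

lemma minimizer_regular:
  obtains g0 D \<omega> e where "\<And>r. r \<in> I \<Longrightarrow> (w has_vector_derivative g0 r) (at r)" "continuous_on I g0"
    "\<And>r. r \<in> I \<Longrightarrow> 0 < D r" "\<And>r. r \<in> I \<Longrightarrow> cnj (w r) * g0 r = Complex (r * D r) (\<omega> / r)"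
    "\<And>r. r \<in> I \<Longrightarrow> e r = 1/2 * (norm (g0 r))\<^sup>2 - (norm (w r))\<^sup>2 / (2 * r\<^sup>2) + F (D r)"
    "\<And>r. r \<in> I \<Longrightarrow> (e has_real_derivative - ((norm (g0 r))\<^sup>2 - (norm (w r))\<^sup>2 / r\<^sup>2) / r) (at r)"
proof -
  obtain \<omega> where \<omega>: "AE r in lborel. r \<in> I \<longrightarrow> r * m r = \<omega>"
    by (rule angular_momentum_constant) (rule that)
  obtain T c where T: "set_integrable lborel I T" "AE r in lborel. r \<in> I \<longrightarrow> T r = radial_source r"
    "AE r in lborel. r \<in> I \<longrightarrow> radial_stress r + (LINT s:{a<..<r}|lborel. T s) = c"
    by (rule inner_variation_equation) (rule that)
  define P where "P r = (LINT s:{a<..<r}|lborel. T s)" for r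
  have Pc: "continuous_on I P" and Pd: "\<And>x y. a < x \<Longrightarrow> x \<le> y \<Longrightarrow> y < b \<Longrightarrow> (LINT r:{x..y}|lborel. T r) = P y - P x"
    using set_integrable_primitive[OF T(1)] by (simp_all add: P_def[abs_def])
  have r0: "0 < r" "w r \<noteq> 0" "0 < (norm (w r))\<^sup>2" if "r \<in> I" for r
    using that a_pos w_nz[of r] by auto
  have nz: "r \<noteq> 0" if "r \<in> I" for r using r0[OF that] by simp
  have wc: "continuous_on I w" using w_cont by (rule continuous_on_subset) simp
  \<comment> \<open>The coefficients result from |g|^2 = ((r d)^2 + (\<omega>/r)^2) / |w|^2 inserted
    into the integrated balance law: \<open>A\<close> multiplies d^2 and all other terms go into
    \<open>K\<close>.\<close>
  define A where "A r = r\<^sup>2 / (2 * (norm (w r))\<^sup>2)" for r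
  define K where "K r = (c - P r) / r + (norm (w r))\<^sup>2 / (2 * r\<^sup>2) - \<omega>\<^sup>2 / (2 * r\<^sup>2 * (norm (w r))\<^sup>2)" for r
  have Apos: "0 < A r" if "r \<in> I" for r using r0[OF that] by (simp add: A_def)
  have Ac: "continuous_on I A" unfolding A_def by (intro continuous_intros wc ballI) (use r0 in auto)
  have Kc: "continuous_on I K" unfolding K_def by (intro continuous_intros wc Pc ballI) (use r0 nz in \<open>simp_all del: greaterThanLessThan_iff\<close>)
  have "\<exists>D. \<forall>r\<in>I. 0 < D r \<and> A r * (D r)\<^sup>2 + F (D r) = K r"
    by (rule bchoice) (use quadratic_plus_F_surj Apos in blast)
  then obtain D where D: "\<And>r. r \<in> I \<Longrightarrow> 0 < D r \<and> A r * (D r)\<^sup>2 + F (D r) = K r" by blast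
  have Dc: "continuous_on I D"
    unfolding continuous_on_def
  proof
    fix r assume r: "r \<in> I"
    show "(D \<longlongrightarrow> D r) (at r within I)"
    proof (rule quadratic_plus_F_solution_tendsto[of A D K])
      show "\<forall>\<^sub>F s in at r within I. 0 < A s \<and> 0 < D s \<and> A s * (D s)\<^sup>2 + F (D s) = K s"
        unfolding eventually_at_filter using D Apos by (auto intro!: always_eventually)
      show "(A \<longlongrightarrow> A r) (at r within I)" "(K \<longlongrightarrow> K r) (at r within I)"
        using Ac Kc r by (auto simp: continuous_on_def)
    qed (use Apos D r in auto)
  qed
  \<comment> \<open>The real and imaginary parts of \<open>cnj w * g\<close> are known, namely r D
    and \<omega>/r; dividing by cnj w, which does not vanish, recovers the derivative.\<close>
  define g0 where "g0 r = Complex (r * D r) (\<omega> / r) * w r / of_real ((norm (w r))\<^sup>2)" for r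
  have g0c: "continuous_on I g0"
  proof -
    have "continuous_on I (\<lambda>r. (of_real (r * D r) + \<i> * of_real (\<omega> / r)) * w r / of_real ((norm (w r))\<^sup>2))"
      by (intro continuous_intros wc Dc ballI) (use r0 nz in \<open>simp_all del: greaterThanLessThan_iff\<close>)
    then show ?thesis by (simp add: g0_def[abs_def] Complex_eq)
  qed
  have cg0: "cnj (w r) * g0 r = Complex (r * D r) (\<omega> / r)" if "r \<in> I" for r
  proof -
    have "cnj (w r) * g0 r = Complex (r * D r) (\<omega> / r) * (w r * cnj (w r)) / of_real ((norm (w r))\<^sup>2)"
      by (simp add: g0_def)
    also have "w r * cnj (w r) = of_real ((norm (w r))\<^sup>2)" by (simp only: complex_norm_square)
    finally show ?thesis using r0(3)[OF that] by simp
  qed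
  have ng: "(norm k)\<^sup>2 = ((Re (cnj (w r) * k))\<^sup>2 + (Im (cnj (w r) * k))\<^sup>2) / (norm (w r))\<^sup>2" if "r \<in> I" for r k
    using r0(3)[OF that] unfolding cmod_power2[of "cnj (w r) * k", symmetric]
    by (simp add: norm_mult power_mult_distrib)
  have eg: "1/2 * (norm (g0 r))\<^sup>2 - (norm (w r))\<^sup>2 / (2 * r\<^sup>2) + F (D r) = (c - P r) / r" if "r \<in> I" for r
  proof -
    have "1/2 * (norm (g0 r))\<^sup>2 = A r * (D r)\<^sup>2 + \<omega>\<^sup>2 / (2 * r\<^sup>2 * (norm (w r))\<^sup>2)"
      unfolding ng[OF that, of "g0 r"] cg0[OF that] A_def using r0[OF that] by (simp add: field_simps power2_eq_square)
    then show ?thesis using D[OF that] unfolding K_def by linarith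
  qed
  have ae: "AE r in lborel. r \<in> I \<longrightarrow> d r = D r \<and> g r = g0 r"
    using q_pos \<omega> T(3)
  proof (eventually_elim, intro impI)
    case (elim r)
    assume r: "r \<in> I"
    have q: "0 < q r" and mr: "m r = \<omega> / r" and st: "radial_stress r + P r = c"
      using elim r r0(1)[OF r] by (auto simp: P_def field_simps)
    have dr: "0 < d r" "q r = r * d r" using q r0(1)[OF r] by (auto simp: d_def)
    have "(norm (g r))\<^sup>2 = ((r * d r)\<^sup>2 + (\<omega> / r)\<^sup>2) / (norm (w r))\<^sup>2"
      unfolding ng[OF r, of "g r"] q_def[symmetric] m_def[symmetric] dr(2) mr ..
    then have "1/2 * (norm (g r))\<^sup>2 = A r * (d r)\<^sup>2 + \<omega>\<^sup>2 / (2 * r\<^sup>2 * (norm (w r))\<^sup>2)"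
      unfolding A_def using r0[OF r] by (simp add: field_simps power2_eq_square)
    moreover have "1/2 * (norm (g r))\<^sup>2 - (norm (w r))\<^sup>2 / (2 * r\<^sup>2) + F (d r) = (c - P r) / r"
      using st r0(1)[OF r] by (simp add: radial_stress_def field_simps)
    ultimately have "A r * (d r)\<^sup>2 + F (d r) = K r" unfolding K_def by linarith
    then have dD: "d r = D r"
      using quadratic_plus_F_less_iff[OF Apos[OF r], of "d r" "D r"] quadratic_plus_F_less_iff[OF Apos[OF r], of "D r" "d r"] D[OF r] dr
      by (cases "d r" "D r" rule: linorder_cases) auto
    have "cnj (w r) * g r = Complex (q r) (m r)" by (simp add: complex_eq_iff q_def m_def)
    also have "\<dots> = cnj (w r) * g0 r" unfolding cg0[OF r] dr(2) mr dD ..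
    finally have "g r = g0 r" using r0(2)[OF r] by simp
    with dD show "d r = D r \<and> g r = g0 r" ..
  qed
  have wd: "(w has_vector_derivative g0 r) (at r)" if "r \<in> I" for r
  proof (rule has_vector_derivative_of_AE_continuous[OF _ g_meas _ g0c that])
    show "(LINT r:{x..y}|lborel. g r) = w y - w x" if "a < x" "x \<le> y" "y < b" for x y
      by (rule sobolev_curve_integrable(3)[OF curve]) (use that in auto)
    show "AE r in lborel. r \<in> I \<longrightarrow> g r = g0 r" using ae by eventually_elim auto
  qed
  define t0 where "t0 r = 1/2 * (norm (g0 r))\<^sup>2 - (norm (w r))\<^sup>2 / (2 * r\<^sup>2) - F (D r)" for r
  have FDc: "continuous_on I (\<lambda>r. F (D r))"
    by (rule continuous_on_compose2[OF cont_F Dc]) (use D in auto)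
  have t0c: "continuous_on I t0" unfolding t0_def[abs_def]
    by (intro continuous_intros FDc g0c wc ballI) (use nz in \<open>simp_all del: greaterThanLessThan_iff\<close>)
  have Pder: "(P has_real_derivative t0 r) (at r)" if r: "r \<in> I" for r
  proof -
    \<comment> \<open>Integrability of \<open>T\<close> on the interval gives measurability only
      after multiplication by the indicator.\<close>
    define T' where "T' r = indicator I r * T r" for r
    have TT: "AE r in lborel. r \<in> I \<longrightarrow> T' r = t0 r"
      using T(2) ae by eventually_elim (auto simp: T'_def radial_source_def t0_def)
    show ?thesis unfolding has_real_derivative_iff_has_vector_derivative
    proof (rule has_vector_derivative_of_AE_continuous[OF _ _ TT t0c r])
      show "T' \<in> borel_measurable borel"
        using T(1) by (auto simp: T'_def[abs_def] set_integrable_def)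
      fix x y assume xy: "a < x" "x \<le> y" "y < b"
      have "(LINT r:{x..y}|lborel. T' r) = (LINT r:{x..y}|lborel. T r)"
        by (rule set_lebesgue_integral_cong) (use xy in \<open>auto simp: T'_def\<close>)
      then show "(LINT r:{x..y}|lborel. T' r) = P y - P x" using Pd[OF xy] by simp
    qed
  qed
  show thesis
  proof (rule that[OF wd g0c _ cg0])
    fix r assume r: "r \<in> I"
    show "0 < D r" using D[OF r] by simp
    show e: "(\<lambda>r. (c - P r) / r) r = 1/2 * (norm (g0 r))\<^sup>2 - (norm (w r))\<^sup>2 / (2 * r\<^sup>2) + F (D r)"
      using eg[OF r] by simp
    have "((\<lambda>r. (c - P r) / r) has_real_derivative ((- t0 r) * r - (c - P r) * 1) / (r * r)) (at r)"
      using r0[OF r] by (auto intro!: derivative_eq_intros Pder[OF r])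
    also have "((- t0 r) * r - (c - P r) * 1) / (r * r) = - (t0 r + (c - P r) / r) / r"
      using r0[OF r] by (simp add: field_simps)
    also have "t0 r + (c - P r) / r = (norm (g0 r))\<^sup>2 - (norm (w r))\<^sup>2 / r\<^sup>2"
      unfolding eg[OF r, symmetric] t0_def by (simp add: field_simps)
    finally show "((\<lambda>r. (c - P r) / r) has_real_derivative - ((norm (g0 r))\<^sup>2 - (norm (w r))\<^sup>2 / r\<^sup>2) / r) (at r)" .
  qed
qed

lemma minimizer_monotone:
  assumes "N \<noteq> 0"
  obtains g0 where "\<And>r. r \<in> I \<Longrightarrow> (w has_vector_derivative g0 r) (at r)" "continuous_on I g0"
    "\<And>r. r \<in> I \<Longrightarrow> 0 < Re (cnj (w r) * g0 r) / r"
    "strict_mono_on I (\<lambda>r. Re (cnj (w r) * g0 r) / r)"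
    "strict_antimono_on I (\<lambda>r. 1/2 * ((norm (g0 r))\<^sup>2 + (norm (w r))\<^sup>2 / r\<^sup>2) + F (Re (cnj (w r) * g0 r) / r))"
proof -
  obtain g0 D \<omega> e where wd: "\<And>r. r \<in> I \<Longrightarrow> (w has_vector_derivative g0 r) (at r)" and g0c: "continuous_on I g0"
    and Dpos: "\<And>r. r \<in> I \<Longrightarrow> 0 < D r" and cg0: "\<And>r. r \<in> I \<Longrightarrow> cnj (w r) * g0 r = Complex (r * D r) (\<omega> / r)"
    and e: "\<And>r. r \<in> I \<Longrightarrow> e r = 1/2 * (norm (g0 r))\<^sup>2 - (norm (w r))\<^sup>2 / (2 * r\<^sup>2) + F (D r)"
    and ed: "\<And>r. r \<in> I \<Longrightarrow> (e has_real_derivative - ((norm (g0 r))\<^sup>2 - (norm (w r))\<^sup>2 / r\<^sup>2) / r) (at r)"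
    by (rule minimizer_regular) (rule that)
  define R where "R r = (norm (w r))\<^sup>2" for r
  have r0: "0 < r" "w r \<noteq> 0" "0 < R r" if "r \<in> I" for r
    using that a_pos w_nz[of r] by (auto simp: R_def)
  have dD: "Re (cnj (w r) * g0 r) / r = D r" if "r \<in> I" for r
    unfolding cg0[OF that] using r0[OF that] by simp
  have ng: "(norm (g0 r))\<^sup>2 = (r\<^sup>2 * (D r)\<^sup>2 + \<omega>\<^sup>2 / r\<^sup>2) / R r" if "r \<in> I" for r
  proof -
    have "(norm (cnj (w r) * g0 r))\<^sup>2 = (r * D r)\<^sup>2 + (\<omega> / r)\<^sup>2" unfolding cg0[OF that] by (simp add: cmod_power2)
    then show ?thesis using r0[OF that] by (simp add: norm_mult power_mult_distrib power_divide field_simps R_def)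
  qed
  have Rd: "(R has_real_derivative 2 * (r * D r)) (at r)" if r: "r \<in> I" for r
  proof -
    have "((\<lambda>r. (w r) \<bullet> (w r)) has_vector_derivative w r \<bullet> g0 r + g0 r \<bullet> w r) (at r)"
      by (rule bounded_bilinear.has_vector_derivative[OF bounded_bilinear_inner wd[OF r] wd[OF r]])
    moreover have "w r \<bullet> g0 r = Re (cnj (w r) * g0 r)" by (simp add: inner_complex_def)
    ultimately show ?thesis
      unfolding has_real_derivative_iff_has_vector_derivative R_def[abs_def] power2_norm_eq_inner
      by (simp add: inner_commute cg0[OF r])
  qed
  \<comment> \<open>Without angular momentum the derivative is a real multiple of \<open>w\<close>,
    so w/|w| has derivative 0 and is constant up to the ends. Its winding number is then 0,
    contradicting \<open>N \<noteq> 0\<close>.\<close>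
  have \<omega>: "\<omega> \<noteq> 0"
  proof
    assume \<omega>0: "\<omega> = 0"
    have sd: "((\<lambda>r. w r / of_real (sqrt (R r))) has_vector_derivative 0) (at r)" if r: "r \<in> I" for r
    proof -
      have "cnj (w r) * (of_real (R r) * g0 r - of_real (r * D r) * w r) =
          of_real (R r) * (cnj (w r) * g0 r) - of_real (r * D r) * (w r * cnj (w r))" by (simp add: algebra_simps)
      also have "w r * cnj (w r) = of_real (R r)" unfolding R_def by (simp only: complex_norm_square)
      also have "cnj (w r) * g0 r = of_real (r * D r)" unfolding cg0[OF r] \<omega>0 by (simp add: complex_eq_iff)
      finally have wg: "of_real (R r) * g0 r = of_real (r * D r) * w r" using r0[OF r] by simp
      have sq: "((\<lambda>r. sqrt (R r)) has_real_derivative r * D r / sqrt (R r)) (at r)"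
        using DERIV_chain2[OF DERIV_real_sqrt[OF r0(3)[OF r]] Rd[OF r]] by (simp add: field_simps)
      have "((\<lambda>r. inverse (sqrt (R r))) has_real_derivative - (r * D r / sqrt (R r)) / (sqrt (R r))\<^sup>2) (at r)"
        using DERIV_inverse'[OF sq] r0[OF r] by (simp add: power2_eq_square field_simps)
      from has_vector_derivative_scaleR[OF this wd[OF r]]
      have *: "((\<lambda>r. inverse (sqrt (R r)) *\<^sub>R w r) has_vector_derivative
         (inverse (sqrt (R r)) *\<^sub>R g0 r + (- (r * D r / sqrt (R r)) / (sqrt (R r))\<^sup>2) *\<^sub>R w r)) (at r)" .
      have "inverse (sqrt (R r)) *\<^sub>R g0 r + (- (r * D r / sqrt (R r)) / (sqrt (R r))\<^sup>2) *\<^sub>R w r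
          = inverse (sqrt (R r) * R r) *\<^sub>R (of_real (R r) * g0 r - of_real (r * D r) * w r)"
        using r0[OF r] by (simp add: scaleR_conv_of_real field_simps)
      then have "inverse (sqrt (R r)) *\<^sub>R g0 r + (- (r * D r / sqrt (R r)) / (sqrt (R r))\<^sup>2) *\<^sub>R w r = 0"
        unfolding wg by simp
      with * show ?thesis by (simp add: scaleR_conv_of_real field_simps)
    qed
    have sgn: "w r / of_real (sqrt (R r)) = sgn (w r)" for r
      by (simp add: R_def sgn_div_norm scaleR_conv_of_real field_simps)
    have sc: "continuous_on {a..b} (\<lambda>r. sgn (w r))"
      using w_nz by (intro continuous_intros continuous_on_subset[OF w_cont]) auto
    have "sgn (w r) = sgn (w a)" if "r \<in> {a..b}" for r
    proof (rule has_derivative_zero_unique_strong_interval[of "{a,b}" a b "\<lambda>r. sgn (w r)" "sgn (w a)" r])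
      fix r assume "r \<in> {a..b} - {a, b}"
      then have "r \<in> I" by auto
      from sd[OF this] show "((\<lambda>r. sgn (w r)) has_derivative (\<lambda>h. 0)) (at r within {a..b})"
        unfolding sgn has_vector_derivative_def by (auto intro: has_derivative_at_withinI)
    qed (use sc that in auto)
    then have "winding_number (\<lambda>t. sgn (w (linepath a b t))) 0 = winding_number (linepath (sgn (w a)) (sgn (w a))) 0"
      using linepath_Icc[OF a_less_b] by (intro winding_number_cong) auto
    also have "\<dots> = 0" using w_nz[of a] a_less_b by (simp add: sgn_zero_iff)
    finally show False using winding assms by (simp add: curve_winding_def)
  qed
  \<comment> \<open>This is |g0 - w/r|^2 expanded, since Re (cnj w g0) / r = D.\<close>
  define S where "S r = (norm (g0 r))\<^sup>2 - 2 * D r + R r / r\<^sup>2" for r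
  have Spos: "0 < S r" if r: "r \<in> I" for r
  proof -
    \<comment> \<open>The second square carries \<omega>^2, so \<open>S\<close> stays positive even
      where r^2 D equals |w|^2; this is the only source of strictness.\<close>
    have "S r = (r\<^sup>2 * D r - R r)\<^sup>2 / (r\<^sup>2 * R r) + \<omega>\<^sup>2 / (r\<^sup>2 * R r)"
      unfolding S_def ng[OF r] using r0[OF r] by (simp add: field_simps power2_eq_square)
    moreover have "0 < \<omega>\<^sup>2 / (r\<^sup>2 * R r)" using r0[OF r] \<omega> by simp
    ultimately show ?thesis using r0[OF r] by (simp add: add_nonneg_pos)
  qed
  have Rr: "((\<lambda>r. R r / r\<^sup>2) has_real_derivative 2 * D r / r - 2 * R r / r^3) (at r)" if r: "r \<in> I" for r
    using r0[OF r] by (auto intro!: derivative_eq_intros Rd[OF r] simp: field_simps power2_eq_square power3_eq_cube)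
  \<comment> \<open>\<open>e\<close> and the quantity of the theorem differ only in the sign of
    |w|^2 / (2 r^2), so adding |w|^2 / r^2 turns one into the other.\<close>
  define z where "z r = e r + R r / r\<^sup>2" for r
  have zd: "(z has_real_derivative - S r / r) (at r)" if r: "r \<in> I" for r
  proof -
    have "(z has_real_derivative - ((norm (g0 r))\<^sup>2 - (norm (w r))\<^sup>2 / r\<^sup>2) / r + (2 * D r / r - 2 * R r / r^3)) (at r)"
      unfolding z_def[abs_def] by (intro DERIV_add ed[OF r] Rr[OF r])
    also have "- ((norm (g0 r))\<^sup>2 - (norm (w r))\<^sup>2 / r\<^sup>2) / r + (2 * D r / r - 2 * R r / r^3) = - S r / r"
      using r0[OF r] by (simp add: S_def R_def field_simps power2_eq_square power3_eq_cube)
    finally show ?thesis .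
  qed
  \<comment> \<open>The coefficients of the regularity argument again, with the integral expressed
    through \<open>e\<close>. Now they are differentiable, because \<open>w\<close> and
    \<open>e\<close> are.\<close>
  define A where "A r = r\<^sup>2 / (2 * R r)" for r
  define K where "K r = e r + R r / (2 * r\<^sup>2) - \<omega>\<^sup>2 / (2 * r\<^sup>2 * R r)" for r
  have sol: "0 < A r \<and> 0 < D r \<and> A r * (D r)\<^sup>2 + F (D r) = K r" if r: "r \<in> I" for r
    using r0[OF r] Dpos[OF r] unfolding A_def K_def e[OF r] ng[OF r] R_def[symmetric] by (simp add: field_simps)
  have Dd: "\<exists>y. (D has_real_derivative y) (at r) \<and> 0 < y" if r: "r \<in> I" for r
  proof -
    have Ad: "(A has_real_derivative r / R r - r^3 * D r / (R r)\<^sup>2) (at r)"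
      unfolding A_def[abs_def] using r0[OF r]
      by (auto intro!: derivative_eq_intros Rd[OF r] simp: field_simps power2_eq_square power3_eq_cube)
    have "((\<lambda>r. R r / (2 * r\<^sup>2)) has_real_derivative D r / r - R r / r^3) (at r)"
      using DERIV_cdivide[OF Rr[OF r], of 2] by (simp add: diff_divide_distrib mult.commute)
    moreover have "((\<lambda>r. \<omega>\<^sup>2 / (2 * r\<^sup>2 * R r)) has_real_derivative - (\<omega>\<^sup>2 / (r^3 * R r)) - \<omega>\<^sup>2 * D r / (r * (R r)\<^sup>2)) (at r)"
      using r0[OF r]
      by (auto intro!: derivative_eq_intros Rd[OF r] simp: field_simps power2_eq_square power3_eq_cube)
    ultimately have Kd: "(K has_real_derivative - ((norm (g0 r))\<^sup>2 - (norm (w r))\<^sup>2 / r\<^sup>2) / r + (D r / r - R r / r^3)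
        - (- (\<omega>\<^sup>2 / (r^3 * R r)) - \<omega>\<^sup>2 * D r / (r * (R r)\<^sup>2))) (at r)"
      unfolding K_def[abs_def] by (intro DERIV_add DERIV_diff ed[OF r])
    \<comment> \<open>The numerator of the derivative of \<open>D\<close> collapses to a positive
      multiple of \<open>S\<close>; every other quantity cancels once |g0|^2 is written through D
      and \<omega>.\<close>
    have eq: "- ((norm (g0 r))\<^sup>2 - (norm (w r))\<^sup>2 / r\<^sup>2) / r + (D r / r - R r / r^3)
        - (- (\<omega>\<^sup>2 / (r^3 * R r)) - \<omega>\<^sup>2 * D r / (r * (R r)\<^sup>2)) - (r / R r - r^3 * D r / (R r)\<^sup>2) * (D r)\<^sup>2 = r * D r / R r * S r"
      unfolding S_def ng[OF r] R_def[symmetric] using r0[OF r] by (simp add: field_simps power2_eq_square power3_eq_cube)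
    have num: "0 < r * D r / R r * S r" using r0[OF r] Spos[OF r] Dpos[OF r] by simp
    have den: "0 < 2 * A r * D r + D r * h'' (D r)"
      using sol[OF r] h''_nonneg[of "D r"] by (intro add_pos_nonneg) auto
    show ?thesis
      using quadratic_plus_F_solution_derivative[OF open_greaterThanLessThan r sol Ad Kd, unfolded eq] divide_pos_pos[OF num den]
      by blast
  qed
  show thesis
  proof (rule that[OF wd g0c])
    show "0 < Re (cnj (w r) * g0 r) / r" if "r \<in> I" for r unfolding dD[OF that] by (rule Dpos[OF that])
    show "strict_mono_on I (\<lambda>r. Re (cnj (w r) * g0 r) / r)"
    proof (rule strict_mono_onI)
      fix r s assume rs: "r \<in> I" "s \<in> I" "r < s"
      have "D r < D s" by (rule DERIV_pos_imp_increasing[OF rs(3)]) (rule Dd, use rs in auto)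
      then show "Re (cnj (w r) * g0 r) / r < Re (cnj (w s) * g0 s) / s" unfolding dD[OF rs(1)] dD[OF rs(2)] .
    qed
    have zz: "1/2 * ((norm (g0 r))\<^sup>2 + (norm (w r))\<^sup>2 / r\<^sup>2) + F (Re (cnj (w r) * g0 r) / r) = z r" if "r \<in> I" for r
      unfolding dD[OF that] z_def e[OF that] R_def by simp
    show "strict_antimono_on I (\<lambda>r. 1/2 * ((norm (g0 r))\<^sup>2 + (norm (w r))\<^sup>2 / r\<^sup>2) + F (Re (cnj (w r) * g0 r) / r))"
    proof (rule monotone_onI)
      fix r s assume rs: "r \<in> I" "s \<in> I" "r < s"
      have "z s < z r"
        by (rule DERIV_neg_imp_decreasing[OF rs(3)], rule exI, rule conjI, rule zd) (use rs Spos r0 in auto)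
      then show "1/2 * ((norm (g0 s))\<^sup>2 + (norm (w s))\<^sup>2 / s\<^sup>2) + F (Re (cnj (w s) * g0 s) / s) <
         1/2 * ((norm (g0 r))\<^sup>2 + (norm (w r))\<^sup>2 / r\<^sup>2) + F (Re (cnj (w r) * g0 r) / r)"
        unfolding zz[OF rs(1)] zz[OF rs(2)] .
    qed
  qed
qed

end

section \<open>A competitor of finite energy, and the conclusion\<close>

lemma curve_winding_spiral:
  assumes "0 < a" "a < b"
  shows "curve_winding a b (\<lambda>r. of_real r * cis (2 * pi * of_int N * (r - a) / (b - a))) N"
proof -
  let ?w = "\<lambda>r. of_real r * cis (2 * pi * of_int N * (r - a) / (b - a))"
  \<comment> \<open>On the unit circle the spiral is the exponential of a segment from 0 to 2 pi i
    N; its winding number is read off from the ends of the segment.\<close>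
  let ?p = "linepath 0 (2 * of_real pi * \<i> * of_int N)"
  have sgn: "sgn (?w (linepath a b t)) = (exp \<circ> ?p) t" if "0 \<le> t" "t \<le> 1" for t
  proof -
    have "0 < linepath a b t" using linepath_Icc[OF assms(2), of t] that assms by auto
    then have "sgn (?w (linepath a b t)) = cis (2 * pi * of_int N * (linepath a b t - a) / (b - a))"
      by (simp add: sgn_mult sgn_of_real)
    also have "\<dots> = cis (2 * pi * of_int N * t)"
    proof -
      have "(linepath a b t - a) / (b - a) = t" using assms by (simp add: linepath_def field_simps)
      then show ?thesis by (simp only: times_divide_eq_right[symmetric])
    qed
    also have "\<dots> = (exp \<circ> ?p) t"
      by (simp add: cis_conv_exp linepath_def algebra_simps scaleR_conv_of_real)
    finally show ?thesis .
  qed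
  have "winding_number (\<lambda>t. sgn (?w (linepath a b t))) 0 = winding_number (exp \<circ> ?p) 0"
    by (rule winding_number_cong) (rule sgn)
  also have "\<dots> = of_int N"
    by (subst winding_number_compose_exp) auto
  finally show ?thesis using assms by (auto simp: curve_winding_def)
qed

context stored_energy
begin

text \<open>Minimality alone would allow an infinite minimum, so finiteness needs an example. The
  uniform twist r e^(i\<phi>(r)), with \<phi> affine and growing by 2 pi N, has determinant 1, so
  \<open>h\<close> enters only through its finite value at 1.\<close>

lemma finite_energy_competitor:
  assumes ab: "0 < a" "a < b"
  obtains w g where "sobolev_curve a b w g" "w a = of_real a" "w b = of_real b" "curve_winding a b w N"
    "\<And>r. 0 < r \<Longrightarrow> 0 \<le> Re (cnj (w r) * g r)" "reduced_energy a b h w g < \<infinity>"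
proof -
  define \<kappa> where "\<kappa> = 2 * pi * of_int N / (b - a)"
  define \<phi> where "\<phi> r = 2 * pi * of_int N * (r - a) / (b - a)" for r
  define w where "w r = of_real r * cis (\<phi> r)" for r
  define g where "g r = (1 + \<i> * of_real (\<kappa> * r)) * cis (\<phi> r)" for r
  have \<phi>: "(\<phi> has_real_derivative \<kappa>) (at r)" for r
    unfolding \<phi>_def[abs_def] \<kappa>_def using ab by (auto intro!: derivative_eq_intros)
  have wd: "(w has_vector_derivative g r) (at r)" for r
  proof -
    have "(w has_vector_derivative (of_real r * (\<i> * of_real \<kappa> * cis (\<phi> r)) + of_real 1 * cis (\<phi> r))) (at r)"
      unfolding w_def[abs_def]
      by (intro has_vector_derivative_mult has_vector_derivative_cis_compose[OF \<phi>] has_vector_derivative_of_real DERIV_ident)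
    then show ?thesis by (simp add: g_def algebra_simps)
  qed
  have \<phi>c: "continuous_on UNIV \<phi>" unfolding \<phi>_def[abs_def] using ab by (intro continuous_intros) auto
  have gc: "continuous_on UNIV g" unfolding g_def[abs_def] by (intro continuous_intros continuous_on_compose2[OF _ \<phi>c, of UNIV cis]) auto
  have wc: "continuous_on UNIV w" unfolding w_def[abs_def] by (intro continuous_intros continuous_on_compose2[OF _ \<phi>c, of UNIV cis]) auto
  have wg: "cnj (w r) * g r = of_real r * (1 + \<i> * of_real (\<kappa> * r))" for r
  proof -
    have "cnj (w r) * g r = of_real r * (1 + \<i> * of_real (\<kappa> * r)) * (cis (\<phi> r) * cnj (cis (\<phi> r)))"
      by (simp add: w_def g_def)
    also have "cis (\<phi> r) * cnj (cis (\<phi> r)) = 1" by (simp add: cis_cnj cis_mult)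
    finally show ?thesis by simp
  qed
  have ng: "(norm (g r))\<^sup>2 = 1 + (\<kappa> * r)\<^sup>2" for r
    by (simp add: g_def norm_mult cmod_power2)
  show thesis
  proof (rule that)
    show "sobolev_curve a b w g"
      unfolding sobolev_curve_def
    proof (intro conjI wc borel_measurable_continuous_onI[OF gc], rule exI[of _ "\<lambda>n. w"], rule exI[of _ "\<lambda>n. g"], intro conjI)
      show "uniform_limit {a..b} (\<lambda>n. w) w sequentially" by (intro uniform_limit_const)
    qed (simp_all add: wd gc)
    show "w a = of_real a" by (simp add: w_def \<phi>_def)
    show "w b = of_real b" using ab by (simp add: w_def \<phi>_def cis_conv_exp exp_eq_1)
    show "curve_winding a b w N" unfolding w_def[abs_def] \<phi>_def[abs_def] by (rule curve_winding_spiral[OF ab])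
    show "0 \<le> Re (cnj (w r) * g r)" if "0 < r" for r unfolding wg using that by simp
    obtain H where H: "0 \<le> H" "h 1 = ennreal H" by (rule that[OF hr_nonneg h_eq[OF zero_less_one]])
    define C where "C = b * (1/2 * (2 + (\<kappa> * b)\<^sup>2) + H)"
    have C: "0 \<le> C" using ab H(1) by (simp add: C_def)
    have "reduced_energy a b h w g \<le> (\<integral>\<^sup>+r. ennreal C * indicator {a<..<b} r \<partial>lborel)"
      unfolding reduced_energy_def
    proof (rule nn_integral_mono)
      fix r
      show "ennreal r * (ennreal (1 / 2 * ((norm (g r))\<^sup>2 + (norm (w r))\<^sup>2 / r\<^sup>2)) + h (Re (cnj (w r) * g r) / r)) *
            indicator {a<..<b} r \<le> ennreal C * indicator {a<..<b} r"
      proof (cases "r \<in> {a<..<b}")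
        case True
        then have r: "0 < r" "r \<le> b" using ab by auto
        have 1: "Re (cnj (w r) * g r) / r = 1" unfolding wg using r by simp
        have 2: "1 / 2 * ((norm (g r))\<^sup>2 + (norm (w r))\<^sup>2 / r\<^sup>2) = 1/2 * (2 + (\<kappa> * r)\<^sup>2)"
          unfolding ng using r by (simp add: w_def norm_mult)
        have "r * (1/2 * (2 + (\<kappa> * r)\<^sup>2) + H) \<le> C"
          unfolding C_def using r H(1)
          by (intro mult_mono add_mono mult_left_mono) (auto simp: power_mult_distrib intro!: mult_left_mono power_mono)
        then have "ennreal (r * (1/2 * (2 + (\<kappa> * r)\<^sup>2) + H)) \<le> ennreal C" by (rule ennreal_leI)
        moreover have "ennreal (r * (1/2 * (2 + (\<kappa> * r)\<^sup>2) + H)) = ennreal r * (ennreal (1/2 * (2 + (\<kappa> * r)\<^sup>2)) + ennreal (H))"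
          using r H(1) by (simp add: ennreal_mult ennreal_plus)
        ultimately show ?thesis
          unfolding 1 2 H(2) using True by simp
      qed simp
    qed
    also have "\<dots> < \<infinity>" using ab by (simp add: nn_integral_cmult ennreal_mult_less_top)
    finally show "reduced_energy a b h w g < \<infinity>" .
  qed
qed

end

text \<open>A Sobolev map and its weak gradient are determined only up to null sets, so pointwise
  monotonicity is stated for a C1 representative \<open>U\<close>, where the gradient is classical.
  Positivity of \<open>d\<close> is part of the claim because \<open>f_of\<close> carries its
  meaning only at positive arguments.\<close>

theorem lemma8:
  fixes a b :: real and N :: int and h0 :: "real \<Rightarrow> ennreal" and u :: "real ^ 2 \<Rightarrow> real ^ 2"
  assumes "0 < a" and "a < b"
    and "H1 h0" and "H2 h0" and "H3 h0" and "H4 h0"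
    and "N \<ge> 1"
    and "is_arg_min (energy a b h0) (\<lambda>v. v \<in> admissible_sym a b N) u"
  shows "\<exists>U. (AE x in lebesgue_on (annulus a b). U x = u x) \<and> C1_on (annulus a b) U \<and>
    (let d = (\<lambda>x. det (jacobian U (at x)));
         z = (\<lambda>x. 1 / 2 * (norm (jacobian U (at x)))\<^sup>2 + f_of h0 (d x))
     in (\<forall>x\<in>annulus a b. 0 < d x) \<and>
        (\<exists>D Z. (\<forall>x\<in>annulus a b. d x = D (norm x) \<and> z x = Z (norm x)) \<and>
           strict_mono_on {a<..<b} D \<and> strict_antimono_on {a<..<b} Z))"
proof -
  note ab = assms(1,2)
  interpret stored_energy h0 using assms(3-6) by unfold_locales
  have u: "u \<in> admissible_sym a b N" and min: "\<And>v. v \<in> admissible_sym a b N \<Longrightarrow> energy a b h0 u \<le> energy a b h0 v"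
    using assms(8) by (auto simp: is_arg_min_linorder)
  obtain w g where wg: "sobolev_curve a b w g" "w a = of_real a" "w b = of_real b"
    and wu: "AE x in lebesgue_on (annulus a b). equivariant_map w x = u x" and wind: "curve_winding a b w N"
    by (rule admissible_sym_reduction[OF ab u]) (rule that)
  have Eu: "energy a b h0 u = ennreal (2 * pi) * reduced_energy a b h0 w g"
    by (rule energy_equivariant_map[OF ab wg(1) wu _ measurable_h]) (use u in \<open>auto simp: admissible_sym_def admissible_def\<close>)
  have minimal: "reduced_energy a b h0 w g \<le> reduced_energy a b h0 v k"
    if v: "sobolev_curve a b v k" "v a = of_real a" "v b = of_real b" "curve_winding a b v N"
      "AE r in lborel. r \<in> {a<..<b} \<longrightarrow> 0 \<le> Re (cnj (v r) * k r)" for v k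
  proof -
    have adm: "equivariant_map v \<in> admissible_sym a b N" by (rule equivariant_map_admissible[OF ab v])
    have "energy a b h0 (equivariant_map v) = ennreal (2 * pi) * reduced_energy a b h0 v k"
      by (rule energy_equivariant_map[OF ab v(1) _ _ measurable_h]) (use adm in \<open>auto simp: admissible_sym_def admissible_def\<close>)
    then have "ennreal (2 * pi) * reduced_energy a b h0 w g \<le> ennreal (2 * pi) * reduced_energy a b h0 v k"
      using min[OF adm] by (simp add: Eu)
    then show ?thesis
      by (subst (asm) ennreal_mult_le_mult_iff) auto
  qed
  \<comment> \<open>The twisted competitor bounds the minimum, so the positivity of the determinant
    almost everywhere becomes available.\<close>
  have finite: "reduced_energy a b h0 w g < \<infinity>"
  proof -
    obtain v k where v: "sobolev_curve a b v k" "v a = of_real a" "v b = of_real b" "curve_winding a b v N"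
      and pos: "\<And>r. 0 < r \<Longrightarrow> 0 \<le> Re (cnj (v r) * k r)" and fin: "reduced_energy a b h0 v k < \<infinity>"
      by (rule finite_energy_competitor[OF ab]) (rule that)
    have "reduced_energy a b h0 w g \<le> reduced_energy a b h0 v k"
      by (rule minimal[OF v]) (use pos ab in auto)
    with fin show ?thesis by (rule order.strict_trans1[rotated])
  qed
  interpret radial_minimizer h0 a b N w g
    by unfold_locales (use ab wg wind finite minimal in auto)
  obtain g0 where wd: "\<And>r. r \<in> I \<Longrightarrow> (w has_vector_derivative g0 r) (at r)" and g0c: "continuous_on I g0"
    and pos: "\<And>r. r \<in> I \<Longrightarrow> 0 < Re (cnj (w r) * g0 r) / r"
    and D: "strict_mono_on I (\<lambda>r. Re (cnj (w r) * g0 r) / r)"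
    and Z: "strict_antimono_on I (\<lambda>r. 1/2 * ((norm (g0 r))\<^sup>2 + (norm (w r))\<^sup>2 / r\<^sup>2) + F (Re (cnj (w r) * g0 r) / r))"
  proof (rule minimizer_monotone)
    show "N \<noteq> 0" using assms(7) by simp
  qed (rule that)
  have nI: "norm x \<in> I" "x \<noteq> 0" if "x \<in> annulus a b" for x using that ab by (auto simp: annulus_def)
  have S: "0 \<notin> annulus a b" "norm ` annulus a b \<subseteq> I" using nI by auto
  have wdS: "(w has_vector_derivative g0 r) (at r)" if "r \<in> norm ` annulus a b" for r
    using wd S(2) that by blast
  note C1 = C1_on_equivariant_map[OF S(1) wdS continuous_on_subset[OF g0c S(2)]]
  show ?thesis
    unfolding Let_def
  proof (intro exI conjI)
    show "AE x in lebesgue_on (annulus a b). equivariant_map w x = u x" by (rule wu)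
    show "C1_on (annulus a b) (equivariant_map w)" by (rule C1(1))
    show "\<forall>x\<in>annulus a b. 0 < det (jacobian (equivariant_map w) (at x))"
      using pos nI by (simp add: C1(2) det_equivariant_grad)
    show "\<forall>x\<in>annulus a b. det (jacobian (equivariant_map w) (at x)) = (\<lambda>r. Re (cnj (w r) * g0 r) / r) (norm x) \<and>
       1 / 2 * (norm (jacobian (equivariant_map w) (at x)))\<^sup>2 + F (det (jacobian (equivariant_map w) (at x))) =
       (\<lambda>r. 1/2 * ((norm (g0 r))\<^sup>2 + (norm (w r))\<^sup>2 / r\<^sup>2) + F (Re (cnj (w r) * g0 r) / r)) (norm x)"
      using nI by (simp add: C1(2) det_equivariant_grad norm_equivariant_grad)
  qed (rule D, rule Z)
qed

end
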